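(* Let $1\leq l,l'<n$, $r,r'\in\mathbb{Z}_n$, $\eta\in\mathbb{P}^1(k)$ and $s\geq 1$. Assume that $l+l'\leq n$, and let $l_1=\min\{l,l'\}$. Then, as $H_n(1,q)$-modules, $$\begin{aligned}V(l,r)\otimes M_s(l',r',\eta)\cong&\Big(\bigoplus_{i=0}^{l_1-1}M_s\big(l+l'-1-2i,\,r+r'+i,\,\eta q^{2i-l+1}\tfrac{(l+l'-1-2i)_q}{(l')_q}\big)\Big)\\&\oplus\Big(\bigoplus_{c(l+l'-1)\leq i\leq l-1}sP(n+l+l'-1-2i,\,r+r'+i)\Big).\end{aligned}$$
   Context: Setting: $k$ is an algebraically closed field, $n>2$ is a fixed integer, $q\in k$ is a primitive $n$-th root of unity, $\mathbb{Z}_n=\mathbb{Z}/n\mathbb{Z}$, and $(i)_q=1+q+\cdots+q^{i-1}$. $H_n(1,q)$ is the Hopf algebra over $k$ (isomorphic to the Drinfeld double of the Taft algebra $H_n(q)$) generated as an algebra by $a,b,c,d$ with relations $ba=qab$, $db=qbd$, $ca=qac$, $dc=qcd$, $bc=cb$, $a^n=0$, $b^n=1$, $c^n=1$, $d^n=0$, $da-qad=1-bc$, with comultiplication $\Delta(a)=a\otimes b+1\otimes a$, $\Delta(b)=b\otimes b$, $\Delta(c)=c\otimes c$, $\Delta(d)=d\otimes c+1\otimes d$, counit $\varepsilon(a)=\varepsilon(d)=0$, $\varepsilon(b)=\varepsilon(c)=1$, and antipode $S(a)=-ab^{-1}$, $S(b)=b^{-1}$, $S(c)=c^{-1}$, $S(d)=-dc^{-1}$.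 All modules are finite-dimensional left $H_n(1,q)$-modules, $\otimes=\otimes_k$ with action through $\Delta$, and $sM$ is the direct sum of $s$ copies of $M$ ($sM=0$ if $s=0$). Simple modules: for $1\leq l\leq n$, $r\in\mathbb{Z}_n$, $V(l,r)$ has basis $v_1,\dots,v_l$ with $av_i=v_{i+1}$ for $i<l$, $av_l=0$, $bv_i=q^{r+i-1}v_i$, $cv_i=q^{i-r-l}v_i$, $dv_1=0$, $dv_i=\alpha_{i-1}(l)v_{i-1}$ for $1<i\leq l$, where $\alpha_i(l)=(i)_q(1-q^{i-l})$. For $1\leq l<n$, $P(l,r)$ is the projective cover of $V(l,r)$, and $P(n,r)=V(n,r)$ (which is projective). Band modules: $\mathbb{P}^1(k)$ is identified with $k\cup\{\infty\}$, with $\alpha\infty=\infty\alpha=\infty$ for $0\neq\alpha\in k$. For $1\leq l<n$, $r\in\mathbb{Z}_n$, $\eta\in\mathbb{P}^1(k)$, the module $M_1(l,r,\eta)$ has basis $v_1,\dots,v_n$ with $bv_i=q^{r+l+i-1}v_i$, $cv_i=q^{i-r}v_i$, $dv_i=\alpha_{i-1}(n-l)v_{i-1}$ for $1<i\leq n-l$, $dv_{n-l+1}=0$, $dv_i=\alpha_{i-n+l-1}(l)v_{i-1}$ for $n-l+1<i\leq n$, and: if $\eta=\infty$, $av_i=0$ for $i\in\{n-l,n\}$, $av_i=v_{i+1}$ otherwise, and $dv_1=v_n$; if $\eta\in k$, $av_i=v_{i+1}$ for $1\leq i<n$, $av_n=0$, and $dv_1=\eta q^lv_n$. With $M_0(l,r,\eta)=0$,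 the modules $M_s(l,r,\eta)$ are determined recursively (up to isomorphism) by the almost split sequences $0\to M_s(l,r,\eta)\to M_{s-1}(l,r,\eta)\oplus M_{s+1}(l,r,\eta)\to M_s(l,r,\eta)\to 0$, $s\geq 1$. Conventions: integers in the second argument of $V$, $P$ and $M_s$ are read modulo $n$; $c(t)=\lfloor (t+1)/2\rfloor$ for $t\in\mathbb{Z}$ (the function $c(\cdot)$ is not to be confused with the generator $c$); a direct sum over an empty range of indices is zero. *)

theory Defs
  imports
    "HOL-Computational_Algebra.Polynomial"
    "Jordan_Normal_Form.Matrix"
    "Jordan_Normal_Form.Matrix_Kernel"
begin

section \<open>Scalars\<close>

definition primitive_root_of_unity :: "nat \<Rightarrow> 'k::field \<Rightarrow> bool" where
  "primitive_root_of_unity n q \<longleftrightarrow> q ^ n = 1 \<and> (\<forall>m. 0 < m \<and> m < n \<longrightarrow> q ^ m \<noteq> 1)"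

definition qint :: "'k::field \<Rightarrow> nat \<Rightarrow> 'k" where
  "qint q i = (\<Sum>j<i. q ^ j)"

definition alpha :: "'k::field \<Rightarrow> nat \<Rightarrow> nat \<Rightarrow> 'k" where
  "alpha q i l = qint q i * (1 - q powi (int i - int l))"

definition c_half :: "int \<Rightarrow> int" where
  "c_half t = (t + 1) div 2"

datatype 'k proj_line = Fin 'k | Infty

text \<open>Multiplication of a point of the projective line by a scalar; it is only used for
  nonzero scalars.\<close>

fun scale_pt :: "'k::field \<Rightarrow> 'k proj_line \<Rightarrow> 'k proj_line" where
  "scale_pt x (Fin y) = Fin (x * y)"
| "scale_pt x Infty = Infty"


section \<open>Finite-dimensional modules over the Hopf algebra \<open>H\<^sub>n(1,q)\<close>\<close>

text \<open>
  A left module over an algebra presented by generators and relations is a vector space with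
  one endomorphism for each generator such that the relations hold. A finite-dimensional
  module with a chosen basis is therefore a quadruple of square matrices; matrices act on
  column vectors, i.e. the \<open>j\<close>-th column holds the image of the \<open>j\<close>-th basis vector.
  Every finite-dimensional module is isomorphic to one of this form, and the zero module is
  the one with \<open>0 \<times> 0\<close> matrices.
\<close>

datatype gen = Ga | Gb | Gc | Gd

record 'k hmod =
  hdim :: nat
  act :: "gen \<Rightarrow> 'k mat"

definition is_hmod :: "nat \<Rightarrow> 'k::field \<Rightarrow> 'k hmod \<Rightarrow> bool" where
  "is_hmod n q M \<longleftrightarrow>
    (\<forall>x. act M x \<in> carrier_mat (hdim M) (hdim M)) \<and>
    (let a = act M Ga; b = act M Gb; c = act M Gc; d = act M Gd;
         I = 1\<^sub>m (hdim M); Z = 0\<^sub>m (hdim M) (hdim M)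
     in b * a = q \<cdot>\<^sub>m (a * b) \<and> d * b = q \<cdot>\<^sub>m (b * d) \<and>
        c * a = q \<cdot>\<^sub>m (a * c) \<and> d * c = q \<cdot>\<^sub>m (c * d) \<and>
        b * c = c * b \<and>
        a ^\<^sub>m n = Z \<and> b ^\<^sub>m n = I \<and> c ^\<^sub>m n = I \<and> d ^\<^sub>m n = Z \<and>
        d * a - q \<cdot>\<^sub>m (a * d) = I - b * c)"

definition homs :: "'k::field hmod \<Rightarrow> 'k hmod \<Rightarrow> 'k mat set" where
  "homs M N = {f \<in> carrier_mat (hdim N) (hdim M). \<forall>x. f * act M x = act N x * f}"

definition mat_injective :: "'k::field mat \<Rightarrow> bool" where
  "mat_injective f \<longleftrightarrow> inj_on (mult_mat_vec f) (carrier_vec (dim_col f))"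

definition mat_surjective :: "'k::field mat \<Rightarrow> bool" where
  "mat_surjective f \<longleftrightarrow> mult_mat_vec f ` carrier_vec (dim_col f) = carrier_vec (dim_row f)"

definition hmod_iso :: "nat \<Rightarrow> 'k::field \<Rightarrow> 'k hmod \<Rightarrow> 'k hmod \<Rightarrow> bool" where
  "hmod_iso n q M N \<longleftrightarrow> is_hmod n q M \<and> is_hmod n q N \<and>
    (\<exists>f \<in> homs M N. \<exists>g \<in> homs N M. g * f = 1\<^sub>m (hdim M) \<and> f * g = 1\<^sub>m (hdim N))"

definition dsum :: "'k::field hmod list \<Rightarrow> 'k hmod" where
  "dsum Ms = \<lparr>hdim = sum_list (map hdim Ms),
    act = (\<lambda>x. diag_block_mat (map (\<lambda>M. act M x) Ms))\<rparr>"

definition copies :: "nat \<Rightarrow> 'k::field hmod \<Rightarrow> 'k hmod" where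
  "copies s M = dsum (replicate s M)"

text \<open>Kronecker product: the matrix of the tensor product of two linear maps with respect to
  the basis \<open>v\<^sub>i \<otimes> w\<^sub>j\<close>, ordered lexicographically.\<close>

definition kron :: "'k::field mat \<Rightarrow> 'k mat \<Rightarrow> 'k mat" where
  "kron A B = mat (dim_row A * dim_row B) (dim_col A * dim_col B)
    (\<lambda>(i, j). A $$ (i div dim_row B, j div dim_col B) * B $$ (i mod dim_row B, j mod dim_col B))"

text \<open>The action on a tensor product is through the comultiplication
  \<open>\<Delta>(a) = a \<otimes> b + 1 \<otimes> a\<close>, \<open>\<Delta>(b) = b \<otimes> b\<close>, \<open>\<Delta>(c) = c \<otimes> c\<close>,
  \<open>\<Delta>(d) = d \<otimes> c + 1 \<otimes> d\<close>.\<close>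

definition tensor :: "'k::field hmod \<Rightarrow> 'k hmod \<Rightarrow> 'k hmod" where
  "tensor M N = \<lparr>hdim = hdim M * hdim N,
    act = (\<lambda>x. case x of
        Ga \<Rightarrow> kron (act M Ga) (act N Gb) + kron (1\<^sub>m (hdim M)) (act N Ga)
      | Gb \<Rightarrow> kron (act M Gb) (act N Gb)
      | Gc \<Rightarrow> kron (act M Gc) (act N Gc)
      | Gd \<Rightarrow> kron (act M Gd) (act N Gc) + kron (1\<^sub>m (hdim M)) (act N Gd))\<rparr>"


section \<open>Projective covers and almost split sequences\<close>

definition is_projective :: "nat \<Rightarrow> 'k::field \<Rightarrow> 'k hmod \<Rightarrow> bool" where
  "is_projective n q P \<longleftrightarrow> is_hmod n q P \<and>
    (\<forall>X Y g h. is_hmod n q X \<and> is_hmod n q Y \<and> g \<in> homs X Y \<and> mat_surjective g \<and> h \<in> homs P Y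
      \<longrightarrow> (\<exists>h' \<in> homs P X. g * h' = h))"

text \<open>A projective cover is an essential epimorphism from a projective module.\<close>

definition is_projective_cover :: "nat \<Rightarrow> 'k::field \<Rightarrow> 'k hmod \<Rightarrow> 'k hmod \<Rightarrow> 'k mat \<Rightarrow> bool" where
  "is_projective_cover n q P M p \<longleftrightarrow> is_projective n q P \<and> is_hmod n q M \<and>
    p \<in> homs P M \<and> mat_surjective p \<and>
    (\<forall>X h. is_hmod n q X \<and> h \<in> homs X P \<and> mat_surjective (p * h) \<longrightarrow> mat_surjective h)"

definition short_exact ::
    "nat \<Rightarrow> 'k::field \<Rightarrow> 'k hmod \<Rightarrow> 'k mat \<Rightarrow> 'k hmod \<Rightarrow> 'k mat \<Rightarrow> 'k hmod \<Rightarrow> bool" where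
  "short_exact n q A f B g C \<longleftrightarrow>
    is_hmod n q A \<and> is_hmod n q B \<and> is_hmod n q C \<and> f \<in> homs A B \<and> g \<in> homs B C \<and>
    mat_injective f \<and> mult_mat_vec f ` carrier_vec (hdim A) = mat_kernel g \<and> mat_surjective g"

definition split_mono :: "'k::field hmod \<Rightarrow> 'k hmod \<Rightarrow> 'k mat \<Rightarrow> bool" where
  "split_mono M N f \<longleftrightarrow> (\<exists>g \<in> homs N M. g * f = 1\<^sub>m (hdim M))"

definition split_epi :: "'k::field hmod \<Rightarrow> 'k hmod \<Rightarrow> 'k mat \<Rightarrow> bool" where
  "split_epi M N f \<longleftrightarrow> (\<exists>g \<in> homs N M. f * g = 1\<^sub>m (hdim N))"

definition left_almost_split ::
    "nat \<Rightarrow> 'k::field \<Rightarrow> 'k hmod \<Rightarrow> 'k hmod \<Rightarrow> 'k mat \<Rightarrow> bool" where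
  "left_almost_split n q A B f \<longleftrightarrow> f \<in> homs A B \<and> \<not> split_mono A B f \<and>
    (\<forall>X h. is_hmod n q X \<and> h \<in> homs A X \<and> \<not> split_mono A X h \<longrightarrow> (\<exists>h' \<in> homs B X. h = h' * f))"

definition right_almost_split ::
    "nat \<Rightarrow> 'k::field \<Rightarrow> 'k hmod \<Rightarrow> 'k hmod \<Rightarrow> 'k mat \<Rightarrow> bool" where
  "right_almost_split n q B C g \<longleftrightarrow> g \<in> homs B C \<and> \<not> split_epi B C g \<and>
    (\<forall>X h. is_hmod n q X \<and> h \<in> homs X C \<and> \<not> split_epi X C h \<longrightarrow> (\<exists>h' \<in> homs X B. h = g * h'))"

definition almost_split ::
    "nat \<Rightarrow> 'k::field \<Rightarrow> 'k hmod \<Rightarrow> 'k mat \<Rightarrow> 'k hmod \<Rightarrow> 'k mat \<Rightarrow> 'k hmod \<Rightarrow> bool" where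
  "almost_split n q A f B g C \<longleftrightarrow> short_exact n q A f B g C \<and>
    left_almost_split n q A B f \<and> right_almost_split n q B C g"


section \<open>The modules \<open>V(l,r)\<close>, \<open>P(l,r)\<close> and \<open>M\<^sub>s(l,r,\<eta>)\<close>\<close>

text \<open>\<open>basis_mat m f\<close> is the matrix of the linear map \<open>v\<^sub>j \<mapsto> \<Sum>\<^sub>i f i j v\<^sub>i\<close> with respect to a
  basis numbered \<open>v\<^sub>1, \<dots>, v\<^sub>m\<close> (matrix indices start at 0). In the definitions below,
  \<open>f i j\<close> is thus the coefficient of \<open>v\<^sub>i\<close> in the image of \<open>v\<^sub>j\<close>.

  The parameter \<open>r\<close> stands for a residue class modulo \<open>n\<close>; it is an integer that only
  enters through powers of the \<open>n\<close>-th root of unity \<open>q\<close>.\<close>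

definition basis_mat :: "nat \<Rightarrow> (nat \<Rightarrow> nat \<Rightarrow> 'k) \<Rightarrow> 'k mat" where
  "basis_mat m f = mat m m (\<lambda>(i, j). f (Suc i) (Suc j))"

definition V_mod :: "'k::field \<Rightarrow> nat \<Rightarrow> int \<Rightarrow> 'k hmod" where
  "V_mod q l r = \<lparr>hdim = l,
    act = (\<lambda>x. basis_mat l (\<lambda>i j. case x of
        Ga \<Rightarrow> if j < l \<and> i = j + 1 then 1 else 0
      | Gb \<Rightarrow> if i = j then q powi (r + int j - 1) else 0
      | Gc \<Rightarrow> if i = j then q powi (int j - r - int l) else 0
      | Gd \<Rightarrow> if 1 < j \<and> i = j - 1 then alpha q (j - 1) l else 0))\<rparr>"

definition M1_mod :: "nat \<Rightarrow> 'k::field \<Rightarrow> nat \<Rightarrow> int \<Rightarrow> 'k proj_line \<Rightarrow> 'k hmod" where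
  "M1_mod n q l r \<eta> = \<lparr>hdim = n,
    act = (\<lambda>x. basis_mat n (\<lambda>i j. case x of
        Ga \<Rightarrow> (case \<eta> of
            Infty \<Rightarrow> if j \<notin> {n - l, n} \<and> i = j + 1 then 1 else 0
          | Fin _ \<Rightarrow> if j < n \<and> i = j + 1 then 1 else 0)
      | Gb \<Rightarrow> if i = j then q powi (r + int l + int j - 1) else 0
      | Gc \<Rightarrow> if i = j then q powi (int j - r) else 0
      | Gd \<Rightarrow>
          if j = 1 then
            (if i = n then (case \<eta> of Infty \<Rightarrow> 1 | Fin y \<Rightarrow> y * q ^ l) else 0)
          else if j \<le> n - l then (if i = j - 1 then alpha q (j - 1) (n - l) else 0)
          else if j = n - l + 1 then 0
          else (if i = j - 1 then alpha q (j - (n - l) - 1) l else 0)))\<rparr>"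

text \<open>The modules \<open>P(l,r)\<close> and \<open>M\<^sub>s(l,r,\<eta>)\<close> are only determined up to isomorphism, so they are
  given as predicates: \<open>is_P n q l r X\<close> means \<open>X \<cong> P(l,r)\<close>, and \<open>is_M n q s l r \<eta> X\<close> means
  \<open>X \<cong> M\<^sub>s(l,r,\<eta>)\<close>.\<close>

definition is_P :: "nat \<Rightarrow> 'k::field \<Rightarrow> nat \<Rightarrow> int \<Rightarrow> 'k hmod \<Rightarrow> bool" where
  "is_P n q l r X \<longleftrightarrow>
    (if l = n then hmod_iso n q X (V_mod q n r)
     else \<exists>p. is_projective_cover n q X (V_mod q l r) p)"

fun is_M :: "nat \<Rightarrow> 'k::field \<Rightarrow> nat \<Rightarrow> nat \<Rightarrow> int \<Rightarrow> 'k proj_line \<Rightarrow> 'k hmod \<Rightarrow> bool" where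
  "is_M n q 0 l r \<eta> X \<longleftrightarrow> is_hmod n q X \<and> hdim X = 0"
| "is_M n q (Suc 0) l r \<eta> X \<longleftrightarrow> hmod_iso n q X (M1_mod n q l r \<eta>)"
| "is_M n q (Suc (Suc s)) l r \<eta> X \<longleftrightarrow> is_hmod n q X \<and>
    (\<exists>L N f g. is_M n q s l r \<eta> L \<and> is_M n q (Suc s) l r \<eta> N \<and>
       almost_split n q N f (dsum [L, X]) g N)"

end

theory Submission
  imports Defs "HOL-Library.Function_Algebras" "Jordan_Normal_Form.Determinant"
begin

text \<open>
  A module \<open>M\<^sub>s(l,r,\<eta>)\<close> is generated by vectors \<open>f\<^sub>e\<close> (\<open>e < s\<close>) over highest weight vectors
  \<open>g\<^sub>e\<close> (killed by \<open>d\<close>), where \<open>a\<^sup>n\<^sup>-\<^sup>l f\<^sub>e\<close> and \<open>d f\<^sub>e\<close> are two linear combinations of \<open>g\<^sub>e\<close> and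
  \<open>g\<^sub>e\<^sub>+\<^sub>1\<close>, i.e. a pencil. This explicit model satisfies the recursion by almost split sequences,
  because its endomorphism ring is local and almost split sequences are unique, so that
  Krull--Schmidt cancellation applies.

  For the tensor product, there are two maps \<open>V(l,r) \<otimes> N \<rightarrow> V(l+1,r) \<otimes> N\<close> that almost commute with
  the generators. By induction on \<open>l\<close> they carry such a family of type \<open>m\<close> to families of types
  \<open>m + 1\<close> and \<open>m - 1\<close>, multiplying the scalar of the pencil by \<open>(m\<plusminus>1)\<^sub>q / (m)\<^sub>q\<close>; this is the origin
  of the parameter \<open>\<eta>q\<^sup>2\<^sup>i\<^sup>-\<^sup>l\<^sup>+\<^sup>1(l+l'-1-2i)\<^sub>q/(l')\<^sub>q\<close>. The generators of the projective summands are found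
  by solving \<open>d x = z\<close> componentwise. A homomorphism is injective as soon as it is so on highest
  weight vectors, and the summands have pairwise different highest weights; hence their sum embeds
  into the tensor product, and the dimensions agree.
\<close>

section \<open>Finitely supported vectors and matrices\<close>

text \<open>The two ladder maps are the components of one homomorphism V(2,0) \<otimes> V(l,r)
  \<rightarrow> V(l+1,r), so the induction on l amounts to tensoring with the two-dimensional simple
  module. Its constants explain the quotient of q-integers in the new parameter. The power of q
  comes from the pencil of M_s(l,r,\<eta>), whose entry \<eta>q^l depends on l: l' - (l + l' - 1 -
  2i) = 2i - l + 1.

  The obstacle is that P(m,t) and M_s are known only by universal properties and must be tied to
  matrices first. In a projective cover P of V(m,t), a weight vector over the generator is corrected
  by terms a^j d^j until it satisfies the relations of a 2n-dimensional model. The resulting map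
  from the model onto P is injective because a lift P \<rightarrow> model turns it into an
  endomorphism of the model that is nonzero on both kinds of highest weight vectors.

  For the tensor product, the commutation relations and a^n = 0 are checked directly; b^n = c^n = 1
  and d^n = 0 reach it only at the end, through the isomorphism with the direct sum.\<close>

definition sc :: "'k::field \<Rightarrow> (nat \<Rightarrow> 'k) \<Rightarrow> nat \<Rightarrow> 'k" (infixr \<open>\<cdot>\<^sub>f\<close> 75) where
  "c \<cdot>\<^sub>f v = (\<lambda>i. c * v i)"

text \<open>Vectors of every length live in the one type of functions on \<open>nat\<close>, so that
  maps between modules of different dimension compose freely; \<open>supp n\<close> picks out the
  n-dimensional space.\<close>

definition supp :: "nat \<Rightarrow> (nat \<Rightarrow> 'k::zero) \<Rightarrow> bool" where
  "supp n v \<longleftrightarrow> (\<forall>i\<ge>n. v i = 0)"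

definition uv :: "nat \<Rightarrow> nat \<Rightarrow> 'k::field" where
  "uv j = (\<lambda>i. if i = j then 1 else 0)"

text \<open>Coordinates beyond the column dimension are ignored and the result vanishes beyond the
  row dimension. Hence \<open>mapp M\<close> is linear on all functions, whatever their
  support.\<close>

definition mapp :: "'k::field mat \<Rightarrow> (nat \<Rightarrow> 'k) \<Rightarrow> nat \<Rightarrow> 'k" where
  "mapp M v = (\<lambda>i. if i < dim_row M then \<Sum>j<dim_col M. M $$ (i, j) * v j else 0)"

definition lin :: "((nat \<Rightarrow> 'k::field) \<Rightarrow> nat \<Rightarrow> 'k) \<Rightarrow> bool" where
  "lin f \<longleftrightarrow> (\<forall>x y. f (x + y) = f x + f y) \<and> (\<forall>c x. f (c \<cdot>\<^sub>f x) = c \<cdot>\<^sub>f f x)"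

lemma sc_apply [simp]: "(c \<cdot>\<^sub>f v) i = c * v i" by (simp add: sc_def)

lemma sc_sc [simp]: "c \<cdot>\<^sub>f d \<cdot>\<^sub>f v = (c * d) \<cdot>\<^sub>f v" by (simp add: fun_eq_iff mult.assoc)
lemma sc_one [simp]: "1 \<cdot>\<^sub>f v = v" by (simp add: fun_eq_iff)
lemma sc_zero [simp]: "0 \<cdot>\<^sub>f v = 0" "c \<cdot>\<^sub>f 0 = 0" by (simp_all add: fun_eq_iff)
lemma sc_add: "c \<cdot>\<^sub>f (v + w) = c \<cdot>\<^sub>f v + c \<cdot>\<^sub>f w" by (simp add: fun_eq_iff algebra_simps)
lemma sc_eq_0_iff [simp]: "c \<cdot>\<^sub>f v = 0 \<longleftrightarrow> c = 0 \<or> v = 0" by (auto simp: fun_eq_iff)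

lemma sum_fun_apply: "(\<Sum>j\<in>A. f j) i = (\<Sum>j\<in>A. f j i)"
  for f :: "'a \<Rightarrow> nat \<Rightarrow> 'k::comm_monoid_add"
  by (induction A rule: infinite_finite_induct) auto

lemma supp_0 [simp]: "supp n 0" by (simp add: supp_def)
lemma supp_add [simp]: "supp n x \<Longrightarrow> supp n y \<Longrightarrow> supp n (x + y)" for x :: "nat \<Rightarrow> 'k::field"
  by (simp add: supp_def)
lemma supp_sc [simp]: "supp n x \<Longrightarrow> supp n (c \<cdot>\<^sub>f x)" by (simp add: supp_def)
lemma supp_diff [simp]: "supp n x \<Longrightarrow> supp n y \<Longrightarrow> supp n (x - y)" for x :: "nat \<Rightarrow> 'k::field"
  by (simp add: supp_def)
lemma supp_uv [simp]: "j < n \<Longrightarrow> supp n (uv j)" by (simp add: supp_def uv_def)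
lemma supp_mapp [simp]: "supp (dim_row M) (mapp M v)" by (simp add: supp_def mapp_def)
lemma supp_mapp': "M \<in> carrier_mat nr nc \<Longrightarrow> supp nr (mapp M v)"
  by (simp add: supp_def mapp_def)
lemma supp_sum: "(\<And>j. j \<in> A \<Longrightarrow> supp n (f j)) \<Longrightarrow> supp n (\<Sum>j\<in>A. f j)"
  for f :: "'a \<Rightarrow> nat \<Rightarrow> 'k::field"
  by (simp add: supp_def sum_fun_apply)

lemma supp_expand: "supp n v \<Longrightarrow> v = (\<Sum>j<n. v j \<cdot>\<^sub>f uv j)"
  by (auto simp: fun_eq_iff sum_fun_apply uv_def supp_def if_distrib [of "\<lambda>x. _ * x"] cong: if_cong)

lemma linD: "lin f \<Longrightarrow> f (x + y) = f x + f y" "lin f \<Longrightarrow> f (c \<cdot>\<^sub>f x) = c \<cdot>\<^sub>f f x"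
  by (simp_all add: lin_def)
lemma lin_0: "lin f \<Longrightarrow> f 0 = 0" using linD(2) [of f 0 0] by simp
lemma lin_diff: assumes "lin f" shows "f (x - y) = f x - f y"
proof -
  have "f ((x - y) + y) = f (x - y) + f y" by (rule linD(1) [OF assms])
  then show ?thesis by (simp add: algebra_simps)
qed
lemma lin_sum: "lin f \<Longrightarrow> f (\<Sum>j\<in>A. g j) = (\<Sum>j\<in>A. f (g j))"
  by (induction A rule: infinite_finite_induct) (auto simp: lin_0 linD)
lemma lin_comp: "lin f \<Longrightarrow> lin g \<Longrightarrow> lin (\<lambda>x. f (g x))" by (simp add: lin_def)
lemma lin_funpow: "lin f \<Longrightarrow> lin (f ^^ k)"
  by (induction k) (auto simp: lin_def)
lemma lin_id: "lin (\<lambda>x. x)" by (simp add: lin_def)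
lemma lin_plus: "lin f \<Longrightarrow> lin g \<Longrightarrow> lin (\<lambda>x. f x + g x)"
  by (simp add: lin_def sc_add algebra_simps)
lemma lin_scale: "lin f \<Longrightarrow> lin (\<lambda>x. c \<cdot>\<^sub>f f x)"
  by (simp add: lin_def sc_add mult.commute)

lemma lin_eq_on_supp:
  assumes "lin f" "lin g" "\<And>j. j < n \<Longrightarrow> f (uv j) = g (uv j)" "supp n v"
  shows "f v = g v"
proof -
  have "f v = f (\<Sum>j<n. v j \<cdot>\<^sub>f uv j)" using supp_expand [OF assms(4)] by simp
  also have "\<dots> = g (\<Sum>j<n. v j \<cdot>\<^sub>f uv j)"
    by (simp add: lin_sum assms linD)
  also have "\<dots> = g v" using supp_expand [OF assms(4)] by simp
  finally show ?thesis .
qed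

lemma lin_mapp: "lin (mapp M)"
  by (auto simp: lin_def mapp_def fun_eq_iff algebra_simps sum.distrib sum_distrib_left)

lemmas mapp_lin [simp] = linD [OF lin_mapp] lin_0 [OF lin_mapp] lin_diff [OF lin_mapp]

lemma mapp_mult:
  assumes "dim_col M = dim_row N"
  shows "mapp (M * N) v = mapp M (mapp N v)"
proof
  fix i
  show "mapp (M * N) v i = mapp M (mapp N v) i"
  proof (cases "i < dim_row M")
    case True
    have "mapp (M * N) v i = (\<Sum>j<dim_col N. (\<Sum>k<dim_row N. M $$ (i, k) * N $$ (k, j)) * v j)"
      using True assms by (simp add: mapp_def scalar_prod_def atLeast0LessThan)
    also have "\<dots> = (\<Sum>j<dim_col N. \<Sum>k<dim_row N. M $$ (i, k) * N $$ (k, j) * v j)"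
      by (simp add: sum_distrib_right)
    also have "\<dots> = (\<Sum>k<dim_row N. \<Sum>j<dim_col N. M $$ (i, k) * N $$ (k, j) * v j)"
      by (rule sum.swap)
    also have "\<dots> = mapp M (mapp N v) i"
      using True assms by (simp add: mapp_def sum_distrib_left mult.assoc)
    finally show ?thesis .
  qed (simp add: mapp_def)
qed

lemma mapp_mult_carrier:
  "M \<in> carrier_mat a b \<Longrightarrow> N \<in> carrier_mat b c \<Longrightarrow> mapp (M * N) v = mapp M (mapp N v)"
  by (rule mapp_mult) auto

lemma mapp_add_mat:
  "M \<in> carrier_mat a b \<Longrightarrow> N \<in> carrier_mat a b \<Longrightarrow> mapp (M + N) v = mapp M v + mapp N v"
  by (auto simp: fun_eq_iff mapp_def sum.distrib algebra_simps)

lemma mapp_minus_mat: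
  "M \<in> carrier_mat a b \<Longrightarrow> N \<in> carrier_mat a b \<Longrightarrow> mapp (M - N) v = mapp M v - mapp N v"
  by (auto simp: fun_eq_iff mapp_def sum_subtractf algebra_simps)

lemma mapp_smult_mat [simp]: "mapp (c \<cdot>\<^sub>m M) v = c \<cdot>\<^sub>f mapp M v"
  by (auto simp: fun_eq_iff mapp_def sum_distrib_left algebra_simps)

lemma mapp_one [simp]: "supp n v \<Longrightarrow> mapp (1\<^sub>m n) v = v"
  by (auto simp: fun_eq_iff mapp_def one_mat_def supp_def if_distrib [of "\<lambda>x. x * _"] cong: if_cong)

lemma mapp_zero_mat [simp]: "mapp (0\<^sub>m a b) v = 0"
  by (auto simp: fun_eq_iff mapp_def)

lemma mapp_uv: "mapp M (uv j) i = (if i < dim_row M \<and> j < dim_col M then M $$ (i, j) else 0)"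
  by (auto simp: mapp_def uv_def if_distrib [of "\<lambda>x. _ * x"] cong: if_cong)

lemma mapp_pow:
  assumes "M \<in> carrier_mat n n" "supp n v"
  shows "mapp (M ^\<^sub>m k) v = (mapp M ^^ k) v"
  using assms(2)
proof (induction k arbitrary: v)
  case 0
  then show ?case using assms by simp
next
  case (Suc k)
  have "mapp (M ^\<^sub>m Suc k) v = mapp (M ^\<^sub>m k) (mapp M v)"
    using mapp_mult_carrier [OF pow_carrier_mat [OF assms(1)] assms(1)] by simp
  also have "\<dots> = (mapp M ^^ k) (mapp M v)" using Suc assms by auto
  also have "\<dots> = (mapp M ^^ Suc k) v" by (simp add: funpow_swap1)
  finally show ?case .
qed

lemma mat_eqI_uv:
  assumes "M \<in> carrier_mat a b" "N \<in> carrier_mat a b"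
    and "\<And>j. j < b \<Longrightarrow> mapp M (uv j) = mapp N (uv j)"
  shows "M = N"
proof (rule eq_matI)
  fix i j assume "i < dim_row N" "j < dim_col N"
  then show "M $$ (i, j) = N $$ (i, j)"
    using fun_cong [OF assms(3), of j i] assms(1,2) by (simp add: mapp_uv)
qed (use assms in auto)

lemma mat_eqI_mapp:
  assumes "M \<in> carrier_mat a b" "N \<in> carrier_mat a b"
    and "\<And>v. supp b v \<Longrightarrow> mapp M v = mapp N v"
  shows "M = N"
  using assms by (intro mat_eqI_uv) auto

definition fmat :: "nat \<Rightarrow> nat \<Rightarrow> ((nat \<Rightarrow> 'k) \<Rightarrow> nat \<Rightarrow> 'k) \<Rightarrow> 'k::field mat" where
  "fmat nr nc f = mat nr nc (\<lambda>(i, j). f (uv j) i)"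

lemma fmat_carrier [simp]: "fmat nr nc f \<in> carrier_mat nr nc" by (simp add: fmat_def)
lemma fmat_dim [simp]: "dim_row (fmat nr nc f) = nr" "dim_col (fmat nr nc f) = nc"
  by (simp_all add: fmat_def)

lemma mapp_fmat:
  assumes "lin f" "\<And>j. j < nc \<Longrightarrow> supp nr (f (uv j))" "supp nc v"
  shows "mapp (fmat nr nc f) v = f v"
proof (rule lin_eq_on_supp [OF lin_mapp assms(1) _ assms(3)])
  fix j assume "j < nc"
  then show "mapp (fmat nr nc f) (uv j) = f (uv j)"
    using assms(2) [of j] by (auto simp: fun_eq_iff mapp_uv fmat_def supp_def not_less)
qed

text \<open>Read as a function of the coefficient vector v, this is the linear map with prescribed
  values u j on the unit vectors.\<close>

definition lcomb :: "nat \<Rightarrow> (nat \<Rightarrow> nat \<Rightarrow> 'k) \<Rightarrow> (nat \<Rightarrow> 'k) \<Rightarrow> nat \<Rightarrow> 'k::field" where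
  "lcomb n u v = (\<Sum>j<n. v j \<cdot>\<^sub>f u j)"

lemma lin_lcomb: "lin (lcomb n u)"
  by (auto simp: lin_def lcomb_def fun_eq_iff sum_fun_apply algebra_simps sum.distrib sum_distrib_left)
lemma lcomb_uv [simp]: "j < n \<Longrightarrow> lcomb n u (uv j) = u j"
  by (auto simp: lcomb_def fun_eq_iff sum_fun_apply uv_def if_distrib [of "\<lambda>x. x * _"] cong: if_cong)
lemma supp_lcomb: "(\<And>j. j < n \<Longrightarrow> supp m (u j)) \<Longrightarrow> supp m (lcomb n u v)"
  by (auto simp: lcomb_def intro!: supp_sum)

lemmas lcomb_lin [simp] = linD [OF lin_lcomb] lin_0 [OF lin_lcomb] lin_diff [OF lin_lcomb]

definition wfm :: "'k::field hmod \<Rightarrow> bool" where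
  "wfm M \<longleftrightarrow> (\<forall>x. act M x \<in> carrier_mat (hdim M) (hdim M))"

lemma is_hmod_wfm: "is_hmod n q M \<Longrightarrow> wfm M" by (simp add: is_hmod_def wfm_def)

lemma wfmD [simp]: "wfm M \<Longrightarrow> act M x \<in> carrier_mat (hdim M) (hdim M)" by (simp add: wfm_def)

lemma supp_act [simp]: "wfm M \<Longrightarrow> supp (hdim M) (mapp (act M x) v)"
  using supp_mapp' [OF wfmD] .

lemma homs_carrier: "f \<in> homs M N \<Longrightarrow> f \<in> carrier_mat (hdim N) (hdim M)" by (simp add: homs_def)

lemma homsI:
  assumes "wfm M" "wfm N" "f \<in> carrier_mat (hdim N) (hdim M)"
    and "\<And>x j. j < hdim M \<Longrightarrow> mapp f (mapp (act M x) (uv j)) = mapp (act N x) (mapp f (uv j))"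
  shows "f \<in> homs M N"
proof -
  have "f * act M x = act N x * f" for x
  proof (rule mat_eqI_uv)
    fix j assume j: "j < hdim M"
    show "mapp (f * act M x) (uv j) = mapp (act N x * f) (uv j)"
      using assms(4) [OF j] mapp_mult_carrier [OF assms(3) wfmD [OF assms(1)]]
        mapp_mult_carrier [OF wfmD [OF assms(2)] assms(3)] by simp
  qed (rule mult_carrier_mat [OF assms(3) wfmD [OF assms(1)]]
      mult_carrier_mat [OF wfmD [OF assms(2)] assms(3)])+
  then show ?thesis using assms(3) by (simp add: homs_def)
qed

lemma homsD:
  assumes "wfm M" "wfm N" "f \<in> homs M N"
  shows "mapp f (mapp (act M x) v) = mapp (act N x) (mapp f v)"
proof -
  have f: "f \<in> carrier_mat (hdim N) (hdim M)" and e: "f * act M x = act N x * f"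
    using assms(3) by (auto simp: homs_def)
  show ?thesis using arg_cong [OF e, of "\<lambda>m. mapp m v"] mapp_mult_carrier [OF f wfmD [OF assms(1)]]
        mapp_mult_carrier [OF wfmD [OF assms(2)] f] by simp
qed

section \<open>Injectivity, surjectivity and inverses of matrices in terms of coordinate
  functions\<close>

definition injm :: "'k::field mat \<Rightarrow> bool" where
  "injm f \<longleftrightarrow> (\<forall>v. supp (dim_col f) v \<and> mapp f v = 0 \<longrightarrow> v = 0)"

lemma mult_mat_vec_mapp:
  assumes "v \<in> carrier_vec (dim_col f)"
  shows "f *\<^sub>v v = vec (dim_row f) (mapp f (\<lambda>j. if j < dim_col f then v $ j else 0))"
  using assms by (intro eq_vecI) (auto simp: mapp_def scalar_prod_def atLeast0LessThan intro!: sum.cong)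

lemma vec_eq_iff_supp: "supp n v \<Longrightarrow> supp n w \<Longrightarrow> vec n v = vec n w \<longleftrightarrow> v = w"
proof
  assume s: "supp n v" "supp n w" and e: "vec n v = vec n w"
  show "v = w"
  proof
    fix i show "v i = w i"
      using s arg_cong [OF e, of "\<lambda>x. x $ i"] by (cases "i < n") (auto simp: supp_def)
  qed
qed simp

lemma mult_mat_vec_vec: "supp (dim_col f) v \<Longrightarrow> f *\<^sub>v vec (dim_col f) v = vec (dim_row f) (mapp f v)"
  by (subst mult_mat_vec_mapp)
     (auto simp: mapp_def intro!: eq_vecI sum.cong)

lemma carrier_vec_obtain:
  assumes "w \<in> carrier_vec n" obtains v where "supp n v" "w = vec n v"
proof
  show "supp n (\<lambda>j. if j < n then w $ j else 0)" by (simp add: supp_def)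
  show "w = vec n (\<lambda>j. if j < n then w $ j else 0)" using assms by auto
qed

lemma injm_iff_mat_injective: "mat_injective f \<longleftrightarrow> injm f"
proof
  assume m: "mat_injective f"
  show "injm f" unfolding injm_def
  proof (intro allI impI, elim conjE)
    fix v assume s: "supp (dim_col f) v" and z: "mapp f v = 0"
    have "f *\<^sub>v vec (dim_col f) v = f *\<^sub>v vec (dim_col f) 0"
      by (simp add: mult_mat_vec_vec s z)
    then have "vec (dim_col f) v = vec (dim_col f) 0"
      using m unfolding mat_injective_def inj_on_def by auto
    then show "v = 0" using vec_eq_iff_supp [OF s supp_0] by blast
  qed
next
  assume i: "injm f"
  show "mat_injective f" unfolding mat_injective_def
  proof (rule inj_onI)
    fix x y assume x: "x \<in> carrier_vec (dim_col f)" and y: "y \<in> carrier_vec (dim_col f)"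
      and e: "f *\<^sub>v x = f *\<^sub>v y"
    obtain v where v: "supp (dim_col f) v" "x = vec (dim_col f) v" using x by (rule carrier_vec_obtain)
    obtain w where w: "supp (dim_col f) w" "y = vec (dim_col f) w" using y by (rule carrier_vec_obtain)
    have "mapp f v = mapp f w"
      using e v w by (auto simp: mult_mat_vec_vec vec_eq_iff_supp)
    then have "mapp f (v - w) = 0" by simp
    then have "v - w = 0" using i supp_diff [OF v(1) w(1)] unfolding injm_def by blast
    then show "x = y" using v w by simp
  qed
qed

lemma mat_surjective_iff:
  fixes f :: "'k::field mat"
  shows "mat_surjective f \<longleftrightarrow> (\<forall>w. supp (dim_row f) w \<longrightarrow> (\<exists>v. supp (dim_col f) v \<and> mapp f v = w))"
proof
  assume m: "mat_surjective f"
  show "\<forall>w. supp (dim_row f) w \<longrightarrow> (\<exists>v. supp (dim_col f) v \<and> mapp f v = w)"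
  proof (intro allI impI)
    fix w :: "nat \<Rightarrow> 'k" assume w: "supp (dim_row f) w"
    have "vec (dim_row f) w \<in> mult_mat_vec f ` carrier_vec (dim_col f)"
      using m unfolding mat_surjective_def by auto
    then obtain x where x: "x \<in> carrier_vec (dim_col f)" "vec (dim_row f) w = f *\<^sub>v x" by auto
    obtain v where v: "supp (dim_col f) v" "x = vec (dim_col f) v" using x(1) by (rule carrier_vec_obtain)
    show "\<exists>v. supp (dim_col f) v \<and> mapp f v = w"
      using x v w by (auto simp: mult_mat_vec_vec vec_eq_iff_supp)
  qed
next
  assume m: "\<forall>w. supp (dim_row f) w \<longrightarrow> (\<exists>v. supp (dim_col f) v \<and> mapp f v = w)"
  show "mat_surjective f" unfolding mat_surjective_def
  proof (intro equalityI subsetI)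
    fix y :: "'k vec" assume "y \<in> carrier_vec (dim_row f)"
    then obtain w where w: "supp (dim_row f) w" "y = vec (dim_row f) w" by (rule carrier_vec_obtain)
    then obtain v where v: "supp (dim_col f) v" "mapp f v = w" using m by blast
    have "y = f *\<^sub>v vec (dim_col f) v" by (simp only: mult_mat_vec_vec [OF v(1)] v(2) w(2))
    then show "y \<in> mult_mat_vec f ` carrier_vec (dim_col f)"
      by (simp only: imageI [OF vec_carrier])
  next
    fix y assume "y \<in> mult_mat_vec f ` carrier_vec (dim_col f)"
    then show "y \<in> carrier_vec (dim_row f)"
      by (auto intro!: carrier_vecI)
  qed
qed

lemma injm_square_inverse:
  assumes "f \<in> carrier_mat m m" "injm f"
  obtains g where "g \<in> carrier_mat m m" "g * f = 1\<^sub>m m" "f * g = 1\<^sub>m m"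
proof -
  have "det f \<noteq> 0"
  proof
    assume "det f = 0"
    then obtain x where x: "x \<in> carrier_vec m" "x \<noteq> 0\<^sub>v m" "f *\<^sub>v x = 0\<^sub>v m"
      using det_0_iff_vec_prod_zero_field [OF assms(1)] by blast
    obtain v where v: "supp m v" "x = vec m v" using x(1) by (rule carrier_vec_obtain)
    have "vec m (mapp f v) = vec m 0"
      using x(3) v assms(1) mult_mat_vec_vec [of f v] by (auto simp: zero_vec_def zero_fun_def)
    then have "mapp f v = 0" using assms(1) vec_eq_iff_supp [of m "mapp f v" 0] by auto
    then have "v = 0" using assms v(1) by (auto simp: injm_def)
    then show False using x(2) v by (auto simp: zero_vec_def zero_fun_def)
  qed
  from det_non_zero_imp_unit [OF assms(1) this, of "()"] that show ?thesis
    by (auto simp: Units_def ring_mat_def)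
qed

section \<open>The commutation relations\<close>

text \<open>Evaluation at an index is taken away from the simplifier so that equations between
  vectors stay equations between vectors; \<open>pointwise\<close> brings it back where coefficients
  are compared.\<close>

declare zero_fun_apply [simp del] plus_fun_apply [simp del] minus_apply [simp del] uminus_apply [simp del] sc_apply [simp del]

lemmas pointwise = fun_eq_iff zero_fun_apply plus_fun_apply minus_apply uminus_apply sc_apply

lemma sc_minus: "(- c) \<cdot>\<^sub>f v = - (c \<cdot>\<^sub>f v)"
  by (simp add: pointwise)

lemma qint_0 [simp]: "qint q 0 = 0" by (simp add: qint_def)
lemma qint_Suc: "qint q (Suc k) = qint q k + q ^ k" by (simp add: qint_def)
lemma qint_1 [simp]: "qint q (Suc 0) = 1" by (simp add: qint_def)

lemma qint_mult: "(q - 1) * qint q k = q ^ k - 1"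
  by (induction k) (simp_all add: qint_Suc algebra_simps)

lemma qint_Suc': "qint q (Suc k) = 1 + q * qint q k"
  using qint_mult [of q k] by (simp add: qint_Suc algebra_simps)

section \<open>Arithmetic of a primitive root of unity\<close>

locale qroot =
  fixes n :: nat and q :: "'k::field"
  assumes n2: "n > 2" and prim: "primitive_root_of_unity n q"
begin

lemma qn [simp]: "q ^ n = 1" and qm: "0 < m \<Longrightarrow> m < n \<Longrightarrow> q ^ m \<noteq> 1"
  using prim by (auto simp: primitive_root_of_unity_def)

lemma q0 [simp]: "q \<noteq> 0" using qn n2 by (metis power_0_left zero_neq_one not_less0)
lemma q1 [simp]: "q \<noteq> 1" using qm [of 1] n2 by auto
lemma q1' [simp]: "q - 1 \<noteq> 0" "1 - q \<noteq> 0" by auto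

lemma qint_eq: "qint q k = (q ^ k - 1) / (q - 1)"
  using qint_mult [of q k] by (simp add: field_simps)

lemma qint_n [simp]: "qint q n = 0" by (simp add: qint_eq)
lemma qint_neq_0: "0 < k \<Longrightarrow> k < n \<Longrightarrow> qint q k \<noteq> 0" by (simp add: qint_eq qm)

lemma qpow_eq_1_iff: "q ^ m = 1 \<longleftrightarrow> n dvd m"
proof
  assume "q ^ m = 1"
  have "q ^ m = q ^ (m mod n) * (q ^ n) ^ (m div n)"
    by (simp only: power_mult [symmetric] power_add [symmetric]) simp
  with \<open>q ^ m = 1\<close> have "q ^ (m mod n) = 1" by simp
  then have "m mod n = 0" using qm [of "m mod n"] n2 by (metis mod_less_divisor gr0I not_less_iff_gr_or_eq zero_less_numeral less_trans)
  then show "n dvd m" by auto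
qed (auto elim!: dvdE simp: power_mult)

lemma qpowi_eq_1_iff: "q powi i = 1 \<longleftrightarrow> int n dvd i"
proof (cases "i \<ge> 0")
  case True
  then obtain m where "i = int m" by (metis nonneg_int_cases)
  then show ?thesis by (simp add: qpow_eq_1_iff)
next
  case False
  then obtain m where "i = - int m" by (metis nle_le nonpos_int_cases)
  then show ?thesis by (simp add: power_int_minus qpow_eq_1_iff)
qed

lemma qpowi_eq_iff: "q powi i = q powi j \<longleftrightarrow> int n dvd (i - j)"
proof -
  have "q powi i = q powi j \<longleftrightarrow> q powi (i - j) = 1"
    by (simp add: power_int_diff)
  then show ?thesis by (simp add: qpowi_eq_1_iff)
qed

lemma qpowi_cong: "int n dvd (i - j) \<Longrightarrow> q powi i = q powi j"
  by (simp add: qpowi_eq_iff)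

lemma qpowi_add: "q powi (i + j) = q powi i * q powi j"
  by (simp add: power_int_add)

lemma qpowi_neq_0 [simp]: "q powi i \<noteq> 0" by simp

lemma alpha_eq: "alpha q i l = qint q i * (1 - q powi (int i - int l))" by (simp add: alpha_def)

lemma alpha_0 [simp]: "alpha q 0 l = 0" and alpha_self [simp]: "alpha q l l = 0"
  and alpha_n [simp]: "alpha q n l = 0"
  by (simp_all add: alpha_def)

lemma alpha_neq_0: "0 < i \<Longrightarrow> i < n \<Longrightarrow> \<not> int n dvd (int i - int l) \<Longrightarrow> alpha q i l \<noteq> 0"
  using qint_neq_0 [of i] qpowi_eq_1_iff [of "int i - int l"] by (auto simp: alpha_def)

lemma alpha_neq_0': "0 < i \<Longrightarrow> i < l \<Longrightarrow> l \<le> n \<Longrightarrow> alpha q i l \<noteq> 0"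
  by (rule alpha_neq_0) (auto dest: zdvd_imp_le zdvd_not_zless simp: dvd_diff_commute [of "int n" "int i"])

text \<open>If n vanished in k, the polynomial 1 + x + ... + x^(n-1) of degree below n would have
  the n distinct roots q^i, the case i = 0 included because its value at 1 is n. The fact is needed
  so that averaging over the powers of b and c does not kill a vector.\<close>

lemma of_nat_n_neq_0: "(of_nat n :: 'k) \<noteq> 0"
proof
  assume n0: "(of_nat n :: 'k) = 0"
  define p where "p = (\<Sum>j<n. monom (1::'k) j)"
  have deg: "degree p < n"
  proof -
    have "degree p \<le> n - 1" unfolding p_def
      by (intro degree_sum_le) (auto simp: degree_monom_eq)
    then show ?thesis using n2 by simp
  qed
  have c: "coeff p 0 = 1"
    using n2 by (simp add: p_def coeff_sum if_distrib cong: if_cong)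
  then have "p \<noteq> 0" by auto
  have roots: "poly p (q ^ i) = 0" if "i < n" for i
  proof (cases "i = 0")
    case True
    then show ?thesis using n0 by (simp add: p_def poly_sum poly_monom)
  next
    case False
    have "poly p (q ^ i) = (\<Sum>j<n. (q ^ i) ^ j)" by (simp add: p_def poly_sum poly_monom)
    also have "(q ^ i - 1) * \<dots> = (q ^ i) ^ n - 1"
      using power_diff_1_eq [of "q ^ i" n] by simp
    also have "\<dots> = 0" by (simp add: power_mult [symmetric] mult.commute [of i] power_mult)
    finally show ?thesis using qm [of i] False that by auto
  qed
  have inj: "inj_on (\<lambda>i. q ^ i) {..<n}"
  proof (rule inj_onI)
    fix i j assume ij: "i \<in> {..<n}" "j \<in> {..<n}" "q ^ i = q ^ j"
    then have "q powi int i = q powi int j" by simp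
    then have "int n dvd int i - int j" by (simp only: qpowi_eq_iff)
    then show "i = j" using ij
      by (metis lessThan_iff mod_less mod_eq_dvd_iff of_nat_eq_iff zmod_int)
  qed
  have "card ((\<lambda>i. q ^ i) ` {..<n}) \<le> card {x. poly p x = 0}"
    by (intro card_mono poly_roots_finite \<open>p \<noteq> 0\<close>) (auto simp: roots)
  also have "\<dots> \<le> degree p" by (rule card_poly_roots_bound [OF \<open>p \<noteq> 0\<close>])
  finally show False using deg inj by (simp add: card_image)
qed

end

text \<open>The operators act on all functions, but da - qad = 1 - bc contains the identity and
  fails outside the support of the module. It is therefore asked only for weight vectors with
  \<open>\<beta> \<noteq> 0\<close>: such an x equals b x divided by \<beta> and so has its support
  in the module. Nilpotency of a and d and the orders of b and c are left out, which lets the locale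
  apply before they are known.\<close>

locale hact = qroot n q for n :: nat and q :: "'k::field" +
  fixes a b c d :: "(nat \<Rightarrow> 'k) \<Rightarrow> nat \<Rightarrow> 'k"
  assumes lin: "lin a" "lin b" "lin c" "lin d"
    and ba: "b (a x) = q \<cdot>\<^sub>f a (b x)" and db: "d (b x) = q \<cdot>\<^sub>f b (d x)"
    and ca: "c (a x) = q \<cdot>\<^sub>f a (c x)" and dc: "d (c x) = q \<cdot>\<^sub>f c (d x)"
    and da: "b x = \<beta> \<cdot>\<^sub>f x \<Longrightarrow> c x = \<chi> \<cdot>\<^sub>f x \<Longrightarrow> \<beta> \<noteq> 0 \<Longrightarrow>
      d (a x) = q \<cdot>\<^sub>f a (d x) + (1 - \<beta> * \<chi>) \<cdot>\<^sub>f x"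
begin

lemmas lins [simp] = linD [OF lin(1)] linD [OF lin(2)] linD [OF lin(3)] linD [OF lin(4)]
  lin_0 [OF lin(1)] lin_0 [OF lin(2)] lin_0 [OF lin(3)] lin_0 [OF lin(4)]
  lin_diff [OF lin(1)] lin_diff [OF lin(2)] lin_diff [OF lin(3)] lin_diff [OF lin(4)]
  linD [OF lin_funpow [OF lin(1)]] linD [OF lin_funpow [OF lin(4)]]
  lin_0 [OF lin_funpow [OF lin(1)]] lin_0 [OF lin_funpow [OF lin(4)]]

definition wt :: "'k \<Rightarrow> 'k \<Rightarrow> (nat \<Rightarrow> 'k) \<Rightarrow> bool" where
  "wt \<beta> \<chi> x \<longleftrightarrow> b x = \<beta> \<cdot>\<^sub>f x \<and> c x = \<chi> \<cdot>\<^sub>f x"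

lemma wtD: "wt \<beta> \<chi> x \<Longrightarrow> b x = \<beta> \<cdot>\<^sub>f x" "wt \<beta> \<chi> x \<Longrightarrow> c x = \<chi> \<cdot>\<^sub>f x"
  by (simp_all add: wt_def)

lemma wt_0 [simp]: "wt \<beta> \<chi> 0" by (simp add: wt_def)
lemma wt_add: "wt \<beta> \<chi> x \<Longrightarrow> wt \<beta> \<chi> y \<Longrightarrow> wt \<beta> \<chi> (x + y)" by (simp add: wt_def sc_add)
lemma wt_diff: "wt \<beta> \<chi> x \<Longrightarrow> wt \<beta> \<chi> y \<Longrightarrow> wt \<beta> \<chi> (x - y)"
  by (simp add: wt_def pointwise algebra_simps)
lemma wt_sc: "wt \<beta> \<chi> x \<Longrightarrow> wt \<beta> \<chi> (k \<cdot>\<^sub>f x)" by (simp add: wt_def mult.commute)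

lemma wt_a: "wt \<beta> \<chi> x \<Longrightarrow> wt (q * \<beta>) (q * \<chi>) (a x)"
  by (simp add: wt_def ba ca)

lemma bd: "b (d x) = inverse q \<cdot>\<^sub>f d (b x)" and cd: "c (d x) = inverse q \<cdot>\<^sub>f d (c x)"
  by (simp_all add: db dc)

lemma wt_d: "wt \<beta> \<chi> x \<Longrightarrow> wt (\<beta> / q) (\<chi> / q) (d x)"
  by (simp add: wt_def bd cd field_simps)

lemma wt_apow: "wt \<beta> \<chi> x \<Longrightarrow> wt (q ^ k * \<beta>) (q ^ k * \<chi>) ((a ^^ k) x)"
  by (induction k) (auto dest!: wt_a simp: mult.assoc)

lemma wt_dpow: "wt \<beta> \<chi> x \<Longrightarrow> wt (\<beta> / q ^ k) (\<chi> / q ^ k) ((d ^^ k) x)"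
proof (induction k)
  case (Suc k)
  from wt_d [OF Suc.IH [OF Suc.prems]] show ?case by (simp add: field_simps)
qed simp

lemma d_a: "wt \<beta> \<chi> x \<Longrightarrow> \<beta> \<noteq> 0 \<Longrightarrow> d (a x) = q \<cdot>\<^sub>f a (d x) + (1 - \<beta> * \<chi>) \<cdot>\<^sub>f x"
  using da by (auto simp: wt_def)

text \<open>Each step moves d past one more a and picks up 1 - bc at the current weight; the
  constants add up to a q-integer times one factor.\<close>

lemma d_apow:
  assumes "wt \<beta> \<chi> x" "\<beta> \<noteq> 0"
  shows "d ((a ^^ Suc k) x) = q ^ Suc k \<cdot>\<^sub>f (a ^^ Suc k) (d x)
    + (qint q (Suc k) * (1 - q ^ k * \<beta> * \<chi>)) \<cdot>\<^sub>f (a ^^ k) x"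
proof (induction k)
  case 0
  then show ?case using d_a [OF assms] by simp
next
  case (Suc k)
  have w: "wt (q ^ Suc k * \<beta>) (q ^ Suc k * \<chi>) ((a ^^ Suc k) x)" by (rule wt_apow [OF assms(1)])
  have "d ((a ^^ Suc (Suc k)) x) = q \<cdot>\<^sub>f a (d ((a ^^ Suc k) x))
      + (1 - (q ^ Suc k * \<beta>) * (q ^ Suc k * \<chi>)) \<cdot>\<^sub>f (a ^^ Suc k) x"
    using d_a [OF w] assms(2) by simp
  also have "\<dots> = q ^ Suc (Suc k) \<cdot>\<^sub>f (a ^^ Suc (Suc k)) (d x)
    + (q * qint q (Suc k) * (1 - q ^ k * \<beta> * \<chi>) + (1 - (q ^ Suc k * \<beta>) * (q ^ Suc k * \<chi>))) \<cdot>\<^sub>f (a ^^ Suc k) x"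
    by (simp only: Suc lins) (simp add: pointwise algebra_simps)
  also have "q * qint q (Suc k) * (1 - q ^ k * \<beta> * \<chi>) + (1 - (q ^ Suc k * \<beta>) * (q ^ Suc k * \<chi>))
      = qint q (Suc (Suc k)) * (1 - q ^ Suc k * \<beta> * \<chi>)"
  proof -
    \<comment> \<open>The difference of the two sides is a multiple of (q - 1) * Q - (q * u - 1),
      which vanishes by \<open>qint_mult\<close> once Q and u are a q-integer and the matching power
      of q.\<close>
    have "q * Q * (1 - u * \<beta> * \<chi>) + (1 - (q * u * \<beta>) * (q * u * \<chi>)) - (1 + q * Q) * (1 - q * u * \<beta> * \<chi>)
        = q * u * \<beta> * \<chi> * ((q - 1) * Q - (q * u - 1))" for Q u :: 'k
      by (simp add: algebra_simps)
    from this [of "qint q (Suc k)" "q ^ k"] show ?thesis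
      unfolding qint_Suc' [of q "Suc k"] using qint_mult [of q "Suc k"] by simp
  qed
  finally show ?case .
qed

lemma dpow_a:
  assumes "wt \<beta> \<chi> x" "\<beta> \<noteq> 0"
  shows "(d ^^ Suc k) (a x) = q ^ Suc k \<cdot>\<^sub>f a ((d ^^ Suc k) x)
    + (qint q (Suc k) * (1 - \<beta> * \<chi> / q ^ k)) \<cdot>\<^sub>f (d ^^ k) x"
proof (induction k)
  case 0
  then show ?case using d_a [OF assms] by simp
next
  case (Suc k)
  have w: "wt (\<beta> / q ^ Suc k) (\<chi> / q ^ Suc k) ((d ^^ Suc k) x)" by (rule wt_dpow [OF assms(1)])
  have divide_neq_0: "\<beta> / q ^ Suc k \<noteq> 0" using assms(2) by simp
  have "(d ^^ Suc (Suc k)) (a x) = q ^ Suc k \<cdot>\<^sub>f d (a ((d ^^ Suc k) x))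
    + (qint q (Suc k) * (1 - \<beta> * \<chi> / q ^ k)) \<cdot>\<^sub>f (d ^^ Suc k) x"
    using arg_cong [OF Suc, of d] by simp
  also have "\<dots> = q ^ Suc (Suc k) \<cdot>\<^sub>f a ((d ^^ Suc (Suc k)) x)
    + (q ^ Suc k * (1 - (\<beta> / q ^ Suc k) * (\<chi> / q ^ Suc k))
        + qint q (Suc k) * (1 - \<beta> * \<chi> / q ^ k)) \<cdot>\<^sub>f (d ^^ Suc k) x"
    unfolding funpow.simps o_apply d_a [OF w [unfolded funpow.simps o_apply] divide_neq_0]
    by (simp add: pointwise field_simps)
  also have "q ^ Suc k * (1 - (\<beta> / q ^ Suc k) * (\<chi> / q ^ Suc k)) + qint q (Suc k) * (1 - \<beta> * \<chi> / q ^ k)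
      = qint q (Suc (Suc k)) * (1 - \<beta> * \<chi> / q ^ Suc k)"
  proof -
    have *: "qint q (Suc (Suc k)) = qint q (Suc k) + q ^ Suc k" by (rule qint_Suc)
    have **: "qint q (Suc k) * q + 1 = qint q (Suc k) + q ^ Suc k"
      using qint_mult [of q "Suc k"] by (simp add: algebra_simps)
    have "q ^ Suc k * (1 - (\<beta> / q ^ Suc k) * (\<chi> / q ^ Suc k)) + qint q (Suc k) * (1 - \<beta> * \<chi> / q ^ k)
      = q ^ Suc k + qint q (Suc k) - \<beta> * \<chi> / q ^ Suc k * (qint q (Suc k) * q + 1)"
      by (simp add: field_simps)
    also have "\<dots> = qint q (Suc (Suc k)) * (1 - \<beta> * \<chi> / q ^ Suc k)"
      unfolding * ** by (simp add: field_simps)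
    finally show ?thesis .
  qed
  finally show ?case .
qed

text \<open>At exponent n the coefficient in \<open>dpow_a\<close> contains (n)_q = 0, and q^n = 1.
  So d^n commutes with a on weight vectors, and d^n = 0 need only be checked on vectors that
  generate under a.\<close>

lemma dn_a:
  assumes "wt \<beta> \<chi> x" "\<beta> \<noteq> 0"
  shows "(d ^^ n) (a x) = a ((d ^^ n) x)"
  using dpow_a [OF assms, of "n - 1"] n2 by simp

lemma dn_apow:
  assumes "wt \<beta> \<chi> x" "\<beta> \<noteq> 0" "(d ^^ n) x = 0"
  shows "(d ^^ n) ((a ^^ k) x) = 0"
proof (induction k)
  case (Suc k)
  from dn_a [OF wt_apow [OF assms(1), of k]] assms(2) Suc show ?case by simp
qed (use assms in simp)

end

text \<open>One column of a bidiagonal matrix applied to the family g. The families used later are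
  indexed by all natural numbers and vanish from index s on, so the last member, which has no
  successor, needs no separate case.\<close>

definition comb :: "'k::field \<Rightarrow> 'k \<Rightarrow> (nat \<Rightarrow> nat \<Rightarrow> 'k) \<Rightarrow> nat \<Rightarrow> nat \<Rightarrow> 'k" where
  "comb x y g e = x \<cdot>\<^sub>f g e + y \<cdot>\<^sub>f g (Suc e)"

lemma lin_comb: "lin F \<Longrightarrow> F (comb x y g e) = comb x y (\<lambda>e. F (g e)) e"
  by (simp add: comb_def linD)

section \<open>Weights as exponents of q, and families of band type\<close>

context hact
begin

definition wti :: "int \<Rightarrow> int \<Rightarrow> (nat \<Rightarrow> 'k) \<Rightarrow> bool" where
  "wti x y v \<longleftrightarrow> wt (q powi x) (q powi y) v"

lemma wtiD: "wti x y v \<Longrightarrow> b v = q powi x \<cdot>\<^sub>f v" "wti x y v \<Longrightarrow> c v = q powi y \<cdot>\<^sub>f v"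
  by (auto simp: wti_def dest: wtD)

lemma wti_0 [simp]: "wti x y 0" by (simp add: wti_def)
lemma wti_add: "wti x y v \<Longrightarrow> wti x y w \<Longrightarrow> wti x y (v + w)" by (simp add: wti_def wt_add)
lemma wti_diff: "wti x y v \<Longrightarrow> wti x y w \<Longrightarrow> wti x y (v - w)" by (simp add: wti_def wt_diff)
lemma wti_sc: "wti x y v \<Longrightarrow> wti x y (k \<cdot>\<^sub>f v)" by (simp add: wti_def wt_sc)
lemma wti_comb: "(\<And>e. wti x y (g e)) \<Longrightarrow> wti x y (comb k l g e)"
  by (simp add: comb_def wti_add wti_sc)

lemma wti_cong: "wti x y v \<Longrightarrow> int n dvd (x - x') \<Longrightarrow> int n dvd (y - y') \<Longrightarrow> wti x' y' v"
  unfolding wti_def by (metis qpowi_cong)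

lemma wti_apow:
  assumes "wti x y v" shows "wti (x + int k) (y + int k) ((a ^^ k) v)"
  using wt_apow [OF assms [unfolded wti_def], of k] by (simp add: wti_def qpowi_add mult.commute)

lemma wti_a: "wti x y v \<Longrightarrow> wti (x + 1) (y + 1) (a v)"
  using wti_apow [of x y v 1] by simp

lemma wti_dpow:
  assumes "wti x y v" shows "wti (x - int k) (y - int k) ((d ^^ k) v)"
  using wt_dpow [OF assms [unfolded wti_def], of k] by (simp add: wti_def power_int_diff)

lemma wti_d: "wti x y v \<Longrightarrow> wti (x - 1) (y - 1) (d v)"
  using wti_dpow [of x y v 1] by simp

lemma d_a_wti: "wti x y v \<Longrightarrow> d (a v) = q \<cdot>\<^sub>f a (d v) + (1 - q powi (x + y)) \<cdot>\<^sub>f v"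
  unfolding wti_def by (subst d_a) (auto simp: qpowi_add)

lemma d_apow_wti:
  assumes "wti x y v"
  shows "d ((a ^^ k) v) = q ^ k \<cdot>\<^sub>f (a ^^ k) (d v) + (qint q k * (1 - q powi (x + y + int k - 1))) \<cdot>\<^sub>f (a ^^ (k - 1)) v"
proof (cases k)
  case (Suc j)
  have "q powi (x + y + int k - 1) = q ^ j * q powi x * q powi y"
    by (simp add: Suc qpowi_add mult_ac)
  with d_apow [OF assms [unfolded wti_def], of j] show ?thesis by (simp add: Suc mult.assoc)
qed simp

text \<open>The congruence says that the weight is that of a highest weight vector of some V(l, _);
  it turns the coefficient into the structure constant \<alpha>_k(l).\<close>

lemma d_apow_hw:
  assumes "wti x y v" "int n dvd (x + y - 1 + int l)"
  shows "d ((a ^^ k) v) = q ^ k \<cdot>\<^sub>f (a ^^ k) (d v) + alpha q k l \<cdot>\<^sub>f (a ^^ (k - 1)) v"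
proof -
  have "q powi (x + y + int k - 1) = q powi (int k - int l)"
    by (rule qpowi_cong) (use assms(2) in \<open>simp add: algebra_simps\<close>)
  then show ?thesis using d_apow_wti [OF assms(1), of k] by (simp add: alpha_eq)
qed

text \<open>The g e have the weight of a generator of V(m,t), the f e that of a generator of
  V(n-m,t+m); A0, A1 and D0, D1 give the two bidiagonal matrices by which a^(n-m) and d glue the
  second kind to the first. With A = (1,0) and D = (\<eta>q^m,1) these are the relations of
  M_s(m,t,\<eta>), with A = (0,1) and D = (1,0) those for \<eta> = \<infinity>. The factor \<kappa>
  is kept apart because it is what the ladder maps change.\<close>

definition band ::
    "'k \<Rightarrow> 'k \<Rightarrow> 'k \<Rightarrow> 'k \<Rightarrow> nat \<Rightarrow> int \<Rightarrow> 'k \<Rightarrow> (nat \<Rightarrow> nat \<Rightarrow> 'k) \<Rightarrow> (nat \<Rightarrow> nat \<Rightarrow> 'k) \<Rightarrow> bool" where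
  "band A0 A1 D0 D1 m t \<kappa> f g \<longleftrightarrow> (\<forall>e. wti t (1 - t - int m) (g e) \<and> wti (t + int m) (1 - t) (f e) \<and>
     d (g e) = 0 \<and> (a ^^ m) (g e) = 0 \<and> (a ^^ (n - m)) (f e) = comb A0 A1 g e \<and>
     d (f e) = \<kappa> \<cdot>\<^sub>f (a ^^ (m - 1)) (comb D0 D1 g e))"

end

text \<open>The identities say that u_1 \<otimes> x \<mapsto> P1 x, u_2 \<otimes> x \<mapsto> P2 x
  commutes with the generators, where u_1, u_2 is the basis of V(2,0) and V(2,0) \<otimes> X carries
  the action through the comultiplication. The constant 1 - 1/q is \<alpha>_1(2).\<close>

locale ladder = hact n q a b c d + tgt: hact n q a' b' c' d'
  for n :: nat and q :: "'k::field" and a b c d a' b' c' d' +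
  fixes P1 P2 :: "(nat \<Rightarrow> 'k) \<Rightarrow> nat \<Rightarrow> 'k"
  assumes linP: "lin P1" "lin P2"
    and aP1: "a' (P1 x) = P1 (a x) + P2 (b x)" and aP2: "a' (P2 x) = P2 (a x)"
    and dP1: "d' (P1 x) = P1 (d x)" and dP2: "d' (P2 x) = (1 - 1 / q) \<cdot>\<^sub>f P1 (c x) + P2 (d x)"
    and bP1: "b' (P1 x) = P1 (b x)" and bP2: "b' (P2 x) = q \<cdot>\<^sub>f P2 (b x)"
    and cP1: "c' (P1 x) = (1 / q) \<cdot>\<^sub>f P1 (c x)" and cP2: "c' (P2 x) = P2 (c x)"
begin

lemmas linPs [simp] = linD [OF linP(1)] linD [OF linP(2)] lin_0 [OF linP(1)] lin_0 [OF linP(2)]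

lemma wti_P1: "wti x y v \<Longrightarrow> tgt.wti x (y - 1) (P1 v)"
  by (simp add: wti_def wt_def tgt.wti_def tgt.wt_def bP1 cP1 power_int_diff)

lemma wti_P2: "wti x y v \<Longrightarrow> tgt.wti (x + 1) y (P2 v)"
  by (simp add: wti_def wt_def tgt.wti_def tgt.wt_def bP2 cP2 power_int_add mult.commute)

lemma apow_P2: "(a' ^^ k) (P2 x) = P2 ((a ^^ k) x)"
  by (induction k) (simp_all add: aP2)

text \<open>Each application of a turns one P1 into P2 b, and the eigenvalues q^j q^x of b met on
  the way sum up to a q-integer.\<close>

lemma apow_P1:
  assumes "wti x y v"
  shows "(a' ^^ k) (P1 v) = P1 ((a ^^ k) v) + (qint q k * q powi x) \<cdot>\<^sub>f P2 ((a ^^ (k - 1)) v)"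
proof (induction k)
  case (Suc k)
  have "(a' ^^ Suc k) (P1 v) = P1 ((a ^^ Suc k) v) + P2 (b ((a ^^ k) v))
      + (qint q k * q powi x) \<cdot>\<^sub>f P2 (a ((a ^^ (k - 1)) v))"
    by (simp add: Suc aP1 aP2)
  also have "(qint q k * q powi x) \<cdot>\<^sub>f P2 (a ((a ^^ (k - 1)) v)) = (qint q k * q powi x) \<cdot>\<^sub>f P2 ((a ^^ k) v)"
    by (cases k) auto
  also have "b ((a ^^ k) v) = (q ^ k * q powi x) \<cdot>\<^sub>f (a ^^ k) v"
    using wtiD(1) [OF wti_apow [OF assms, of k]] by (simp add: qpowi_add mult.commute)
  finally show ?case by (simp add: qint_Suc) (simp add: pointwise algebra_simps)
qed simp

text \<open>In V(2,0) \<otimes> V(m,t) the vector u_1 \<otimes> g generates the part of dimension m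
  + 1, whence the new g. In the new f one constant serves two purposes: it removes the P2 part of
  a^(n-m-1) f and the P1 part of d f.\<close>

lemma band_up:
  assumes B: "band A0 A1 D0 D1 m t \<kappa> f g" and m: "1 \<le> m" "m + 1 < n"
  shows "tgt.band A0 A1 D0 D1 (Suc m) t (\<kappa> * qint q (Suc m) / qint q m)
    (\<lambda>e. P1 (a (f e)) + (q powi t * qint q (Suc m)) \<cdot>\<^sub>f P2 (f e)) (\<lambda>e. P1 (g e))"
    (is "tgt.band _ _ _ _ _ _ ?\<kappa> ?f ?g")
proof -
  let ?G = "\<lambda>e. comb D0 D1 g e"
  have g: "wti t (1 - t - int m) (g e)" "d (g e) = 0" "(a ^^ m) (g e) = 0"
    and f: "wti (t + int m) (1 - t) (f e)" "(a ^^ (n - m)) (f e) = comb A0 A1 g e"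
      "d (f e) = \<kappa> \<cdot>\<^sub>f (a ^^ (m - 1)) (?G e)" for e
    using B by (auto simp: band_def)
  have wG: "wti t (1 - t - int m) (?G e)" for e by (rule wti_comb [OF g(1)])
  have aG: "(a ^^ m) (?G e) = 0" for e by (simp add: lin_comb [OF lin_funpow [OF lin(1)]] g comb_def)
  have P1c: "comb x y ?g e = P1 (comb x y g e)" for x y e by (simp add: comb_def)
  have m0: "qint q m \<noteq> 0" using m by (simp add: qint_neq_0)
  have wg: "tgt.wti t (1 - t - int (Suc m)) (?g e)" for e
    using wti_P1 [OF g(1), of e] by (simp add: algebra_simps)
  have wf: "tgt.wti (t + int (Suc m)) (1 - t) (?f e)" for e
  proof -
    have 1: "tgt.wti (t + int (Suc m)) (1 - t) (P1 (a (f e)))"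
      using wti_P1 [OF wti_a [OF f(1)], of e] by (simp add: algebra_simps)
    have 2: "tgt.wti (t + int (Suc m)) (1 - t) (P2 (f e))"
      using wti_P2 [OF f(1), of e] by (simp add: algebra_simps)
    show ?thesis by (rule tgt.wti_add [OF 1 tgt.wti_sc [OF 2]])
  qed
  have ag: "(a' ^^ Suc m) (?g e) = 0" for e
    unfolding apow_P1 [OF g(1)] using g(3) by simp
  have af: "(a' ^^ (n - Suc m)) (?f e) = comb A0 A1 ?g e" for e
  proof -
    obtain k where k: "n - Suc m = Suc k" using m by (cases "n - Suc m") auto
    have nm: "n - m = Suc (Suc k)" using k m by auto
    have "(a' ^^ Suc k) (?f e) = P1 ((a ^^ Suc k) (a (f e))) + (qint q (Suc k) * q powi (t + int m + 1)) \<cdot>\<^sub>f P2 ((a ^^ k) (a (f e)))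
        + (q powi t * qint q (Suc m)) \<cdot>\<^sub>f P2 ((a ^^ Suc k) (f e))"
      unfolding tgt.lins apow_P2 apow_P1 [OF wti_a [OF f(1)]] by simp
    also have "(a ^^ Suc k) (a (f e)) = comb A0 A1 g e" using f(2) [of e] nm by (simp add: funpow_swap1)
    also have "(a ^^ k) (a (f e)) = (a ^^ Suc k) (f e)" by (simp add: funpow_swap1)
    \<comment> \<open>This cancels the P2 terms: (k+1) + (m+1) = n gives (k+1)_q q^(m+1) =
      -(m+1)_q.\<close>
    also have "qint q (Suc k) * q powi (t + int m + 1) = - (q powi t * qint q (Suc m))"
    proof -
      have "q ^ Suc k * q ^ Suc m = 1"
        using m k by (simp only: power_add [symmetric]) (metis Suc_leI add.commute le_add_diff_inverse m(2) Suc_eq_plus1 less_imp_le_nat qn)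
      then have "qint q (Suc k) * q ^ Suc m = - qint q (Suc m)"
        by (simp only: qint_eq) (simp add: field_simps)
      moreover have "qint q (Suc k) * q powi (t + int m + 1) = q powi t * (qint q (Suc k) * q ^ Suc m)"
        by (simp add: qpowi_add)
      ultimately show ?thesis by simp
    qed
    finally show ?thesis unfolding P1c k by (simp add: sc_minus)
  qed
  have df: "d' (?f e) = ?\<kappa> \<cdot>\<^sub>f (a' ^^ (Suc m - 1)) (comb D0 D1 ?g e)" for e
  proof -
    have z: "a (d (f e)) = 0"
    proof -
      have "a (d (f e)) = \<kappa> \<cdot>\<^sub>f (a ^^ Suc (m - 1)) (?G e)" by (simp add: f)
      then show ?thesis using aG m by simp
    qed
    have "d' (?f e) = P1 (d (a (f e))) + (q powi t * qint q (Suc m)) \<cdot>\<^sub>f ((1 - 1 / q) \<cdot>\<^sub>f P1 (c (f e)) + P2 (d (f e)))"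
      by (simp add: dP1 dP2)
    also have "d (a (f e)) = (1 - q powi (int m + 1)) \<cdot>\<^sub>f f e"
      using d_a_wti [OF f(1), of e] z by (simp add: algebra_simps)
    also have "c (f e) = q powi (1 - t) \<cdot>\<^sub>f f e" by (rule wtiD(2) [OF f(1)])
    finally have "d' (?f e) = (1 - q powi (int m + 1) + q powi t * qint q (Suc m) * (1 - 1 / q) * q powi (1 - t)) \<cdot>\<^sub>f P1 (f e)
       + (q powi t * qint q (Suc m)) \<cdot>\<^sub>f P2 (d (f e))"
      by (simp only: linPs lins tgt.lins sc_sc) (simp add: pointwise algebra_simps)
    also have "1 - q powi (int m + 1) + q powi t * qint q (Suc m) * (1 - 1 / q) * q powi (1 - t) = 0"
    proof -
      have "q powi t * qint q (Suc m) * (1 - 1 / q) * q powi (1 - t) = (q - 1) * qint q (Suc m)"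
        by (simp add: power_int_diff field_simps)
      then show ?thesis by (simp add: qint_mult power_int_add mult.commute)
    qed
    finally have 1: "d' (?f e) = (q powi t * qint q (Suc m) * \<kappa>) \<cdot>\<^sub>f P2 ((a ^^ (m - 1)) (?G e))"
      by (simp add: f)
    \<comment> \<open>Comparing \<open>1\<close> with this multiple of the same vector is what
      multiplies \<kappa> by (m+1)_q / (m)_q.\<close>
    have "(a' ^^ m) (P1 (?G e)) = (qint q m * q powi t) \<cdot>\<^sub>f P2 ((a ^^ (m - 1)) (?G e))"
      unfolding apow_P1 [OF wG] by (simp add: aG)
    then show ?thesis unfolding 1 P1c using m0 by (simp add: field_simps)
  qed
  show ?thesis unfolding tgt.band_def
    using wg wf ag af df by (auto simp: dP1 g)
qed

text \<open>The new g is the combination of P1 a g and P2 g killed by d, which generates the part of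
  dimension m - 1 in V(2,0) \<otimes> V(m,t). Let G be the D-combination of g. Since d P1 f =
  \<kappa> P1 a^(m-1) G is not yet a multiple of a^(m-2) applied to the D-combination of the new g,
  a multiple of P2 a^(m-1) G is added to P1 f.\<close>

lemma band_down:
  assumes B: "band A0 A1 D0 D1 m t \<kappa> f g" and m: "2 \<le> m" "m < n"
  shows "tgt.band A0 A1 D0 D1 (m - 1) (t + 1) (\<kappa> * qint q (m - 1) / qint q m)
    (\<lambda>e. P1 (f e) + (- (\<kappa>) * q powi (t + int m) / ((q - 1) * qint q m)) \<cdot>\<^sub>f P2 ((a ^^ (m - 1)) (comb D0 D1 g e)))
    (\<lambda>e. P1 (a (g e)) + (- (q powi (t + 1) * qint q (m - 1))) \<cdot>\<^sub>f P2 (g e))"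
    (is "tgt.band _ _ _ _ _ _ ?\<kappa> ?f ?g")
proof -
  let ?G = "\<lambda>e. comb D0 D1 g e"
  \<comment> \<open>The P1 and P2 coefficients of d f are \<kappa> + \<mu>(1 - 1/q)q^(-t) and
    \<mu>(m-1)_q(1 - 1/q); they must be in the ratio 1 : -q^(t+m-1) found in a^(m-2) of the new g.
    As (m-1)_q + q^(m-1) = (m)_q, this equation has the solution \<mu>.\<close>
  define \<mu> where "\<mu> = - (\<kappa>) * q powi (t + int m) / ((q - 1) * qint q m)"
  \<comment> \<open>Chosen so that d kills P1 a g + \<nu> P2 g: the contribution 1 - q^(1-m) from d
    a g is cancelled by the term \<nu>(1 - 1/q) P1 c g.\<close>
  define \<nu> where "\<nu> = - (q powi (t + 1) * qint q (m - 1))"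
  define k where "k = m - 2"
  then have k: "m = Suc (Suc k)" using m by simp
  have g: "wti t (1 - t - int m) (g e)" "d (g e) = 0" "(a ^^ m) (g e) = 0"
    and f: "wti (t + int m) (1 - t) (f e)" "(a ^^ (n - m)) (f e) = comb A0 A1 g e"
      "d (f e) = \<kappa> \<cdot>\<^sub>f (a ^^ (m - 1)) (?G e)" for e
    using B by (auto simp: band_def)
  have wG: "wti t (1 - t - int m) (comb x y g e)" for e x y by (rule wti_comb [OF g(1)])
  have aG: "(a ^^ m) (comb x y g e) = 0" for e x y by (simp add: lin_comb [OF lin_funpow [OF lin(1)]] g comb_def)
  have dG: "d (comb x y g e) = 0" for e x y by (simp add: lin_comb [OF lin(4)] g comb_def)
  have P1c: "comb x y (\<lambda>e. P1 (a (g e)) + \<nu> \<cdot>\<^sub>f P2 (g e)) e = P1 (a (comb x y g e)) + \<nu> \<cdot>\<^sub>f P2 (comb x y g e)" for x y e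
    by (simp add: comb_def) (simp add: pointwise algebra_simps)
  have m0: "qint q m \<noteq> 0" using m by (simp add: qint_neq_0)
  have m1: "qint q (m - 1) \<noteq> 0" using m by (simp add: qint_neq_0)
  have wg: "tgt.wti (t + 1) (1 - (t + 1) - int (m - 1)) (P1 (a (g e)) + \<nu> \<cdot>\<^sub>f P2 (g e))" for e
  proof -
    have 1: "tgt.wti (t + 1) (1 - (t + 1) - int (m - 1)) (P1 (a (g e)))"
      using wti_P1 [OF wti_a [OF g(1)], of e] m by (simp add: of_nat_diff algebra_simps)
    have 2: "tgt.wti (t + 1) (1 - (t + 1) - int (m - 1)) (P2 (g e))"
      using wti_P2 [OF g(1), of e] m by (simp add: of_nat_diff algebra_simps)
    show ?thesis by (rule tgt.wti_add [OF 1 tgt.wti_sc [OF 2]])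
  qed
  have wf: "tgt.wti (t + 1 + int (m - 1)) (1 - (t + 1)) (P1 (f e) + \<mu> \<cdot>\<^sub>f P2 ((a ^^ (m - 1)) (?G e)))" for e
  proof -
    have 1: "tgt.wti (t + int m) (- t) (P1 (f e))" using wti_P1 [OF f(1), of e] by simp
    have "tgt.wti (t + int (m - 1) + 1) (1 - t - int m + int (m - 1)) (P2 ((a ^^ (m - 1)) (?G e)))"
      by (rule wti_P2 [OF wti_apow [OF wG]])
    then have 2: "tgt.wti (t + int m) (- t) (P2 ((a ^^ (m - 1)) (?G e)))" using m by (simp add: of_nat_diff algebra_simps)
    show ?thesis using tgt.wti_add [OF 1 tgt.wti_sc [OF 2]] m by (simp add: of_nat_diff algebra_simps)
  qed
  \<comment> \<open>At j = 0 the P2 coefficient is \<nu>, and at j = m - 1 it vanishes.\<close>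
  have ag': "(a' ^^ j) (P1 (a G) + \<nu> \<cdot>\<^sub>f P2 G)
      = P1 ((a ^^ Suc j) G) + (q powi (t + 1) * (qint q j - qint q (m - 1))) \<cdot>\<^sub>f P2 ((a ^^ j) G)"
    if "wti t (1 - t - int m) G" for j G
  proof (cases j)
    case 0
    then show ?thesis by (simp add: \<nu>_def)
  next
    case (Suc i)
    have "(a' ^^ j) (P1 (a G) + \<nu> \<cdot>\<^sub>f P2 G) = P1 ((a ^^ j) (a G)) + (qint q j * q powi (t + 1)) \<cdot>\<^sub>f P2 ((a ^^ (j - 1)) (a G))
       + \<nu> \<cdot>\<^sub>f P2 ((a ^^ j) G)"
      unfolding tgt.lins apow_P2 apow_P1 [OF wti_a [OF that]] by simp
    also have "(a ^^ (j - 1)) (a G) = (a ^^ j) G" using Suc by (simp add: funpow_swap1)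
    also have "(a ^^ j) (a G) = (a ^^ Suc j) G" by (simp add: funpow_swap1)
    finally show ?thesis by (simp only: linPs lins tgt.lins sc_sc \<nu>_def) (simp add: pointwise algebra_simps)
  qed
  have ag: "(a' ^^ (m - 1)) (P1 (a (g e)) + \<nu> \<cdot>\<^sub>f P2 (g e)) = 0" for e
    unfolding ag' [OF g(1)] using g(3) m by simp
  have dg: "d' (P1 (a (g e)) + \<nu> \<cdot>\<^sub>f P2 (g e)) = 0" for e
  proof -
    have "d' (P1 (a (g e)) + \<nu> \<cdot>\<^sub>f P2 (g e)) = P1 (d (a (g e))) + \<nu> \<cdot>\<^sub>f ((1 - 1 / q) \<cdot>\<^sub>f P1 (c (g e)) + P2 (d (g e)))"
      by (simp add: dP1 dP2)
    also have "d (a (g e)) = (1 - q powi (1 - int m)) \<cdot>\<^sub>f g e"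
      using d_a_wti [OF g(1), of e] g by simp
    also have "c (g e) = q powi (1 - t - int m) \<cdot>\<^sub>f g e" by (rule wtiD(2) [OF g(1)])
    finally have "d' (P1 (a (g e)) + \<nu> \<cdot>\<^sub>f P2 (g e))
        = (1 - q powi (1 - int m) + \<nu> * (1 - 1 / q) * q powi (1 - t - int m)) \<cdot>\<^sub>f P1 (g e)"
      by (simp only: linPs lins tgt.lins sc_sc g sc_zero add_0_right) (simp add: pointwise algebra_simps)
    also have "1 - q powi (1 - int m) + \<nu> * (1 - 1 / q) * q powi (1 - t - int m) = 0"
    proof -
      have "\<nu> * (1 - 1 / q) = - (q powi t * (q ^ (m - 1) - 1))"
        unfolding \<nu>_def qint_mult [of q "m - 1", symmetric] by (simp add: qpowi_add field_simps)
      moreover have "q ^ (m - 1) = q powi (int m - 1)" by (simp add: k qpowi_add)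
      ultimately have "\<nu> * (1 - 1 / q) * q powi (1 - t - int m)
          = q powi t * q powi (1 - t - int m) - q powi (int m - 1) * q powi t * q powi (1 - t - int m)"
        by (simp only:) (simp add: algebra_simps)
      then show ?thesis by (simp only: qpowi_add [symmetric]) simp
    qed
    finally show ?thesis by simp
  qed
  have af: "(a' ^^ (n - (m - 1))) (P1 (f e) + \<mu> \<cdot>\<^sub>f P2 ((a ^^ (m - 1)) (?G e)))
      = comb A0 A1 (\<lambda>e. P1 (a (g e)) + \<nu> \<cdot>\<^sub>f P2 (g e)) e" for e
  proof -
    have j: "n - (m - 1) = Suc (n - m)" using m by auto
    have z: "(a ^^ Suc (n - m)) ((a ^^ (m - 1)) (?G e)) = 0"
    proof -
      have "Suc (n - m) + (m - 1) = (n - m) + m" using m by auto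
      then have "(a ^^ Suc (n - m)) ((a ^^ (m - 1)) (?G e)) = (a ^^ (n - m)) ((a ^^ m) (?G e))"
        by (simp only: funpow_add [symmetric] o_apply [symmetric, of "a ^^ _" "a ^^ _"])
      then show ?thesis by (simp add: aG)
    qed
    have "(a' ^^ Suc (n - m)) (P1 (f e) + \<mu> \<cdot>\<^sub>f P2 ((a ^^ (m - 1)) (?G e)))
      = P1 ((a ^^ Suc (n - m)) (f e)) + (qint q (Suc (n - m)) * q powi (t + int m)) \<cdot>\<^sub>f P2 ((a ^^ (n - m)) (f e))"
      unfolding tgt.lins apow_P2 apow_P1 [OF f(1)] z by simp
    \<comment> \<open>The exponents n - m + 1 and m - 1 add up to n, so the coefficient of P2 comes
      out as the same \<nu> that makes the new g a highest weight vector.\<close>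
    also have "qint q (Suc (n - m)) * q powi (t + int m) = \<nu>"
    proof -
      have "q ^ Suc (n - m) * q ^ (m - 1) = q ^ n"
        using m by (simp only: power_add [symmetric]) simp
      then have 1: "q ^ Suc (n - m) * q ^ (m - 1) = 1" by simp
      have "q powi (t + int m) = q powi (t + 1) * q ^ (m - 1)"
        by (simp add: power2_eq_square k qpowi_add)
      then have "qint q (Suc (n - m)) * q powi (t + int m) = q powi (t + 1) * (qint q (Suc (n - m)) * q ^ (m - 1))"
        by (simp only: mult.left_commute)
      moreover have "qint q (Suc (n - m)) * q ^ (m - 1) = - qint q (m - 1)"
        using 1 by (simp only: qint_eq) (simp add: field_simps)
      ultimately show ?thesis by (simp only: \<nu>_def mult_minus_right)
    qed
    finally show ?thesis unfolding j P1c using f(2) [of e] by simp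
  qed
  have df: "d' (P1 (f e) + \<mu> \<cdot>\<^sub>f P2 ((a ^^ (m - 1)) (?G e)))
      = ?\<kappa> \<cdot>\<^sub>f (a' ^^ (m - 1 - 1)) (comb D0 D1 (\<lambda>e. P1 (a (g e)) + \<nu> \<cdot>\<^sub>f P2 (g e)) e)" for e
  proof -
    have dd: "d ((a ^^ (m - 1)) (?G e)) = (qint q (m - 1) * (1 - 1 / q)) \<cdot>\<^sub>f (a ^^ k) (?G e)"
      using d_apow_wti [OF wG, of "m - 1"] by (simp add: dG k power_int_minus inverse_eq_divide)
    have cc: "c ((a ^^ (m - 1)) (?G e)) = q powi (- t) \<cdot>\<^sub>f (a ^^ (m - 1)) (?G e)"
      using wtiD(2) [OF wti_apow [OF wG, of "m - 1"]] k by simp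
    have "d' (P1 (f e) + \<mu> \<cdot>\<^sub>f P2 ((a ^^ (m - 1)) (?G e)))
      = (\<kappa> + \<mu> * (1 - 1 / q) * q powi (- t)) \<cdot>\<^sub>f P1 ((a ^^ (m - 1)) (?G e))
        + (\<mu> * (qint q (m - 1) * (1 - 1 / q))) \<cdot>\<^sub>f P2 ((a ^^ k) (?G e))"
      by (simp only: tgt.lins dP1 dP2 f(3) dd cc linPs sc_sc) (simp add: pointwise algebra_simps)
    also have "\<mu> * (1 - 1 / q) = - (\<kappa>) * q powi (t + int (m - 1)) / qint q m"
      using m0 by (simp add: \<mu>_def k qpowi_add field_simps power2_eq_square)
    also have "\<mu> * (qint q (m - 1) * (1 - 1 / q)) = - ?\<kappa> * q powi (t + int (m - 1))"
      using m0 by (simp add: \<mu>_def k qpowi_add field_simps power2_eq_square)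
    also have "\<kappa> + - (\<kappa>) * q powi (t + int (m - 1)) / qint q m * q powi (- t) = ?\<kappa>"
      using m0 qint_Suc [of q "m - 1"] k by (simp add: qpowi_add power_int_minus field_simps power2_eq_square)
    finally have 1: "d' (P1 (f e) + \<mu> \<cdot>\<^sub>f P2 ((a ^^ (m - 1)) (?G e)))
      = ?\<kappa> \<cdot>\<^sub>f P1 ((a ^^ (m - 1)) (?G e)) + (- ?\<kappa> * q powi (t + int (m - 1))) \<cdot>\<^sub>f P2 ((a ^^ k) (?G e))" .
    have "q powi (t + 1) * (qint q k - qint q (m - 1)) = - (q powi (t + int (m - 1)))"
      by (simp add: k qint_Suc qpowi_add)
    then have "(a' ^^ k) (P1 (a (?G e)) + \<nu> \<cdot>\<^sub>f P2 (?G e)) = P1 ((a ^^ (m - 1)) (?G e)) + (- (q powi (t + int (m - 1)))) \<cdot>\<^sub>f P2 ((a ^^ k) (?G e))"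
      unfolding ag' [OF wG] by (simp add: k)
    then show ?thesis unfolding 1 P1c by (simp add: k) (simp add: pointwise algebra_simps)
  qed
  show ?thesis unfolding tgt.band_def \<mu>_def [symmetric] \<nu>_def [symmetric]
    using wg wf ag dg af df by auto
qed

end

section \<open>Modules and homomorphisms\<close>

abbreviation op :: "'k::field hmod \<Rightarrow> gen \<Rightarrow> (nat \<Rightarrow> 'k) \<Rightarrow> nat \<Rightarrow> 'k" where
  "op M x \<equiv> mapp (act M x)"

text \<open>Homomorphisms as functions instead of matrices. Outside the support of A nothing is
  asked but linearity, so such functions are compared only on supported vectors.\<close>

definition hm :: "'k::field hmod \<Rightarrow> 'k hmod \<Rightarrow> ((nat \<Rightarrow> 'k) \<Rightarrow> nat \<Rightarrow> 'k) \<Rightarrow> bool" where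
  "hm A B F \<longleftrightarrow> lin F \<and> (\<forall>v. supp (hdim A) v \<longrightarrow> supp (hdim B) (F v) \<and>
     (\<forall>x. F (op A x v) = op B x (F v)))"

lemma hmD:
  assumes "hm A B F"
  shows "lin F" "supp (hdim A) v \<Longrightarrow> supp (hdim B) (F v)"
    "supp (hdim A) v \<Longrightarrow> F (op A x v) = op B x (F v)"
  using assms by (auto simp: hm_def)

lemma hm_homs: "wfm A \<Longrightarrow> wfm B \<Longrightarrow> f \<in> homs A B \<Longrightarrow> hm A B (mapp f)"
  by (auto simp: hm_def lin_mapp homsD dest!: homs_carrier intro: supp_mapp')

lemma hm_fmat:
  assumes "wfm A" "wfm B" "hm A B F"
  shows "fmat (hdim B) (hdim A) F \<in> homs A B"
    and "supp (hdim A) v \<Longrightarrow> mapp (fmat (hdim B) (hdim A) F) v = F v"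
proof -
  have *: "mapp (fmat (hdim B) (hdim A) F) v = F v" if "supp (hdim A) v" for v
    by (rule mapp_fmat [OF hmD(1) [OF assms(3)] hmD(2) [OF assms(3) supp_uv] that])
  show "fmat (hdim B) (hdim A) F \<in> homs A B"
    by (rule homsI) (use assms in \<open>auto simp: * hmD\<close>)
  show "supp (hdim A) v \<Longrightarrow> mapp (fmat (hdim B) (hdim A) F) v = F v" by (rule *)
qed

lemma hmI_uv:
  assumes "wfm A" "wfm B" "lin F" "\<And>j. j < hdim A \<Longrightarrow> supp (hdim B) (F (uv j))"
    "\<And>x j. j < hdim A \<Longrightarrow> F (op A x (uv j)) = op B x (F (uv j))"
  shows "hm A B F"
  unfolding hm_def
proof (intro conjI allI impI)
  fix v :: "nat \<Rightarrow> 'a" assume v: "supp (hdim A) v"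
  have "F v = F (\<Sum>j<hdim A. v j \<cdot>\<^sub>f uv j)" using supp_expand [OF v] by simp
  also have "\<dots> = (\<Sum>j<hdim A. v j \<cdot>\<^sub>f F (uv j))" by (simp add: lin_sum assms linD)
  finally show "supp (hdim B) (F v)" using assms(4) by (auto intro!: supp_sum)
  show "F (op A x v) = op B x (F v)" for x
    by (rule lin_eq_on_supp [OF lin_comp [OF assms(3) lin_mapp] lin_comp [OF lin_mapp assms(3)] assms(5) v])
qed (rule assms)

lemma hm_comp: "hm A B F \<Longrightarrow> hm B C G \<Longrightarrow> hm A C (\<lambda>v. G (F v))"
  by (auto simp: hm_def lin_comp)
lemma hm_id: "wfm A \<Longrightarrow> hm A A (\<lambda>v. v)" by (simp add: hm_def lin_id)
lemma hm_plus: "hm A B F \<Longrightarrow> hm A B G \<Longrightarrow> hm A B (\<lambda>v. F v + G v)"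
  by (auto simp: hm_def lin_plus)
lemma lin_minus: "lin f \<Longrightarrow> lin g \<Longrightarrow> lin (\<lambda>x. f x - g x)"
  by (simp add: lin_def) (simp add: pointwise algebra_simps)
lemma hm_minus: "hm A B F \<Longrightarrow> hm A B G \<Longrightarrow> hm A B (\<lambda>v. F v - G v)"
  by (auto simp: hm_def lin_minus)

definition finj :: "'k::field hmod \<Rightarrow> ((nat \<Rightarrow> 'k) \<Rightarrow> nat \<Rightarrow> 'k) \<Rightarrow> bool" where
  "finj A F \<longleftrightarrow> (\<forall>v. supp (hdim A) v \<and> F v = 0 \<longrightarrow> v = 0)"

definition fsurj :: "'k::field hmod \<Rightarrow> 'k hmod \<Rightarrow> ((nat \<Rightarrow> 'k) \<Rightarrow> nat \<Rightarrow> 'k) \<Rightarrow> bool" where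
  "fsurj A B F \<longleftrightarrow> (\<forall>w. supp (hdim B) w \<longrightarrow> (\<exists>v. supp (hdim A) v \<and> F v = w))"

definition inverses ::
  "'k::field hmod \<Rightarrow> 'k hmod \<Rightarrow> ((nat \<Rightarrow> 'k) \<Rightarrow> nat \<Rightarrow> 'k) \<Rightarrow> ((nat \<Rightarrow> 'k) \<Rightarrow> nat \<Rightarrow> 'k) \<Rightarrow> bool" where
  "inverses A B F G \<longleftrightarrow> hm A B F \<and> hm B A G \<and> (\<forall>v. supp (hdim A) v \<longrightarrow> G (F v) = v) \<and>
     (\<forall>w. supp (hdim B) w \<longrightarrow> F (G w) = w)"

text \<open>No module relations are required here: an isomorphism can be built first and the
  relations carried across it afterwards (\<open>is_hmod_transport\<close>).\<close>

definition fiso :: "'k::field hmod \<Rightarrow> 'k hmod \<Rightarrow> bool" where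
  "fiso A B \<longleftrightarrow> (\<exists>F G. inverses A B F G)"

lemma inversesD:
  assumes "inverses A B F G"
  shows "hm A B F" "hm B A G" "supp (hdim A) v \<Longrightarrow> G (F v) = v" "supp (hdim B) v \<Longrightarrow> F (G v) = v"
  using assms by (auto simp: inverses_def)

lemma inverses_comp: "inverses A B F G \<Longrightarrow> inverses B C F' G' \<Longrightarrow>
    inverses A C (\<lambda>v. F' (F v)) (\<lambda>v. G (G' v))"
  by (auto simp: inverses_def hmD intro: hm_comp)

lemma fiso_refl: "wfm A \<Longrightarrow> fiso A A"
  unfolding fiso_def inverses_def by (metis hm_id)
lemma fiso_sym: "fiso A B \<Longrightarrow> fiso B A" by (auto simp: fiso_def inverses_def)
lemma fiso_trans: "fiso A B \<Longrightarrow> fiso B C \<Longrightarrow> fiso A C"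
  unfolding fiso_def using inverses_comp by blast

lemma finj_eq: "lin F \<Longrightarrow> finj A F \<Longrightarrow> supp (hdim A) v \<Longrightarrow> supp (hdim A) w \<Longrightarrow> F v = F w \<Longrightarrow> v = w"
  using lin_diff [of F v w] supp_diff [of "hdim A" v w] unfolding finj_def
  by (metis diff_self eq_iff_diff_eq_0)

text \<open>Preimages are chosen on the standard basis and extended linearly; injectivity of F makes
  the result compatible with the action.\<close>

lemma factor_mono:
  assumes "wfm N" "wfm B" "wfm Z" "hm N B F" "finj N F" "hm Z B H"
    and ex: "\<And>v. supp (hdim Z) v \<Longrightarrow> \<exists>u. supp (hdim N) u \<and> F u = H v"
  obtains K where "hm Z N K" "\<And>v. supp (hdim Z) v \<Longrightarrow> F (K v) = H v"
proof -
  define u where "u = (\<lambda>j. SOME u. supp (hdim N) u \<and> F u = H (uv j))"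
  have u: "supp (hdim N) (u j) \<and> F (u j) = H (uv j)" if "j < hdim Z" for j
    unfolding u_def using someI_ex [OF ex [OF supp_uv [OF that]]] .
  define K where "K = lcomb (hdim Z) u"
  have FK: "F (K v) = H v" if "supp (hdim Z) v" for v
    unfolding K_def
    by (rule lin_eq_on_supp [OF lin_comp [OF hmD(1) [OF assms(4)] lin_lcomb] hmD(1) [OF assms(6)] _ that])
       (simp add: u)
  have sK: "supp (hdim N) (K v)" for v unfolding K_def by (rule supp_lcomb) (use u in auto)
  have "hm Z N K" unfolding hm_def
  proof (intro conjI allI impI)
    show "lin K" by (simp add: K_def lin_lcomb)
    fix v :: "nat \<Rightarrow> 'a" and x assume v: "supp (hdim Z) v"
    have "F (K (op Z x v)) = F (op N x (K v))"
      using v assms by (simp add: FK hmD(3) [OF assms(6)] hmD(3) [OF assms(4)] sK)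
    then show "K (op Z x v) = op N x (K v)"
      using finj_eq [OF hmD(1) [OF assms(4)] assms(5)] sK assms(1) by auto
  qed (rule sK)
  with FK show ?thesis using that by blast
qed

text \<open>Preimages of the basis of N are chosen in B and H is applied to them; the condition on
  the kernel makes the result independent of the choice.\<close>

lemma factor_epi:
  assumes "wfm B" "wfm N" "wfm Y" "hm B N F" "fsurj B N F" "hm B Y H"
    and ker: "\<And>v. supp (hdim B) v \<Longrightarrow> F v = 0 \<Longrightarrow> H v = 0"
  obtains K where "hm N Y K" "\<And>v. supp (hdim B) v \<Longrightarrow> K (F v) = H v"
proof -
  define u where "u = (\<lambda>j. SOME u. supp (hdim B) u \<and> F u = uv j)"
  have u: "supp (hdim B) (u j) \<and> F (u j) = uv j" if "j < hdim N" for j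
  proof -
    have "\<exists>v. supp (hdim B) v \<and> F v = uv j" using assms(5) supp_uv [OF that] unfolding fsurj_def by blast
    from someI_ex [OF this] show ?thesis unfolding u_def .
  qed
  define K where "K = (\<lambda>v. H (lcomb (hdim N) u v))"
  have su: "supp (hdim B) (lcomb (hdim N) u v)" for v by (rule supp_lcomb) (use u in auto)
  have Fl: "F (lcomb (hdim N) u v) = v" if "supp (hdim N) v" for v
    by (rule lin_eq_on_supp [OF lin_comp [OF hmD(1) [OF assms(4)] lin_lcomb] lin_id _ that])
       (simp add: u)
  have same: "H v = H w" if "supp (hdim B) v" "supp (hdim B) w" "F v = F w" for v w
  proof -
    have "H (v - w) = 0" using that lin_diff [OF hmD(1) [OF assms(4)]] by (intro ker) auto
    then show ?thesis using lin_diff [OF hmD(1) [OF assms(6)]] by simp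
  qed
  have KF: "K (F v) = H v" if "supp (hdim B) v" for v
    unfolding K_def by (rule same) (use that su Fl hmD(2) [OF assms(4)] in auto)
  have "hm N Y K" unfolding hm_def
  proof (intro conjI allI impI)
    show "lin K" unfolding K_def by (rule lin_comp [OF hmD(1) [OF assms(6)] lin_lcomb])
    fix v :: "nat \<Rightarrow> 'a" assume v: "supp (hdim N) v"
    show "supp (hdim Y) (K v)" unfolding K_def by (rule hmD(2) [OF assms(6) su])
    fix x
    obtain w where w: "supp (hdim B) w" "F w = v" using assms(5) v by (auto simp: fsurj_def)
    have "K (op N x v) = K (F (op B x w))" using w by (simp add: hmD(3) [OF assms(4)])
    also have "\<dots> = op Y x (H w)" using w assms(1) by (simp add: KF hmD(3) [OF assms(6)])
    also have "\<dots> = op Y x (K v)" using KF w by auto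
    finally show "K (op N x v) = op Y x (K v)" .
  qed
  with KF show ?thesis using that by blast
qed

lemma bij_inverses:
  assumes "wfm A" "wfm B" "hm A B F" "finj A F" "fsurj A B F"
  obtains G where "inverses A B F G"
proof -
  obtain K where K: "hm B A K" "\<And>v. supp (hdim B) v \<Longrightarrow> F (K v) = v"
    by (rule factor_mono [OF assms(1,2,2,3,4) hm_id [OF assms(2)]])
       (use assms(5) in \<open>auto simp: fsurj_def\<close>)
  have "K (F v) = v" if "supp (hdim A) v" for v
    by (rule finj_eq [OF hmD(1) [OF assms(3)] assms(4)])
       (use that K hmD(2) [OF assms(3)] hmD(2) [OF K(1)] in auto)
  with K assms(3) show ?thesis using that by (auto simp: inverses_def)
qed

lemma finj_fsurj:
  assumes "wfm A" "wfm B" "hm A B F" "finj A F" "hdim A = hdim B"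
  shows "fsurj A B F"
proof -
  let ?f = "fmat (hdim B) (hdim A) F"
  note f = hm_fmat [OF assms(1-3)]
  have "injm ?f" using assms(4) by (auto simp: injm_def finj_def f(2))
  then obtain g where g: "g \<in> carrier_mat (hdim A) (hdim A)" "?f * g = 1\<^sub>m (hdim A)"
    using injm_square_inverse [of ?f "hdim A"] assms(5) by auto
  show ?thesis unfolding fsurj_def
  proof (intro allI impI)
    fix w :: "nat \<Rightarrow> 'a" assume w: "supp (hdim B) w"
    have s: "supp (hdim A) (mapp g w)" by (rule supp_mapp' [OF g(1)])
    have "F (mapp g w) = mapp ?f (mapp g w)" by (rule f(2) [OF s, symmetric])
    also have "\<dots> = mapp (?f * g) w" by (rule mapp_mult_carrier [OF fmat_carrier g(1), symmetric])
    also have "\<dots> = mapp (1\<^sub>m (hdim A)) w" by (simp only: g(2))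
    also have "\<dots> = w" using w assms(5) by simp
    finally show "\<exists>v. supp (hdim A) v \<and> F v = w" using s by blast
  qed
qed

lemma finj_inverses:
  assumes "wfm A" "wfm B" "hm A B F" "finj A F" "hdim A = hdim B"
  obtains G where "inverses A B F G"
  using bij_inverses [OF assms(1-4) finj_fsurj [OF assms]] .

section \<open>The defining relations, vector by vector\<close>

definition hrel :: "nat \<Rightarrow> 'k::field \<Rightarrow> 'k hmod \<Rightarrow> (nat \<Rightarrow> 'k) \<Rightarrow> bool" where
  "hrel n q M v \<longleftrightarrow>
     op M Gb (op M Ga v) = q \<cdot>\<^sub>f op M Ga (op M Gb v) \<and> op M Gd (op M Gb v) = q \<cdot>\<^sub>f op M Gb (op M Gd v) \<and>
     op M Gc (op M Ga v) = q \<cdot>\<^sub>f op M Ga (op M Gc v) \<and> op M Gd (op M Gc v) = q \<cdot>\<^sub>f op M Gc (op M Gd v) \<and>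
     op M Gb (op M Gc v) = op M Gc (op M Gb v) \<and>
     (op M Ga ^^ n) v = 0 \<and> (op M Gb ^^ n) v = v \<and> (op M Gc ^^ n) v = v \<and> (op M Gd ^^ n) v = 0 \<and>
     op M Gd (op M Ga v) - q \<cdot>\<^sub>f op M Ga (op M Gd v) = v - op M Gb (op M Gc v)"

lemma is_hmod_iff:
  assumes "wfm M"
  shows "is_hmod n q M \<longleftrightarrow> (\<forall>v. supp (hdim M) v \<longrightarrow> hrel n q M v)" (is "?L \<longleftrightarrow> ?R")
proof -
  let ?m = "hdim M"
  have c: "act M x \<in> carrier_mat ?m ?m" for x using assms by simp
  have pc: "act M x ^\<^sub>m n \<in> carrier_mat ?m ?m" for x using c by (rule pow_carrier_mat)
  have mm: "mapp (act M x * act M y) v = op M x (op M y v)" for x y v by (rule mapp_mult_carrier [OF c c])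
  have mc: "act M x * act M y \<in> carrier_mat ?m ?m" for x y by (rule mult_carrier_mat [OF c c])
  have sc: "k \<cdot>\<^sub>m (act M x * act M y) \<in> carrier_mat ?m ?m" for x y k by (rule smult_carrier_mat [OF mc])
  have pw: "supp ?m v \<Longrightarrow> mapp (act M x ^\<^sub>m n) v = (op M x ^^ n) v" for x v by (rule mapp_pow [OF c])
  have mi: "mapp (X - Y) v = mapp X v - mapp Y v"
    if "X \<in> carrier_mat ?m ?m" "Y \<in> carrier_mat ?m ?m" for X Y v
    by (rule mapp_minus_mat [OF that])
  have mic: "X - Y \<in> carrier_mat ?m ?m"
    if "Y \<in> carrier_mat ?m ?m" for X Y :: "'a mat"
    by (rule minus_carrier_mat [OF that])
  have eq: "X = Y \<longleftrightarrow> (\<forall>v. supp ?m v \<longrightarrow> mapp X v = mapp Y v)"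
    if "X \<in> carrier_mat ?m ?m" "Y \<in> carrier_mat ?m ?m" for X Y
    using mat_eqI_mapp [OF that] by auto
  have "?L \<longleftrightarrow>
    (act M Gb * act M Ga = q \<cdot>\<^sub>m (act M Ga * act M Gb) \<and> act M Gd * act M Gb = q \<cdot>\<^sub>m (act M Gb * act M Gd) \<and>
     act M Gc * act M Ga = q \<cdot>\<^sub>m (act M Ga * act M Gc) \<and> act M Gd * act M Gc = q \<cdot>\<^sub>m (act M Gc * act M Gd) \<and>
     act M Gb * act M Gc = act M Gc * act M Gb \<and>
     act M Ga ^\<^sub>m n = 0\<^sub>m ?m ?m \<and> act M Gb ^\<^sub>m n = 1\<^sub>m ?m \<and> act M Gc ^\<^sub>m n = 1\<^sub>m ?m \<and> act M Gd ^\<^sub>m n = 0\<^sub>m ?m ?m \<and>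
     act M Gd * act M Ga - q \<cdot>\<^sub>m (act M Ga * act M Gd) = 1\<^sub>m ?m - act M Gb * act M Gc)"
    using c by (simp add: is_hmod_def Let_def)
  also have "\<dots> \<longleftrightarrow> ?R"
    unfolding eq [OF mc sc] eq [OF mc mc] eq [OF pc zero_carrier_mat] eq [OF pc one_carrier_mat]
      eq [OF mic [OF sc] mic [OF mc]] hrel_def mm mapp_smult_mat mi [OF mc sc] mi [OF one_carrier_mat mc]
      mapp_zero_mat
    by (auto simp: pw)
  finally show ?thesis .
qed

lemma is_hmodI:
  assumes "wfm M" "\<And>j. j < hdim M \<Longrightarrow> hrel n q M (uv j)"
  shows "is_hmod n q M"
  unfolding is_hmod_iff [OF assms(1)]
proof (intro allI impI)
  fix v :: "nat \<Rightarrow> 'a" assume v: "supp (hdim M) v"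
  have E: "f v = g v" if "lin f" "lin g" "\<And>j. j < hdim M \<Longrightarrow> f (uv j) = g (uv j)" for f g
    by (rule lin_eq_on_supp [OF that v])
  note l = lin_def linD [OF lin_funpow [OF lin_mapp]]
  have l2: "lin (\<lambda>v. op M x (op M y v))" "lin (\<lambda>v. q \<cdot>\<^sub>f op M x (op M y v))" "lin (\<lambda>v. (op M x ^^ k) v)"
    "lin (\<lambda>v::nat \<Rightarrow> 'a. 0)" for x y k
    by (simp_all add: l sc_add mult.commute)
  show "hrel n q M v" unfolding hrel_def
    by (intro conjI; rule E; (intro l2 lin_id lin_minus)?)
       (use assms(2) in \<open>simp_all add: hrel_def\<close>)
qed

lemma is_hmodD: "is_hmod n q M \<Longrightarrow> supp (hdim M) v \<Longrightarrow> hrel n q M v"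
  using is_hmod_iff [OF is_hmod_wfm] by blast

lemma hm_funpow: "hm A B F \<Longrightarrow> supp (hdim A) v \<Longrightarrow> wfm A \<Longrightarrow> F ((op A x ^^ k) v) = (op B x ^^ k) (F v)"
proof (induction k)
  case (Suc k)
  have "supp (hdim A) ((op A x ^^ k) v)" using Suc.prems by (cases k) auto
  with Suc show ?case by (simp add: hmD)
qed simp

lemma is_hmod_transport:
  assumes "is_hmod n q A" "wfm B" "hm A B F" "fsurj A B F"
  shows "is_hmod n q B"
proof -
  note A = is_hmod_wfm [OF assms(1)]
  note l = hmD(1) [OF assms(3)]
  show ?thesis unfolding is_hmod_iff [OF assms(2)]
  proof (intro allI impI)
    fix w :: "nat \<Rightarrow> 'a" assume "supp (hdim B) w"
    then obtain v where v: "supp (hdim A) v" "w = F v" using assms(4) by (auto simp: fsurj_def)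
    have r: "hrel n q A v" by (rule is_hmodD [OF assms(1) v(1)])
    note sim = hmD(3) [OF assms(3)] hm_funpow [OF assms(3) v(1) A]
    have F: "op B x (op B y w) = F (op A x (op A y v))"
        "(op B x ^^ k) w = F ((op A x ^^ k) v)" for x y k
      using v A by (simp_all add: sim)
    show "hrel n q B w"
      unfolding hrel_def F using r v(2)
      by (simp add: hrel_def linD [OF l] lin_diff [OF l, symmetric] lin_0 [OF l])
         (simp add: linD(2) [OF l, symmetric] lin_diff [OF l, symmetric])
  qed
qed

lemma hmod_iso_iff: "hmod_iso n q A B \<longleftrightarrow> is_hmod n q A \<and> is_hmod n q B \<and> fiso A B"
proof safe
  assume h: "hmod_iso n q A B"
  then show A: "is_hmod n q A" and B: "is_hmod n q B" by (auto simp: hmod_iso_def)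
  note w = is_hmod_wfm [OF A] is_hmod_wfm [OF B]
  from h obtain f g where fg: "f \<in> homs A B" "g \<in> homs B A" "g * f = 1\<^sub>m (hdim A)" "f * g = 1\<^sub>m (hdim B)"
    by (auto simp: hmod_iso_def)
  have "inverses A B (mapp f) (mapp g)"
    unfolding inverses_def
    using hm_homs [OF w(1,2) fg(1)] hm_homs [OF w(2,1) fg(2)] fg(3,4)
      mapp_mult_carrier [OF homs_carrier [OF fg(1)] homs_carrier [OF fg(2)]]
      mapp_mult_carrier [OF homs_carrier [OF fg(2)] homs_carrier [OF fg(1)]]
    by (metis mapp_one)
  then show "fiso A B" by (auto simp: fiso_def)
next
  assume A: "is_hmod n q A" and B: "is_hmod n q B" and "fiso A B"
  note w = is_hmod_wfm [OF A] is_hmod_wfm [OF B]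
  from \<open>fiso A B\<close> obtain F G where FG: "inverses A B F G" by (auto simp: fiso_def)
  note f = hm_fmat [OF w(1,2) inversesD(1) [OF FG]] and g = hm_fmat [OF w(2,1) inversesD(2) [OF FG]]
  let ?f = "fmat (hdim B) (hdim A) F" and ?g = "fmat (hdim A) (hdim B) G"
  have "?g * ?f = 1\<^sub>m (hdim A)"
    by (rule mat_eqI_mapp [OF mult_carrier_mat [OF fmat_carrier fmat_carrier] one_carrier_mat])
       (simp add: mapp_mult_carrier [OF fmat_carrier fmat_carrier] f g hmD(2) [OF inversesD(1) [OF FG]] inversesD(3) [OF FG])
  moreover have "?f * ?g = 1\<^sub>m (hdim B)"
    by (rule mat_eqI_mapp [OF mult_carrier_mat [OF fmat_carrier fmat_carrier] one_carrier_mat])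
       (simp add: mapp_mult_carrier [OF fmat_carrier fmat_carrier] f g hmD(2) [OF inversesD(2) [OF FG]] inversesD(4) [OF FG])
  ultimately show "hmod_iso n q A B" unfolding hmod_iso_def using A B f(1) g(1) by blast
qed

lemma is_hmod_hact:
  assumes "qroot n q" "is_hmod n q M"
  shows "hact n q (op M Ga) (op M Gb) (op M Gc) (op M Gd)"
proof -
  note w = is_hmod_wfm [OF assms(2)]
  have c: "act M x \<in> carrier_mat (hdim M) (hdim M)" for x using w by simp
  have mm: "op M x (op M y v) = mapp (act M x * act M y) v" for x y v by (simp add: mapp_mult_carrier [OF c c])
  interpret qroot n q by fact
  show ?thesis
  proof (unfold_locales; (rule lin_mapp)?)
    show "op M Gb (op M Ga x) = q \<cdot>\<^sub>f op M Ga (op M Gb x)" "op M Gd (op M Gb x) = q \<cdot>\<^sub>f op M Gb (op M Gd x)"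
      "op M Gc (op M Ga x) = q \<cdot>\<^sub>f op M Ga (op M Gc x)" "op M Gd (op M Gc x) = q \<cdot>\<^sub>f op M Gc (op M Gd x)" for x
      unfolding mm mapp_smult_mat [symmetric] using assms(2) by (simp_all add: is_hmod_def Let_def)
    fix x \<beta> \<chi> assume bx: "op M Gb x = \<beta> \<cdot>\<^sub>f x" and cx: "op M Gc x = \<chi> \<cdot>\<^sub>f x" and "\<beta> \<noteq> 0"
    have "supp (hdim M) (op M Gb x)" using w by simp
    then have s: "supp (hdim M) x" using \<open>\<beta> \<noteq> 0\<close> by (simp add: bx supp_def sc_apply)
    have "op M Gd (op M Ga x) - q \<cdot>\<^sub>f op M Ga (op M Gd x) = x - op M Gb (op M Gc x)"
      using is_hmodD [OF assms(2) s] by (simp add: hrel_def)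
    then show "op M Gd (op M Ga x) = q \<cdot>\<^sub>f op M Ga (op M Gd x) + (1 - \<beta> * \<chi>) \<cdot>\<^sub>f x"
      by (simp add: bx cx diff_eq_eq) (simp add: pointwise algebra_simps)
  qed
qed

text \<open>Uniqueness of almost split sequences, for a candidate 0 \<rightarrow> N0 \<rightarrow>
  B' \<rightarrow> N0 \<rightarrow> 0. As g' is no split epimorphism, it lifts through g to some h :
  B' \<rightarrow> B, which induces an endomorphism k of the kernel N0. If k is invertible, h is
  bijective by the argument of the five lemma. If k factors through f', then h can be corrected to
  vanish on the kernel of g', and it yields a section of g, which is impossible.\<close>

lemma ar_unique:
  assumes "almost_split n q N f B g N" "inverses N N0 \<phi> \<psi>" "wfm N0" "is_hmod n q B'"
    and f': "hm N0 B' f'" "finj N0 f'" and g': "hm B' N0 g'" "fsurj B' N0 g'"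
    and g'f': "\<And>v. supp (hdim N0) v \<Longrightarrow> g' (f' v) = 0"
    and ker: "\<And>v. supp (hdim B') v \<Longrightarrow> g' v = 0 \<Longrightarrow> \<exists>w. supp (hdim N0) w \<and> v = f' w"
    and nosplit: "\<not> (\<exists>w. hm N0 B' w \<and> (\<forall>v. supp (hdim N0) v \<longrightarrow> g' (w v) = v))"
    and local: "\<And>k. hm N0 N0 k \<Longrightarrow> (\<exists>k'. inverses N0 N0 k k') \<or>
        (\<exists>t. hm B' N0 t \<and> (\<forall>v. supp (hdim N0) v \<longrightarrow> k v = t (f' v)))"
  shows "fiso B' B"
proof -
  have se: "short_exact n q N f B g N" and ra: "right_almost_split n q B N g"
    using assms(1) by (auto simp: almost_split_def)
  have B: "wfm B" and N: "wfm N" and fh: "f \<in> homs N B" and gh: "g \<in> homs B N"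
    using se by (auto simp: short_exact_def intro: is_hmod_wfm)
  note B' = is_hmod_wfm [OF assms(4)]
  note f = hm_homs [OF N B fh] and g = hm_homs [OF B N gh]
  note \<phi>\<psi> = inversesD [OF assms(2)]
  have fc: "f \<in> carrier_mat (hdim B) (hdim N)" and gc: "g \<in> carrier_mat (hdim N) (hdim B)"
    using fh gh by (auto dest: homs_carrier)
  have finj: "finj N (mapp f)"
    using se fc by (auto simp: short_exact_def injm_iff_mat_injective injm_def finj_def)
  have im: "mult_mat_vec f ` carrier_vec (hdim N) = mat_kernel g" using se by (simp add: short_exact_def)
  have gf: "mapp g (mapp f v) = 0" if v: "supp (hdim N) v" for v
  proof -
    have "f *\<^sub>v vec (hdim N) v \<in> mat_kernel g" using im by (metis imageI vec_carrier)
    moreover have "f *\<^sub>v vec (hdim N) v = vec (hdim B) (mapp f v)"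
      using mult_mat_vec_vec [of f v] fc v by auto
    ultimately have "g *\<^sub>v vec (hdim B) (mapp f v) = 0\<^sub>v (hdim N)"
      using gc by (auto simp: mat_kernel_def)
    then have "vec (hdim N) (mapp g (mapp f v)) = vec (hdim N) 0"
      using mult_mat_vec_vec [of g "mapp f v"] gc hmD(2) [OF f v] by (auto simp: zero_vec_def zero_fun_def)
    then show ?thesis
      using vec_eq_iff_supp [OF hmD(2) [OF g hmD(2) [OF f v]] supp_0] by blast
  qed
  have kg: "\<exists>u. supp (hdim N) u \<and> mapp f u = b" if b: "supp (hdim B) b" "mapp g b = 0" for b
  proof -
    have "g *\<^sub>v vec (hdim B) b = 0\<^sub>v (hdim N)"
      using mult_mat_vec_vec [of g b] gc b by (auto simp: zero_vec_def zero_fun_apply)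
    then have "vec (hdim B) b \<in> mat_kernel g" using gc by (auto simp: mat_kernel_def)
    then obtain x where x: "x \<in> carrier_vec (hdim N)" "vec (hdim B) b = f *\<^sub>v x" using im by (metis imageE)
    obtain u where u: "supp (hdim N) u" "x = vec (hdim N) u" using x(1) by (rule carrier_vec_obtain)
    have "vec (hdim B) b = vec (hdim B) (mapp f u)"
      using x u fc mult_mat_vec_vec [of f u] by auto
    then show ?thesis using u vec_eq_iff_supp [OF b(1) hmD(2) [OF f u(1)]] by blast
  qed
  have nse: "\<not> split_epi B N g" using ra by (simp add: right_almost_split_def)
  have nse': False if "hm N B w" "\<And>v. supp (hdim N) v \<Longrightarrow> mapp g (w v) = v" for w
  proof -
    note wm = hm_fmat [OF N B that(1)]
    have "g * fmat (hdim B) (hdim N) w = 1\<^sub>m (hdim N)"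
      by (rule mat_eqI_mapp [OF mult_carrier_mat [OF gc fmat_carrier] one_carrier_mat])
         (simp add: mapp_mult_carrier [OF gc fmat_carrier] wm that(2))
    then show False using nse wm(1) unfolding split_epi_def by blast
  qed
  have h0: "hm B' N (\<lambda>v. \<psi> (g' v))" by (rule hm_comp [OF g'(1) \<phi>\<psi>(2)])
  note h0m = hm_fmat [OF B' N h0]
  \<comment> \<open>A section of \<psi> g', composed with \<psi>, would be a section of g', which
    \<open>nosplit\<close> excludes.\<close>
  have "\<not> split_epi B' N (fmat (hdim N) (hdim B') (\<lambda>v. \<psi> (g' v)))"
  proof
    assume "split_epi B' N (fmat (hdim N) (hdim B') (\<lambda>v. \<psi> (g' v)))"
    then obtain w where w: "w \<in> homs N B'" "fmat (hdim N) (hdim B') (\<lambda>v. \<psi> (g' v)) * w = 1\<^sub>m (hdim N)"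
      by (auto simp: split_epi_def)
    note wh = hm_homs [OF N B' w(1)]
    have e: "\<psi> (g' (mapp w v)) = v" if "supp (hdim N) v" for v
      using arg_cong [OF w(2), of "\<lambda>m. mapp m v"] that
      by (simp add: mapp_mult_carrier [OF fmat_carrier homs_carrier [OF w(1)]] h0m(2) hmD(2) [OF wh])
    have "hm N0 B' (\<lambda>v. mapp w (\<psi> v))" by (rule hm_comp [OF \<phi>\<psi>(2) wh])
    moreover have "g' (mapp w (\<psi> v)) = v" if v: "supp (hdim N0) v" for v
    proof -
      have s: "supp (hdim N) (\<psi> v)" by (rule hmD(2) [OF \<phi>\<psi>(2) v])
      have "\<phi> (\<psi> (g' (mapp w (\<psi> v)))) = \<phi> (\<psi> v)" using e [OF s] by simp
      then show ?thesis using \<phi>\<psi>(4) v hmD(2) [OF g'(1) hmD(2) [OF wh s]] by simp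
    qed
    ultimately show False using nosplit by blast
  qed
  then obtain hh where hh: "hh \<in> homs B' B" "fmat (hdim N) (hdim B') (\<lambda>v. \<psi> (g' v)) = g * hh"
    using ra h0m(1) assms(4) unfolding right_almost_split_def by blast
  define h where "h = mapp hh"
  have h: "hm B' B h" unfolding h_def by (rule hm_homs [OF B' B hh(1)])
  have gh: "mapp g (h v) = \<psi> (g' v)" if "supp (hdim B') v" for v
    using arg_cong [OF hh(2), of "\<lambda>m. mapp m v"] that
    by (simp add: mapp_mult_carrier [OF gc homs_carrier [OF hh(1)]] h0m(2) h_def)
  have \<psi>0: "\<psi> 0 = 0" by (rule lin_0 [OF hmD(1) [OF \<phi>\<psi>(2)]])
  \<comment> \<open>The map h f' lands in the kernel of g, so it factors through f; the factor is
    the map induced on the kernels.\<close>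
  obtain k0 where k0: "hm N0 N k0" "\<And>v. supp (hdim N0) v \<Longrightarrow> mapp f (k0 v) = h (f' v)"
    by (rule factor_mono [OF N B assms(3) f finj hm_comp [OF f'(1) h]])
       (use kg gh g'f' hmD(2) [OF f'(1)] hmD(2) [OF h] \<psi>0 in auto)
  have k: "hm N0 N0 (\<lambda>v. \<phi> (k0 v))" by (rule hm_comp [OF k0(1) \<phi>\<psi>(1)])
  consider k' where "inverses N0 N0 (\<lambda>v. \<phi> (k0 v)) k'"
    | t where "hm B' N0 t" "\<And>v. supp (hdim N0) v \<Longrightarrow> \<phi> (k0 v) = t (f' v)"
    using local [OF k] by blast
  then show ?thesis
  proof cases
    case 1
    note k' = inversesD [OF 1]
    have inj: "finj B' h" unfolding finj_def
    proof (intro allI impI, elim conjE)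
      fix v assume v: "supp (hdim B') v" "h v = 0"
      have "\<psi> (g' v) = 0" using gh [OF v(1)] v(2) by simp
      then have "\<phi> (\<psi> (g' v)) = 0" using lin_0 [OF hmD(1) [OF \<phi>\<psi>(1)]] by simp
      then have "g' v = 0" using \<phi>\<psi>(4) hmD(2) [OF g'(1) v(1)] by simp
      then obtain w where w: "supp (hdim N0) w" "v = f' w" using ker v(1) by blast
      have "mapp f (k0 w) = 0" using k0(2) [OF w(1)] v(2) w(2) by simp
      then have "k0 w = 0" using finj hmD(2) [OF k0(1) w(1)] by (auto simp: finj_def)
      then have "k' (\<phi> (k0 w)) = 0" using lin_0 [OF hmD(1) [OF \<phi>\<psi>(1)]] lin_0 [OF hmD(1) [OF k'(2)]] by simp
      then have "w = 0" using k'(3) w(1) by simp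
      then show "v = 0" using w(2) lin_0 [OF hmD(1) [OF f'(1)]] by simp
    qed
    have surj: "fsurj B' B h" unfolding fsurj_def
    proof (intro allI impI)
      fix b :: "nat \<Rightarrow> 'a" assume b: "supp (hdim B) b"
      have s: "supp (hdim N0) (\<phi> (mapp g b))" using hmD(2) [OF \<phi>\<psi>(1) hmD(2) [OF g b]] .
      then obtain v where v: "supp (hdim B') v" "g' v = \<phi> (mapp g b)" using g'(2) by (auto simp: fsurj_def)
      have "mapp g (h v) = mapp g b" using gh [OF v(1)] v(2) \<phi>\<psi>(3) [OF hmD(2) [OF g b]] by simp
      then have "mapp g (b - h v) = 0" by simp
      then obtain u where u: "supp (hdim N) u" "mapp f u = b - h v"
        using kg [of "b - h v"] b hmD(2) [OF h v(1)] by auto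
      define w where "w = k' (\<phi> u)"
      have w: "supp (hdim N0) w" unfolding w_def by (rule hmD(2) [OF k'(2) hmD(2) [OF \<phi>\<psi>(1) u(1)]])
      have "\<phi> (k0 w) = \<phi> u" unfolding w_def by (rule k'(4)) (rule hmD(2) [OF \<phi>\<psi>(1) u(1)])
      then have "\<psi> (\<phi> (k0 w)) = \<psi> (\<phi> u)" by simp
      then have "k0 w = u" using \<phi>\<psi>(3) u(1) hmD(2) [OF k0(1) w] by simp
      then have "h (f' w) = b - h v" using k0(2) [OF w] u(2) by simp
      then have "h (v + f' w) = b" using linD(1) [OF hmD(1) [OF h]] by simp
      then show "\<exists>v. supp (hdim B') v \<and> h v = b" using v(1) hmD(2) [OF f'(1) w] by (metis supp_add)
    qed
    from bij_inverses [OF B' B h inj surj] show ?thesis unfolding fiso_def by blast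
  next
    case 2
    \<comment> \<open>The subtracted term cancels h on the kernel of g' and leaves g h unchanged,
      because g f = 0.\<close>
    define H where "H = (\<lambda>v. h v - mapp f (\<psi> (t v)))"
    have t': "hm B' N (\<lambda>v. \<psi> (t v))" by (rule hm_comp [OF 2(1) \<phi>\<psi>(2)])
    have H: "hm B' B H" unfolding H_def by (rule hm_minus [OF h hm_comp [OF t' f]])
    have H0: "H v = 0" if v: "supp (hdim B') v" "g' v = 0" for v
    proof -
      obtain w where w: "supp (hdim N0) w" "v = f' w" using ker v by blast
      have "\<psi> (t (f' w)) = k0 w" using 2(2) [OF w(1)] \<phi>\<psi>(3) [OF hmD(2) [OF k0(1) w(1)]] by simp
      then show ?thesis using k0(2) [OF w(1)] w(2) by (simp add: H_def)
    qed
    obtain W where W: "hm N0 B W" "\<And>v. supp (hdim B') v \<Longrightarrow> W (g' v) = H v"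
      using factor_epi [OF B' assms(3) B g' H H0] by blast
    have W1: "hm N B (\<lambda>v. W (\<phi> v))" by (rule hm_comp [OF \<phi>\<psi>(1) W(1)])
    have "mapp g (W (\<phi> v)) = v" if v: "supp (hdim N) v" for v
    proof -
      obtain b where b: "supp (hdim B') b" "g' b = \<phi> v"
        using g'(2) hmD(2) [OF \<phi>\<psi>(1) v] by (auto simp: fsurj_def)
      have "mapp g (W (\<phi> v)) = mapp g (H b)" using W(2) [OF b(1)] b(2) by simp
      also have "\<dots> = \<psi> (g' b)" using gf hmD(2) [OF t' b(1)] by (simp add: H_def gh [OF b(1)])
      also have "\<dots> = v" using b(2) \<phi>\<psi>(3) [OF v] by simp
      finally show ?thesis .
    qed
    then show ?thesis using nse' W1 by blast
  qed
qed

section \<open>Direct sums and highest weights\<close>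

lemma lin_uminus: "lin f \<Longrightarrow> f (- v) = - f v"
  using lin_diff [of f 0 v] lin_0 [of f] by simp

text \<open>Direct sums are described by inclusions and projections and not by \<open>dsum\<close>,
  so that a summand or the whole can be replaced by an isomorphic module
  (\<open>biprod_fiso\<close>).\<close>

definition biprod ::
  "'k::field hmod \<Rightarrow> 'k hmod \<Rightarrow> 'k hmod \<Rightarrow> ((nat \<Rightarrow> 'k) \<Rightarrow> nat \<Rightarrow> 'k) \<Rightarrow> ((nat \<Rightarrow> 'k) \<Rightarrow> nat \<Rightarrow> 'k) \<Rightarrow>
    ((nat \<Rightarrow> 'k) \<Rightarrow> nat \<Rightarrow> 'k) \<Rightarrow> ((nat \<Rightarrow> 'k) \<Rightarrow> nat \<Rightarrow> 'k) \<Rightarrow> bool" where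
  "biprod C A B i1 i2 p1 p2 \<longleftrightarrow> hm A C i1 \<and> hm B C i2 \<and> hm C A p1 \<and> hm C B p2 \<and>
     (\<forall>v. supp (hdim A) v \<longrightarrow> p1 (i1 v) = v \<and> p2 (i1 v) = 0) \<and>
     (\<forall>v. supp (hdim B) v \<longrightarrow> p2 (i2 v) = v \<and> p1 (i2 v) = 0) \<and>
     (\<forall>v. supp (hdim C) v \<longrightarrow> i1 (p1 v) + i2 (p2 v) = v)"

lemma biprodD:
  assumes "biprod C A B i1 i2 p1 p2"
  shows "hm A C i1" "hm B C i2" "hm C A p1" "hm C B p2"
    "supp (hdim A) v \<Longrightarrow> p1 (i1 v) = v" "supp (hdim A) v \<Longrightarrow> p2 (i1 v) = 0"
    "supp (hdim B) v \<Longrightarrow> p2 (i2 v) = v" "supp (hdim B) v \<Longrightarrow> p1 (i2 v) = 0"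
    "supp (hdim C) v \<Longrightarrow> i1 (p1 v) + i2 (p2 v) = v"
  using assms by (auto simp: biprod_def)

lemma biprod_fiso:
  assumes "biprod C A B i1 i2 p1 p2" "inverses A A' F G" "inverses C C' H K"
  shows "biprod C' A' B (\<lambda>v. H (i1 (G v))) (\<lambda>v. H (i2 v)) (\<lambda>v. F (p1 (K v))) (\<lambda>v. p2 (K v))"
proof -
  note b = biprodD [OF assms(1)] and f = inversesD [OF assms(2)] and h = inversesD [OF assms(3)]
  have "H (i1 (G (F (p1 (K v))))) + H (i2 (p2 (K v))) = v" if "supp (hdim C') v" for v
  proof -
    have s: "supp (hdim C) (K v)" by (rule hmD(2) [OF h(2) that])
    show ?thesis
      using linD(1) [OF hmD(1) [OF h(1)], of "i1 (p1 (K v))" "i2 (p2 (K v))"] b(9) [OF s] h(4) [OF that]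
      by (simp add: f(3) [OF hmD(2) [OF b(3) s]])
  qed
  then show ?thesis
    unfolding biprod_def
    by (intro conjI allI impI hm_comp [OF hm_comp [OF f(2) b(1)] h(1)] hm_comp [OF b(2) h(1)]
        hm_comp [OF hm_comp [OF h(2) b(3)] f(1)] hm_comp [OF h(2) b(4)])
       (simp_all add: h(3) b f hmD(2) [OF b(1)] hmD(2) [OF b(2)] hmD(2) [OF f(2)] lin_0 [OF hmD(1) [OF f(1)]])
qed

section \<open>Local endomorphism rings and cancellation\<close>

definition invertible_end :: "'k::field hmod \<Rightarrow> ((nat \<Rightarrow> 'k) \<Rightarrow> nat \<Rightarrow> 'k) \<Rightarrow> bool" where
  "invertible_end G F \<longleftrightarrow> (\<exists>H. inverses G G F H)"

text \<open>Equivalent to closure of the non-invertible endomorphisms under addition. This form can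
  be checked by one additive scalar that vanishes exactly on the non-invertible ones.\<close>

definition local_end :: "'k::field hmod \<Rightarrow> bool" where
  "local_end G \<longleftrightarrow> (\<forall>F K. hm G G F \<and> hm G G K \<and> \<not> invertible_end G F \<and> invertible_end G K \<longrightarrow>
     invertible_end G (\<lambda>v. F v + K v))"

text \<open>Gaussian elimination with the invertible corner r1 i1 as pivot: i2 is corrected by a
  multiple of i1 until it lands in the kernel of r1, which is the copy of Z.\<close>

lemma cancel_inv:
  assumes "biprod C G X i1 i2 p1 p2" "biprod C G Z j1 j2 r1 r2"
    and "inverses G G (\<lambda>v. r1 (i1 v)) H"
  shows "fiso X Z"
proof -
  note i = biprodD [OF assms(1)] and j = biprodD [OF assms(2)] and h = inversesD [OF assms(3)]
  note li = linD [OF hmD(1) [OF i(1)]] linD [OF hmD(1) [OF i(2)]] linD [OF hmD(1) [OF i(3)]] linD [OF hmD(1) [OF i(4)]]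
    lin_diff [OF hmD(1) [OF i(1)]] lin_diff [OF hmD(1) [OF i(2)]] lin_diff [OF hmD(1) [OF i(3)]] lin_diff [OF hmD(1) [OF i(4)]]
    lin_0 [OF hmD(1) [OF i(1)]] lin_0 [OF hmD(1) [OF i(2)]] lin_0 [OF hmD(1) [OF i(3)]] lin_0 [OF hmD(1) [OF i(4)]]
  note lj = linD [OF hmD(1) [OF j(1)]] linD [OF hmD(1) [OF j(2)]] linD [OF hmD(1) [OF j(3)]] linD [OF hmD(1) [OF j(4)]]
    lin_diff [OF hmD(1) [OF j(1)]] lin_diff [OF hmD(1) [OF j(2)]] lin_diff [OF hmD(1) [OF j(3)]] lin_diff [OF hmD(1) [OF j(4)]]
    lin_0 [OF hmD(1) [OF j(1)]] lin_0 [OF hmD(1) [OF j(2)]] lin_0 [OF hmD(1) [OF j(3)]] lin_0 [OF hmD(1) [OF j(4)]]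
  note lH = linD [OF hmD(1) [OF h(2)]] lin_diff [OF hmD(1) [OF h(2)]] lin_0 [OF hmD(1) [OF h(2)]]
    lin_uminus [OF hmD(1) [OF h(2)]] lin_uminus [OF hmD(1) [OF i(1)]]
  let ?z = "\<lambda>v. i2 v - i1 (H (r1 (i2 v)))"
  have hz: "hm X C ?z" by (rule hm_minus [OF i(2) hm_comp [OF hm_comp [OF hm_comp [OF i(2) j(3)] h(2)] i(1)]])
  have hu: "hm X Z (\<lambda>v. r2 (?z v))" by (rule hm_comp [OF hz j(4)])
  have hw: "hm Z X (\<lambda>v. p2 (j2 v))" by (rule hm_comp [OF j(2) i(4)])
  have 1: "p2 (j2 (r2 (?z v))) = v" if v: "supp (hdim X) v" for v
  proof -
    have s: "supp (hdim C) (?z v)" by (rule hmD(2) [OF hz v])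
    have s2: "supp (hdim G) (r1 (i2 v))" by (rule hmD(2) [OF j(3) hmD(2) [OF i(2) v]])
    have "r1 (?z v) = 0" using h(4) [OF s2] by (simp add: lj)
    then have "j2 (r2 (?z v)) = ?z v" using j(9) [OF s] by (simp add: lj)
    then have "p2 (j2 (r2 (?z v))) = p2 (?z v)" by simp
    also have "\<dots> = v" using i(7) [OF v] i(6) [OF hmD(2) [OF h(2) s2]] by (simp add: li)
    finally show ?thesis .
  qed
  have 2: "r2 (?z (p2 (j2 v))) = v" if v: "supp (hdim Z) v" for v
  proof -
    have s: "supp (hdim C) (j2 v)" by (rule hmD(2) [OF j(2) v])
    have s2: "supp (hdim G) (p1 (j2 v))" by (rule hmD(2) [OF i(3) s])
    have e: "i2 (p2 (j2 v)) = j2 v - i1 (p1 (j2 v))" using i(9) [OF s] by (simp add: algebra_simps)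
    have "H (r1 (i1 (p1 (j2 v)))) = p1 (j2 v)" by (rule h(3) [OF s2])
    then have "?z (p2 (j2 v)) = j2 v" unfolding e by (simp add: lj lH j(8) [OF v] li)
    then show ?thesis using j(7) [OF v] by simp
  qed
  show ?thesis unfolding fiso_def inverses_def using hu hw 1 2 by blast
qed

text \<open>If the corner \<alpha> = r1 i1 is not invertible, then p1 j1 \<alpha> + p1 j2 r2 i1 = id
  and locality make the second term \<beta> invertible, hence also \<alpha> + \<beta>. Shearing the
  second decomposition along p1 j2 : Z \<rightarrow> G turns its corner into \<alpha> + \<beta>, and
  elimination applies.\<close>

lemma cancel:
  assumes "biprod C G X i1 i2 p1 p2" "biprod C G Z j1 j2 r1 r2" and loc: "local_end G" and G: "wfm G"
  shows "fiso X Z"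
proof (cases "invertible_end G (\<lambda>v. r1 (i1 v))")
  case True
  then show ?thesis using cancel_inv [OF assms(1,2)] by (auto simp: invertible_end_def)
next
  case False
  note i = biprodD [OF assms(1)] and j = biprodD [OF assms(2)]
  note l = linD [OF hmD(1) [OF i(1)]] linD [OF hmD(1) [OF i(3)]] lin_0 [OF hmD(1) [OF i(1)]] lin_0 [OF hmD(1) [OF i(3)]]
     linD [OF hmD(1) [OF j(1)]] linD [OF hmD(1) [OF j(2)]] linD [OF hmD(1) [OF j(3)]] linD [OF hmD(1) [OF j(4)]]
     lin_0 [OF hmD(1) [OF j(1)]] lin_0 [OF hmD(1) [OF j(2)]] lin_0 [OF hmD(1) [OF j(3)]] lin_0 [OF hmD(1) [OF j(4)]]
     lin_diff [OF hmD(1) [OF j(2)]] lin_diff [OF hmD(1) [OF j(1)]] lin_diff [OF hmD(1) [OF j(3)]] lin_diff [OF hmD(1) [OF j(4)]]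
     lin_diff [OF hmD(1) [OF i(3)]]
  let ?\<alpha> = "\<lambda>v. r1 (i1 v)" and ?\<beta> = "\<lambda>v. p1 (j2 (r2 (i1 v)))" and ?\<gamma> = "\<lambda>v. p1 (j1 (r1 (i1 v)))"
  have h\<alpha>: "hm G G ?\<alpha>" by (rule hm_comp [OF i(1) j(3)])
  have h\<beta>: "hm G G ?\<beta>" by (rule hm_comp [OF hm_comp [OF hm_comp [OF i(1) j(4)] j(2)] i(3)])
  have h\<gamma>: "hm G G ?\<gamma>" by (rule hm_comp [OF hm_comp [OF h\<alpha> j(1)] i(3)])
  have sum: "?\<gamma> v + ?\<beta> v = v" if v: "supp (hdim G) v" for v
    using j(9) [OF hmD(2) [OF i(1) v]] i(5) [OF v] l(3) [of "j1 (r1 (i1 v))" "j2 (r2 (i1 v))"] by simp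
  \<comment> \<open>Otherwise id - \<beta> = p1 j1 \<alpha> would be invertible, so \<alpha> would
    be injective and, by dimension, invertible.\<close>
  have \<beta>: "invertible_end G ?\<beta>"
  proof (rule ccontr)
    assume n: "\<not> invertible_end G ?\<beta>"
    have hm: "hm G G (\<lambda>v. (-1) \<cdot>\<^sub>f ?\<beta> v)"
      using h\<beta> by (auto simp: hm_def lin_scale)
    have n': "\<not> invertible_end G (\<lambda>v. (-1) \<cdot>\<^sub>f ?\<beta> v)"
    proof
      assume "invertible_end G (\<lambda>v. (-1) \<cdot>\<^sub>f ?\<beta> v)"
      then obtain H where H: "inverses G G (\<lambda>v. (-1) \<cdot>\<^sub>f ?\<beta> v) H" by (auto simp: invertible_end_def)
      note H' = inversesD [OF H]
      have "hm G G (\<lambda>v. (-1) \<cdot>\<^sub>f H v)" using H'(2) by (auto simp: hm_def lin_scale)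
      moreover have "(-1) \<cdot>\<^sub>f H (?\<beta> v) = v" if "supp (hdim G) v" for v
        using H'(3) [OF that] linD(2) [OF hmD(1) [OF H'(2)], of "-1" "?\<beta> v"] by simp
      moreover have "?\<beta> ((-1) \<cdot>\<^sub>f H v) = v" if "supp (hdim G) v" for v
        using H'(4) [OF that] linD(2) [OF hmD(1) [OF h\<beta>], of "-1" "H v"] by simp
      ultimately have "inverses G G ?\<beta> (\<lambda>v. (-1) \<cdot>\<^sub>f H v)" using h\<beta> by (simp add: inverses_def)
      then show False using n by (auto simp: invertible_end_def)
    qed
    have "invertible_end G (\<lambda>v. v)"
      using hm_id [OF G] by (auto simp: invertible_end_def inverses_def)
    then have "invertible_end G (\<lambda>v. (-1) \<cdot>\<^sub>f ?\<beta> v + v)"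
      using loc hm n' hm_id [OF G] by (auto simp: local_end_def)
    then obtain H where "inverses G G (\<lambda>v. (-1) \<cdot>\<^sub>f ?\<beta> v + v) H" by (auto simp: invertible_end_def)
    note H = inversesD [OF this]
    have e: "(-1) \<cdot>\<^sub>f ?\<beta> v + v = ?\<gamma> v" if "supp (hdim G) v" for v
      using sum [OF that] by (simp add: sc_minus) (metis add_diff_cancel_right' uminus_add_conv_diff)
    have "finj G ?\<alpha>" unfolding finj_def
    proof (intro allI impI, elim conjE)
      fix v assume v: "supp (hdim G) v" "?\<alpha> v = 0"
      have "H (?\<gamma> v) = v" using H(3) [OF v(1)] e [OF v(1)] by simp
      then show "v = 0" using v(2) lin_0 [OF hmD(1) [OF H(2)]] by (simp add: l)
    qed
    from finj_inverses [OF G G h\<alpha> this refl] show False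
      using False by (auto simp: invertible_end_def)
  qed
  have ab: "invertible_end G (\<lambda>v. ?\<alpha> v + ?\<beta> v)"
    using loc h\<alpha> h\<beta> False \<beta> by (auto simp: local_end_def)
  \<comment> \<open>The inclusion of G and the projection to Z stay as they are; the other two maps
    are sheared so that the biproduct identities persist.\<close>
  have b: "biprod C G Z j1 (\<lambda>v. j2 v - j1 (p1 (j2 v))) (\<lambda>v. r1 v + p1 (j2 (r2 v))) r2"
    unfolding biprod_def
  proof (intro conjI allI impI)
    show "hm G C j1" "hm C Z r2" by (rule j)+
    show "hm Z C (\<lambda>v. j2 v - j1 (p1 (j2 v)))"
      by (rule hm_minus [OF j(2) hm_comp [OF hm_comp [OF j(2) i(3)] j(1)]])
    show "hm C G (\<lambda>v. r1 v + p1 (j2 (r2 v)))"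
      by (rule hm_plus [OF j(3) hm_comp [OF hm_comp [OF j(4) j(2)] i(3)]])
  next
    fix v :: "nat \<Rightarrow> 'a" assume v: "supp (hdim G) v"
    show "r1 (j1 v) + p1 (j2 (r2 (j1 v))) = v" "r2 (j1 v) = 0" using j(5,6) [OF v] by (simp_all add: l)
  next
    fix v :: "nat \<Rightarrow> 'a" assume v: "supp (hdim Z) v"
    have s: "supp (hdim G) (p1 (j2 v))" by (rule hmD(2) [OF i(3) hmD(2) [OF j(2) v]])
    show "r2 (j2 v - j1 (p1 (j2 v))) = v" using j(7) [OF v] j(6) [OF s] by (simp add: l)
    show "r1 (j2 v - j1 (p1 (j2 v))) + p1 (j2 (r2 (j2 v - j1 (p1 (j2 v))))) = 0"
      using j(7) [OF v] j(6) [OF s] j(5) [OF s] j(8) [OF v] by (simp add: l)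
  next
    fix v :: "nat \<Rightarrow> 'a" assume v: "supp (hdim C) v"
    show "j1 (r1 v + p1 (j2 (r2 v))) + (j2 (r2 v) - j1 (p1 (j2 (r2 v)))) = v"
      using j(9) [OF v] by (simp add: l algebra_simps)
  qed
  show ?thesis
    using ab cancel_inv [OF assms(1) b] by (auto simp: invertible_end_def)
qed

section \<open>Splitting coordinates, and direct sums of lists of modules\<close>

definition lo :: "nat \<Rightarrow> (nat \<Rightarrow> 'k::field) \<Rightarrow> nat \<Rightarrow> 'k" where "lo m v = (\<lambda>i. if i < m then v i else 0)"
definition hi :: "nat \<Rightarrow> (nat \<Rightarrow> 'k::field) \<Rightarrow> nat \<Rightarrow> 'k" where "hi m v = (\<lambda>i. v (i + m))"
definition jn :: "nat \<Rightarrow> (nat \<Rightarrow> 'k::field) \<Rightarrow> (nat \<Rightarrow> 'k) \<Rightarrow> nat \<Rightarrow> 'k" where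
  "jn m v w = (\<lambda>i. if i < m then v i else w (i - m))"

lemma lin_lo: "lin (lo m)" and lin_hi: "lin (hi m)" and lin_jn: "lin (jn m 0)"
  by (auto simp: lin_def lo_def hi_def jn_def pointwise)

lemma lo_id [simp]: "supp m v \<Longrightarrow> lo m v = v" by (auto simp: lo_def supp_def fun_eq_iff)
lemma supp_lo [simp]: "supp m (lo m v)" by (simp add: lo_def supp_def)
lemma supp_lo' [simp]: "supp (m + k) (lo m v)" by (simp add: lo_def supp_def)
lemma supp_hi [simp]: "supp (m + k) v \<Longrightarrow> supp k (hi m v)" by (simp add: hi_def supp_def)
lemma supp_jn [simp]: "supp k w \<Longrightarrow> supp (m + k) (jn m v w)" by (auto simp: jn_def supp_def)
lemma lo_jn [simp]: "lo m (jn m v w) = lo m v" and hi_jn [simp]: "hi m (jn m v w) = w"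
  by (auto simp: jn_def lo_def hi_def fun_eq_iff)
lemma hi_lo [simp]: "hi m (lo m v) = 0" by (simp add: lo_def hi_def pointwise)
lemma lo_0 [simp]: "lo m 0 = 0" and hi_0 [simp]: "hi m 0 = 0" and jn_0 [simp]: "jn m 0 0 = 0"
  by (simp_all add: lo_def hi_def jn_def pointwise)
lemma lo_plus_jn: "lo m v + jn m 0 (hi m v) = v" by (auto simp: lo_def hi_def jn_def pointwise)
lemma hi_supp [simp]: "supp m v \<Longrightarrow> hi m v = 0" by (simp add: hi_def supp_def pointwise)

lemma supp_add_right [simp]: "supp m v \<Longrightarrow> supp (m + k) v" by (simp add: supp_def)

lemma jn_supp [simp]: "supp m u \<Longrightarrow> jn m u 0 = u"
  by (auto simp: jn_def supp_def fun_eq_iff zero_fun_apply)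

lemma lohi_eqI: "lo m v = lo m w \<Longrightarrow> hi m v = hi m w \<Longrightarrow> v = w"
  by (metis lo_plus_jn)

lemma hdim_dsum_Cons [simp]: "hdim (dsum (M # Ms)) = hdim M + hdim (dsum Ms)"
  by (simp add: dsum_def)
lemma hdim_dsum_Nil [simp]: "hdim (dsum []) = 0" by (simp add: dsum_def)

lemma wfm_dsum:
  assumes "\<And>M. M \<in> set Ms \<Longrightarrow> wfm M"
  shows "wfm (dsum Ms)"
  unfolding wfm_def
proof (intro allI carrier_matI)
  fix x
  have d: "dim_row (act M x) = hdim M" "dim_col (act M x) = hdim M" if "M \<in> set Ms" for M
    using wfmD [OF assms [OF that], of x] by (rule carrier_matD)+
  show "dim_row (act (dsum Ms) x) = hdim (dsum Ms)"
    by (simp add: dsum_def dim_diag_block_mat o_def d cong: map_cong)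
  show "dim_col (act (dsum Ms) x) = hdim (dsum Ms)"
    by (simp add: dsum_def dim_diag_block_mat o_def d cong: map_cong)
qed

lemma op_dsum_Cons:
  assumes "wfm M" "wfm (dsum Ms)"
  shows "op (dsum (M # Ms)) x v = jn (hdim M) (op M x (lo (hdim M) v)) (op (dsum Ms) x (hi (hdim M) v))"
proof -
  let ?m = "hdim M" and ?k = "hdim (dsum Ms)"
  let ?A = "act M x" and ?D = "act (dsum Ms) x"
  have A: "dim_row ?A = ?m" "dim_col ?A = ?m" and D: "dim_row ?D = ?k" "dim_col ?D = ?k"
    using wfmD [OF assms(1), of x] wfmD [OF assms(2), of x] by auto
  have e: "act (dsum (M # Ms)) x = four_block_mat ?A (0\<^sub>m ?m ?k) (0\<^sub>m ?k ?m) ?D"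
    using A D by (simp add: dsum_def Let_def)
  have split: "(\<Sum>j<m + k. f j) = (\<Sum>j<m. f j) + (\<Sum>j<k. f (j + m))" for f :: "nat \<Rightarrow> 'a" and m k
    by (induction k) (simp_all add: add.assoc add.commute)
  show ?thesis
  proof
    fix i
    show "op (dsum (M # Ms)) x v i = jn ?m (op M x (lo ?m v)) (op (dsum Ms) x (hi ?m v)) i"
      unfolding e mapp_def jn_def using A D
      by (auto simp: split index_mat_four_block lo_def hi_def not_less intro!: sum.cong)
  qed
qed

lemma biprod_dsum:
  assumes "wfm M" "wfm (dsum Ms)"
  shows "biprod (dsum (M # Ms)) M (dsum Ms) (lo (hdim M)) (jn (hdim M) 0) (lo (hdim M)) (hi (hdim M))"
  unfolding biprod_def hm_def using assms
  by (simp add: lin_lo lin_hi lin_jn op_dsum_Cons lo_plus_jn)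

lemma dsum_single: "wfm M \<Longrightarrow> dsum [M] = (M :: 'k::field hmod)"
proof -
  assume a: "wfm M"
  have "four_block_mat (act M x) (0\<^sub>m (hdim M) 0) (0\<^sub>m 0 (hdim M)) (0\<^sub>m 0 0) = act M x" for x
    using wfmD [OF a, of x] by (intro eq_matI) (auto simp: index_mat_four_block)
  moreover have "dim_row (act M x) = hdim M" "dim_col (act M x) = hdim M" for x
    using wfmD [OF a, of x] by auto
  ultimately show "dsum [M] = M"
    by (cases M) (simp add: dsum_def Let_def fun_eq_iff)
qed

lemma fiso_dsum_Cons:
  assumes w: "wfm M" "wfm (dsum Ms)" "wfm M'" "wfm (dsum Ms')"
    and "fiso M M'" "fiso (dsum Ms) (dsum Ms')"
  shows "fiso (dsum (M # Ms)) (dsum (M' # Ms'))"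
proof -
  obtain F G where FG: "inverses M M' F G" using assms by (auto simp: fiso_def)
  obtain H K where HK: "inverses (dsum Ms) (dsum Ms') H K" using assms by (auto simp: fiso_def)
  note a = biprodD [OF biprod_dsum [OF w(1,2)]] and b = biprodD [OF biprod_dsum [OF w(3,4)]]
  note f = inversesD [OF FG] and h = inversesD [OF HK]
  let ?m = "hdim M" and ?m' = "hdim M'"
  let ?S = "\<lambda>v. lo ?m' (F (lo ?m v)) + jn ?m' 0 (H (hi ?m v))"
  let ?T = "\<lambda>v. lo ?m (G (lo ?m' v)) + jn ?m 0 (K (hi ?m' v))"
  have S: "hm (dsum (M # Ms)) (dsum (M' # Ms')) ?S"
    by (rule hm_plus [OF hm_comp [OF hm_comp [OF a(3) f(1)] b(1)] hm_comp [OF hm_comp [OF a(4) h(1)] b(2)]])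
  have T: "hm (dsum (M' # Ms')) (dsum (M # Ms)) ?T"
    by (rule hm_plus [OF hm_comp [OF hm_comp [OF b(3) f(2)] a(1)] hm_comp [OF hm_comp [OF b(4) h(2)] a(2)]])
  have [simp]: "lo k (u + v) = lo k u + lo k v" "hi k (u + v) = hi k u + hi k v" for u v :: "nat \<Rightarrow> 'a" and k
    by (rule linD [OF lin_lo] linD [OF lin_hi])+
  have ts: "?T (?S v) = v" if v: "supp (hdim (dsum (M # Ms))) v" for v
    using v hmD(2) [OF f(1), of "lo ?m v"] hmD(2) [OF h(1), of "hi ?m v"]
    by (simp add: f(3) h(3) lo_plus_jn)
  have st: "?S (?T v) = v" if v: "supp (hdim (dsum (M' # Ms'))) v" for v
    using v hmD(2) [OF f(2), of "lo ?m' v"] hmD(2) [OF h(2), of "hi ?m' v"]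
    by (simp add: f(4) h(4) lo_plus_jn)
  have "inverses (dsum (M # Ms)) (dsum (M' # Ms')) ?S ?T"
    unfolding inverses_def by (intro conjI allI impI S T st ts)
  then show ?thesis unfolding fiso_def by (intro exI)
qed

lemma fiso_dsum_map:
  assumes "\<And>i. i \<in> set xs \<Longrightarrow> fiso (X i) (X' i)" "\<And>i. i \<in> set xs \<Longrightarrow> wfm (X i)"
    "\<And>i. i \<in> set xs \<Longrightarrow> wfm (X' i)"
  shows "fiso (dsum (map X xs)) (dsum (map X' xs))"
  using assms
proof (induction xs)
  case Nil
  show ?case using fiso_refl [OF wfm_dsum [of "[]"]] by simp
next
  case (Cons x xs)
  have 1: "wfm (dsum (map X xs))"
    by (rule wfm_dsum) (clarsimp simp: Cons.prems(2))
  have 2: "wfm (dsum (map X' xs))"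
    by (rule wfm_dsum) (clarsimp simp: Cons.prems(3))
  have 3: "fiso (dsum (map X xs)) (dsum (map X' xs))"
    by (rule Cons.IH) (simp_all add: Cons.prems)
  show ?case unfolding list.map
    by (rule fiso_dsum_Cons [OF _ 1 _ 2 _ 3]) (simp_all add: Cons.prems)
qed

lemma fiso_copies:
  assumes "fiso X X'" "wfm X" "wfm X'"
  shows "fiso (copies s X) (copies s X')"
proof -
  have "fiso (dsum (map (\<lambda>_::nat. X) [0..<s])) (dsum (map (\<lambda>_. X') [0..<s]))"
    by (rule fiso_dsum_map) (simp_all add: assms)
  then show ?thesis unfolding copies_def map_replicate_trivial .
qed

lemma op_funpow_dsum_Cons:
  assumes "wfm M" "wfm (dsum Ms)"
  shows "lo (hdim M) ((op (dsum (M # Ms)) x ^^ k) v) = (op M x ^^ k) (lo (hdim M) v)"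
    "hi (hdim M) ((op (dsum (M # Ms)) x ^^ k) v) = (op (dsum Ms) x ^^ k) (hi (hdim M) v)"
  using assms by (induction k) (simp_all add: op_dsum_Cons)

lemma is_hmod_dsum_Cons:
  assumes h: "is_hmod n q M" "is_hmod n q (dsum Ms)"
  shows "is_hmod n q (dsum (M # Ms))"
proof -
  note w = is_hmod_wfm [OF h(1)] is_hmod_wfm [OF h(2)]
  have wC: "wfm (dsum (M # Ms))"
    unfolding wfm_def
  proof
    fix x
    have c: "act M x \<in> carrier_mat (hdim M) (hdim M)" "act (dsum Ms) x \<in> carrier_mat (hdim (dsum Ms)) (hdim (dsum Ms))"
      using w by simp_all
    then show "act (dsum (M # Ms)) x \<in> carrier_mat (hdim (dsum (M # Ms))) (hdim (dsum (M # Ms)))"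
      by (simp add: dsum_def Let_def)
  qed
  let ?m = "hdim M"
  note l = linD [OF lin_lo] linD [OF lin_hi] lin_diff [OF lin_lo] lin_diff [OF lin_hi]
  show ?thesis unfolding is_hmod_iff [OF wC]
  proof (intro allI impI)
    fix v :: "nat \<Rightarrow> 'a" assume v: "supp (hdim (dsum (M # Ms))) v"
    have r: "hrel n q M (lo ?m v)" "hrel n q (dsum Ms) (hi ?m v)"
      using is_hmodD [OF h(1), of "lo ?m v"] is_hmodD [OF h(2), of "hi ?m v"] v by auto
    have o: "lo ?m (op (dsum (M # Ms)) x v) = op M x (lo ?m v)"
        "hi ?m (op (dsum (M # Ms)) x v) = op (dsum Ms) x (hi ?m v)" for x v
      using w by (simp_all add: op_dsum_Cons)
    show "hrel n q (dsum (M # Ms)) v"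
      unfolding hrel_def
      by (intro conjI; rule lohi_eqI [of ?m])
         (use r in \<open>simp_all add: hrel_def o l op_funpow_dsum_Cons [OF w]\<close>)
  qed
qed

lemma is_hmod_dsum: "(\<And>M. M \<in> set Ms \<Longrightarrow> is_hmod n q M) \<Longrightarrow> is_hmod n q (dsum Ms)"
proof (induction Ms)
  case Nil
  then show ?case by (intro is_hmodI wfm_dsum) auto
next
  case (Cons M Ms)
  then show ?case by (intro is_hmod_dsum_Cons) auto
qed

section \<open>Highest weight vectors and embeddings of direct sums\<close>

definition diagb :: "'k::field hmod \<Rightarrow> bool" where
  "diagb X \<longleftrightarrow> (\<exists>\<beta>. \<forall>j<hdim X. op X Gb (uv j) = \<beta> j \<cdot>\<^sub>f uv j)"

text \<open>Of the weight only the eigenvalue of b is recorded; it already separates the summands of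
  the decomposition.\<close>

definition hws :: "'k::field hmod \<Rightarrow> 'k set \<Rightarrow> bool" where
  "hws X S \<longleftrightarrow> (\<forall>\<beta> v. supp (hdim X) v \<and> v \<noteq> 0 \<and> op X Gd v = 0 \<and> op X Gb v = \<beta> \<cdot>\<^sub>f v \<longrightarrow> \<beta> \<in> S)"

text \<open>A nonzero kernel contains a highest weight vector. Since d is nilpotent, a last power of
  d leaves a nonzero kernel vector killed by d. Since b is diagonal, the eigencomponents of that
  vector are coordinate projections; these commute with F and, up to a shift of the eigenvalue, with
  d, so some nonzero eigencomponent is again in the kernel.\<close>

lemma hw_inj:
  assumes X: "is_hmod n q X" "q \<noteq> 0" and W: "wfm W" and F: "hm X W F"
    and dX: "diagb X" and dW: "diagb W"
    and hw: "\<And>\<beta> v. supp (hdim X) v \<Longrightarrow> v \<noteq> 0 \<Longrightarrow> op X Gd v = 0 \<Longrightarrow> op X Gb v = \<beta> \<cdot>\<^sub>f v \<Longrightarrow> F v \<noteq> 0"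
  shows "finj X F"
proof -
  note wX = is_hmod_wfm [OF X(1)]
  obtain bx where bx: "\<And>j. j < hdim X \<Longrightarrow> op X Gb (uv j) = bx j \<cdot>\<^sub>f uv j" using dX by (auto simp: diagb_def)
  obtain bw where bw: "\<And>j. j < hdim W \<Longrightarrow> op W Gb (uv j) = bw j \<cdot>\<^sub>f uv j" using dW by (auto simp: diagb_def)
  define pr :: "nat \<Rightarrow> (nat \<Rightarrow> 'a) \<Rightarrow> 'a \<Rightarrow> (nat \<Rightarrow> 'a) \<Rightarrow> nat \<Rightarrow> 'a"
    where "pr = (\<lambda>m b \<beta> v i. if i < m \<and> b i = \<beta> then v i else 0)"
  have lpr: "lin (pr m b \<beta>)" for m b \<beta> by (auto simp: lin_def pr_def pointwise)
  have spr: "supp m (pr m b \<beta> v)" for m b \<beta> v by (simp add: pr_def supp_def)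
  have op_b: "op Y Gb v i = b i * v i"
    if "wfm Y" "\<And>j. j < hdim Y \<Longrightarrow> op Y Gb (uv j) = b j \<cdot>\<^sub>f uv j" "supp (hdim Y) v" for Y b v i
  proof -
    have l: "lin (\<lambda>v i. b i * v i)" by (auto simp: lin_def pointwise algebra_simps)
    have "op Y Gb v = (\<lambda>i. b i * v i)"
      by (rule lin_eq_on_supp [OF lin_mapp l _ that(3)], simp only: that(2), auto simp: pointwise uv_def)
    then show ?thesis by simp
  qed
  have eig: "pr m b \<beta> v = (if \<theta> = \<beta> then v else 0)"
    if "\<And>i. i < m \<Longrightarrow> b i * v i = \<theta> * v i" "supp m v" for m b \<beta> v \<theta>
  proof
    fix i
    show "pr m b \<beta> v i = (if \<theta> = \<beta> then v else 0) i"
      using that(1) [of i] that(2)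
      by (cases "i < m"; cases "v i = 0") (auto simp: pr_def zero_fun_apply supp_def)
  qed
  have pr_uv: "pr (hdim X) bx \<beta> (uv j) = (if bx j = \<beta> then uv j else 0)" if "j < hdim X" for j \<beta>
    using that by (auto simp: pr_def fun_eq_iff zero_fun_apply uv_def)
  have Fpr: "F (pr (hdim X) bx \<beta> v) = pr (hdim W) bw \<beta> (F v)" if v: "supp (hdim X) v" for \<beta> v
  proof (rule lin_eq_on_supp [OF lin_comp [OF hmD(1) [OF F] lpr] lin_comp [OF lpr hmD(1) [OF F]] _ v])
    fix j assume j: "j < hdim X"
    have s: "supp (hdim W) (F (uv j))" by (rule hmD(2) [OF F supp_uv [OF j]])
    have "op W Gb (F (uv j)) = bx j \<cdot>\<^sub>f F (uv j)"
      using hmD(3) [OF F supp_uv [OF j], of Gb] linD(2) [OF hmD(1) [OF F]] by (simp add: bx [OF j])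
    then have "bw i * F (uv j) i = bx j * F (uv j) i" for i
      using op_b [OF W bw s, of i] by (metis sc_apply)
    then have "pr (hdim W) bw \<beta> (F (uv j)) = (if bx j = \<beta> then F (uv j) else 0)" using s by (intro eig)
    then show "F (pr (hdim X) bx \<beta> (uv j)) = pr (hdim W) bw \<beta> (F (uv j))"
      by (simp add: pr_uv [OF j] lin_0 [OF hmD(1) [OF F]])
  qed
  have dpr: "op X Gd (pr (hdim X) bx \<beta> v) = pr (hdim X) bx (\<beta> / q) (op X Gd v)" if v: "supp (hdim X) v" for \<beta> v
  proof (rule lin_eq_on_supp [OF lin_comp [OF lin_mapp lpr] lin_comp [OF lpr lin_mapp] _ v])
    fix j assume j: "j < hdim X"
    have s: "supp (hdim X) (op X Gd (uv j))" using wX by simp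
    have "op X Gd (op X Gb (uv j)) = q \<cdot>\<^sub>f op X Gb (op X Gd (uv j))"
      using is_hmodD [OF X(1) supp_uv [OF j]] by (simp add: hrel_def)
    then have "bx j \<cdot>\<^sub>f op X Gd (uv j) = q \<cdot>\<^sub>f op X Gb (op X Gd (uv j))" by (simp add: bx [OF j])
    then have "bx j * op X Gd (uv j) i = q * (bx i * op X Gd (uv j) i)" for i
      using op_b [OF wX bx s, of i] by (metis sc_apply)
    then have "bx i * op X Gd (uv j) i = bx j / q * op X Gd (uv j) i" for i
      by (metis X(2) nonzero_mult_div_cancel_left times_divide_eq_left)
    then have "pr (hdim X) bx (\<beta> / q) (op X Gd (uv j)) = (if bx j / q = \<beta> / q then op X Gd (uv j) else 0)"
      using s by (intro eig)
    then show "op X Gd (pr (hdim X) bx \<beta> (uv j)) = pr (hdim X) bx (\<beta> / q) (op X Gd (uv j))"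
      using X(2) by (simp add: pr_uv [OF j])
  qed
  show ?thesis unfolding finj_def
  proof (intro allI impI, elim conjE, rule ccontr)
    fix v assume v: "supp (hdim X) v" "F v = 0" "v \<noteq> 0"
    have nil: "\<exists>k. (op X Gd ^^ k) v = 0" using is_hmodD [OF X(1) v(1)] by (auto simp: hrel_def)
    define k where "k = (LEAST k. (op X Gd ^^ k) v = 0)"
    have k0: "(op X Gd ^^ k) v = 0" unfolding k_def by (rule LeastI_ex [OF nil])
    then have "k \<noteq> 0" using v(3) by (cases k) auto
    then obtain k' where k': "k = Suc k'" by (cases k) auto
    define w where "w = (op X Gd ^^ k') v"
    have w0: "w \<noteq> 0" unfolding w_def using not_less_Least [of k' "\<lambda>k. (op X Gd ^^ k) v = 0"] k' by (auto simp: k_def)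
    have sw: "supp (hdim X) w" unfolding w_def using v(1) wX by (cases k') auto
    have dw: "op X Gd w = 0" using k0 by (simp add: w_def k')
    have Fw: "F w = 0" unfolding w_def using hm_funpow [OF F v(1) wX, of k' Gd] v(2)
      by (simp add: lin_0 [OF lin_funpow [OF lin_mapp]])
    obtain i where i: "w i \<noteq> 0" using w0 by (auto simp: fun_eq_iff zero_fun_apply)
    then have ii: "i < hdim X" using sw by (metis supp_def not_less)
    define u where "u = pr (hdim X) bx (bx i) w"
    have su: "supp (hdim X) u" by (simp add: u_def spr)
    have "u i \<noteq> 0" using i ii by (simp add: u_def pr_def)
    then have u0: "u \<noteq> 0" by (auto simp: zero_fun_apply)
    have du: "op X Gd u = 0" by (simp add: u_def dpr [OF sw] dw lin_0 [OF lpr])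
    have Fu: "F u = 0" by (simp add: u_def Fpr [OF sw] Fw lin_0 [OF lpr])
    have "op X Gb u = bx i \<cdot>\<^sub>f u"
    proof
      fix l show "op X Gb u l = (bx i \<cdot>\<^sub>f u) l"
        using op_b [OF wX bx su, of l] by (simp only: sc_apply) (simp add: u_def pr_def)
    qed
    from hw [OF su u0 du this] Fu show False by simp
  qed
qed

definition emb :: "nat \<Rightarrow> 'k::field \<Rightarrow> 'k hmod \<Rightarrow> 'k hmod \<Rightarrow> 'k set \<Rightarrow> bool" where
  "emb n q W X S \<longleftrightarrow> is_hmod n q X \<and> diagb X \<and> hws X S \<and> (\<exists>F. hm X W F \<and> finj X F)"

lemma emb_Nil: "wfm W \<Longrightarrow> emb n q W (dsum []) {}"
proof -
  assume W: "wfm W"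
  have z: "supp 0 v \<Longrightarrow> v = 0" for v :: "nat \<Rightarrow> 'a" by (simp add: supp_def pointwise)
  have "hm (dsum []) W (\<lambda>v. 0)"
    unfolding hm_def lin_def using W by (auto dest: z simp: sc_add)
  moreover have "finj (dsum []) (\<lambda>v :: nat \<Rightarrow> 'a. 0)" unfolding finj_def by (auto dest: z)
  ultimately show ?thesis unfolding emb_def
    using is_hmod_dsum [of "[]" n q] by (auto simp: diagb_def hws_def dest: z)
qed

text \<open>Both components of a highest weight vector of the sum are zero or highest weight vectors
  for the same eigenvalue of b. As S and T are disjoint, one of them vanishes, and the sum of the
  two embeddings is nonzero on the other.\<close>

lemma emb_Cons:
  assumes q: "q \<noteq> 0" and W: "wfm W" "diagb W" and 1: "emb n q W M S" and 2: "emb n q W (dsum Ms) T"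
    and disj: "S \<inter> T = {}"
  shows "emb n q W (dsum (M # Ms)) (S \<union> T)"
proof -
  let ?m = "hdim M"
  obtain F where F: "hm M W F" "finj M F" using 1 by (auto simp: emb_def)
  obtain G where G: "hm (dsum Ms) W G" "finj (dsum Ms) G" using 2 by (auto simp: emb_def)
  have h: "is_hmod n q M" "is_hmod n q (dsum Ms)" using 1 2 by (auto simp: emb_def)
  note w = is_hmod_wfm [OF h(1)] is_hmod_wfm [OF h(2)]
  note a = biprodD [OF biprod_dsum [OF w]]
  note l = linD [OF lin_lo] linD [OF lin_hi] lin_diff [OF lin_lo] lin_diff [OF lin_hi]
  note hD = is_hmod_dsum_Cons [OF h]
  obtain b1 where b1: "\<And>j. j < hdim M \<Longrightarrow> op M Gb (uv j) = b1 j \<cdot>\<^sub>f uv j" using 1 by (auto simp: emb_def diagb_def)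
  obtain b2 where b2: "\<And>j. j < hdim (dsum Ms) \<Longrightarrow> op (dsum Ms) Gb (uv j) = b2 j \<cdot>\<^sub>f uv j"
    using 2 by (auto simp: emb_def diagb_def)
  have bD: "op (dsum (M # Ms)) Gb (uv j) = (if j < ?m then b1 j else b2 (j - ?m)) \<cdot>\<^sub>f uv j"
    if "j < hdim (dsum (M # Ms))" for j
  proof (cases "j < ?m")
    case True
    have "lo ?m (uv j) = (uv j :: nat \<Rightarrow> 'a)" "hi ?m (uv j) = (0 :: nat \<Rightarrow> 'a)"
      using True by (auto simp: lo_def hi_def uv_def fun_eq_iff zero_fun_apply)
    then show ?thesis using True
      by (simp add: op_dsum_Cons [OF w] b1; auto simp: jn_def uv_def pointwise)
  next
    case False
    have "lo ?m (uv j) = (0 :: nat \<Rightarrow> 'a)" "hi ?m (uv j) = (uv (j - ?m) :: nat \<Rightarrow> 'a)"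
      using False by (auto simp: lo_def hi_def uv_def fun_eq_iff zero_fun_apply)
    then show ?thesis using False that
      by (simp add: op_dsum_Cons [OF w] b2; auto simp: jn_def uv_def pointwise)
  qed
  have dD: "diagb (dsum (M # Ms))" unfolding diagb_def
    by (intro exI [of _ "\<lambda>j. if j < ?m then b1 j else b2 (j - ?m)"] allI impI bD)
  have comps: "op M Gd (lo ?m v) = 0 \<and> op (dsum Ms) Gd (hi ?m v) = 0 \<and>
      op M Gb (lo ?m v) = \<beta> \<cdot>\<^sub>f lo ?m v \<and> op (dsum Ms) Gb (hi ?m v) = \<beta> \<cdot>\<^sub>f hi ?m v"
    if "op (dsum (M # Ms)) Gd v = 0" "op (dsum (M # Ms)) Gb v = \<beta> \<cdot>\<^sub>f v" for \<beta> v
  proof -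
    have o: "lo ?m (op (dsum (M # Ms)) x v) = op M x (lo ?m v)"
        "hi ?m (op (dsum (M # Ms)) x v) = op (dsum Ms) x (hi ?m v)" for x
      using w by (simp_all add: op_dsum_Cons)
    show ?thesis using o [of Gd] o [of Gb] that by (simp add: l)
  qed
  have hwD: "lo ?m v = 0 \<and> hi ?m v \<noteq> 0 \<and> \<beta> \<in> T \<or> hi ?m v = 0 \<and> lo ?m v \<noteq> 0 \<and> \<beta> \<in> S"
    if v: "supp (hdim (dsum (M # Ms))) v" "v \<noteq> 0" "op (dsum (M # Ms)) Gd v = 0" "op (dsum (M # Ms)) Gb v = \<beta> \<cdot>\<^sub>f v" for \<beta> v
  proof -
    note c = comps [OF v(3,4)]
    have hS: "hws M S" and hT: "hws (dsum Ms) T" using 1 2 by (auto simp: emb_def)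
    have "lo ?m v \<noteq> 0 \<Longrightarrow> \<beta> \<in> S"
      using hS [unfolded hws_def, rule_format, of "lo ?m v" \<beta>] c by simp
    moreover have "hi ?m v \<noteq> 0 \<Longrightarrow> \<beta> \<in> T"
      using hT [unfolded hws_def, rule_format, of "hi ?m v" \<beta>] c v(1) by simp
    moreover have "lo ?m v \<noteq> 0 \<or> hi ?m v \<noteq> 0" using v(2) lo_plus_jn [of ?m v] by auto
    ultimately show ?thesis using disj by blast
  qed
  let ?H = "\<lambda>v. F (lo ?m v) + G (hi ?m v)"
  have H: "hm (dsum (M # Ms)) W ?H" by (rule hm_plus [OF hm_comp [OF a(3) F(1)] hm_comp [OF a(4) G(1)]])
  have "finj (dsum (M # Ms)) ?H"
  proof (rule hw_inj [OF hD q W(1) H dD W(2)])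
    fix \<beta> v assume v: "supp (hdim (dsum (M # Ms))) v" "v \<noteq> 0" "op (dsum (M # Ms)) Gd v = 0"
      "op (dsum (M # Ms)) Gb v = \<beta> \<cdot>\<^sub>f v"
    show "?H v \<noteq> 0"
    proof (cases "lo ?m v = 0")
      case True
      then have "hi ?m v \<noteq> 0" using hwD [OF v] by blast
      then have "G (hi ?m v) \<noteq> 0" using G(2) v(1) unfolding finj_def by (metis hdim_dsum_Cons supp_hi)
      then show ?thesis by (simp add: True lin_0 [OF hmD(1) [OF F(1)]])
    next
      case False
      then have "hi ?m v = 0" using hwD [OF v] by blast
      moreover have "F (lo ?m v) \<noteq> 0" using F(2) False unfolding finj_def by (metis supp_lo)
      ultimately show ?thesis by (simp add: lin_0 [OF hmD(1) [OF G(1)]])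
    qed
  qed
  moreover have "hws (dsum (M # Ms)) (S \<union> T)"
    unfolding hws_def
  proof (intro allI impI, elim conjE)
    fix \<beta> v assume "supp (hdim (dsum (M # Ms))) v" "v \<noteq> 0" "op (dsum (M # Ms)) Gd v = 0"
      "op (dsum (M # Ms)) Gb v = \<beta> \<cdot>\<^sub>f v"
    from hwD [OF this] show "\<beta> \<in> S \<union> T" by blast
  qed
  ultimately show ?thesis unfolding emb_def by (intro conjI hD dD exI [of _ ?H] H)
qed

lemma emb_dsum:
  assumes q: "q \<noteq> 0" and W: "wfm W" "diagb W"
    and "\<And>i. i \<in> set xs \<Longrightarrow> emb n q W (X i) (S i)" "distinct xs"
    and "\<And>i j. i \<in> set xs \<Longrightarrow> j \<in> set xs \<Longrightarrow> i \<noteq> j \<Longrightarrow> S i \<inter> S j = {}"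
  shows "emb n q W (dsum (map X xs)) (\<Union>i\<in>set xs. S i)"
  using assms(4-)
proof (induction xs)
  case Nil
  then show ?case using emb_Nil [OF W(1)] by simp
next
  case (Cons x xs)
  have "emb n q W (dsum (X x # map X xs)) (S x \<union> (\<Union>i\<in>set xs. S i))"
    by (rule emb_Cons [OF q W]) (use Cons in \<open>auto\<close>)
  then show ?case by simp
qed

section \<open>The explicit band modules\<close>

text \<open>This is da - qad = 1 - bc on the basis of V(l,r), where bc acts by q^(2p+1-l) on the
  basis vector with index p counted from 0.\<close>

lemma (in qroot) alpha_step: "alpha q (Suc p) l = q * alpha q p l + 1 - q powi (2 * int p + 1 - int l)"
proof -
  have e: "q powi (2 * int p + 1 - int l) = q ^ p * q powi (int p + 1 - int l)"
  proof -
    have "2 * int p + 1 - int l = int p + (int p + 1 - int l)" by simp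
    then show ?thesis by (simp only: qpowi_add power_int_of_nat)
  qed
  have e1: "q powi (int (Suc p) - int l) = q powi (int p + 1 - int l)" by (simp add: algebra_simps)
  have e2: "q * q powi (int p - int l) = q powi (int p + 1 - int l)"
    using qpowi_add [of 1 "int p - int l"] by (simp add: algebra_simps)
  have "alpha q (Suc p) l = (1 + q * qint q p) * 1 - (q ^ p + qint q p) * q powi (int p + 1 - int l)"
    unfolding alpha_eq e1 right_diff_distrib by (simp only: qint_Suc' [symmetric]) (simp add: qint_Suc add.commute)
  also have "\<dots> = q * alpha q p l + 1 - q powi (2 * int p + 1 - int l)"
    unfolding e alpha_eq e2 [symmetric] by (simp add: algebra_simps)
  finally show ?thesis .
qed

lemma (in qroot) qpowi_pow_n: "(q powi x) ^ n = 1"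
  by (simp add: power_int_power' power_int_mult power_int_power flip: power_int_mult)
     (metis mult.commute power_int_mult power_int_1_left power_int_of_nat qn)

lemma (in hact) dpow_apow_hw:
  assumes "wti x y v" "d v = 0" "j < k"
  shows "(d ^^ k) ((a ^^ j) v) = 0"
  using assms(3)
proof (induction j arbitrary: k)
  case 0
  then obtain k' where "k = Suc k'" by (cases k) auto
  then have "(d ^^ k) v = (d ^^ k') (d v)" by (simp only: funpow_Suc_right o_apply)
  then show ?case using assms(2) by simp
next
  case (Suc j)
  then obtain k' where k: "k = Suc k'" "j < k'" by (cases k) auto
  have "(d ^^ k) ((a ^^ Suc j) v) = (d ^^ k') (d ((a ^^ Suc j) v))" by (simp add: k funpow_swap1)
  also have "\<dots> = (qint q (Suc j) * (1 - q powi (x + y + int (Suc j) - 1))) \<cdot>\<^sub>f (d ^^ k') ((a ^^ j) v)"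
    unfolding d_apow_wti [OF assms(1)] by (simp add: assms(2))
  also have "\<dots> = 0" using Suc.IH [OF k(2)] by simp
  finally show ?case .
qed

text \<open>The part of \<open>hrel\<close> that \<open>hact\<close> asks for; the remaining
  relations are recovered in \<open>is_hmodI_gen\<close> from weights and generators.\<close>

definition hrel0 :: "'k::field \<Rightarrow> 'k hmod \<Rightarrow> (nat \<Rightarrow> 'k) \<Rightarrow> bool" where
  "hrel0 q M v \<longleftrightarrow>
     op M Gb (op M Ga v) = q \<cdot>\<^sub>f op M Ga (op M Gb v) \<and> op M Gd (op M Gb v) = q \<cdot>\<^sub>f op M Gb (op M Gd v) \<and>
     op M Gc (op M Ga v) = q \<cdot>\<^sub>f op M Ga (op M Gc v) \<and> op M Gd (op M Gc v) = q \<cdot>\<^sub>f op M Gc (op M Gd v) \<and>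
     op M Gd (op M Ga v) = q \<cdot>\<^sub>f op M Ga (op M Gd v) + v - op M Gb (op M Gc v)"

lemma op_lo: "wfm M \<Longrightarrow> op M x v = op M x (lo (hdim M) v)"
  using carrier_matD(2) [OF wfmD [of M x]] by (auto simp: mapp_def lo_def fun_eq_iff intro!: sum.cong)

lemma hactI:
  assumes "qroot n q" "wfm M" and u: "\<And>j. j < hdim M \<Longrightarrow> hrel0 q M (uv j)"
  shows "hact n q (op M Ga) (op M Gb) (op M Gc) (op M Gd)"
proof -
  interpret qroot n q by fact
  have E: "f v = g v" if "lin f" "lin g" "\<And>j. j < hdim M \<Longrightarrow> f (uv j) = g (uv j)" "supp (hdim M) v" for f g v
    by (rule lin_eq_on_supp [OF that])
  have l2: "lin (\<lambda>v. op M x (op M y v))" "lin (\<lambda>v. q \<cdot>\<^sub>f op M x (op M y v))" for x y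
    by (simp_all add: lin_def sc_add mult.commute)
  have R: "hrel0 q M v" if "supp (hdim M) v" for v
    unfolding hrel0_def
    by (intro conjI; rule E [OF _ _ _ that]; (intro l2 lin_id lin_minus lin_plus)?)
       (use u in \<open>simp_all add: hrel0_def\<close>)
  \<comment> \<open>The four relations without an identity term see only the coordinates below the
    dimension, so cutting off the rest extends them to all functions.\<close>
  have R': "hrel0 q M (lo (hdim M) v)" for v by (rule R) simp
  have op2: "op M y (op M x v) = op M y (op M x (lo (hdim M) v))" for x y v
    using op_lo [OF assms(2), of x v] by simp
  show ?thesis
  proof (unfold_locales; (rule lin_mapp)?)
    show "op M Gb (op M Ga x) = q \<cdot>\<^sub>f op M Ga (op M Gb x)" "op M Gd (op M Gb x) = q \<cdot>\<^sub>f op M Gb (op M Gd x)"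
      "op M Gc (op M Ga x) = q \<cdot>\<^sub>f op M Ga (op M Gc x)" "op M Gd (op M Gc x) = q \<cdot>\<^sub>f op M Gc (op M Gd x)" for x
      using R' [of x] unfolding hrel0_def op2 [of _ _ x] by simp_all
    fix x \<beta> \<chi> assume bx: "op M Gb x = \<beta> \<cdot>\<^sub>f x" and cx: "op M Gc x = \<chi> \<cdot>\<^sub>f x" and "\<beta> \<noteq> 0"
    have "supp (hdim M) (op M Gb x)" using assms(2) by simp
    then have s: "supp (hdim M) x" using \<open>\<beta> \<noteq> 0\<close> by (simp add: bx supp_def sc_apply)
    show "op M Gd (op M Ga x) = q \<cdot>\<^sub>f op M Ga (op M Gd x) + (1 - \<beta> * \<chi>) \<cdot>\<^sub>f x"
      using R [OF s] unfolding hrel0_def by (simp add: bx cx) (simp add: pointwise algebra_simps)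
  qed
qed

lemma funpow_eigen: "lin f \<Longrightarrow> f v = k \<cdot>\<^sub>f v \<Longrightarrow> (f ^^ j) v = k ^ j \<cdot>\<^sub>f v"
  by (induction j) (simp_all add: linD mult.commute)

text \<open>A module is an \<open>H\<^sub>n(1,q)\<close>-module once the commutation relations hold on a basis of weight
  vectors and every basis vector is a multiple \<open>a\<^sup>k v\<close> of a vector killed by powers of \<open>a\<close> and \<open>d\<close>.\<close>

lemma is_hmodI_gen:
  assumes Q: "qroot n q" and w: "wfm M" and u: "\<And>j. j < hdim M \<Longrightarrow> hrel0 q M (uv j)"
    and wt: "\<And>j. j < hdim M \<Longrightarrow> \<exists>x y. op M Gb (uv j) = q powi x \<cdot>\<^sub>f uv j \<and> op M Gc (uv j) = q powi y \<cdot>\<^sub>f uv j"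
    and gen: "\<And>j. j < hdim M \<Longrightarrow> \<exists>v k x y. uv j = (op M Ga ^^ k) v \<and> (op M Ga ^^ n) v = 0 \<and> (op M Gd ^^ n) v = 0 \<and>
      op M Gb v = q powi x \<cdot>\<^sub>f v \<and> op M Gc v = q powi y \<cdot>\<^sub>f v"
  shows "is_hmod n q M"
proof (rule is_hmodI [OF w])
  fix j assume j: "j < hdim M"
  interpret qroot n q by fact
  interpret hact n q "op M Ga" "op M Gb" "op M Gc" "op M Gd" by (rule hactI [OF Q w u])
  obtain x y where xy: "op M Gb (uv j) = q powi x \<cdot>\<^sub>f uv j" "op M Gc (uv j) = q powi y \<cdot>\<^sub>f uv j" using wt [OF j] by blast
  obtain v k x' y' where v: "uv j = (op M Ga ^^ k) v" "(op M Ga ^^ n) v = 0" "(op M Gd ^^ n) v = 0"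
      "op M Gb v = q powi x' \<cdot>\<^sub>f v" "op M Gc v = q powi y' \<cdot>\<^sub>f v" using gen [OF j] by blast
  have "(op M Ga ^^ n) ((op M Ga ^^ k) v) = (op M Ga ^^ k) ((op M Ga ^^ n) v)"
    by (simp only: o_apply [symmetric, of "op M Ga ^^ _" "op M Ga ^^ _"] funpow_add [symmetric] add.commute)
  then have an: "(op M Ga ^^ n) (uv j) = 0" by (simp add: v)
  have "wt (q powi x') (q powi y') v" using v by (simp add: wt_def)
  then have dn: "(op M Gd ^^ n) (uv j) = 0" unfolding v(1) by (rule dn_apow) (simp_all add: v)
  have bn: "(op M Gb ^^ n) (uv j) = uv j" "(op M Gc ^^ n) (uv j) = uv j"
    by (simp_all add: funpow_eigen [OF lin_mapp xy(1)] funpow_eigen [OF lin_mapp xy(2)] qpowi_pow_n)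
  show "hrel n q M (uv j)"
    using u [OF j] an dn bn unfolding hrel_def hrel0_def
    by (simp add: xy mult.commute algebra_simps)
qed

definition penc :: "'k::field \<Rightarrow> 'k \<Rightarrow> nat \<Rightarrow> nat \<Rightarrow> 'k" where
  "penc x y i j = (if i = j then x else if i = Suc j then y else 0)"

text \<open>Basis vector number p * s + e, with p < n and e < s, has the role of a^p f_e if p < n -
  m and of a^(p-(n-m)) g_e otherwise. The pencils enter only where a passes from block n - m - 1 to
  block n - m, and where d maps block 0 to block n - 1.\<close>

definition band_mod :: "nat \<Rightarrow> 'k::field \<Rightarrow> nat \<Rightarrow> nat \<Rightarrow> int \<Rightarrow> 'k \<Rightarrow> 'k \<Rightarrow> 'k \<Rightarrow> 'k \<Rightarrow> 'k hmod" where
  "band_mod n q s m t A0 A1 D0 D1 = \<lparr>hdim = n * s, act = (\<lambda>x. mat (n * s) (n * s) (\<lambda>(i, j).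
     case x of
       Ga \<Rightarrow> if i div s = Suc (j div s) then
               (if Suc (j div s) = n - m then penc A0 A1 (i mod s) (j mod s) else if i mod s = j mod s then 1 else 0)
             else 0
     | Gb \<Rightarrow> if i = j then q powi (t + int m + int (j div s)) else 0
     | Gc \<Rightarrow> if i = j then q powi (int (j div s) + 1 - t) else 0
     | Gd \<Rightarrow> if j div s = 0 then (if Suc (i div s) = n then penc D0 D1 (i mod s) (j mod s) else 0)
             else if Suc (i div s) = j div s \<and> i mod s = j mod s then
               (if j div s < n - m then alpha q (j div s) (n - m) else alpha q (j div s - (n - m)) m)
             else 0))\<rparr>"

lemma hdim_GG [simp]: "hdim (band_mod n q s m t A0 A1 D0 D1) = n * s" by (simp add: band_mod_def)
lemma wfm_GG [simp]: "wfm (band_mod n q s m t A0 A1 D0 D1)" by (simp add: wfm_def band_mod_def)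

text \<open>Zero outside the index range, so that the formulas for the action hold at both ends of
  the range without side conditions.\<close>

definition bv :: "nat \<Rightarrow> nat \<Rightarrow> nat \<Rightarrow> nat \<Rightarrow> nat \<Rightarrow> 'k::field" where
  "bv n s p e = (if p < n \<and> e < s then uv (p * s + e) else 0)"

lemma idx_iff: "e < s \<Longrightarrow> i = p * s + e \<longleftrightarrow> i div s = p \<and> i mod s = (e::nat)"
  by auto

lemma idx_less: "p < n \<Longrightarrow> e < s \<Longrightarrow> p * s + e < n * (s::nat)"
  by (metis (no_types) add.commute add_less_mono1 less_eq_Suc_le less_le_trans mult_Suc mult_le_mono1)

lemma idx_less_iff: "e < s \<Longrightarrow> i < n * (s::nat) \<longleftrightarrow> i div s < n"
  by (simp add: div_less_iff_less_mult)

lemma idx_less': "i < n * (s::nat) \<Longrightarrow> i div s < n \<and> i mod s < s"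
  by (metis less_mult_imp_div_less mod_less_divisor mult_0_right not_gr_zero not_less_zero)

lemma bv_apply: "e < s \<Longrightarrow> p < n \<Longrightarrow> bv n s p e i = (if i div s = p \<and> i mod s = e then 1 else 0)"
  by (auto simp: bv_def uv_def idx_iff)

lemma bv_0 [simp]: "n \<le> p \<Longrightarrow> bv n s p e = 0" "s \<le> e \<Longrightarrow> bv n s p e = 0" by (simp_all add: bv_def)

lemma uv_bv: "j < n * s \<Longrightarrow> uv j = bv n s (j div s) (j mod s)"
  using idx_less' [of j n s] by (simp add: bv_def)

lemma supp_bv [simp]: "supp (n * s) (bv n s p e)"
  by (simp add: bv_def idx_less)

context qroot
begin

context
  fixes m :: nat and t :: int and A0 A1 D0 D1 :: 'k and s :: nat
  assumes m: "1 \<le> m" "m < n"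
begin

abbreviation "GG \<equiv> band_mod n q s m t A0 A1 D0 D1"

lemma op_GG:
  assumes "e < s" "p < n"
  shows "op GG x (bv n s p e) i = (if i div s < n then act GG x $$ (i, p * s + e) else 0)"
  using assms idx_less [OF assms(2,1)] idx_less_iff [OF assms(1), of i n]
  by (simp add: bv_def mapp_uv) (simp add: band_mod_def)

lemma act_GG:
  assumes "e < s" "p < n" "i div s < n"
  shows "act GG Ga $$ (i, p * s + e) = (if i div s = Suc p then
      (if Suc p = n - m then penc A0 A1 (i mod s) e else if i mod s = e then 1 else 0) else 0)"
    "act GG Gb $$ (i, p * s + e) = (if i div s = p \<and> i mod s = e then q powi (t + int m + int p) else 0)"
    "act GG Gc $$ (i, p * s + e) = (if i div s = p \<and> i mod s = e then q powi (int p + 1 - t) else 0)"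
    "act GG Gd $$ (i, p * s + e) = (if p = 0 then (if Suc (i div s) = n then penc D0 D1 (i mod s) e else 0)
       else if Suc (i div s) = p \<and> i mod s = e then
         (if p < n - m then alpha q p (n - m) else alpha q (p - (n - m)) m)
       else 0)"
proof -
  have pe: "(p * s + e) div s = p" "(p * s + e) mod s = e" using assms by simp_all
  have l: "p * s + e < n * s" "i < n * s" using idx_less [OF assms(2,1)] idx_less_iff [OF assms(1), of i n] assms by auto
  show "act GG Ga $$ (i, p * s + e) = (if i div s = Suc p then
      (if Suc p = n - m then penc A0 A1 (i mod s) e else if i mod s = e then 1 else 0) else 0)"
    "act GG Gb $$ (i, p * s + e) = (if i div s = p \<and> i mod s = e then q powi (t + int m + int p) else 0)"
    "act GG Gc $$ (i, p * s + e) = (if i div s = p \<and> i mod s = e then q powi (int p + 1 - t) else 0)"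
    "act GG Gd $$ (i, p * s + e) = (if p = 0 then (if Suc (i div s) = n then penc D0 D1 (i mod s) e else 0)
       else if Suc (i div s) = p \<and> i mod s = e then
         (if p < n - m then alpha q p (n - m) else alpha q (p - (n - m)) m)
       else 0)"
    unfolding band_mod_def using l
    by (simp_all add: pe assms(1), simp_all add: idx_iff [OF assms(1)] pe)
qed

lemma comb_bv_apply:
  assumes "e < s" "p < n"
  shows "comb x y (bv n s p) e i = (if i div s = p then penc x y (i mod s) e else 0)"
proof (cases "Suc e < s")
  case True
  then show ?thesis using assms
    by (simp add: comb_def plus_fun_apply sc_apply bv_apply penc_def)
next
  case False
  have "i mod s < s" using assms by simp
  with False have "i mod s \<noteq> Suc e" by linarith
  then show ?thesis using assms False
    by (simp add: comb_def plus_fun_apply sc_apply zero_fun_apply bv_apply penc_def not_less)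
qed

lemma op_Ga: "op GG Ga (bv n s p e)
    = (if Suc p = n - m then comb A0 A1 (bv n s (Suc p)) e else bv n s (Suc p) e)"
proof (cases "e < s \<and> p < n")
  case True
  then have es: "e < s" "p < n" by auto
  show ?thesis
  proof
    fix i
    show "op GG Ga (bv n s p e) i = (if Suc p = n - m then comb A0 A1 (bv n s (Suc p)) e else bv n s (Suc p) e) i"
    proof (cases "Suc p < n")
      case True
      show ?thesis unfolding op_GG [OF es] using True es
        by (simp add: act_GG comb_bv_apply bv_apply)
    next
      case False
      then have "Suc p \<noteq> n - m" "n \<le> Suc p" using es m by auto
      then show ?thesis unfolding op_GG [OF es] using es by (simp add: act_GG zero_fun_apply)
    qed
  qed
next
  case False
  then show ?thesis using m by (auto simp: comb_def not_less)
qed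

lemma op_Gb: "op GG Gb (bv n s p e) = q powi (t + int m + int p) \<cdot>\<^sub>f bv n s p e"
proof (cases "e < s \<and> p < n")
  case True
  then show ?thesis by (simp add: fun_eq_iff op_GG act_GG sc_apply bv_apply)
next
  case False
  then show ?thesis by (auto simp: not_less)
qed

lemma op_Gc: "op GG Gc (bv n s p e) = q powi (int p + 1 - t) \<cdot>\<^sub>f bv n s p e"
proof (cases "e < s \<and> p < n")
  case True
  then show ?thesis by (simp add: fun_eq_iff op_GG act_GG sc_apply bv_apply)
next
  case False
  then show ?thesis by (auto simp: not_less)
qed

lemma op_Gd: "op GG Gd (bv n s p e) = (if p = 0 then comb D0 D1 (bv n s (n - 1)) e
    else (if p < n - m then alpha q p (n - m) else if p < n then alpha q (p - (n - m)) m else 0) \<cdot>\<^sub>f bv n s (p - 1) e)"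
proof (cases "e < s \<and> p < n")
  case True
  then have es: "e < s" "p < n" by auto
  have n1: "n - 1 < n" using m by simp
  show ?thesis
  proof
    fix i
    have "Suc (i div s) = n \<longleftrightarrow> i div s = n - 1" "Suc (i div s) = p \<longleftrightarrow> i div s = p - 1" if "p \<noteq> 0"
      using that n1 by auto
    moreover have "Suc (i div s) = n \<longleftrightarrow> i div s = n - 1" using n1 by auto
    ultimately show "op GG Gd (bv n s p e) i = (if p = 0 then comb D0 D1 (bv n s (n - 1)) e
      else (if p < n - m then alpha q p (n - m) else if p < n then alpha q (p - (n - m)) m else 0) \<cdot>\<^sub>f bv n s (p - 1) e) i"
      unfolding op_GG [OF es]
      using es n1 comb_bv_apply [OF es(1) n1, of D0 D1 i] act_GG(4) [OF es, of i]
      by (cases "p = 0"; cases "i div s < n") (simp_all add: sc_apply bv_apply)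
  qed
next
  case False
  then show ?thesis by (auto simp: comb_def not_less)
qed

lemma apow_bv_lower: "p + k < n - m \<Longrightarrow> (op GG Ga ^^ k) (bv n s p e) = bv n s (p + k) e"
  by (induction k) (auto simp: op_Ga)

lemma apow_bv_upper: "n - m \<le> p \<Longrightarrow> (op GG Ga ^^ k) (bv n s p e) = bv n s (p + k) e"
  by (induction k) (auto simp: op_Ga)

lemma bv_cases:
  "p < n - m \<Longrightarrow> bv n s p e = (op GG Ga ^^ p) (bv n s 0 e)"
  "n - m \<le> p \<Longrightarrow> bv n s p e = (op GG Ga ^^ (p - (n - m))) (bv n s (n - m) e)"
  using apow_bv_lower [of 0 p e] apow_bv_upper [of "n - m" "p - (n - m)" e] by auto

lemma apow_f: "(op GG Ga ^^ (n - m)) (bv n s 0 e) = comb A0 A1 (bv n s (n - m)) e"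
proof -
  obtain k where k: "n - m = Suc k" using m by (cases "n - m") auto
  show ?thesis unfolding k using apow_bv_lower [of 0 k e] by (simp add: op_Ga k)
qed

lemma hrel0_GG: "hrel0 q GG (bv n s p e)"
proof (cases "p < n")
  case True
  note ops = op_Ga op_Gb op_Gc op_Gd
  have wa: "op GG Gb (op GG Ga (bv n s p e)) = q powi (t + int m + int p + 1) \<cdot>\<^sub>f op GG Ga (bv n s p e)"
    "op GG Gc (op GG Ga (bv n s p e)) = q powi (int p + 1 - t + 1) \<cdot>\<^sub>f op GG Ga (bv n s p e)"
  proof -
    have e1: "t + int m + int (Suc p) = t + int m + int p + 1" "int (Suc p) + 1 - t = int p + 1 - t + 1"
      by simp_all
    have cb: "op GG Gb (comb x y (bv n s p) e) = q powi (t + int m + int p) \<cdot>\<^sub>f comb x y (bv n s p) e"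
      "op GG Gc (comb x y (bv n s p) e) = q powi (int p + 1 - t) \<cdot>\<^sub>f comb x y (bv n s p) e" for x y p
      by (simp_all add: comb_def ops sc_add mult.commute)
    show "op GG Gb (op GG Ga (bv n s p e)) = q powi (t + int m + int p + 1) \<cdot>\<^sub>f op GG Ga (bv n s p e)"
      "op GG Gc (op GG Ga (bv n s p e)) = q powi (int p + 1 - t + 1) \<cdot>\<^sub>f op GG Ga (bv n s p e)"
      unfolding op_Ga by (cases "Suc p = n - m"; simp only: if_True if_False cb op_Gb op_Gc e1 [symmetric])+
  qed
  have wd: "op GG Gb (op GG Gd (bv n s p e)) = q powi (t + int m + int p - 1) \<cdot>\<^sub>f op GG Gd (bv n s p e)"
    "op GG Gc (op GG Gd (bv n s p e)) = q powi (int p + 1 - t - 1) \<cdot>\<^sub>f op GG Gd (bv n s p e)"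
  proof -
    \<comment> \<open>The passage of d from block 0 to block n - 1 has the right weight because
      exponents count modulo n.\<close>
    have 1: "q powi (t + int m + int (n - 1)) = q powi (t + int m - 1)"
      "q powi (int (n - 1) + 1 - t) = q powi (- t)"
      using n2 by (auto intro!: qpowi_cong simp: of_nat_diff)
    show "op GG Gb (op GG Gd (bv n s p e)) = q powi (t + int m + int p - 1) \<cdot>\<^sub>f op GG Gd (bv n s p e)"
      using 1 by (cases p) (auto simp: ops comb_def sc_add mult.commute algebra_simps)
    show "op GG Gc (op GG Gd (bv n s p e)) = q powi (int p + 1 - t - 1) \<cdot>\<^sub>f op GG Gd (bv n s p e)"
      using 1 by (cases p) (auto simp: ops comb_def sc_add mult.commute algebra_simps)
  qed
  have bc: "op GG Gb (op GG Gc (bv n s p e)) = q powi (int m + 2 * int p + 1) \<cdot>\<^sub>f bv n s p e"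
    by (simp add: ops qpowi_add [symmetric] algebra_simps)
  have da: "op GG Gd (op GG Ga (bv n s p e)) = q \<cdot>\<^sub>f op GG Ga (op GG Gd (bv n s p e))
     + (1 - q powi (int m + 2 * int p + 1)) \<cdot>\<^sub>f bv n s p e"
  \<comment> \<open>The blocks below n - m behave like V(n-m,t+m), the others like V(m,t). At the
    seams the pencils drop out, since d g = 0 and a kills the top block, in agreement with
    \<alpha>_l(l) = 0 and \<alpha>_0(l) = 0.\<close>
  proof (cases "p < n - m")
    case True
    have A: "q * alpha q p (n - m) + (1 - q powi (int m + 2 * int p + 1)) = alpha q (Suc p) (n - m)"
      unfolding alpha_step
      using m by (auto intro!: qpowi_cong simp: of_nat_diff algebra_simps)
    have 1: "op GG Gd (op GG Ga (bv n s p e)) = alpha q (Suc p) (n - m) \<cdot>\<^sub>f bv n s p e"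
    proof (cases "Suc p = n - m")
      case True
      then show ?thesis by (simp add: ops comb_def)
    next
      case False
      with \<open>p < n - m\<close> show ?thesis by (simp add: ops)
    qed
    have 2: "q \<cdot>\<^sub>f op GG Ga (op GG Gd (bv n s p e)) = (q * alpha q p (n - m)) \<cdot>\<^sub>f bv n s p e"
    proof (cases p)
      case 0
      then show ?thesis using m by (simp add: ops comb_def)
    next
      case (Suc p')
      then show ?thesis using True by (simp add: ops)
    qed
    show ?thesis unfolding 1 2 A [symmetric] by (simp add: pointwise algebra_simps)
  next
    case False
    define k where "k = p - (n - m)"
    have p: "p = n - m + k" using False by (simp add: k_def)
    have A: "q * alpha q k m + (1 - q powi (int m + 2 * int p + 1)) = alpha q (Suc k) m"
    proof -
      have "q powi (int m + 2 * int p + 1) = q powi (2 * int k + 1 - int m)"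
        using m by (intro qpowi_cong) (simp add: p of_nat_diff)
      then show ?thesis unfolding alpha_step by simp
    qed
    have 1: "op GG Gd (op GG Ga (bv n s p e)) = alpha q (Suc k) m \<cdot>\<^sub>f bv n s p e"
    proof (cases "Suc p < n")
      case True
      have "Suc p \<noteq> n - m" "\<not> Suc p < n - m" "Suc p - (n - m) = Suc k" using p m by auto
      then show ?thesis using True by (simp add: ops)
    next
      case False
      then have "Suc k = m" using p m \<open>p < n\<close> by auto
      moreover have "Suc p \<noteq> n - m" using False m by auto
      ultimately show ?thesis using False by (simp add: ops)
    qed
    have 2: "q \<cdot>\<^sub>f op GG Ga (op GG Gd (bv n s p e)) = (q * alpha q k m) \<cdot>\<^sub>f bv n s p e"
    proof (cases k)
      case 0
      then show ?thesis using m by (simp add: ops p)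
    next
      case (Suc k')
      have "p \<noteq> 0" "\<not> p < n - m" "Suc (p - 1) \<noteq> n - m" "Suc (p - 1) = p" "p - (n - m) = k"
        using p m Suc by auto
      then show ?thesis using \<open>p < n\<close> by (simp add: ops)
    qed
    show ?thesis unfolding 1 2 A [symmetric] by (simp add: pointwise algebra_simps)
  qed
  show ?thesis unfolding hrel0_def bc wa wd da
    by (simp add: op_Gb op_Gc qpowi_add power_int_diff mult.commute) (simp add: pointwise algebra_simps power2_eq_square)
next
  case False
  then show ?thesis by (simp add: hrel0_def)
qed

lemma hact_GG: "hact n q (op GG Ga) (op GG Gb) (op GG Gc) (op GG Gd)"
  by (rule hactI [OF qroot_axioms wfm_GG]) (simp add: uv_bv hrel0_GG)

lemma band_GG: "hact.band n q (op GG Ga) (op GG Gb) (op GG Gc) (op GG Gd) A0 A1 D0 D1 m t 1 (bv n s 0) (bv n s (n - m))"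
proof -
  interpret hact n q "op GG Ga" "op GG Gb" "op GG Gc" "op GG Gd" by (rule hact_GG)
  have n1: "n - m + (m - 1) = n - 1" using m by simp
  have c: "q powi (t + int m + int (n - m)) = q powi t" "q powi (int (n - m) + 1 - t) = q powi (1 - t - int m)"
    using m by (auto intro!: qpowi_cong simp: of_nat_diff)
  have "(op GG Ga ^^ m) (bv n s (n - m) e) = 0" for e
    using apow_bv_upper [of "n - m" m e] m by simp
  moreover have "op GG Gd (bv n s 0 e) = (op GG Ga ^^ (m - 1)) (comb D0 D1 (bv n s (n - m)) e)" for e
    unfolding lin_comb [OF lin_funpow [OF lin(1)]]
    using apow_bv_upper [of "n - m" "m - 1"] n1 by (simp add: op_Gd)
  moreover have "op GG Gd (bv n s (n - m) e) = 0" for e using m by (simp add: op_Gd)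
  moreover have "wti t (1 - t - int m) (bv n s (n - m) e)" for e
    unfolding wti_def wt_def op_Gb op_Gc c by simp
  moreover have "wti (t + int m) (1 - t) (bv n s 0 e)" for e
    by (simp add: wti_def wt_def op_Gb op_Gc)
  ultimately show ?thesis unfolding band_def
    by (simp add: apow_f)
qed

lemma is_hmod_GG: "is_hmod n q GG"
proof (rule is_hmodI_gen [OF qroot_axioms wfm_GG])
  interpret hact n q "op GG Ga" "op GG Gb" "op GG Gc" "op GG Gd" by (rule hact_GG)
  fix j assume "j < hdim GG"
  then have j: "uv j = bv n s (j div s) (j mod s)" by (simp add: uv_bv)
  let ?p = "j div s" and ?e = "j mod s"
  note B = band_GG [unfolded band_def, rule_format]
  show "hrel0 q GG (uv j)" by (simp add: j hrel0_GG)
  show "\<exists>x y. op GG Gb (uv j) = q powi x \<cdot>\<^sub>f uv j \<and> op GG Gc (uv j) = q powi y \<cdot>\<^sub>f uv j"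
    unfolding j using op_Gb op_Gc by blast
  have ag: "(op GG Ga ^^ k) (bv n s (n - m) e) = 0" if "m \<le> k" for e k
    using apow_bv_upper [of "n - m" k e] m that by simp
  have dg: "(op GG Gd ^^ n) (bv n s (n - m) e) = 0" for e
    using dpow_apow_hw [of t "1 - t - int m" "bv n s (n - m) e" 0 n] B n2 by auto
  have af: "(op GG Ga ^^ n) (bv n s 0 e) = 0" for e
  proof -
    have "(op GG Ga ^^ n) (bv n s 0 e) = (op GG Ga ^^ m) ((op GG Ga ^^ (n - m)) (bv n s 0 e))"
      using m by (simp only: o_apply [symmetric, of "op GG Ga ^^ _" "op GG Ga ^^ _"] funpow_add [symmetric]) simp
    then show ?thesis by (simp add: apow_f lin_comb [OF lin_funpow [OF lin(1)]] ag) (simp add: comb_def)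
  qed
  have df: "(op GG Gd ^^ n) (bv n s 0 e) = 0" for e
  proof -
    obtain k where k: "n = Suc k" using n2 by (cases n) auto
    have z: "(op GG Gd ^^ k) ((op GG Ga ^^ (m - 1)) (bv n s (n - m) e)) = 0" for e
      using B m k by (intro dpow_apow_hw [of t "1 - t - int m"]) auto
    have "(op GG Gd ^^ n) (bv n s 0 e) = (op GG Gd ^^ k) (op GG Gd (bv n s 0 e))" by (simp add: k funpow_swap1)
    also have "op GG Gd (bv n s 0 e) = comb D0 D1 (\<lambda>e. (op GG Ga ^^ (m - 1)) (bv n s (n - m) e)) e"
      using B [of e] by (simp add: lin_comb [OF lin_funpow [OF lin(1)]])
    finally show ?thesis unfolding lin_comb [OF lin_funpow [OF lin(4)]] z by (simp add: comb_def)
  qed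
  show "\<exists>v k x y. uv j = (op GG Ga ^^ k) v \<and> (op GG Ga ^^ n) v = 0 \<and> (op GG Gd ^^ n) v = 0 \<and>
      op GG Gb v = q powi x \<cdot>\<^sub>f v \<and> op GG Gc v = q powi y \<cdot>\<^sub>f v"
    unfolding j
  proof (cases "?p < n - m")
    case True
    show "\<exists>v k x y. bv n s ?p ?e = (op GG Ga ^^ k) v \<and> (op GG Ga ^^ n) v = 0 \<and> (op GG Gd ^^ n) v = 0 \<and>
      op GG Gb v = q powi x \<cdot>\<^sub>f v \<and> op GG Gc v = q powi y \<cdot>\<^sub>f v"
      using bv_cases(1) [OF True] af df op_Gb op_Gc by blast
  next
    case False
    then show "\<exists>v k x y. bv n s ?p ?e = (op GG Ga ^^ k) v \<and> (op GG Ga ^^ n) v = 0 \<and> (op GG Gd ^^ n) v = 0 \<and>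
      op GG Gb v = q powi x \<cdot>\<^sub>f v \<and> op GG Gc v = q powi y \<cdot>\<^sub>f v"
      using bv_cases(2) [of ?p ?e] ag [of n] dg m op_Gb op_Gc by (metis less_imp_le_nat not_less)
  qed
qed

end

end

section \<open>Simple and projective modules\<close>

text \<open>Numbered from 0: \<open>vv l k\<close> is the basis vector v_(k+1) of V(l,r), and it is
  zero from k = l on.\<close>

definition vv :: "nat \<Rightarrow> nat \<Rightarrow> nat \<Rightarrow> 'k::field" where "vv l k = (if k < l then uv k else 0)"

lemma supp_vv [simp]: "supp l (vv l k)" by (simp add: vv_def)
lemma vv_0 [simp]: "l \<le> k \<Longrightarrow> vv l k = 0" by (simp add: vv_def)
lemma uv_vv: "j < l \<Longrightarrow> uv j = vv l j" by (simp add: vv_def)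

lemma hdim_V [simp]: "hdim (V_mod q l r) = l" by (simp add: V_mod_def)
lemma wfm_V [simp]: "wfm (V_mod q l r)" by (simp add: wfm_def V_mod_def basis_mat_def)

lemma nat_eq_of_dvd: "a < n \<Longrightarrow> b < n \<Longrightarrow> int n dvd int a - int b \<Longrightarrow> a = b"
  unfolding mod_eq_dvd_iff [symmetric] by (simp flip: zmod_int)

context qroot
begin

lemma op_V:
  "op (V_mod q l r) Ga (vv l k) = vv l (Suc k)"
  "op (V_mod q l r) Gb (vv l k) = q powi (r + int k) \<cdot>\<^sub>f vv l k"
  "op (V_mod q l r) Gc (vv l k) = q powi (int k + 1 - r - int l) \<cdot>\<^sub>f vv l k"
  "op (V_mod q l r) Gd (vv l k) = alpha q k l \<cdot>\<^sub>f vv l (k - 1)"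
proof -
  show "op (V_mod q l r) Ga (vv l k) = vv l (Suc k)"
    by (auto simp: fun_eq_iff vv_def mapp_uv zero_fun_apply V_mod_def basis_mat_def) (auto simp: uv_def)
  show "op (V_mod q l r) Gb (vv l k) = q powi (r + int k) \<cdot>\<^sub>f vv l k"
    by (auto simp: fun_eq_iff vv_def mapp_uv zero_fun_apply V_mod_def basis_mat_def sc_apply) (auto simp: uv_def)
  show "op (V_mod q l r) Gc (vv l k) = q powi (int k + 1 - r - int l) \<cdot>\<^sub>f vv l k"
    by (auto simp: fun_eq_iff vv_def mapp_uv zero_fun_apply V_mod_def basis_mat_def sc_apply) (auto simp: uv_def algebra_simps)
  show "op (V_mod q l r) Gd (vv l k) = alpha q k l \<cdot>\<^sub>f vv l (k - 1)"
  proof (cases "k < l")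
    case True
    then show ?thesis
      by (cases k; auto simp: fun_eq_iff vv_def mapp_uv zero_fun_apply V_mod_def basis_mat_def sc_apply; auto simp: uv_def)
  next
    case False
    then show ?thesis by (cases "k = l") auto
  qed
qed

lemma apow_V: "(op (V_mod q l r) Ga ^^ k) (vv l j) = vv l (j + k)"
  by (induction k) (auto simp: op_V)

text \<open>The constants met on the way down are \<alpha>_1(l), ..., \<alpha>_k(l), none of which
  vanishes. This is what allows a vector to be moved through V(l,r) and back.\<close>

lemma dpow_V: "k < l \<Longrightarrow> l \<le> n \<Longrightarrow> \<exists>\<xi>. \<xi> \<noteq> 0 \<and> (op (V_mod q l r) Gd ^^ k) (vv l k) = \<xi> \<cdot>\<^sub>f vv l 0"
proof (induction k)
  case 0
  then show ?case by (intro exI [of _ 1]) simp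
next
  case (Suc k)
  then obtain \<xi> where "\<xi> \<noteq> 0" "(op (V_mod q l r) Gd ^^ k) (vv l k) = \<xi> \<cdot>\<^sub>f vv l 0" by auto
  moreover have "(op (V_mod q l r) Gd ^^ Suc k) (vv l (Suc k)) = alpha q (Suc k) l \<cdot>\<^sub>f (op (V_mod q l r) Gd ^^ k) (vv l k)"
    by (simp only: funpow_Suc_right o_apply op_V diff_Suc_1 linD [OF lin_funpow [OF lin_mapp]])
  moreover have "alpha q (Suc k) l \<noteq> 0" using Suc.prems by (intro alpha_neq_0') auto
  ultimately show ?case by (intro exI [of _ "alpha q (Suc k) l * \<xi>"]) simp
qed

section \<open>The explicit model of the projective cover P(m,t)\<close>

definition xv :: "nat \<Rightarrow> nat \<Rightarrow> 'k" where "xv i = (if i < n then uv i else 0)"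
definition pv :: "nat \<Rightarrow> nat \<Rightarrow> 'k" where "pv i = (if i < n then uv (n + i) else 0)"

text \<open>Two n-dimensional modules generated by highest weight vectors, glued together: x_i = a^i
  x and p_i = a^i p with x of weight t, p of weight t + m, d p = 0 and d x = a^(n-m-1) p. The entry
  q^j is the coefficient of a^j d x in d a^j x, see \<open>d_apow_hw\<close>; row indices from 2n on
  do not exist, in accordance with a^n p = 0.\<close>

definition PP :: "nat \<Rightarrow> int \<Rightarrow> 'k hmod" where
  "PP m t = \<lparr>hdim = 2 * n, act = (\<lambda>x. mat (2 * n) (2 * n) (\<lambda>(i, j). case x of
      Ga \<Rightarrow> if i = Suc j \<and> i \<noteq> n then 1 else 0
    | Gb \<Rightarrow> if i = j then (if j < n then q powi (t + int j) else q powi (t + int m + int (j - n))) else 0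
    | Gc \<Rightarrow> if i = j then (if j < n then q powi (1 - t - int m + int j) else q powi (1 - t + int (j - n))) else 0
    | Gd \<Rightarrow> if j < n then (if Suc i = j then alpha q j m else if i = n + (j + (n - m) - 1) then q ^ j else 0)
            else if Suc i = j \<and> n \<le> i then alpha q (j - n) (n - m) else 0))\<rparr>"

lemma hdim_PP [simp]: "hdim (PP m t) = 2 * n" by (simp add: PP_def)
lemma wfm_PP [simp]: "wfm (PP m t)" by (simp add: wfm_def PP_def)
lemma supp_xv [simp]: "supp (2 * n) (xv i)" and supp_pv [simp]: "supp (2 * n) (pv i)"
  by (simp_all add: xv_def pv_def)
lemma xv_0 [simp]: "n \<le> i \<Longrightarrow> xv i = 0" and pv_0 [simp]: "n \<le> i \<Longrightarrow> pv i = 0"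
  by (simp_all add: xv_def pv_def)

lemma uv_cases: "j < 2 * n \<Longrightarrow> (j < n \<and> uv j = xv j) \<or> (n \<le> j \<and> j - n < n \<and> uv j = pv (j - n))"
  by (auto simp: xv_def pv_def)

context
  fixes m :: nat and t :: int
  assumes m: "1 \<le> m" "m < n"
begin

lemma op_PP_x:
  "op (PP m t) Ga (xv i) = xv (Suc i)"
  "op (PP m t) Gb (xv i) = q powi (t + int i) \<cdot>\<^sub>f xv i"
  "op (PP m t) Gc (xv i) = q powi (1 - t - int m + int i) \<cdot>\<^sub>f xv i"
  "op (PP m t) Gd (xv i) = alpha q i m \<cdot>\<^sub>f xv (i - 1) + q ^ i \<cdot>\<^sub>f pv (i + (n - m) - 1)"
proof -
  show "op (PP m t) Ga (xv i) = xv (Suc i)"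
    by (auto simp: fun_eq_iff xv_def mapp_uv zero_fun_apply PP_def) (auto simp: uv_def)
  show "op (PP m t) Gb (xv i) = q powi (t + int i) \<cdot>\<^sub>f xv i"
    by (auto simp: fun_eq_iff xv_def mapp_uv zero_fun_apply PP_def sc_apply) (auto simp: uv_def)
  show "op (PP m t) Gc (xv i) = q powi (1 - t - int m + int i) \<cdot>\<^sub>f xv i"
    by (auto simp: fun_eq_iff xv_def mapp_uv zero_fun_apply PP_def sc_apply) (auto simp: uv_def)
  show "op (PP m t) Gd (xv i) = alpha q i m \<cdot>\<^sub>f xv (i - 1) + q ^ i \<cdot>\<^sub>f pv (i + (n - m) - 1)"
  proof (cases "i < n")
    case True
    then show ?thesis using m
      by (cases i; auto simp: fun_eq_iff xv_def pv_def mapp_uv zero_fun_apply plus_fun_apply PP_def sc_apply; auto simp: uv_def)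
  next
    case False
    then show ?thesis using m by (cases "i = n") auto
  qed
qed

lemma op_PP_p:
  "op (PP m t) Ga (pv i) = pv (Suc i)"
  "op (PP m t) Gb (pv i) = q powi (t + int m + int i) \<cdot>\<^sub>f pv i"
  "op (PP m t) Gc (pv i) = q powi (1 - t + int i) \<cdot>\<^sub>f pv i"
  "op (PP m t) Gd (pv i) = alpha q i (n - m) \<cdot>\<^sub>f pv (i - 1)"
proof -
  show "op (PP m t) Ga (pv i) = pv (Suc i)"
    by (auto simp: fun_eq_iff pv_def mapp_uv zero_fun_apply PP_def) (auto simp: uv_def)
  show "op (PP m t) Gb (pv i) = q powi (t + int m + int i) \<cdot>\<^sub>f pv i"
    by (auto simp: fun_eq_iff pv_def mapp_uv zero_fun_apply PP_def sc_apply) (auto simp: uv_def)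
  show "op (PP m t) Gc (pv i) = q powi (1 - t + int i) \<cdot>\<^sub>f pv i"
    by (auto simp: fun_eq_iff pv_def mapp_uv zero_fun_apply PP_def sc_apply) (auto simp: uv_def)
  show "op (PP m t) Gd (pv i) = alpha q i (n - m) \<cdot>\<^sub>f pv (i - 1)"
  proof (cases "i < n")
    case True
    then show ?thesis
      by (cases i; auto simp: fun_eq_iff pv_def mapp_uv zero_fun_apply PP_def sc_apply; auto simp: uv_def)
  next
    case False
    then show ?thesis by (cases "i = n") auto
  qed
qed

lemma apow_PP: "(op (PP m t) Ga ^^ k) (xv i) = xv (i + k)" "(op (PP m t) Ga ^^ k) (pv i) = pv (i + k)"
  by (induction k) (auto simp: op_PP_x op_PP_p)

lemma hrel0_PP: "hrel0 q (PP m t) (xv i)" "hrel0 q (PP m t) (pv i)"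
proof -
  have e: "q powi (x + int (Suc i)) = q * q powi (x + int i)" for x i
    using qpowi_add [of "x + int i" 1] by (simp add: algebra_simps)
  \<comment> \<open>Truncated subtraction does no harm: at i = 0 the factor \<alpha>_0(l) is
    zero.\<close>
  have e1: "alpha q i l \<cdot>\<^sub>f (q powi (x + int i) \<cdot>\<^sub>f g (i - 1)) = alpha q i l \<cdot>\<^sub>f ((q * q powi (x + int (i - 1))) \<cdot>\<^sub>f g (i - 1))"
    for x i l and g :: "nat \<Rightarrow> nat \<Rightarrow> 'k"
    using e [of x "i - 1"] by (cases i) auto
  have ap: "alpha q i l \<cdot>\<^sub>f g (Suc (i - 1)) = alpha q i l \<cdot>\<^sub>f g i" for l i and g :: "nat \<Rightarrow> nat \<Rightarrow> 'k"
    by (cases i) auto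
  show "hrel0 q (PP m t) (pv i)"
  proof -
    have s: "q powi (t + int m + int i) * q powi (1 - t + int i) = q powi (2 * int i + 1 - int (n - m))"
      unfolding qpowi_add [symmetric] using m by (intro qpowi_cong) (simp add: of_nat_diff)
    have d: "op (PP m t) Gd (pv (Suc i)) = (q * alpha q i (n - m) + 1 - q powi (2 * int i + 1 - int (n - m))) \<cdot>\<^sub>f pv i"
      by (simp add: op_PP_p alpha_step)
    have w: "alpha q i (n - m) \<cdot>\<^sub>f (q powi (t + int m + int i) \<cdot>\<^sub>f pv (i - 1))
        = alpha q i (n - m) \<cdot>\<^sub>f ((q * q powi (t + int m + int (i - 1))) \<cdot>\<^sub>f pv (i - 1))"
      "alpha q i (n - m) \<cdot>\<^sub>f (q powi (1 - t + int i) \<cdot>\<^sub>f pv (i - 1))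
        = alpha q i (n - m) \<cdot>\<^sub>f ((q * q powi (1 - t + int (i - 1))) \<cdot>\<^sub>f pv (i - 1))"
      by (rule e1)+
    have db: "op (PP m t) Gd (op (PP m t) Gb (pv i)) = q \<cdot>\<^sub>f op (PP m t) Gb (op (PP m t) Gd (pv i))"
      using w(1) by (simp add: op_PP_p mult_ac)
    have dc: "op (PP m t) Gd (op (PP m t) Gc (pv i)) = q \<cdot>\<^sub>f op (PP m t) Gc (op (PP m t) Gd (pv i))"
      using w(2) by (simp add: op_PP_p mult_ac)
    have ad: "op (PP m t) Ga (op (PP m t) Gd (pv i)) = alpha q i (n - m) \<cdot>\<^sub>f pv i"
      by (cases i) (simp_all add: op_PP_p(4) op_PP_p(1))
    have bc: "op (PP m t) Gb (op (PP m t) Gc (pv i)) = q powi (2 * int i + 1 - int (n - m)) \<cdot>\<^sub>f pv i"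
      using s by (simp only: op_PP_p(2,3) linD [OF lin_mapp] sc_sc mult.commute)
    have E: "op (PP m t) Gb (pv (Suc i)) = (q * q powi (t + int m + int i)) \<cdot>\<^sub>f pv (Suc i)"
      "op (PP m t) Gc (pv (Suc i)) = (q * q powi (1 - t + int i)) \<cdot>\<^sub>f pv (Suc i)"
      by (simp_all only: op_PP_p(2,3) e)
    show ?thesis
      unfolding hrel0_def d ad bc op_PP_p(1)
    proof (intro conjI)
      show "op (PP m t) Gb (pv (Suc i)) = q \<cdot>\<^sub>f op (PP m t) Ga (op (PP m t) Gb (pv i))"
        unfolding E by (simp only: op_PP_p(1,2) linD [OF lin_mapp] sc_sc)
      show "op (PP m t) Gc (pv (Suc i)) = q \<cdot>\<^sub>f op (PP m t) Ga (op (PP m t) Gc (pv i))"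
        unfolding E by (simp only: op_PP_p(1,3) linD [OF lin_mapp] sc_sc)
    qed (rule db dc | simp add: pointwise algebra_simps)+
  qed
  show "hrel0 q (PP m t) (xv i)"
  proof -
    have s: "q powi (t + int i) * q powi (1 - t - int m + int i) = q powi (2 * int i + 1 - int m)"
      unfolding qpowi_add [symmetric] by (rule arg_cong [of _ _ "\<lambda>x. q powi x"]) simp
    have N: "Suc (i + (n - m) - 1) = i + (n - m)" using m by simp
    have d: "op (PP m t) Gd (xv (Suc i)) = (q * alpha q i m + 1 - q powi (2 * int i + 1 - int m)) \<cdot>\<^sub>f xv i
        + q ^ Suc i \<cdot>\<^sub>f pv (i + (n - m))"
      using m by (simp add: op_PP_x alpha_step)
    have w: "alpha q i m \<cdot>\<^sub>f (q powi (t + int i) \<cdot>\<^sub>f xv (i - 1))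
        = alpha q i m \<cdot>\<^sub>f ((q * q powi (t + int (i - 1))) \<cdot>\<^sub>f xv (i - 1))"
      "alpha q i m \<cdot>\<^sub>f (q powi (1 - t - int m + int i) \<cdot>\<^sub>f xv (i - 1))
        = alpha q i m \<cdot>\<^sub>f ((q * q powi (1 - t - int m + int (i - 1))) \<cdot>\<^sub>f xv (i - 1))"
      by (rule e1)+
    have b: "q * q powi (t + int m + int (i + (n - m) - 1)) = q powi (t + int i)"
      "q * q powi (1 - t + int (i + (n - m) - 1)) = q powi (1 - t - int m + int i)"
    proof -
      have "q * q powi (t + int m + int (i + (n - m) - 1)) = q powi (t + int m + int (i + (n - m)))"
        "q * q powi (1 - t + int (i + (n - m) - 1)) = q powi (1 - t + int (i + (n - m)))"
        using e [of "t + int m" "i + (n - m) - 1"] e [of "1 - t" "i + (n - m) - 1"] by (simp_all only: N)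
      moreover have "q powi (t + int m + int (i + (n - m))) = q powi (t + int i)"
        "q powi (1 - t + int (i + (n - m))) = q powi (1 - t - int m + int i)"
        using m by (auto intro!: qpowi_cong simp: of_nat_diff)
      ultimately show "q * q powi (t + int m + int (i + (n - m) - 1)) = q powi (t + int i)"
        "q * q powi (1 - t + int (i + (n - m) - 1)) = q powi (1 - t - int m + int i)" by simp_all
    qed
    have db: "op (PP m t) Gd (op (PP m t) Gb (xv i)) = q \<cdot>\<^sub>f op (PP m t) Gb (op (PP m t) Gd (xv i))"
    proof -
      have "q \<cdot>\<^sub>f op (PP m t) Gb (op (PP m t) Gd (xv i)) =
        alpha q i m \<cdot>\<^sub>f ((q * q powi (t + int (i - 1))) \<cdot>\<^sub>f xv (i - 1))
         + (q ^ i * (q * q powi (t + int m + int (i + (n - m) - 1)))) \<cdot>\<^sub>f pv (i + (n - m) - 1)"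
        by (simp add: op_PP_x op_PP_p sc_add mult_ac)
      also have "\<dots> = q powi (t + int i) \<cdot>\<^sub>f op (PP m t) Gd (xv i)"
        unfolding w(1) [symmetric] b by (simp add: op_PP_x sc_add mult_ac)
      finally show ?thesis by (simp add: op_PP_x(2))
    qed
    have dc: "op (PP m t) Gd (op (PP m t) Gc (xv i)) = q \<cdot>\<^sub>f op (PP m t) Gc (op (PP m t) Gd (xv i))"
    proof -
      have "q \<cdot>\<^sub>f op (PP m t) Gc (op (PP m t) Gd (xv i)) =
        alpha q i m \<cdot>\<^sub>f ((q * q powi (1 - t - int m + int (i - 1))) \<cdot>\<^sub>f xv (i - 1))
         + (q ^ i * (q * q powi (1 - t + int (i + (n - m) - 1)))) \<cdot>\<^sub>f pv (i + (n - m) - 1)"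
        by (simp add: op_PP_x op_PP_p sc_add mult_ac)
      also have "\<dots> = q powi (1 - t - int m + int i) \<cdot>\<^sub>f op (PP m t) Gd (xv i)"
        unfolding w(2) [symmetric] b by (simp add: op_PP_x sc_add mult_ac)
      finally show ?thesis by (simp add: op_PP_x(3))
    qed
    have ad: "op (PP m t) Ga (op (PP m t) Gd (xv i)) = alpha q i m \<cdot>\<^sub>f xv i + q ^ i \<cdot>\<^sub>f pv (i + (n - m))"
      unfolding op_PP_x(4) linD [OF lin_mapp] op_PP_x(1) op_PP_p(1) N by (cases i) simp_all
    have bc: "op (PP m t) Gb (op (PP m t) Gc (xv i)) = q powi (2 * int i + 1 - int m) \<cdot>\<^sub>f xv i"
      using s by (simp only: op_PP_x(2,3) linD [OF lin_mapp] sc_sc mult.commute)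
    have E: "op (PP m t) Gb (xv (Suc i)) = (q * q powi (t + int i)) \<cdot>\<^sub>f xv (Suc i)"
      "op (PP m t) Gc (xv (Suc i)) = (q * q powi (1 - t - int m + int i)) \<cdot>\<^sub>f xv (Suc i)"
      by (simp_all only: op_PP_x(2,3) e)
    show ?thesis
      unfolding hrel0_def d ad bc op_PP_x(1)
    proof (intro conjI)
      show "op (PP m t) Gb (xv (Suc i)) = q \<cdot>\<^sub>f op (PP m t) Ga (op (PP m t) Gb (xv i))"
        unfolding E by (simp only: op_PP_x(1,2) linD [OF lin_mapp] sc_sc)
      show "op (PP m t) Gc (xv (Suc i)) = q \<cdot>\<^sub>f op (PP m t) Ga (op (PP m t) Gc (xv i))"
        unfolding E by (simp only: op_PP_x(1,3) linD [OF lin_mapp] sc_sc)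
    qed (rule db dc | simp add: pointwise algebra_simps)+
  qed
qed

lemma hact_PP: "hact n q (op (PP m t) Ga) (op (PP m t) Gb) (op (PP m t) Gc) (op (PP m t) Gd)"
  by (rule hactI [OF qroot_axioms wfm_PP]) (use uv_cases hrel0_PP in \<open>metis hdim_PP\<close>)

lemma d_pv_0: "op (PP m t) Gd (pv 0) = 0" by (simp add: op_PP_p)
lemma d_xv_0: "op (PP m t) Gd (xv 0) = pv (n - m - 1)" by (simp add: op_PP_x)

lemma is_hmod_PP: "is_hmod n q (PP m t)"
proof (rule is_hmodI_gen [OF qroot_axioms wfm_PP])
  interpret hact n q "op (PP m t) Ga" "op (PP m t) Gb" "op (PP m t) Gc" "op (PP m t) Gd" by (rule hact_PP)
  fix j assume "j < hdim (PP m t)"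
  then have j: "(j < n \<and> uv j = xv j) \<or> (n \<le> j \<and> j - n < n \<and> uv j = pv (j - n))" using uv_cases by simp
  show "hrel0 q (PP m t) (uv j)" using j hrel0_PP by metis
  show "\<exists>x y. op (PP m t) Gb (uv j) = q powi x \<cdot>\<^sub>f uv j \<and> op (PP m t) Gc (uv j) = q powi y \<cdot>\<^sub>f uv j"
    using j op_PP_x(2,3) op_PP_p(2,3) by metis
  have wp: "wti (t + int m) (1 - t) (pv 0)" by (simp add: wti_def wt_def op_PP_p)
  have dp: "(op (PP m t) Gd ^^ n) (pv 0) = 0"
    using dpow_apow_hw [OF wp d_pv_0, of 0 n] n2 by simp
  have dx: "(op (PP m t) Gd ^^ n) (xv 0) = 0"
  proof -
    have "(op (PP m t) Gd ^^ n) (xv 0) = (op (PP m t) Gd ^^ (n - 1)) (op (PP m t) Gd (xv 0))"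
      using n2 by (cases n) (simp_all add: funpow_swap1)
    also have "op (PP m t) Gd (xv 0) = (op (PP m t) Ga ^^ (n - m - 1)) (pv 0)" by (simp add: d_xv_0 apow_PP)
    finally show ?thesis using dpow_apow_hw [OF wp d_pv_0, of "n - m - 1" "n - 1"] m by simp
  qed
  have an: "(op (PP m t) Ga ^^ n) (xv 0) = 0" "(op (PP m t) Ga ^^ n) (pv 0) = 0" by (simp_all add: apow_PP)
  have gx: "uv j = (op (PP m t) Ga ^^ j) (xv 0)" if "uv j = xv j" using that by (simp add: apow_PP)
  have gp: "uv j = (op (PP m t) Ga ^^ (j - n)) (pv 0)" if "uv j = pv (j - n)" using that by (simp add: apow_PP)
  show "\<exists>v k x y. uv j = (op (PP m t) Ga ^^ k) v \<and> (op (PP m t) Ga ^^ n) v = 0 \<and> (op (PP m t) Gd ^^ n) v = 0 \<and>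
      op (PP m t) Gb v = q powi x \<cdot>\<^sub>f v \<and> op (PP m t) Gc v = q powi y \<cdot>\<^sub>f v"
    using j gx gp an dp dx op_PP_x(2,3) [of 0] op_PP_p(2,3) [of 0] by metis
qed

text \<open>The model is presented by x and p with these relations: the images of the basis vectors
  are forced, and that d acts correctly on them is \<open>d_apow_hw\<close>, once for x and once for
  p.\<close>

lemma PP_hom:
  assumes W: "hact n q (op W Ga) (op W Gb) (op W Gc) (op W Gd)" "wfm W"
    and s: "supp (hdim W) x" "supp (hdim W) p"
    and wx: "hact.wti q (op W Gb) (op W Gc) t (1 - t - int m) x" and wp: "hact.wti q (op W Gb) (op W Gc) (t + int m) (1 - t) p"
    and d: "op W Gd p = 0" "op W Gd x = (op W Ga ^^ (n - m - 1)) p"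
    and a: "(op W Ga ^^ n) x = 0" "(op W Ga ^^ n) p = 0"
  shows "\<exists>F. hm (PP m t) W F \<and> (\<forall>i. F (xv i) = (op W Ga ^^ i) x) \<and> (\<forall>i. F (pv i) = (op W Ga ^^ i) p)"
proof -
  interpret hact n q "op W Ga" "op W Gb" "op W Gc" "op W Gd" by (rule W)
  define F where "F = lcomb (2 * n) (\<lambda>j. if j < n then (op W Ga ^^ j) x else (op W Ga ^^ (j - n)) p)"
  have lF: "lin F" by (simp add: F_def lin_lcomb)
  have z: "(op W Ga ^^ i) x = 0" "(op W Ga ^^ i) p = 0" if "n \<le> i" for i
  proof -
    have "(op W Ga ^^ i) v = (op W Ga ^^ (i - n)) ((op W Ga ^^ n) v)" for v
      using that by (simp only: o_apply [symmetric, of "op W Ga ^^ _" "op W Ga ^^ _"] funpow_add [symmetric]) simp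
    then show "(op W Ga ^^ i) x = 0" "(op W Ga ^^ i) p = 0" by (simp_all add: a)
  qed
  have Fx: "F (xv i) = (op W Ga ^^ i) x" for i
    using z(1) [of i] by (cases "i < n") (auto simp: xv_def F_def)
  have Fp: "F (pv i) = (op W Ga ^^ i) p" for i
    using z(2) [of i] by (cases "i < n") (auto simp: pv_def F_def)
  have sa: "supp (hdim W) ((op W Ga ^^ i) v)" if "supp (hdim W) v" for i v
    using that W(2) by (cases i) auto
  have wxi: "op W Gb ((op W Ga ^^ i) x) = q powi (t + int i) \<cdot>\<^sub>f (op W Ga ^^ i) x"
    "op W Gc ((op W Ga ^^ i) x) = q powi (1 - t - int m + int i) \<cdot>\<^sub>f (op W Ga ^^ i) x" for i
    using wtiD [OF wti_apow [OF wx, of i]] by auto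
  have wpi: "op W Gb ((op W Ga ^^ i) p) = q powi (t + int m + int i) \<cdot>\<^sub>f (op W Ga ^^ i) p"
    "op W Gc ((op W Ga ^^ i) p) = q powi (1 - t + int i) \<cdot>\<^sub>f (op W Ga ^^ i) p" for i
    using wtiD [OF wti_apow [OF wp, of i]] by auto
  have dxi: "op W Gd ((op W Ga ^^ i) x) = alpha q i m \<cdot>\<^sub>f (op W Ga ^^ (i - 1)) x + q ^ i \<cdot>\<^sub>f (op W Ga ^^ (i + (n - m) - 1)) p" for i
  proof -
    have "i + (n - m) - 1 = i + (n - m - 1)" using m by simp
    then have e: "(op W Ga ^^ (i + (n - m) - 1)) p = (op W Ga ^^ i) ((op W Ga ^^ (n - m - 1)) p)"
      by (simp only: funpow_add o_apply)
    have "int n dvd (t + (1 - t - int m) - 1 + int m)" by simp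
    from d_apow_hw [OF wx this, of i] show ?thesis unfolding d e by (simp add: add.commute)
  qed
  have dpi: "op W Gd ((op W Ga ^^ i) p) = alpha q i (n - m) \<cdot>\<^sub>f (op W Ga ^^ (i - 1)) p" for i
  proof -
    have "int n dvd (t + int m + (1 - t) - 1 + int (n - m))" using m by (simp add: of_nat_diff)
    from d_apow_hw [OF wp this, of i] show ?thesis by (simp add: d)
  qed
  have hx: "F (op (PP m t) y (xv i)) = op W y (F (xv i))" for y i
    unfolding Fx by (cases y) (simp_all add: op_PP_x linD [OF lF] Fx Fp wxi dxi)
  have hp: "F (op (PP m t) y (pv i)) = op W y (F (pv i))" for y i
    unfolding Fp by (cases y) (simp_all add: op_PP_p linD [OF lF] Fp wpi dpi)
  have "hm (PP m t) W F"
  proof (rule hmI_uv [OF wfm_PP W(2) lF])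
    fix j assume "j < hdim (PP m t)"
    then have j: "(j < n \<and> uv j = xv j) \<or> (n \<le> j \<and> j - n < n \<and> uv j = pv (j - n))" using uv_cases by simp
    show "supp (hdim W) (F (uv j))" using j Fx Fp sa s by metis
    show "F (op (PP m t) y (uv j)) = op W y (F (uv j))" for y using j hx hp by metis
  qed
  then show ?thesis using Fx Fp by blast
qed

text \<open>Modulo n each weight occurs once among the x_i and once among the p_i, there with index
  i - m; the case split brings this index into the range below n.\<close>

lemma weight_PP:
  assumes v: "supp (2 * n) v" and b: "op (PP m t) Gb v = \<beta> \<cdot>\<^sub>f v" and v0: "v \<noteq> 0"
  shows "\<exists>i c c'. i < n \<and> \<beta> = q powi (t + int i) \<and>
    v = c \<cdot>\<^sub>f xv i + c' \<cdot>\<^sub>f pv (if m \<le> i then i - m else i + (n - m))"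
proof -
  define w where "w = (\<lambda>j. if j < n then t + int j else t + int m + int (j - n))"
  have l: "lin (\<lambda>v j. q powi (w j) * v j)" by (auto simp: lin_def pointwise algebra_simps)
  have "op (PP m t) Gb v = (\<lambda>j. q powi (w j) * v j)"
  proof (rule lin_eq_on_supp [OF lin_mapp l _ v])
    fix j assume "j < 2 * n"
    from uv_cases [OF this] show "op (PP m t) Gb (uv j) = (\<lambda>i. q powi (w i) * uv j i)"
      by (elim disjE conjE) (simp_all add: op_PP_x(2) op_PP_p(2), auto simp: fun_eq_iff sc_apply w_def xv_def pv_def uv_def)
  qed
  then have e: "q powi (w j) * v j = \<beta> * v j" for j using b by (metis sc_apply)
  obtain j where j: "v j \<noteq> 0" using v0 by (auto simp: fun_eq_iff zero_fun_apply)
  then have jn: "j < 2 * n" using v by (metis supp_def not_less)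
  have \<beta>: "\<beta> = q powi (w j)" using e [of j] j by simp
  define i where "i = nat ((w j - t) mod int n)"
  have n0: "0 < int n" using n2 by simp
  have ii: "int i = (w j - t) mod int n" using n0 by (simp add: i_def)
  have i: "i < n" using ii n0 by (metis of_nat_less_iff pos_mod_bound)
  have wi: "q powi (w j) = q powi (t + int i)"
  proof (rule qpowi_cong)
    have "w j - t - (w j - t) mod int n = (w j - t) div int n * int n" by (simp add: minus_mod_eq_div_mult)
    then show "int n dvd w j - (t + int i)" unfolding ii by (metis diff_diff_eq dvd_triv_right)
  qed
  let ?i' = "if m \<le> i then i - m else i + (n - m)"
  have i': "?i' < n" using i m by auto
  have only: "v k = 0" if "k \<noteq> i" "k \<noteq> n + ?i'" for k
  proof (rule ccontr)
    assume k: "v k \<noteq> 0"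
    then have kn: "k < 2 * n" using v by (metis supp_def not_less)
    have "q powi (w k) = q powi (t + int i)" using e [of k] k \<beta> wi by simp
    then have dv: "int n dvd w k - (t + int i)" by (simp only: qpowi_eq_iff)
    show False
    proof (cases "k < n")
      case True
      then have "int n dvd int k - int i" using dv by (simp add: w_def)
      then have "k = i" by (rule nat_eq_of_dvd [OF True i])
      then show False using that(1) by simp
    next
      case False
      define k' where "k' = k - n"
      have k': "k' < n" "k = n + k'" using False kn by (auto simp: k'_def)
      have "int n dvd int m + int k' - int i" using dv False by (simp add: w_def k'_def algebra_simps)
      then have "int n dvd int k' - int ?i'"
      proof (cases "m \<le> i")
        case True
        then show ?thesis using \<open>int n dvd int m + int k' - int i\<close> by (simp add: of_nat_diff algebra_simps)
      next
        case False
        have "int k' - int ?i' = (int m + int k' - int i) - int n" using False m by (simp add: of_nat_diff)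
        then show ?thesis using \<open>int n dvd int m + int k' - int i\<close> by (simp only: dvd_diff dvd_refl)
      qed
      then have "k' = ?i'" by (rule nat_eq_of_dvd [OF k'(1) i'])
      then show False using that(2) k'(2) by simp
    qed
  qed
  have "v = v i \<cdot>\<^sub>f xv i + v (n + ?i') \<cdot>\<^sub>f pv ?i'"
  proof
    fix k show "v k = (v i \<cdot>\<^sub>f xv i + v (n + ?i') \<cdot>\<^sub>f pv ?i') k"
      using only [of k] i i' by (auto simp: pointwise xv_def pv_def uv_def)
  qed
  then show ?thesis using i \<beta> wi by metis
qed

text \<open>On a weight space d has nonzero structure constants except at i = 0 and i = m. There the
  constants of both basis vectors vanish, and the glueing term q^i p_(i+n-m-1) forces the
  coefficient of x_i to be zero.\<close>

lemma hw_PP: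
  assumes v: "supp (2 * n) v" and b: "op (PP m t) Gb v = \<beta> \<cdot>\<^sub>f v" and v0: "v \<noteq> 0"
    and d: "op (PP m t) Gd v = 0"
  shows "(\<exists>c. v = c \<cdot>\<^sub>f pv 0 \<and> \<beta> = q powi (t + int m)) \<or> (\<exists>c. v = c \<cdot>\<^sub>f pv (n - m) \<and> \<beta> = q powi t)"
proof -
  obtain i c c' where i: "i < n" and \<beta>: "\<beta> = q powi (t + int i)"
    and ve: "v = c \<cdot>\<^sub>f xv i + c' \<cdot>\<^sub>f pv (if m \<le> i then i - m else i + (n - m))"
    using weight_PP [OF v b v0] by blast
  let ?i' = "if m \<le> i then i - m else i + (n - m)"
  have i': "?i' < n" using i m by auto
  have D: "c \<cdot>\<^sub>f (alpha q i m \<cdot>\<^sub>f xv (i - 1) + q ^ i \<cdot>\<^sub>f pv (i + (n - m) - 1)) + (c' * alpha q ?i' (n - m)) \<cdot>\<^sub>f pv (?i' - 1) = 0"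
    using d unfolding ve by (simp only: linD [OF lin_mapp] op_PP_x(4) op_PP_p(4) sc_sc)
  have X: "xv a k = (if k = a then 1 else 0)" if "a < n" for a k using that by (simp add: xv_def uv_def)
  have P: "pv a k = (if a < n \<and> k = n + a then 1 else 0)" for a k by (simp add: pv_def uv_def zero_fun_apply)
  consider "i = 0" | "i = m" | "0 < i" "i \<noteq> m" by blast
  then show ?thesis
  proof cases
    case 1
    have "c \<cdot>\<^sub>f pv (n - m - 1) = 0" using D 1 m by simp
    from fun_cong [OF this, of "n + (n - m - 1)"] have "c = 0" using m by (simp add: pointwise P)
    then have "v = c' \<cdot>\<^sub>f pv (n - m)" using ve 1 m by simp
    then show ?thesis using \<beta> 1 by auto
  next
    case 2
    have "m + (n - m) - 1 = n - 1" using m by simp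
    then have "c \<cdot>\<^sub>f (q ^ m \<cdot>\<^sub>f pv (n - 1)) = 0" using D 2 m by simp
    from fun_cong [OF this, of "n + (n - 1)"] have "c = 0" using m q0 by (simp add: pointwise P)
    then have "v = c' \<cdot>\<^sub>f pv 0" using ve 2 by simp
    then show ?thesis using \<beta> 2 by auto
  next
    case 3
    have A: "alpha q i m \<noteq> 0"
    proof (rule alpha_neq_0 [OF 3(1) i])
      show "\<not> int n dvd int i - int m"
      proof
        assume "int n dvd int i - int m"
        then have "i = m" by (rule nat_eq_of_dvd [OF i m(2)])
        then show False using 3 by simp
      qed
    qed
    have i0: "?i' \<noteq> 0" "?i' \<noteq> n - m" using 3 i m by (auto split: if_splits)
    have A': "alpha q ?i' (n - m) \<noteq> 0"
    proof (rule alpha_neq_0)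
      show "0 < ?i'" "?i' < n" using i0 i' by auto
      show "\<not> int n dvd int ?i' - int (n - m)"
      proof
        assume "int n dvd int ?i' - int (n - m)"
        then have "?i' = n - m" by (rule nat_eq_of_dvd [rotated 2]) (use i' m in auto)
        then show False using i0 by simp
      qed
    qed
    have "i - 1 < n" "i - 1 \<noteq> n + a" for a using i by auto
    then have "c * alpha q i m = 0"
      using fun_cong [OF D, of "i - 1"] X [of "i - 1" "i - 1"] by (simp only: pointwise) (simp add: P)
    then have c: "c = 0" using A by simp
    have "?i' - 1 < n" using i' by simp
    then have "c' * alpha q ?i' (n - m) = 0"
      using fun_cong [OF D, of "n + (?i' - 1)"] P [of "?i' - 1" "n + (?i' - 1)"] by (simp only: c) (simp only: pointwise, simp)
    then have "c' = 0" using A' by simp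
    then show ?thesis using ve c v0 by simp
  qed
qed

end

end

lemma uv_neq_0: "uv j \<noteq> (0 :: nat \<Rightarrow> 'k::field)"
proof
  assume "uv j = (0 :: nat \<Rightarrow> 'k)"
  from fun_cong [OF this, of j] show False by (simp add: uv_def zero_fun_apply)
qed

context hact
begin

text \<open>The vector x' is a combination of the a^j d^j x with j \<le> k in which x has
  coefficient C; the clause about \<pi> says this without naming the other coefficients. In each
  step d a^(k+1) d^(k+1) x consists of the wanted term and a multiple s of the previous right-hand
  side, which is subtracted. The hypothesis \<open>nz\<close> makes s, and with it C,
  nonzero.\<close>

lemma ex_a_dpow:
  assumes w: "wti X Y x" and nz: "\<forall>j. 1 \<le> j \<and> j \<le> k \<longrightarrow> qint q j * (1 - q powi (X + Y - int j - 1)) \<noteq> 0"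
  shows "\<exists>x' C. wti X Y x' \<and> d x' = (a ^^ k) ((d ^^ Suc k) x) \<and> C \<noteq> 0 \<and>
    (\<forall>\<pi>. lin \<pi> \<and> (\<forall>j>0. \<pi> ((a ^^ j) ((d ^^ j) x)) = 0) \<longrightarrow> \<pi> x' = C \<cdot>\<^sub>f \<pi> x) \<and>
    (\<forall>N. (\<forall>j. supp N ((a ^^ j) ((d ^^ j) x))) \<longrightarrow> supp N x')"
  using nz
proof (induction k)
  case 0
  have "supp N x" if "\<forall>j. supp N ((a ^^ j) ((d ^^ j) x))" for N using that [rule_format, of 0] by simp
  then show ?case using w by (intro exI [of _ x] exI [of _ 1]) auto
next
  case (Suc k)
  have nzk: "\<forall>j. 1 \<le> j \<and> j \<le> k \<longrightarrow> qint q j * (1 - q powi (X + Y - int j - 1)) \<noteq> 0"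
    using Suc.prems by simp
  obtain z C where z: "wti X Y z" "d z = (a ^^ k) ((d ^^ Suc k) x)" "C \<noteq> 0"
    and z\<pi>: "\<And>\<pi>. lin \<pi> \<Longrightarrow> (\<forall>j>0. \<pi> ((a ^^ j) ((d ^^ j) x)) = 0) \<Longrightarrow> \<pi> z = C \<cdot>\<^sub>f \<pi> x"
    and zs: "\<And>N. (\<forall>j. supp N ((a ^^ j) ((d ^^ j) x))) \<Longrightarrow> supp N z"
    using Suc.IH [OF nzk] by auto
  define u where "u = (a ^^ Suc k) ((d ^^ Suc k) x)"
  define s where "s = qint q (Suc k) * (1 - q powi (X + Y - int (Suc k) - 1))"
  have s0: "s \<noteq> 0" unfolding s_def by (rule Suc.prems [rule_format]) auto
  have wd: "wti (X - int (Suc k)) (Y - int (Suc k)) ((d ^^ Suc k) x)" by (rule wti_dpow [OF w])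
  have wu: "wti X Y u" unfolding u_def by (rule wti_cong [OF wti_apow [OF wd]]) simp_all
  have "X - int (Suc k) + (Y - int (Suc k)) + int (Suc k) - 1 = X + Y - int (Suc k) - 1" by simp
  with d_apow_wti [OF wd, of "Suc k"] have du: "d u = q ^ Suc k \<cdot>\<^sub>f (a ^^ Suc k) ((d ^^ Suc (Suc k)) x) + s \<cdot>\<^sub>f (a ^^ k) ((d ^^ Suc k) x)"
    by (simp only: u_def s_def diff_Suc_1 funpow.simps o_apply)
  define x' where "x' = inverse (q ^ Suc k) \<cdot>\<^sub>f (u - s \<cdot>\<^sub>f z)"
  have qi: "inverse (q ^ Suc k) * q ^ Suc k = 1" by (rule left_inverse) simp
  have "d (u - s \<cdot>\<^sub>f z) = q ^ Suc k \<cdot>\<^sub>f (a ^^ Suc k) ((d ^^ Suc (Suc k)) x)"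
    unfolding lins du z(2) by (simp add: pointwise)
  then have dx: "d x' = (a ^^ Suc k) ((d ^^ Suc (Suc k)) x)" unfolding x'_def by (simp only: lins sc_sc qi) simp
  have "wti X Y x'" unfolding x'_def by (intro wti_sc wti_diff wu z(1))
  moreover have "\<pi> x' = (- (inverse (q ^ Suc k) * (s * C))) \<cdot>\<^sub>f \<pi> x"
    if \<pi>: "lin \<pi>" "\<forall>j>0. \<pi> ((a ^^ j) ((d ^^ j) x)) = 0" for \<pi>
  proof -
    have "\<pi> u = 0" unfolding u_def using \<pi>(2) by blast
    then show ?thesis unfolding x'_def by (simp only: linD [OF \<pi>(1)] lin_diff [OF \<pi>(1)] z\<pi> [OF \<pi>] sc_sc)
      (simp add: pointwise algebra_simps)
  qed
  moreover have "supp N x'" if "\<forall>j. supp N ((a ^^ j) ((d ^^ j) x))" for N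
    using zs [OF that] that [rule_format, of "Suc k"] by (simp only: x'_def u_def supp_sc supp_diff)
  ultimately show ?case using dx s0 z(3)
    by (intro exI [of _ x'] exI [of _ "- (inverse (q ^ Suc k) * (s * C))"]) auto
qed

end

section \<open>Weight vectors by averaging, and the identification of projective covers\<close>

context qroot
begin

text \<open>For f^n = 1 and \<mu>^n = 1 this is n times the projection onto the eigenspace of
  \<mu>.\<close>

definition eproj :: "((nat \<Rightarrow> 'k) \<Rightarrow> nat \<Rightarrow> 'k) \<Rightarrow> 'k \<Rightarrow> (nat \<Rightarrow> 'k) \<Rightarrow> nat \<Rightarrow> 'k" where
  "eproj f \<mu> v = (\<Sum>j<n. inverse \<mu> ^ j \<cdot>\<^sub>f (f ^^ j) v)"

lemma eproj_eigen:
  assumes "lin f" "(f ^^ n) v = v" "\<mu> ^ n = 1"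
  shows "f (eproj f \<mu> v) = \<mu> \<cdot>\<^sub>f eproj f \<mu> v"
proof -
  have \<mu>: "\<mu> \<noteq> 0" using assms(3) n2 by (metis power_0_left not_gr_zero not_less_zero zero_neq_one)
  have m: "lin (\<lambda>v. \<mu> \<cdot>\<^sub>f v)" by (auto simp: lin_def pointwise algebra_simps)
  define G where "G = (\<lambda>j. inverse \<mu> ^ j \<cdot>\<^sub>f (f ^^ j) v)"
  have "f (eproj f \<mu> v) = (\<Sum>j<n. f (G j))" unfolding eproj_def G_def by (rule lin_sum [OF assms(1)])
  also have "\<dots> = (\<Sum>j<n. \<mu> \<cdot>\<^sub>f G (Suc j))"
    by (rule sum.cong) (simp_all add: G_def linD [OF assms(1)] \<mu> flip: mult.assoc)
  also have "\<dots> = \<mu> \<cdot>\<^sub>f (\<Sum>j<n. G (Suc j))" by (rule lin_sum [OF m, symmetric])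
  also have "(\<Sum>j<n. G (Suc j)) = (\<Sum>j<n. G j)"
  proof -
    have "(\<Sum>j<n. G (Suc j)) + G 0 = (\<Sum>j<n. G j) + G n"
      using sum.lessThan_Suc_shift [of G n] sum.lessThan_Suc [of G n] by (simp add: add.commute)
    moreover have "G n = G 0" using assms by (simp add: G_def power_inverse)
    ultimately show ?thesis by simp
  qed
  finally show ?thesis by (simp add: eproj_def G_def)
qed

lemma eproj_hm:
  assumes F: "lin F" and c: "\<And>j. F ((f ^^ j) v) = (g ^^ j) (F v)" and e: "g (F v) = \<mu> \<cdot>\<^sub>f F v" "\<mu> \<noteq> 0" and g: "lin g"
  shows "F (eproj f \<mu> v) = of_nat n \<cdot>\<^sub>f F v"
proof -
  have "(g ^^ j) (F v) = \<mu> ^ j \<cdot>\<^sub>f F v" for j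
    by (induction j) (simp_all add: linD [OF g] e mult.commute)
  then have "F (inverse \<mu> ^ j \<cdot>\<^sub>f (f ^^ j) v) = F v" for j
    using e(2) by (simp add: linD [OF F] c flip: power_mult_distrib)
  then have "F (eproj f \<mu> v) = (\<Sum>j<n. F v)" by (simp only: eproj_def lin_sum [OF F])
  also have "\<dots> = of_nat n \<cdot>\<^sub>f F v" by (simp add: fun_eq_iff sc_apply sum_fun_apply)
  finally show ?thesis .
qed

lemma op_funpow_supp: "wfm M \<Longrightarrow> supp (hdim M) v \<Longrightarrow> supp (hdim M) ((op M x ^^ k) v)"
  by (cases k) auto

lemma eproj_supp: "wfm M \<Longrightarrow> supp (hdim M) v \<Longrightarrow> supp (hdim M) (eproj (op M x) \<mu> v)"
  unfolding eproj_def by (intro supp_sum supp_sc op_funpow_supp)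

lemma V_hom:
  assumes W: "hact n q (op W Ga) (op W Gb) (op W Gc) (op W Gd)" "wfm W" and l: "l \<le> n"
    and s: "supp (hdim W) x" and wx: "hact.wti q (op W Gb) (op W Gc) t (1 - t - int l) x"
    and d: "op W Gd x = 0" and a: "(op W Ga ^^ l) x = 0"
  shows "\<exists>F. hm (V_mod q l t) W F \<and> (\<forall>i. F (vv l i) = (op W Ga ^^ i) x)"
proof -
  interpret hact n q "op W Ga" "op W Gb" "op W Gc" "op W Gd" by (rule W)
  define F where "F = lcomb l (\<lambda>j. (op W Ga ^^ j) x)"
  have lF: "lin F" by (simp add: F_def lin_lcomb)
  have z: "(op W Ga ^^ i) x = 0" if "l \<le> i" for i
  proof -
    have "(op W Ga ^^ i) x = (op W Ga ^^ (i - l)) ((op W Ga ^^ l) x)"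
      using that by (simp only: o_apply [symmetric, of "op W Ga ^^ _" "op W Ga ^^ _"] funpow_add [symmetric]) simp
    then show ?thesis by (simp add: a)
  qed
  have Fx: "F (vv l i) = (op W Ga ^^ i) x" for i
    using z [of i] by (cases "i < l") (auto simp: vv_def F_def)
  have wxi: "op W Gb ((op W Ga ^^ i) x) = q powi (t + int i) \<cdot>\<^sub>f (op W Ga ^^ i) x"
    "op W Gc ((op W Ga ^^ i) x) = q powi (1 - t - int l + int i) \<cdot>\<^sub>f (op W Ga ^^ i) x" for i
    using wtiD [OF wti_apow [OF wx, of i]] by auto
  have dxi: "op W Gd ((op W Ga ^^ i) x) = alpha q i l \<cdot>\<^sub>f (op W Ga ^^ (i - 1)) x" for i
  proof -
    have "int n dvd (t + (1 - t - int l) - 1 + int l)" by simp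
    from d_apow_hw [OF wx this, of i] show ?thesis unfolding d by simp
  qed
  have ce: "int k + 1 - t - int l = 1 - t - int l + int k" for k by simp
  have hx: "F (op (V_mod q l t) y (vv l i)) = op W y (F (vv l i))" for y i
    unfolding Fx by (cases y) (simp_all only: op_V linD [OF lF] Fx wxi dxi ce funpow.simps o_apply)
  have "hm (V_mod q l t) W F"
    by (rule hmI_uv [OF wfm_V W(2) lF]) (simp_all add: uv_vv hx, simp add: Fx op_funpow_supp [OF W(2) s])
  then show ?thesis using Fx by blast
qed

lemma diagb_V: "diagb (V_mod q l t)"
  unfolding diagb_def by (intro exI [of _ "\<lambda>j. q powi (t + int j)"]) (simp add: uv_vv op_V)

lemma diagb_PP: "1 \<le> m \<Longrightarrow> m < n \<Longrightarrow> diagb (PP m t)"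
  unfolding diagb_def
proof (intro exI [of _ "\<lambda>j. if j < n then q powi (t + int j) else q powi (t + int m + int (j - n))"] allI impI)
  fix j assume m: "1 \<le> m" "m < n" and "j < hdim (PP m t)"
  then have "j < 2 * n" by simp
  from uv_cases [OF this] show "op (PP m t) Gb (uv j) = (if j < n then q powi (t + int j) else q powi (t + int m + int (j - n))) \<cdot>\<^sub>f uv j"
    using op_PP_x(2) [OF m] op_PP_p(2) [OF m] by auto
qed

lemma fsurj_iff: "wfm A \<Longrightarrow> wfm B \<Longrightarrow> p \<in> homs A B \<Longrightarrow> mat_surjective p \<longleftrightarrow> fsurj A B (mapp p)"
  by (auto simp: mat_surjective_iff fsurj_def dest!: homs_carrier)

lemma projective_lift:
  assumes "is_projective n q P" "is_hmod n q X" "is_hmod n q Y" "hm X Y G" "fsurj X Y G" "hm P Y H"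
  shows "\<exists>H'. hm P X H' \<and> (\<forall>v. supp (hdim P) v \<longrightarrow> G (H' v) = H v)"
proof -
  have P: "is_hmod n q P" using assms(1) by (simp add: is_projective_def)
  note w = is_hmod_wfm [OF P] is_hmod_wfm [OF assms(2)] is_hmod_wfm [OF assms(3)]
  let ?g = "fmat (hdim Y) (hdim X) G" and ?h = "fmat (hdim Y) (hdim P) H"
  note g = hm_fmat [OF w(2,3) assms(4)] and h = hm_fmat [OF w(1,3) assms(6)]
  have "mat_surjective ?g" unfolding fsurj_iff [OF w(2,3) g(1)] using assms(5) g(2) by (simp add: fsurj_def) metis
  then obtain h' where h': "h' \<in> homs P X" "?g * h' = ?h"
    using assms(1-3) g(1) h(1) unfolding is_projective_def by blast
  have "hm P X (mapp h')" by (rule hm_homs [OF w(1,2) h'(1)])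
  moreover have "G (mapp h' v) = H v" if v: "supp (hdim P) v" for v
  proof -
    have "supp (hdim X) (mapp h' v)" by (rule hmD(2) [OF calculation v])
    then have "G (mapp h' v) = mapp ?g (mapp h' v)" using g(2) by simp
    also have "\<dots> = mapp ?h v" using mapp_mult_carrier [OF homs_carrier [OF g(1)] homs_carrier [OF h'(1)]] h'(2) by metis
    also have "\<dots> = H v" by (rule h(2) [OF v])
    finally show ?thesis .
  qed
  ultimately show ?thesis by blast
qed

lemma cover_essential:
  assumes "is_projective_cover n q P M p" "is_hmod n q X" "hm X P H" "fsurj X M (\<lambda>v. mapp p (H v))"
  shows "fsurj X P H"
proof -
  have P: "is_hmod n q P" "is_hmod n q M" "p \<in> homs P M"
    using assms(1) by (auto simp: is_projective_cover_def is_projective_def)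
  note w = is_hmod_wfm [OF P(1)] is_hmod_wfm [OF P(2)] is_hmod_wfm [OF assms(2)]
  let ?h = "fmat (hdim P) (hdim X) H"
  note h = hm_fmat [OF w(3,1) assms(3)]
  have ph: "mapp (p * ?h) v = mapp p (H v)" if "supp (hdim X) v" for v
    using mapp_mult_carrier [OF homs_carrier [OF P(3)] homs_carrier [OF h(1)], of v] h(2) [OF that] by simp
  have "p * ?h \<in> carrier_mat (hdim M) (hdim X)" using homs_carrier [OF P(3)] homs_carrier [OF h(1)] by (rule mult_carrier_mat)
  then have "mat_surjective (p * ?h)"
    unfolding mat_surjective_iff using assms(4) ph unfolding fsurj_def by (metis carrier_matD)
  then have "mat_surjective ?h" using assms(1,2) h(1) unfolding is_projective_cover_def by blast
  then show ?thesis unfolding fsurj_iff [OF w(3,1) h(1)] unfolding fsurj_def using h(2) by metis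
qed

text \<open>Two maps are compared: \<psi> from the model to P is onto because the cover is
  essential, and \<phi> from P to the model exists because P is projective. Their composite on the
  model is injective by \<open>hw_inj\<close>, hence so is \<psi>.\<close>

theorem cover_PP:
  assumes m: "1 \<le> m" "m < n" and cov: "is_projective_cover n q P (V_mod q m t) p0"
  shows "is_hmod n q P \<and> fiso P (PP m t)"
proof -
  let ?V = "V_mod q m t"
  have P: "is_projective n q P" "is_hmod n q P" "is_hmod n q ?V" "p0 \<in> homs P ?V" "mat_surjective p0"
    using cov by (auto simp: is_projective_cover_def is_projective_def)
  note wP = is_hmod_wfm [OF P(2)]
  define \<pi> where "\<pi> = mapp p0"
  have h\<pi>: "hm P ?V \<pi>" unfolding \<pi>_def by (rule hm_homs [OF wP wfm_V P(4)])
  have s\<pi>: "fsurj P ?V \<pi>" using P(5) fsurj_iff [OF wP wfm_V P(4)] by (simp add: \<pi>_def)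
  interpret P: hact n q "op P Ga" "op P Gb" "op P Gc" "op P Gd" by (rule is_hmod_hact [OF qroot_axioms P(2)])
  let ?a = "op P Ga" and ?b = "op P Gb" and ?c = "op P Gc" and ?d = "op P Gd"
  have l\<pi>: "lin \<pi>" by (rule hmD(1) [OF h\<pi>])
  note \<pi>p = hm_funpow [OF h\<pi> _ wP]
  have an: "(?a ^^ n) v = 0" "(?d ^^ n) v = 0" "(?b ^^ n) v = v" "(?c ^^ n) v = v" "?b (?c v) = ?c (?b v)"
    if "supp (hdim P) v" for v
    using is_hmodD [OF P(2) that] by (auto simp: hrel_def)
  obtain v0 where v0: "supp (hdim P) v0" "\<pi> v0 = vv m 0"
    using s\<pi> unfolding fsurj_def using supp_vv [of m 0] by (metis hdim_V)
  let ?\<beta> = "q powi t" and ?\<gamma> = "q powi (1 - t - int m)"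
  have pw: "(q powi z) ^ n = 1" for z by (rule qpowi_pow_n)
  \<comment> \<open>Averaging over b and then over c turns the lift of v_1 into a weight vector; its
    image is n^2 v_1, which is nonzero.\<close>
  define w0 where "w0 = eproj ?b ?\<beta> v0"
  define x0 where "x0 = eproj ?c ?\<gamma> w0"
  have sw: "supp (hdim P) w0" and sx0: "supp (hdim P) x0"
    unfolding w0_def x0_def by (intro eproj_supp wP v0)+
  have bw: "?b w0 = ?\<beta> \<cdot>\<^sub>f w0" unfolding w0_def by (rule eproj_eigen [OF lin_mapp an(3) [OF v0(1)] pw])
  have cx: "?c x0 = ?\<gamma> \<cdot>\<^sub>f x0" unfolding x0_def by (rule eproj_eigen [OF lin_mapp an(4) [OF sw] pw])
  have bx: "?b x0 = ?\<beta> \<cdot>\<^sub>f x0"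
  proof -
    have "?b ((?c ^^ j) w0) = ?\<beta> \<cdot>\<^sub>f (?c ^^ j) w0" for j
    proof (induction j)
      case (Suc j)
      have "?b (?c ((?c ^^ j) w0)) = ?c (?b ((?c ^^ j) w0))" by (rule an(5) [OF op_funpow_supp [OF wP sw]])
      then show ?case by (simp add: Suc)
    qed (simp add: bw)
    moreover have "lin (\<lambda>v. ?\<beta> \<cdot>\<^sub>f v)" by (auto simp: lin_def pointwise algebra_simps)
    ultimately show ?thesis
      by (simp only: x0_def eproj_def lin_sum [OF P.lin(2)] lin_sum [OF \<open>lin (\<lambda>v. ?\<beta> \<cdot>\<^sub>f v)\<close>] P.lins sc_sc mult.commute)
  qed
  have wx0: "P.wti t (1 - t - int m) x0" using bx cx by (simp add: P.wti_def P.wt_def)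
  have \<pi>w: "\<pi> w0 = of_nat n \<cdot>\<^sub>f vv m 0" unfolding w0_def v0(2) [symmetric]
    by (rule eproj_hm [OF l\<pi> \<pi>p [OF v0(1)] _ _ lin_mapp]) (simp_all add: v0 op_V)
  have \<pi>x0: "\<pi> x0 = (of_nat n * of_nat n) \<cdot>\<^sub>f vv m 0"
  proof -
    have "\<pi> x0 = of_nat n \<cdot>\<^sub>f \<pi> w0" unfolding x0_def
    proof (rule eproj_hm [OF l\<pi> \<pi>p [OF sw] _ _ lin_mapp])
      have e: "int 0 + 1 - t - int m = 1 - t - int m" by simp
      show "op ?V Gc (\<pi> w0) = ?\<gamma> \<cdot>\<^sub>f \<pi> w0"
        unfolding \<pi>w linD [OF lin_mapp] op_V e sc_sc by (simp only: mult.commute)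
    qed simp
    then show ?thesis by (simp add: \<pi>w)
  qed
  \<comment> \<open>Going through a^(m-1) and back by d^(m-1) gives d^(n-m+1) x1 = d^n a^(m-1) x0 =
    0, so d^(n-m) x1 is killed by d; the image in V(m,t) changes only by the nonzero factor
    \<xi>.\<close>
  define x1 where "x1 = (?d ^^ (m - 1)) ((?a ^^ (m - 1)) x0)"
  have sx1: "supp (hdim P) x1" unfolding x1_def by (intro op_funpow_supp wP sx0)
  have wx1: "P.wti t (1 - t - int m) x1" unfolding x1_def
    by (rule P.wti_cong [OF P.wti_dpow [OF P.wti_apow [OF wx0]]]) simp_all
  have "m - 1 < m" using m by simp
  from dpow_V [OF this, of t] obtain \<xi> where \<xi>: "\<xi> \<noteq> 0" "(op ?V Gd ^^ (m - 1)) (vv m (m - 1)) = \<xi> \<cdot>\<^sub>f vv m 0"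
    using m by auto
  have \<pi>x1: "\<pi> x1 = (of_nat n * of_nat n * \<xi>) \<cdot>\<^sub>f vv m 0"
    unfolding x1_def by (simp add: \<pi>p op_funpow_supp wP sx0 \<pi>x0 apow_V \<xi>(2) [simplified] linD [OF lin_funpow [OF lin_mapp]])
  \<comment> \<open>The second factor could vanish only if n divided m + j, but 0 < m + j <
    n.\<close>
  have nz: "qint q j * (1 - q powi (t + (1 - t - int m) - int j - 1)) \<noteq> 0" if "1 \<le> j" "j \<le> n - m - 1" for j
  proof -
    have j: "0 < j" "j < n" using that m by auto
    have "q powi (t + (1 - t - int m) - int j - 1) \<noteq> 1"
    proof
      assume "q powi (t + (1 - t - int m) - int j - 1) = 1"
      then have "int n dvd - int (m + j)" unfolding qpowi_eq_1_iff by (simp add: algebra_simps)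
      then have "n dvd m + j" by (simp only: dvd_minus_iff int_dvd_int_iff)
      then show False using that m by (auto dest: dvd_imp_le)
    qed
    then show ?thesis using qint_neq_0 [OF j] by simp
  qed
  have "\<forall>j. 1 \<le> j \<and> j \<le> n - m - 1 \<longrightarrow> qint q j * (1 - q powi (t + (1 - t - int m) - int j - 1)) \<noteq> 0"
    using nz by blast
  note Z = P.ex_a_dpow [OF wx1 this]
  obtain x C where x: "P.wti t (1 - t - int m) x" "?d x = (?a ^^ (n - m - 1)) ((?d ^^ Suc (n - m - 1)) x1)" "C \<noteq> 0"
    "\<forall>\<pi>. lin \<pi> \<and> (\<forall>j>0. \<pi> ((?a ^^ j) ((?d ^^ j) x1)) = 0) \<longrightarrow> \<pi> x = C \<cdot>\<^sub>f \<pi> x1"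
    "\<forall>N. (\<forall>j. supp N ((?a ^^ j) ((?d ^^ j) x1))) \<longrightarrow> supp N x"
    using Z by (elim exE conjE) (rule that)
  define p where "p = (?d ^^ (n - m)) x1"
  have sp: "supp (hdim P) p" unfolding p_def by (intro op_funpow_supp wP sx1)
  have sx: "supp (hdim P) x" by (rule x(5) [rule_format]) (intro op_funpow_supp wP sx1)
  have dx: "?d x = (?a ^^ (n - m - 1)) p" using x(2) m by (simp add: p_def Suc_diff_Suc del: funpow.simps)
  have dp: "?d p = 0"
  proof -
    have "?d p = (?d ^^ (Suc (n - m) + (m - 1))) ((?a ^^ (m - 1)) x0)"
      by (simp only: p_def x1_def funpow_add o_apply funpow.simps)
    also have "Suc (n - m) + (m - 1) = n" using m by simp
    also have "(?d ^^ n) ((?a ^^ (m - 1)) x0) = 0" by (rule an(2)) (intro op_funpow_supp wP sx0)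
    finally show ?thesis .
  qed
  have wp: "P.wti (t + int m) (1 - t) p" unfolding p_def
    by (rule P.wti_cong [OF P.wti_dpow [OF wx1]]) (use m in \<open>simp_all add: of_nat_diff\<close>)
  define \<kappa> where "\<kappa> = C * (of_nat n * of_nat n * \<xi>)"
  have \<kappa>: "\<kappa> \<noteq> 0" using x(3) \<xi>(1) of_nat_n_neq_0 by (simp add: \<kappa>_def)
  have \<pi>x: "\<pi> x = \<kappa> \<cdot>\<^sub>f vv m 0"
  proof -
    have "\<pi> ((?a ^^ j) ((?d ^^ j) x1)) = 0" if j: "j > 0" for j
    proof -
      obtain i where i: "j = Suc i" using gr0_implies_Suc [OF j] by blast
      have "(op ?V Gd ^^ j) (\<pi> x1) = 0"
        unfolding \<pi>x1 i funpow_Suc_right o_apply linD [OF lin_mapp] op_V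
        by (simp add: lin_0 [OF lin_funpow [OF lin_mapp]])
      then show ?thesis by (simp add: \<pi>p op_funpow_supp wP sx1 lin_0 [OF lin_funpow [OF lin_mapp]])
    qed
    then have "\<pi> x = C \<cdot>\<^sub>f \<pi> x1" using x(4) l\<pi> by blast
    then show ?thesis by (simp add: \<pi>x1 \<kappa>_def)
  qed
  obtain \<psi> where \<psi>: "hm (PP m t) P \<psi>" "\<And>i. \<psi> (xv i) = (?a ^^ i) x" "\<And>i. \<psi> (pv i) = (?a ^^ i) p"
    using PP_hom [OF m P.hact_axioms wP sx sp x(1) wp dp dx an(1) [OF sx] an(1) [OF sp]] by blast
  note l\<psi> = hmD(1) [OF \<psi>(1)]
  have \<pi>\<psi>x: "\<pi> (\<psi> (xv i)) = \<kappa> \<cdot>\<^sub>f vv m i" for i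
    by (simp add: \<psi>(2) \<pi>p sx \<pi>x linD [OF lin_funpow [OF lin_mapp]] apow_V)
  \<comment> \<open>The composite with \<pi> hits a nonzero multiple of every basis vector of
    V(m,t), so it is onto, and the essential property of the cover applies.\<close>
  have sur: "fsurj (PP m t) P \<psi>"
  proof (rule cover_essential [OF cov is_hmod_PP [OF m] \<psi>(1)])
    show "fsurj (PP m t) ?V (\<lambda>v. mapp p0 (\<psi> v))" unfolding fsurj_def
    proof (intro allI impI)
      fix w :: "nat \<Rightarrow> 'k" assume "supp (hdim ?V) w"
      then have w: "supp m w" by simp
      let ?u = "\<Sum>i<m. (w i / \<kappa>) \<cdot>\<^sub>f xv i"
      have "\<pi> (\<psi> ?u) = (\<Sum>i<m. w i \<cdot>\<^sub>f vv m i)"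
        unfolding lin_sum [OF l\<psi>] lin_sum [OF l\<pi>]
        by (rule sum.cong) (simp_all add: linD [OF l\<psi>] linD [OF l\<pi>] \<pi>\<psi>x \<kappa>)
      also have "\<dots> = (\<Sum>i<m. w i \<cdot>\<^sub>f uv i)" by (rule sum.cong) (simp_all add: uv_vv)
      also have "\<dots> = w" by (rule supp_expand [OF w, symmetric])
      finally have "mapp p0 (\<psi> ?u) = w" unfolding \<pi>_def .
      moreover have "supp (hdim (PP m t)) ?u" by (intro supp_sum supp_sc) simp
      ultimately show "\<exists>v. supp (hdim (PP m t)) v \<and> mapp p0 (\<psi> v) = w" by blast
    qed
  qed
  interpret V: hact n q "op ?V Ga" "op ?V Gb" "op ?V Gc" "op ?V Gd" by (rule is_hmod_hact [OF qroot_axioms P(3)])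
  have "V.wti t (1 - t - int m) (vv m 0)" by (simp add: V.wti_def V.wt_def op_V)
  moreover have "op ?V Gd (vv m 0) = (op ?V Ga ^^ (n - m - 1)) 0" by (simp add: op_V)
  moreover have "(op ?V Ga ^^ n) (vv m 0) = 0" using m by (simp add: apow_V)
  ultimately obtain pr where pr: "hm (PP m t) ?V pr" "\<And>i. pr (xv i) = (op ?V Ga ^^ i) (vv m 0)" "\<And>i. pr (pv i) = (op ?V Ga ^^ i) 0"
    using PP_hom [OF m V.hact_axioms wfm_V, of "vv m 0" 0 t] by auto
  have pr': "pr (xv i) = vv m i" "pr (pv i) = 0" for i by (simp_all add: pr(2,3) apow_V)
  note lpr = hmD(1) [OF pr(1)]
  have "fsurj (PP m t) ?V pr" unfolding fsurj_def
  proof (intro allI impI)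
    fix w :: "nat \<Rightarrow> 'k" assume "supp (hdim ?V) w"
    then have w: "supp m w" by simp
    let ?u = "\<Sum>i<m. w i \<cdot>\<^sub>f xv i"
    have "pr ?u = (\<Sum>i<m. w i \<cdot>\<^sub>f uv i)"
      unfolding lin_sum [OF lpr] by (rule sum.cong) (simp_all add: linD [OF lpr] pr' uv_vv)
    also have "\<dots> = w" by (rule supp_expand [OF w, symmetric])
    finally have "pr ?u = w" .
    moreover have "supp (hdim (PP m t)) ?u" by (intro supp_sum supp_sc) simp
    ultimately show "\<exists>v. supp (hdim (PP m t)) v \<and> pr v = w" by blast
  qed
  \<comment> \<open>The map pr sends x to v_1 and p to 0; projectivity of P lifts \<pi> along
    it.\<close>
  then obtain \<phi> where \<phi>: "hm P (PP m t) \<phi>" "\<And>v. supp (hdim P) v \<Longrightarrow> pr (\<phi> v) = \<pi> v"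
    using projective_lift [OF P(1) is_hmod_PP [OF m] P(3) pr(1) _ h\<pi>] by blast
  let ?Q = "PP m t"
  \<comment> \<open>By weight, \<theta> x = c x + c' p_(n-m), and applying pr shows that c is
    nonzero. The relation for d x and then a carry c over to p_(n-m-1) and p_(n-m); as p_(n-m) =
    a^(n-m) p_0, also \<theta> p_0 is nonzero.\<close>
  define \<theta> where "\<theta> = (\<lambda>v. \<phi> (\<psi> v))"
  have h\<theta>: "hm ?Q ?Q \<theta>" unfolding \<theta>_def by (rule hm_comp [OF \<psi>(1) \<phi>(1)])
  note l\<theta> = hmD(1) [OF h\<theta>]
  have sup: "supp (hdim ?Q) (xv i)" "supp (hdim ?Q) (pv i)" for i by simp_all
  have prt: "pr (\<theta> (xv 0)) = \<kappa> \<cdot>\<^sub>f vv m 0"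
    using \<phi>(2) [OF hmD(2) [OF \<psi>(1) sup(1)], of 0] \<pi>\<psi>x [of 0] by (simp add: \<theta>_def)
  have b\<theta>: "op ?Q Gb (\<theta> (xv 0)) = q powi t \<cdot>\<^sub>f \<theta> (xv 0)"
    using hmD(3) [OF h\<theta> sup(1), of Gb 0] by (simp add: op_PP_x [OF m] linD [OF l\<theta>])
  have v00: "vv m 0 \<noteq> 0" using m uv_neq_0 by (simp add: vv_def)
  have \<theta>0: "\<theta> (xv 0) \<noteq> 0" using prt v00 \<kappa> by (auto simp: lin_0 [OF lpr])
  have s\<theta>: "supp (2 * n) (\<theta> (xv 0))" using hmD(2) [OF h\<theta> sup(1), of 0] by simp
  obtain i c c' where i: "i < n" "q powi t = q powi (t + int i)"
    and e: "\<theta> (xv 0) = c \<cdot>\<^sub>f xv i + c' \<cdot>\<^sub>f pv (if m \<le> i then i - m else i + (n - m))"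
    using weight_PP [OF m s\<theta> b\<theta> \<theta>0] by blast
  have "int n dvd int i" using i(2) by (simp add: qpowi_eq_iff)
  then have "n dvd i" by simp
  then have i0: "i = 0" using i(1) by (cases "i = 0") (auto dest: dvd_imp_le)
  have e: "\<theta> (xv 0) = c \<cdot>\<^sub>f xv 0 + c' \<cdot>\<^sub>f pv (n - m)" using e i0 m by simp
  have c0: "c \<noteq> 0"
  proof
    assume "c = 0"
    then have "pr (\<theta> (xv 0)) = 0" by (simp add: e linD [OF lpr] pr')
    then show False using prt v00 \<kappa> by auto
  qed
  have t1: "\<theta> (pv (n - m - 1)) = c \<cdot>\<^sub>f pv (n - m - 1)"
  proof -
    have "\<theta> (op ?Q Gd (xv 0)) = op ?Q Gd (\<theta> (xv 0))" by (rule hmD(3) [OF h\<theta> sup(1)])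
    then show ?thesis unfolding e d_xv_0 [OF m] linD [OF lin_mapp] op_PP_p [OF m] by simp
  qed
  have t2: "\<theta> (pv (n - m)) = c \<cdot>\<^sub>f pv (n - m)"
  proof -
    have "\<theta> (op ?Q Ga (pv (n - m - 1))) = op ?Q Ga (\<theta> (pv (n - m - 1)))" by (rule hmD(3) [OF h\<theta> sup(2)])
    moreover have "Suc (n - m - 1) = n - m" using m by simp
    ultimately show ?thesis unfolding t1 linD [OF lin_mapp] op_PP_p [OF m] by simp
  qed
  have p0: "pv j \<noteq> 0" if "j < n" for j using that uv_neq_0 by (simp add: pv_def)
  have t3: "\<theta> (pv 0) \<noteq> 0"
  proof
    assume "\<theta> (pv 0) = 0"
    then have "\<theta> ((op ?Q Ga ^^ (n - m)) (pv 0)) = 0"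
      using hm_funpow [OF h\<theta> sup(2) [of 0] wfm_PP, where x = Ga and k = "n - m"] by (simp add: lin_0 [OF lin_funpow [OF lin_mapp]])
    then show False using t2 c0 p0 [of "n - m"] m by (simp add: apow_PP [OF m])
  qed
  have t4: "\<theta> (pv (n - m)) \<noteq> 0" using t2 c0 p0 [of "n - m"] m by simp
  have "finj ?Q \<theta>"
  proof (rule hw_inj [OF is_hmod_PP [OF m] q0 wfm_PP h\<theta> diagb_PP [OF m] diagb_PP [OF m]])
    fix \<beta> v assume v: "supp (hdim ?Q) v" "v \<noteq> 0" "op ?Q Gd v = 0" "op ?Q Gb v = \<beta> \<cdot>\<^sub>f v"
    from v(1) have "supp (2 * n) v" by simp
    from hw_PP [OF m this v(4,2,3)] obtain c where "v = c \<cdot>\<^sub>f pv 0 \<or> v = c \<cdot>\<^sub>f pv (n - m)" by blast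
    then show "\<theta> v \<noteq> 0" using v(2) t3 t4 by (auto simp: linD [OF l\<theta>])
  qed
  then have "finj ?Q \<psi>" unfolding finj_def \<theta>_def using lin_0 [OF hmD(1) [OF \<phi>(1)]] by metis
  then obtain G where "inverses ?Q P \<psi> G" by (rule bij_inverses [OF wfm_PP wP \<psi>(1) _ sur])
  then show ?thesis using P(2) by (meson fiso_def fiso_sym)
qed

end

section \<open>Almost split sequences of band modules\<close>

text \<open>In every block, copy e goes to copy e + k and is dropped if that is s' or more. With k =
  0 and smaller s' this is truncation, with k = 1 and s' = s + 1 an inclusion; the maps of the
  almost split sequences are of these two kinds.\<close>

definition sft :: "nat \<Rightarrow> nat \<Rightarrow> nat \<Rightarrow> nat \<Rightarrow> (nat \<Rightarrow> 'k) \<Rightarrow> nat \<Rightarrow> 'k::field" where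
  "sft n k s s' v = (\<lambda>i. if i div s' < n \<and> 0 < s' \<and> k \<le> i mod s' \<and> i mod s' - k < s
     then v ((i div s') * s + (i mod s' - k)) else 0)"

lemma lin_sft: "lin (sft n k s s')" by (auto simp: lin_def sft_def pointwise)

lemma div_mod_eqI: "e < s \<Longrightarrow> (p * s + e) div s = p \<and> (p * s + e) mod s = (e::nat)" by simp

lemma supp_sft [simp]: "supp (n * s') (sft n k s s' v)"
proof (cases "0 < s'")
  case True
  then show ?thesis by (auto simp: supp_def sft_def dest!: leD simp: div_less_iff_less_mult)
qed (simp add: supp_def sft_def)

lemma bv_coord: "e < s \<Longrightarrow> p < n \<Longrightarrow> E < s \<Longrightarrow> bv n s p e (P * s + E) = (if P = p \<and> E = e then 1 else 0)"
  by (simp add: bv_apply)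

text \<open>The condition s' \<le> s + k makes the shift respect the convention that copies from s
  on are zero.\<close>

lemma sft_bv:
  assumes "s' \<le> s + k"
  shows "sft n k s s' (bv n s p e) = bv n s' p (e + k)"
proof (cases "p < n \<and> e < s")
  case True
  show ?thesis
  proof
    fix i
    have L: "sft n k s s' (bv n s p e) i = (if i div s' < n \<and> 0 < s' \<and> k \<le> i mod s' \<and> i mod s' - k < s
        \<and> i div s' = p \<and> i mod s' - k = e then 1 else 0)"
    proof (cases "i div s' < n \<and> 0 < s' \<and> k \<le> i mod s' \<and> i mod s' - k < s")
      case c: True
      then have "sft n k s s' (bv n s p e) i = bv n s p e (i div s' * s + (i mod s' - k))"
        by (simp only: sft_def if_P)
      also have "\<dots> = (if i div s' = p \<and> i mod s' - k = e then 1 else 0)"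
        by (rule bv_coord) (use True c in auto)
      finally show ?thesis using c by simp
    qed (auto simp: sft_def)
    show "sft n k s s' (bv n s p e) i = bv n s' p (e + k) i"
    proof (cases "e + k < s'")
      case e: True
      then show ?thesis unfolding L using True by (auto simp: bv_apply)
    next
      case False
      then have "i mod s' \<noteq> e + k" if "0 < s'" using mod_less_divisor [OF that, of i] by linarith
      then show ?thesis unfolding L using False by (auto simp: zero_fun_apply)
    qed
  qed
next
  case False
  then have "bv n s p e = (0 :: nat \<Rightarrow> 'a)" "bv n s' p (e + k) = (0 :: nat \<Rightarrow> 'a)"
    using assms by auto
  then show ?thesis by (simp add: lin_0 [OF lin_sft])
qed

lemma supp_eq_0I:
  assumes "supp (n * s) v" "\<And>p e. p < n \<Longrightarrow> e < s \<Longrightarrow> v (p * s + e) = 0"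
  shows "v = 0"
proof
  fix i
  show "v i = 0 i"
  proof (cases "i < n * s")
    case True
    then show ?thesis using assms(2) [of "i div s" "i mod s"] idx_less' [OF True] by (simp add: zero_fun_apply)
  next
    case False
    then show ?thesis using assms(1) by (simp add: supp_def zero_fun_apply)
  qed
qed

section \<open>Homomorphisms between band modules\<close>

context qroot
begin

context
  fixes m :: nat and t :: int and A0 A1 D0 D1 :: 'k
  assumes m: "1 \<le> m" "m < n" and det: "A0 * D1 \<noteq> A1 * D0"
begin

abbreviation "G s \<equiv> band_mod n q s m t A0 A1 D0 D1"

lemma hm_sft:
  assumes "s' \<le> s + k"
  shows "hm (G s) (G s') (sft n k s s')"
proof (rule hmI_uv)
  fix j x assume j: "j < hdim (G s)"
  let ?p = "j div s" and ?e = "j mod s"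
  have u: "uv j = bv n s ?p ?e" using j by (simp add: uv_bv m)
  note sb = sft_bv [OF assms, of n]
  have cb: "sft n k s s' (comb x y (bv n s p) e) = comb x y (bv n s' p) (e + k)" for x y p e
    by (simp add: lin_comb [OF lin_sft] sb) (simp add: comb_def)
  show "sft n k s s' (op (G s) x (uv j)) = op (G s') x (sft n k s s' (uv j))"
    unfolding u sb
    by (cases x) (simp_all add: op_Ga [OF m] op_Gb [OF m] op_Gc [OF m] op_Gd [OF m] cb sb linD [OF lin_sft])
qed (simp_all add: lin_sft m)

text \<open>Together with d f_e this gives two bidiagonal images of f_e in the same block n - 1; by
  the determinant condition they can be solved for the basis vectors of that block.\<close>

lemma apow_top:
  "(op (G s) Ga ^^ (n - 1)) (bv n s 0 e) = comb A0 A1 (bv n s (n - 1)) e"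
proof -
  have "n - 1 = (m - 1) + (n - m)" using m by simp
  then have "(op (G s) Ga ^^ (n - 1)) (bv n s 0 e) = (op (G s) Ga ^^ (m - 1)) ((op (G s) Ga ^^ (n - m)) (bv n s 0 e))"
    by (simp only: funpow_add o_apply)
  also have "\<dots> = comb A0 A1 (\<lambda>e. (op (G s) Ga ^^ (m - 1)) (bv n s (n - m) e)) e"
    by (simp only: apow_f [OF m] lin_comb [OF lin_funpow [OF lin_mapp]])
  also have "\<dots> = comb A0 A1 (bv n s (n - 1)) e"
    using apow_bv_upper [OF m order.refl, where k = "m - 1"] m by simp
  finally show ?thesis .
qed

text \<open>The n blocks carry n different eigenvalues of b, so block p is a whole eigenspace and w
  has no coordinates elsewhere.\<close>

lemma weight_space:
  assumes "supp (n * s) w" "op (G s) Gb w = q powi (t + int m + int p) \<cdot>\<^sub>f w" "p < n"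
  shows "w = lcomb s (bv n s p) (\<lambda>i. w (p * s + i))"
proof
  fix i
  have L: "lcomb s (bv n s p) (\<lambda>i. w (p * s + i)) i = (if i div s = p \<and> 0 < s then w i else 0)"
  proof -
    have "lcomb s (bv n s p) (\<lambda>i. w (p * s + i)) i = (\<Sum>e<s. w (p * s + e) * bv n s p e i)"
      by (simp add: lcomb_def sum_fun_apply sc_apply)
    also have "\<dots> = (\<Sum>e<s. if e = i mod s then (if i div s = p then w (p * s + e) else 0) else 0)"
      using assms(3) by (intro sum.cong) (auto simp: bv_apply)
    also have "\<dots> = (if i div s = p \<and> 0 < s then w i else 0)" by auto
    finally show ?thesis .
  qed
  show "w i = lcomb s (bv n s p) (\<lambda>i. w (p * s + i)) i"
  proof (cases "i < n * s")
    case True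
    have id: "i div s < n" "i mod s < s" using idx_less' [OF True] by auto
    have l: "lin (\<lambda>v i. q powi (t + int m + int (i div s)) * v i)" by (auto simp: lin_def pointwise algebra_simps)
    have "op (G s) Gb w = (\<lambda>i. q powi (t + int m + int (i div s)) * w i)"
    proof (rule lin_eq_on_supp [OF lin_mapp l _ assms(1)])
      fix j assume "j < n * s"
      then show "op (G s) Gb (uv j) = (\<lambda>i. q powi (t + int m + int (i div s)) * uv j i)"
        by (simp add: uv_bv op_Gb [OF m]) (use idx_less' [of j n s] in \<open>auto simp: fun_eq_iff sc_apply bv_apply\<close>)
    qed
    then have e: "q powi (t + int m + int (i div s)) * w i = q powi (t + int m + int p) * w i"
      using assms(2) by (metis sc_apply)
    have "w i = 0" if "i div s \<noteq> p"
    proof (rule ccontr)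
      assume "w i \<noteq> 0"
      then have "q powi (t + int m + int (i div s)) = q powi (t + int m + int p)" using e by simp
      then have "int n dvd int (i div s) - int p" by (simp only: qpowi_eq_iff) simp
      then have "int (i div s) mod int n = int p mod int n" by (simp add: mod_eq_dvd_iff)
      then show False using that id assms(3) by (simp flip: zmod_int)
    qed
    then show ?thesis unfolding L using id by auto
  next
    case False
    then have "\<not> i div s = p \<or> s = 0" using assms(3) by (metis div_less_iff_less_mult not_gr_zero)
    then show ?thesis unfolding L using assms(1) False by (auto simp: supp_def)
  qed
qed

lemma lcomb_bv_coord:
  assumes "p < n" "e < s"
  shows "lcomb s (bv n s p) \<tau> (p * s + e) = \<tau> e"
proof -
  have "lcomb s (bv n s p) \<tau> (p * s + e) = (\<Sum>e'<s. \<tau> e' * bv n s p e' (p * s + e))"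
    by (simp add: lcomb_def sum_fun_apply sc_apply)
  also have "\<dots> = (\<Sum>e'<s. if e' = e then \<tau> e' else 0)"
    using assms by (intro sum.cong) (auto simp: bv_apply)
  finally show ?thesis using assms by simp
qed

text \<open>The determinant condition lets a^(n-1) f_e and d f_e be combined into a^(m-1) g_e, and
  in another way into a^(m-1) g_(e+1). The first combination forces F to act on all blocks by one
  matrix \<tau>, the second forces \<tau> to commute with the nilpotent shift, which is the Toeplitz
  condition.\<close>

lemma hom_toeplitz:
  assumes F: "hm (G s) (G s') F"
  shows "\<exists>\<tau>. (\<forall>p e. p < n \<longrightarrow> e < s \<longrightarrow> F (bv n s p e) = lcomb s' (bv n s' p) (\<lambda>i. \<tau> i e)) \<and>
    (\<forall>i e. e < s \<longrightarrow> i < s' \<longrightarrow> (if Suc e < s then \<tau> i (Suc e) else 0) = (case i of 0 \<Rightarrow> 0 | Suc i' \<Rightarrow> \<tau> i' e))"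
proof -
  note lF = linD [OF hmD(1) [OF F]] lin_0 [OF hmD(1) [OF F]]
  have Fop: "F (op (G s) x (bv n s p e)) = op (G s') x (F (bv n s p e))" for x p e
    by (rule hmD(3) [OF F]) simp
  have wG: "wfm (G s)" by simp
  have Fpow: "F ((op (G s) x ^^ k) (bv n s p e)) = (op (G s') x ^^ k) (F (bv n s p e))" for x k p e
    by (rule hm_funpow [OF F _ wG]) simp
  have sF: "supp (n * s') (F (bv n s p e))" for p e using hmD(2) [OF F, of "bv n s p e"] by simp
  define T where "T = (\<lambda>p i e. F (bv n s p e) (p * s' + i))"
  have FT: "F (bv n s p e) = lcomb s' (bv n s' p) (\<lambda>i. T p i e)" if "p < n" for p e
    unfolding T_def
    by (rule weight_space [OF sF _ that]) (simp add: Fop [symmetric] op_Gb [OF m] lF)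
  define \<tau> where "\<tau> = T 0"
  have n0: "0 < n" "n - 1 < n" using m by auto
  have lc: "f (lcomb s' g v) = lcomb s' (\<lambda>i. f (g i)) v" if "lin f" for f g v
    by (simp add: lcomb_def lin_sum [OF that] linD [OF that])
  define \<Delta> where "\<Delta> = A0 * D1 - A1 * D0"
  have \<Delta>: "\<Delta> \<noteq> 0" using det by (simp add: \<Delta>_def)
  \<comment> \<open>The pairs of coefficients used for Z and Y below are the rows of the inverse of
    the matrix with rows (A0, A1) and (D0, D1).\<close>
  define zy where "zy = (\<lambda>s x y v. x \<cdot>\<^sub>f (op (G s) Ga ^^ (n - 1)) v + y \<cdot>\<^sub>f op (G s) Gd v)"
  have lzy: "lin (zy s x y)" for s x y
    unfolding zy_def by (intro lin_plus lin_scale lin_funpow lin_mapp)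
  have Z: "zy s (D1 / \<Delta>) (- A1 / \<Delta>) (bv n s 0 e) = bv n s (n - 1) e"
    and Y: "zy s (- D0 / \<Delta>) (A0 / \<Delta>) (bv n s 0 e) = bv n s (n - 1) (Suc e)" for s e
  proof -
    have "zy s x y (bv n s 0 e) = (x * A0 + y * D0) \<cdot>\<^sub>f bv n s (n - 1) e + (x * A1 + y * D1) \<cdot>\<^sub>f bv n s (n - 1) (Suc e)" for x y
      unfolding zy_def by (simp only: apow_top op_Gd [OF m] if_True comb_def) (simp add: pointwise algebra_simps)
    then show "zy s (D1 / \<Delta>) (- A1 / \<Delta>) (bv n s 0 e) = bv n s (n - 1) e"
      "zy s (- D0 / \<Delta>) (A0 / \<Delta>) (bv n s 0 e) = bv n s (n - 1) (Suc e)"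
      using \<Delta> by (simp_all add: field_simps) (simp_all add: \<Delta>_def field_simps)
  qed
  have Fzy: "F (zy s x y (bv n s 0 e)) = zy s' x y (F (bv n s 0 e))" for x y e
    unfolding zy_def by (simp add: lF Fpow Fop)
  have top: "T (n - 1) i e = \<tau> i e" if "i < s'" for i e
  proof -
    have "F (bv n s (n - 1) e) = zy s' (D1 / \<Delta>) (- A1 / \<Delta>) (F (bv n s 0 e))"
      by (simp only: Z [of s e, symmetric] Fzy)
    also have "\<dots> = lcomb s' (bv n s' (n - 1)) (\<lambda>i. \<tau> i e)"
      unfolding FT [OF n0(1)] lc [OF lzy] Z by (simp add: \<tau>_def)
    finally show ?thesis using lcomb_bv_coord [OF n0(2) that, of "\<lambda>i. \<tau> i e"] by (simp add: T_def)
  qed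
  have low: "T p i e = \<tau> i e" if "p < n - m" "i < s'" for p i e
  proof -
    have p: "p < n" using that by simp
    have bl: "bv n s p e = (op (G s) Ga ^^ p) (bv n s 0 e)" for s e by (rule bv_cases(1) [OF m that(1)])
    have "F (bv n s p e) = (op (G s') Ga ^^ p) (F (bv n s 0 e))"
      unfolding bl [of s] by (rule Fpow)
    also have "\<dots> = lcomb s' (bv n s' p) (\<lambda>i. \<tau> i e)"
      unfolding FT [OF n0(1)] lc [OF lin_funpow [OF lin_mapp]] bl [of s', symmetric] by (simp add: \<tau>_def)
    finally show ?thesis using lcomb_bv_coord [OF p that(2), of "\<lambda>i. \<tau> i e"] by (simp add: T_def)
  qed
  have nm: "n - m < n" using m by simp
  have up: "T p i e = T (n - m) i e" if "n - m \<le> p" "p < n" "i < s'" for p i e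
  proof -
    have bu: "bv n s p e = (op (G s) Ga ^^ (p - (n - m))) (bv n s (n - m) e)" for s e
      by (rule bv_cases(2) [OF m that(1)])
    have "F (bv n s p e) = (op (G s') Ga ^^ (p - (n - m))) (F (bv n s (n - m) e))"
      unfolding bu [of s] by (rule Fpow)
    also have "\<dots> = lcomb s' (bv n s' p) (\<lambda>i. T (n - m) i e)"
      unfolding FT [OF nm] lc [OF lin_funpow [OF lin_mapp]] bu [of s', symmetric] ..
    finally show ?thesis using lcomb_bv_coord [OF that(2,3), of "\<lambda>i. T (n - m) i e"] by (simp add: T_def)
  qed
  \<comment> \<open>The blocks of a^p f follow block 0 and the blocks of a^p g follow block n - m;
    the top block n - 1 is of the second kind and has been linked to block 0 by
    \<open>top\<close>.\<close>
  have all: "T p i e = \<tau> i e" if "p < n" "i < s'" for p i e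
  proof (cases "p < n - m")
    case True
    then show ?thesis by (rule low [OF _ that(2)])
  next
    case False
    have "n - m \<le> n - 1" using m by simp
    then show ?thesis using up [of p i e] up [of "n - 1" i e] top [of i e] False that n0 by simp
  qed
  have 1: "F (bv n s p e) = lcomb s' (bv n s' p) (\<lambda>i. \<tau> i e)" if "p < n" for p e
    unfolding FT [OF that] by (simp add: lcomb_def all [OF that])
  have 2: "(if Suc e < s then \<tau> i (Suc e) else 0) = (case i of 0 \<Rightarrow> 0 | Suc i' \<Rightarrow> \<tau> i' e)" if "e < s" "i < s'" for i e
  proof -
    have "F (bv n s (n - 1) (Suc e)) = zy s' (- D0 / \<Delta>) (A0 / \<Delta>) (F (bv n s 0 e))"
      by (simp only: Y [of s e, symmetric] Fzy)
    also have "\<dots> = lcomb s' (\<lambda>i. bv n s' (n - 1) (Suc i)) (\<lambda>i. \<tau> i e)"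
      unfolding 1 [OF n0(1)] lc [OF lzy] Y ..
    finally have E: "F (bv n s (n - 1) (Suc e)) ((n - 1) * s' + i) = (\<Sum>j<s'. \<tau> j e * bv n s' (n - 1) (Suc j) ((n - 1) * s' + i))"
      by (simp add: lcomb_def sum_fun_apply sc_apply)
    have "bv n s' (n - 1) (Suc j) ((n - 1) * s' + i) = (if i = Suc j then 1 else 0 :: 'k)" if "j < s'" for j
      using \<open>i < s'\<close> n0 by (cases "Suc j < s'") (auto simp: bv_apply zero_fun_apply)
    then have R: "(\<Sum>j<s'. \<tau> j e * bv n s' (n - 1) (Suc j) ((n - 1) * s' + i)) = (\<Sum>j<s'. if i = Suc j then \<tau> j e else 0)"
      by (intro sum.cong) auto
    have R2: "\<dots> = (case i of 0 \<Rightarrow> 0 | Suc i' \<Rightarrow> \<tau> i' e)" using \<open>i < s'\<close> by (cases i) auto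
    show ?thesis
    proof (cases "Suc e < s")
      case True
      then show ?thesis using E R R2 1 [OF n0(2), of "Suc e"] lcomb_bv_coord [OF n0(2) that(2), of "\<lambda>i. \<tau> i (Suc e)"] by simp
    next
      case False
      then show ?thesis using E R R2 by (simp add: lF zero_fun_apply)
    qed
  qed
  show ?thesis using 1 2 by (intro exI [of _ \<tau>] conjI allI impI)
qed

text \<open>The condition moves an entry along its diagonal. A diagonal above the main one runs into
  row 0, where the right-hand side is zero; the main diagonal is constant, and for s < s' it runs
  into the last column, where the left-hand side is zero.\<close>

lemma toeplitz_lower:
  assumes T: "\<And>i e. e < s \<Longrightarrow> i < s' \<Longrightarrow> (if Suc e < s then \<tau> i (Suc e) else 0) = (case i of 0 \<Rightarrow> 0 | Suc i' \<Rightarrow> \<tau> i' e)"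
  shows "e < s \<Longrightarrow> i < s' \<Longrightarrow> i < e \<Longrightarrow> \<tau> i e = (0 :: 'k)"
    and "e < s \<Longrightarrow> e < s' \<Longrightarrow> \<tau> e e = \<tau> 0 0"
    and "s < s' \<Longrightarrow> 0 < s \<Longrightarrow> \<tau> 0 0 = 0"
proof -
  show A: "\<tau> i e = 0" if "e < s" "i < s'" "i < e" for i e
    using that
  proof (induction e arbitrary: i)
    case (Suc e)
    from T [of e i] Suc.prems have "\<tau> i (Suc e) = (case i of 0 \<Rightarrow> 0 | Suc i' \<Rightarrow> \<tau> i' e)" by simp
    then show ?case using Suc by (cases i) auto
  qed simp
  show B: "\<tau> e e = \<tau> 0 0" if "e < s" "e < s'" for e
    using that
  proof (induction e)
    case (Suc e)
    from T [of e "Suc e"] Suc.prems have "\<tau> (Suc e) (Suc e) = \<tau> e e" by simp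
    then show ?case using Suc by simp
  qed simp
  show "\<tau> 0 0 = 0" if "s < s'" "0 < s"
    using T [of "s - 1" s] B [of "s - 1"] that by (cases s) auto
qed

lemma hom_coord:
  assumes F: "hm (G s) (G s') F"
    and \<tau>: "\<And>p e. p < n \<Longrightarrow> e < s \<Longrightarrow> F (bv n s p e) = lcomb s' (bv n s' p) (\<lambda>i. \<tau> i e)"
    and v: "supp (n * s) v" and "p < n" "i < s'"
  shows "F v (p * s' + i) = (\<Sum>e<s. \<tau> i e * v (p * s + e))"
proof -
  \<comment> \<open>A single coordinate is a scalar; spread out as a function supported at one index
    it becomes a linear map to which \<open>lin_eq_on_supp\<close> applies.\<close>
  define \<Phi> where "\<Phi> = (\<lambda>v j. if p * s' + i = j then \<Sum>e<s. \<tau> i e * v (p * s + e) else 0)"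
  define \<Psi> where "\<Psi> = (\<lambda>v j. if p * s' + i = j then F v j else 0)"
  have l: "lin \<Phi>" unfolding \<Phi>_def
    by (auto simp: lin_def pointwise algebra_simps sum.distrib sum_distrib_left)
  have l': "lin \<Psi>" unfolding \<Psi>_def
    by (auto simp: lin_def linD [OF hmD(1) [OF F]] pointwise)
  have "\<Psi> v = \<Phi> v"
  proof (rule lin_eq_on_supp [OF l' l _ v])
    fix j assume j: "j < n * s"
    let ?p = "j div s" and ?e = "j mod s"
    note pe = idx_less' [OF j]
    have "F (uv j) (p * s' + i) = lcomb s' (bv n s' ?p) (\<lambda>i. \<tau> i ?e) (p * s' + i)"
      using pe by (simp add: uv_bv [OF j] \<tau>)
    also have "\<dots> = (if ?p = p then \<tau> i ?e else 0)"
    proof (cases "?p = p")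
      case True
      then show ?thesis using lcomb_bv_coord [OF assms(4,5), of "\<lambda>i. \<tau> i ?e"] by simp
    next
      case False
      have "lcomb s' (bv n s' ?p) (\<lambda>i. \<tau> i ?e) (p * s' + i) = (\<Sum>e<s'. \<tau> e ?e * bv n s' ?p e (p * s' + i))"
        by (simp add: lcomb_def sum_fun_apply sc_apply)
      also have "\<dots> = 0" using False assms(5) pe by (intro sum.neutral) (auto simp: bv_apply)
      finally show ?thesis using False by simp
    qed
    also have "\<dots> = (\<Sum>e<s. \<tau> i e * uv j (p * s + e))"
    proof -
      have "(\<Sum>e<s. \<tau> i e * uv j (p * s + e)) = (\<Sum>e<s. if e = ?e then (if ?p = p then \<tau> i e else 0) else 0)"
      proof (intro sum.cong refl)
        fix e assume "e \<in> {..<s}"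
        then have "e < s" by simp
        then show "\<tau> i e * uv j (p * s + e) = (if e = ?e then (if ?p = p then \<tau> i e else 0) else 0)"
          using idx_iff [of e s j p] by (auto simp: uv_def)
      qed
      then show ?thesis using pe by simp
    qed
    finally show "\<Psi> (uv j) = \<Phi> (uv j)" by (auto simp: \<Psi>_def \<Phi>_def)
  qed
  then show ?thesis by (metis \<Psi>_def \<Phi>_def)
qed

lemma bv00: "0 < s \<Longrightarrow> bv n s 0 0 0 = (1 :: 'k)" using m by (simp add: bv_def uv_def)

text \<open>A lower triangular Toeplitz matrix is governed by its constant diagonal entry, which is
  read off as the coordinate of F f_0 at f_0. If it vanishes, the last column is zero, so the last
  copy is killed in every block.\<close>

lemma invertible_end_iff:
  assumes F: "hm (G s) (G s) F" and s: "0 < s"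
  shows "invertible_end (G s) F \<longleftrightarrow> F (bv n s 0 0) 0 \<noteq> 0"
    and "F (bv n s 0 0) 0 = 0 \<Longrightarrow> p < n \<Longrightarrow> F (bv n s p (s - 1)) = 0"
proof -
  obtain \<tau> where t1: "\<forall>p e. p < n \<longrightarrow> e < s \<longrightarrow> F (bv n s p e) = lcomb s (bv n s p) (\<lambda>i. \<tau> i e)"
    and t2: "\<forall>i e. e < s \<longrightarrow> i < s \<longrightarrow> (if Suc e < s then \<tau> i (Suc e) else 0) = (case i of 0 \<Rightarrow> 0 | Suc i' \<Rightarrow> \<tau> i' e)"
    using hom_toeplitz [OF F] by blast
  note \<tau> = t1 [rule_format] and T = t2 [rule_format]
  have n0: "0 < n" using m by simp
  have t00: "F (bv n s 0 0) 0 = \<tau> 0 0"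
    using \<tau> [OF n0 s] lcomb_bv_coord [OF n0 s, where \<tau> = "\<lambda>i. \<tau> i 0"] by simp
  note low = toeplitz_lower(1) [where \<tau> = \<tau> and s = s and s' = s, OF T]
    and diag = toeplitz_lower(2) [where \<tau> = \<tau> and s = s and s' = s, OF T]
  show kill: "F (bv n s p (s - 1)) = 0" if "F (bv n s 0 0) 0 = 0" "p < n" for p
  proof -
    have "\<tau> i (s - 1) = 0" if "i < s" for i
      using low [of "s - 1" i] diag [of "s - 1"] that s t00 \<open>F (bv n s 0 0) 0 = 0\<close> by (cases "i = s - 1") auto
    then have "lcomb s (bv n s p) (\<lambda>i. \<tau> i (s - 1)) = 0" by (simp add: lcomb_def)
    then show ?thesis using \<tau> [OF that(2), of "s - 1"] s by simp
  qed
  show "invertible_end (G s) F \<longleftrightarrow> F (bv n s 0 0) 0 \<noteq> 0"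
  proof
    assume "invertible_end (G s) F"
    then obtain H where "inverses (G s) (G s) F H" by (auto simp: invertible_end_def)
    note H = inversesD [OF this]
    show "F (bv n s 0 0) 0 \<noteq> 0"
    proof
      assume z: "F (bv n s 0 0) 0 = 0"
      have "H (F (bv n s 0 (s - 1))) = bv n s 0 (s - 1)" by (rule H(3)) simp
      then have "bv n s 0 (s - 1) = (0 :: nat \<Rightarrow> 'k)" using kill [OF z n0] lin_0 [OF hmD(1) [OF H(2)]] by simp
      then have "bv n s 0 (s - 1) (s - 1) = (0 :: 'k)" by (simp add: zero_fun_apply)
      then show False using s n0 by (simp add: bv_def uv_def)
    qed
  next
    assume nz: "F (bv n s 0 0) 0 \<noteq> 0"
    have "finj (G s) F" unfolding finj_def
    proof (intro allI impI, elim conjE)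
      fix v assume v: "supp (hdim (G s)) v" "F v = 0"
      have v': "supp (n * s) v" using v by simp
      show "v = 0"
      proof (rule supp_eq_0I [OF v'])
        fix p e assume p: "p < n" and "e < s"
        then show "v (p * s + e) = 0"
        \<comment> \<open>Forward substitution: row e involves only copies up to e, and its diagonal
          entry is the nonzero scalar.\<close>
        proof (induction e rule: less_induct)
          case (less e)
          have "0 = (\<Sum>e'<s. \<tau> e e' * v (p * s + e'))"
            using hom_coord [where \<tau> = \<tau>, OF F \<tau> v' p less.prems(2)] v(2) by (simp add: zero_fun_apply)
          also have "\<dots> = (\<Sum>e'<s. if e' = e then \<tau> e e * v (p * s + e) else 0)"
          proof (intro sum.cong refl)
            fix e' assume "e' \<in> {..<s}"
            then show "\<tau> e e' * v (p * s + e') = (if e' = e then \<tau> e e * v (p * s + e) else 0)"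
              using less.IH [of e'] low [of e' e] less.prems p by (cases e' e rule: linorder_cases) auto
          qed
          also have "\<dots> = \<tau> e e * v (p * s + e)" using less.prems by simp
          finally show ?case using diag [of e] less.prems t00 nz by simp
        qed
      qed
    qed
    from finj_inverses [OF wfm_GG wfm_GG F this refl]
    show "invertible_end (G s) F" by (auto simp: invertible_end_def)
  qed
qed

text \<open>The diagonal scalar is additive in the endomorphism, so a summand with scalar zero does
  not affect invertibility. For s = 0 the module is zero and everything is invertible.\<close>

lemma local_end_G: "local_end (G s)"
proof (cases "s = 0")
  case True
  have "invertible_end (G s) F" if "hm (G s) (G s) F" for F
  proof -
    have z: "supp (n * s) v \<Longrightarrow> v = 0" for v :: "nat \<Rightarrow> 'k"
      using True by (simp add: supp_def pointwise)
    have "inverses (G s) (G s) F F" unfolding inverses_def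
      using that lin_0 [OF hmD(1) [OF that]] by (auto dest!: z)
    then show ?thesis by (auto simp: invertible_end_def)
  qed
  note inv0 = this
  show ?thesis unfolding local_end_def
  proof (intro allI impI, elim conjE)
    fix F K assume a: "hm (G s) (G s) F" "hm (G s) (G s) K"
    show "invertible_end (G s) (\<lambda>v. F v + K v)" by (rule inv0 [OF hm_plus [OF a]])
  qed
next
  case False
  then have s: "0 < s" by simp
  show ?thesis unfolding local_end_def
  proof (intro allI impI, elim conjE)
    fix F K assume a: "hm (G s) (G s) F" "hm (G s) (G s) K" "\<not> invertible_end (G s) F" "invertible_end (G s) K"
    show "invertible_end (G s) (\<lambda>v. F v + K v)"
      using a(3,4) unfolding invertible_end_iff(1) [OF a(1) s] invertible_end_iff(1) [OF a(2) s]
        invertible_end_iff(1) [OF hm_plus [OF a(1,2)] s] by (simp add: plus_fun_apply)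
  qed
qed

text \<open>The candidate is 0 \<rightarrow> G(s+1) \<rightarrow> G(s) \<oplus> G(s+2) \<rightarrow>
  G(s+1) \<rightarrow> 0, with truncation and inclusion as components of f', and with g' the
  difference of truncation and inclusion. After \<open>ar_unique\<close> has identified the middle
  terms, the common summand L, isomorphic to G(s), is cancelled.\<close>

lemma ar_step:
  assumes AS: "almost_split n q N f (dsum [L, X]) g N" and N: "fiso N (G (Suc s))" and L: "fiso L (G s)"
    and LX: "is_hmod n q L" "is_hmod n q X"
  shows "fiso X (G (Suc (Suc s)))"
proof -
  let ?G0 = "G s" and ?G1 = "G (Suc s)" and ?G2 = "G (Suc (Suc s))"
  let ?B = "dsum [?G0, ?G2]"
  have hB: "is_hmod n q ?B" by (rule is_hmod_dsum) (use is_hmod_GG [OF m] in auto)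
  have d1: "dsum [?G2] = ?G2" by (rule dsum_single) simp
  obtain \<phi> \<psi> where \<phi>: "inverses N ?G1 \<phi> \<psi>" using N by (auto simp: fiso_def)
  have wG: "wfm (G s)" for s by simp
  have bp: "biprod ?B ?G0 ?G2 (lo (n * s)) (jn (n * s) 0) (lo (n * s)) (hi (n * s))"
    using biprod_dsum [OF wG, of "[?G2]" s] d1 by simp
  let ?i1 = "lo (n * s)" and ?i2 = "jn (n * s) 0" and ?p1 = "lo (n * s)" and ?p2 = "hi (n * s)"
  note b = biprodD [OF bp]
  let ?\<pi> = "sft n 0 (Suc s) s" and ?\<iota> = "sft n 1 (Suc s) (Suc (Suc s))"
  let ?\<pi>2 = "sft n 0 (Suc (Suc s)) (Suc s)" and ?iq = "sft n 1 s (Suc s)"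
  have h\<pi>: "hm ?G1 ?G0 ?\<pi>" and h\<iota>: "hm ?G1 ?G2 ?\<iota>" and h\<pi>2: "hm ?G2 ?G1 ?\<pi>2" and hiq: "hm ?G0 ?G1 ?iq"
    by (rule hm_sft; simp)+
  define f' :: "(nat \<Rightarrow> 'k) \<Rightarrow> nat \<Rightarrow> 'k" where "f' = (\<lambda>v. ?i1 (?\<pi> v) + ?i2 (?\<iota> v))"
  define g' :: "(nat \<Rightarrow> 'k) \<Rightarrow> nat \<Rightarrow> 'k" where "g' = (\<lambda>v. ?\<pi>2 (?p2 v) - ?iq (?p1 v))"
  have hf': "hm ?G1 ?B f'" unfolding f'_def by (rule hm_plus [OF hm_comp [OF h\<pi> b(1)] hm_comp [OF h\<iota> b(2)]])
  have hg': "hm ?B ?G1 g'" unfolding g'_def by (rule hm_minus [OF hm_comp [OF b(4) h\<pi>2] hm_comp [OF b(3) hiq]])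
  have sup: "supp (hdim (G k)) v \<longleftrightarrow> supp (n * k) v" for k and v :: "nat \<Rightarrow> 'k" by simp
  have p1f: "?p1 (f' v) = ?\<pi> v" "?p2 (f' v) = ?\<iota> v" if v: "supp (n * Suc s) v" for v
    using b(5) [of "?\<pi> v"] b(8) [of "?\<iota> v"] b(6) [of "?\<pi> v"] b(7) [of "?\<iota> v"]
    by (simp_all only: f'_def linD [OF lin_lo] linD [OF lin_hi] sup supp_sft) simp_all
  have \<iota>_inj: "v = 0" if "supp (n * k) v" "sft n 1 k (Suc k) v = 0" for k and v :: "nat \<Rightarrow> 'k"
  proof (rule supp_eq_0I [OF that(1)])
    fix p e assume pe: "p < n" "e < k"
    have "sft n 1 k (Suc k) v (p * Suc k + Suc e) = v (p * k + e)"
      using div_mod_eqI [of "Suc e" "Suc k" p] pe by (simp add: sft_def)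
    then show "v (p * k + e) = 0" by (metis that(2) zero_fun_apply)
  qed
  have comm: "?\<pi>2 (?\<iota> v) = ?iq (?\<pi> v)" if "supp (n * Suc s) v" for v
  proof (rule lin_eq_on_supp [OF lin_comp [OF lin_sft lin_sft] lin_comp [OF lin_sft lin_sft] _ that])
    fix j assume j: "j < n * Suc s"
    show "?\<pi>2 (?\<iota> (uv j)) = ?iq (?\<pi> (uv j))" by (simp only: uv_bv [OF j]) (simp add: sft_bv)
  qed
  have fB: "fiso ?B (dsum [L, X])"
  proof (rule ar_unique [OF AS \<phi> wG hB hf' _ hg'])
    show "finj ?G1 f'" unfolding finj_def
    proof (intro allI impI, elim conjE)
      fix v assume v: "supp (hdim ?G1) v" "f' v = 0"
      have v': "supp (n * Suc s) v" using v(1) by (simp only: sup)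
      have "?\<iota> v = 0" using p1f(2) [OF v'] v(2) by simp
      then show "v = 0" by (rule \<iota>_inj [OF v'])
    qed
    show "fsurj ?B ?G1 g'" unfolding fsurj_def
    proof (intro allI impI)
      fix w :: "nat \<Rightarrow> 'k" assume "supp (hdim ?G1) w"
      then have w: "supp (n * Suc s) w" by (simp only: sup)
      \<comment> \<open>This is w with an empty last copy s + 1 added in each block, a preimage
        under truncation.\<close>
      define u where "u = (\<lambda>i. if i div Suc (Suc s) < n \<and> i mod Suc (Suc s) < Suc s
        then w (i div Suc (Suc s) * Suc s + i mod Suc (Suc s)) else 0)"
      have su: "supp (n * Suc (Suc s)) u"
        by (auto simp: supp_def u_def div_less_iff_less_mult dest!: leD)
      have "?\<pi>2 u = w"
      proof
        fix i
        show "?\<pi>2 u i = w i"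
        proof (cases "i < n * Suc s")
          case True
          note pe = idx_less' [OF True]
          have lt: "i mod Suc s < Suc (Suc s)" by (rule less_SucI) (use pe in auto)
          from div_mod_eqI [OF lt, of "i div Suc s"] show ?thesis using pe lt
            by (simp add: sft_def u_def del: mult_Suc_right mult_Suc)
        next
          case False
          then have "supp (n * Suc s) (?\<pi>2 u)" "n * Suc s \<le> i" by (simp_all del: mult_Suc_right)
          then show ?thesis using w by (simp add: supp_def)
        qed
      qed
      moreover have "?p2 (?i2 u) = u" "?p1 (?i2 u) = 0" using b(7,8) [of u] su by (simp_all only: sup)
      ultimately have "g' (?i2 u) = w" by (simp add: g'_def lin_0 [OF lin_sft])
      moreover have "supp (hdim ?B) (?i2 u)" by (rule hmD(2) [OF b(2)]) (simp only: sup su)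
      ultimately show "\<exists>v. supp (hdim ?B) v \<and> g' v = w" by blast
    qed
    show "g' (f' v) = 0" if "supp (hdim ?G1) v" for v
      using p1f [of v] comm [of v] that by (simp only: sup g'_def) simp
    show "\<exists>w. supp (hdim ?G1) w \<and> v = f' w" if v: "supp (hdim ?B) v" "g' v = 0" for v
    proof -
      let ?v1 = "?p1 v" and ?v2 = "?p2 v"
      have s1: "supp (n * s) ?v1" and s2: "supp (n * Suc (Suc s)) ?v2"
        using hmD(2) [OF b(3) v(1)] hmD(2) [OF b(4) v(1)] by (simp_all only: sup)
      have e: "?\<pi>2 ?v2 = ?iq ?v1" using v(2) by (simp add: g'_def)
      \<comment> \<open>Images under the inclusion have no part in copy 0, so by \<open>e\<close>
        neither has v2; lowering all copies of v2 by one gives its preimage.\<close>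
      define w where "w = (\<lambda>i. if i div Suc s < n then ?v2 (i div Suc s * Suc (Suc s) + Suc (i mod Suc s)) else 0)"
      have sw: "supp (n * Suc s) w"
        by (auto simp: supp_def w_def div_less_iff_less_mult dest!: leD)
      have z: "?v2 (p * Suc (Suc s)) = 0" if "p < n" for p
      proof -
        have "?\<pi>2 ?v2 (p * Suc s) = ?v2 (p * Suc (Suc s))"
          using div_mod_eqI [of 0 "Suc s" p] that by (simp add: sft_def del: mult_Suc_right mult_Suc)
        moreover have "?iq ?v1 (p * Suc s) = 0"
          using div_mod_eqI [of 0 "Suc s" p] by (simp add: sft_def del: mult_Suc_right mult_Suc)
        ultimately show ?thesis by (metis e)
      qed
      have "?\<iota> w = ?v2"
      proof
        fix i
        show "?\<iota> w i = ?v2 i"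
        proof (cases "i < n * Suc (Suc s)")
          case True
          note pe = idx_less' [OF True]
          show ?thesis
          proof (cases "i mod Suc (Suc s)")
            case 0
            then have "i div Suc (Suc s) * Suc (Suc s) = i" by (metis add_0_right div_mult_mod_eq)
            then show ?thesis using z [of "i div Suc (Suc s)"] pe 0 by (simp add: sft_def)
          next
            case (Suc e)
            have e: "e < Suc s" using Suc pe by simp
            have "i div Suc (Suc s) * Suc (Suc s) + Suc e = i" using div_mult_mod_eq [of i "Suc (Suc s)"] Suc by simp
            then show ?thesis using pe Suc e div_mod_eqI [OF e, of "i div Suc (Suc s)"]
              by (simp add: sft_def w_def del: mult_Suc_right mult_Suc)
          qed
        next
          case False
          then have "supp (n * Suc (Suc s)) (?\<iota> w)" "n * Suc (Suc s) \<le> i" by (simp_all del: mult_Suc_right)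
          then show ?thesis using s2 by (simp add: supp_def)
        qed
      qed
      note \<iota>w = this
      have "?iq (?\<pi> w - ?v1) = 0"
        using comm [OF sw] e \<iota>w by (simp add: lin_diff [OF lin_sft])
      then have "?\<pi> w - ?v1 = 0" by (rule \<iota>_inj [rotated]) (use s1 in simp)
      then have \<pi>w: "?\<pi> w = ?v1" by simp
      have "f' w = ?i1 ?v1 + ?i2 ?v2" by (simp only: f'_def \<iota>w \<pi>w)
      also have "\<dots> = v" by (rule b(9) [OF v(1)])
      finally show ?thesis using sw by (metis sup)
    qed
    \<comment> \<open>The component G(s+1) \<rightarrow> G(s+2) of a section has diagonal zero by
      \<open>toeplitz_lower\<close>, and the inclusion of G(s) never reaches copy 0. So the
      coordinate of g' w f_0 at f_0 is 0 instead of 1.\<close>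
    show "\<not> (\<exists>w. hm ?G1 ?B w \<and> (\<forall>v. supp (hdim ?G1) v \<longrightarrow> g' (w v) = v))"
    proof safe
      fix w assume w: "hm ?G1 ?B w" "\<forall>v. supp (hdim ?G1) v \<longrightarrow> g' (w v) = v"
      have h: "hm ?G1 ?G2 (\<lambda>v. ?p2 (w v))" by (rule hm_comp [OF w(1) b(4)])
      obtain \<tau> where t1: "\<forall>p e. p < n \<longrightarrow> e < Suc s \<longrightarrow> ?p2 (w (bv n (Suc s) p e)) = lcomb (Suc (Suc s)) (bv n (Suc (Suc s)) p) (\<lambda>i. \<tau> i e)"
        and t2: "\<forall>i e. e < Suc s \<longrightarrow> i < Suc (Suc s) \<longrightarrow> (if Suc e < Suc s then \<tau> i (Suc e) else 0) = (case i of 0 \<Rightarrow> 0 | Suc i' \<Rightarrow> \<tau> i' e)"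
        using hom_toeplitz [OF h] by blast
      note \<tau> = t1 [rule_format] and T = t2 [rule_format]
      have n0: "0 < n" using m by simp
      have "?p2 (w (bv n (Suc s) 0 0)) 0 = \<tau> 0 0"
        using \<tau> [OF n0, of 0] lcomb_bv_coord [OF n0, of 0 "Suc (Suc s)" "\<lambda>i. \<tau> i 0"] by simp
      also have "\<dots> = 0" using toeplitz_lower(3) [where \<tau> = \<tau> and s = "Suc s" and s' = "Suc (Suc s)", OF T] by simp
      finally have "g' (w (bv n (Suc s) 0 0)) 0 = 0"
        using n0 by (simp add: g'_def pointwise sft_def)
      moreover have "g' (w (bv n (Suc s) 0 0)) = bv n (Suc s) 0 0" using w(2) by (simp only: sup supp_bv)
      ultimately show False using bv00 [of "Suc s"] by simp
    qed
    show "(\<exists>k'. inverses ?G1 ?G1 k k') \<or> (\<exists>t. hm ?B ?G1 t \<and> (\<forall>v. supp (hdim ?G1) v \<longrightarrow> k v = t (f' v)))"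
      if k: "hm ?G1 ?G1 k" for k
    proof (cases "k (bv n (Suc s) 0 0) 0 = 0")
      case False
      then show ?thesis using invertible_end_iff(1) [OF k] by (auto simp: invertible_end_def)
    next
      case True
      \<comment> \<open>A non-invertible endomorphism kills the last copy of each block. These
        copies span the kernel of the truncation, so k factors through the first component of
        f'.\<close>
      have kill: "k (bv n (Suc s) p s) = 0" if "p < n" for p
        using invertible_end_iff(2) [OF k _ True that] by simp
      have ker: "k v = 0" if v: "supp (hdim ?G1) v" "?\<pi> v = 0" for v
      proof -
        have v': "supp (n * Suc s) v" using v(1) by (simp only: sup)
        have vz: "v (p * Suc s + e) = 0" if "p < n" "e < s" for p e
        proof -
          have "?\<pi> v (p * s + e) = v (p * Suc s + e)"
            using div_mod_eqI [OF that(2), of p] that by (simp add: sft_def del: mult_Suc_right mult_Suc)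
          then show ?thesis by (metis v(2) zero_fun_apply)
        qed
        have "v j \<cdot>\<^sub>f k (uv j) = 0" if j: "j < n * Suc s" for j
        proof (cases "j mod Suc s < s")
          case True
          then have "v j = 0" using vz [of "j div Suc s" "j mod Suc s"] idx_less' [OF j] by (simp del: mult_Suc_right)
          then show ?thesis by simp
        next
          case False
          moreover have "j mod Suc s < Suc s" using idx_less' [OF j] by blast
          ultimately have "j mod Suc s = s" by linarith
          then have "k (uv j) = 0" using kill [of "j div Suc s"] idx_less' [OF j] by (simp only: uv_bv [OF j])
          then show ?thesis by simp
        qed
        then have "(\<Sum>j<n * Suc s. v j \<cdot>\<^sub>f k (uv j)) = 0" by (intro sum.neutral) simp
        moreover have "k v = (\<Sum>j<n * Suc s. v j \<cdot>\<^sub>f k (uv j))"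
          using arg_cong [OF supp_expand [OF v'], of k]
          by (simp only: lin_sum [OF hmD(1) [OF k]] linD [OF hmD(1) [OF k]])
        ultimately show ?thesis by simp
      qed
      have surj: "fsurj ?G1 ?G0 ?\<pi>" unfolding fsurj_def
      proof (intro allI impI)
        fix w :: "nat \<Rightarrow> 'k" assume "supp (hdim ?G0) w"
        then have w: "supp (n * s) w" by (simp only: sup)
        define u where "u = (\<lambda>i. if i div Suc s < n \<and> i mod Suc s < s
          then w (i div Suc s * s + i mod Suc s) else 0)"
        have su: "supp (n * Suc s) u"
          by (auto simp: supp_def u_def div_less_iff_less_mult dest!: leD)
        have "?\<pi> u = w"
        proof
          fix i
          show "?\<pi> u i = w i"
          proof (cases "i < n * s")
            case True
            note pe = idx_less' [OF True]
            have lt: "i mod s < Suc s" by (rule less_SucI) (use pe in auto)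
            from div_mod_eqI [OF lt, of "i div s"] show ?thesis using pe lt
              by (simp add: sft_def u_def del: mult_Suc_right mult_Suc)
          next
            case False
            then have "supp (n * s) (?\<pi> u)" "n * s \<le> i" by (simp_all del: mult_Suc_right)
            then show ?thesis using w by (simp add: supp_def)
          qed
        qed
        then show "\<exists>v. supp (hdim ?G1) v \<and> ?\<pi> v = w" using su by (metis sup)
      qed
      obtain K where K: "hm ?G0 ?G1 K" "\<And>v. supp (hdim ?G1) v \<Longrightarrow> K (?\<pi> v) = k v"
        using factor_epi [OF wG wG wG h\<pi> surj k ker] by blast
      have "hm ?B ?G1 (\<lambda>v. K (?p1 v))" by (rule hm_comp [OF b(3) K(1)])
      moreover have "k v = K (?p1 (f' v))" if "supp (hdim ?G1) v" for v
        using K(2) [OF that] p1f(1) that by (simp only: sup)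
      ultimately show ?thesis by blast
    qed
  qed
  have wL: "wfm L" and wX: "wfm X" using LX by (auto intro: is_hmod_wfm)
  obtain H K where HK: "inverses ?B (dsum [L, X]) H K" using fB by (auto simp: fiso_def)
  obtain F E where FE: "inverses L ?G0 F E" using L by (auto simp: fiso_def)
  have wLX: "wfm (dsum [L, X])" by (rule wfm_dsum) (use wL wX in auto)
  have b1: "biprod (dsum [L, X]) L X (lo (hdim L)) (jn (hdim L) 0) (lo (hdim L)) (hi (hdim L))"
    using biprod_dsum [of L "[X]"] wL wX by (simp add: dsum_single)
  have idi: "inverses C C (\<lambda>v. v) (\<lambda>v. v)" if "wfm C" for C :: "'k hmod"
    using hm_id [OF that] by (simp add: inverses_def)
  note b2 = biprod_fiso [OF b1 FE idi [OF wLX]]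
  note b3 = biprod_fiso [OF bp idi [OF wG] HK]
  show ?thesis by (rule cancel [OF b2 b3 local_end_G wG])
qed

end

text \<open>For \<eta> = y in k the pencil is a^(n-l) f_e = g_e, d f_e = a^(l-1) (y q^l g_e +
  g_(e+1)), a Jordan block with the value y q^l prescribed by M_1. For \<eta> = \<infinity> the
  roles of a and d are exchanged: a^(n-l) f_e = g_(e+1), d f_e = a^(l-1) g_e.\<close>

definition Gm :: "nat \<Rightarrow> nat \<Rightarrow> int \<Rightarrow> 'k proj_line \<Rightarrow> 'k hmod" where
  "Gm s l r \<eta> = (case \<eta> of Fin y \<Rightarrow> band_mod n q s l r 1 0 (y * q ^ l) 1 | Infty \<Rightarrow> band_mod n q s l r 0 1 1 0)"

text \<open>For s = 1 there is no g_1, so only the entries A0 and D0 of the pencil survive, and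
  block p is the basis vector v_(p+1); the two modules then have equal matrices.\<close>

lemma Gm_1:
  assumes "1 \<le> l" "l < n"
  shows "M1_mod n q l r \<eta> = Gm (Suc 0) l r \<eta>"
proof -
  have "act (M1_mod n q l r \<eta>) x = act (Gm (Suc 0) l r \<eta>) x" for x
  proof (cases \<eta>)
    case (Fin y)
    show ?thesis unfolding Fin
      by (cases x; rule eq_matI)
         (use assms in \<open>auto simp: M1_mod_def Gm_def band_mod_def basis_mat_def penc_def of_nat_diff algebra_simps Suc_diff_le\<close>)
  next
    case Infty
    show ?thesis unfolding Infty
      by (cases x; rule eq_matI)
         (use assms in \<open>auto simp: M1_mod_def Gm_def band_mod_def basis_mat_def penc_def of_nat_diff algebra_simps Suc_diff_le\<close>)
  qed
  moreover have "hdim (M1_mod n q l r \<eta>) = hdim (Gm (Suc 0) l r \<eta>)"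
    by (cases \<eta>) (simp_all add: M1_mod_def Gm_def band_mod_def)
  ultimately show ?thesis by (cases "M1_mod n q l r \<eta>"; cases "Gm (Suc 0) l r \<eta>") (simp add: fun_eq_iff)
qed

lemma is_M_Gm:
  assumes "1 \<le> l" "l < n" "is_M n q s l r \<eta> X"
  shows "is_hmod n q X \<and> fiso X (Gm s l r \<eta>)"
  using assms(3)
proof (induction s arbitrary: X rule: less_induct)
  case (less s)
  show ?case
  proof (cases s)
    case 0
    have h: "is_hmod n q X" "hdim X = 0" using less.prems 0 by auto
    have d: "hdim (Gm s l r \<eta>) = 0" "wfm (Gm s l r \<eta>)"
      using 0 by (cases \<eta>; simp add: Gm_def wfm_def band_mod_def)+
    have z: "supp 0 v \<Longrightarrow> v = 0" for v :: "nat \<Rightarrow> 'k" by (simp add: supp_def pointwise)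
    have o: "op M x 0 = 0" for M :: "'k hmod" and x by simp
    have i: "inverses X (Gm s l r \<eta>) (\<lambda>v. 0) (\<lambda>v. 0)"
      unfolding inverses_def hm_def lin_def h(2) d(1) by (auto dest: z simp: o sc_add)
    then show ?thesis using h by (auto simp: fiso_def)
  next
    case (Suc s')
    show ?thesis
    proof (cases s')
      case 0
      have "hmod_iso n q X (M1_mod n q l r \<eta>)" using less.prems Suc 0 by simp
      then show ?thesis using Suc 0 by (simp add: hmod_iso_iff Gm_1 [OF assms(1,2)])
    next
      case (Suc s'')
      have s: "s = Suc (Suc s'')" using \<open>s = Suc s'\<close> Suc by simp
      from less.prems obtain L N f g where a: "is_hmod n q X" "is_M n q s'' l r \<eta> L"
        "is_M n q (Suc s'') l r \<eta> N" "almost_split n q N f (dsum [L, X]) g N" by (auto simp: s)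
      have L: "is_hmod n q L" "fiso L (Gm s'' l r \<eta>)" using less.IH [OF _ a(2)] s by auto
      have N: "fiso N (Gm (Suc s'') l r \<eta>)" using less.IH [OF _ a(3)] s by auto
      have "fiso X (Gm (Suc (Suc s'')) l r \<eta>)"
      proof (cases \<eta>)
        case (Fin y)
        have d: "1 * 1 \<noteq> 0 * (y * q ^ l)" by simp
        show ?thesis using ar_step [OF assms(1,2) d a(4) _ _ L(1) a(1)] L(2) N by (simp add: Gm_def Fin)
      next
        case Infty
        have d: "0 * 0 \<noteq> 1 * (1::'k)" by simp
        show ?thesis using ar_step [OF assms(1,2) d a(4) _ _ L(1) a(1)] L(2) N by (simp add: Gm_def Infty)
      qed
      then show ?thesis using a(1) s by simp
    qed
  qed
qed

end

section \<open>Embeddings of band modules and copies\<close>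

definition indep :: "nat \<Rightarrow> (nat \<Rightarrow> nat \<Rightarrow> 'k::field) \<Rightarrow> bool" where
  "indep s u \<longleftrightarrow> (\<forall>c. lcomb s u c = 0 \<longrightarrow> (\<forall>e<s. c e = 0))"

lemma lin_of_lcomb: "lin F \<Longrightarrow> F (lcomb s u c) = lcomb s (\<lambda>e. F (u e)) c"
  by (simp add: lcomb_def lin_sum linD)

lemma lcomb_cong: "(\<And>e. e < s \<Longrightarrow> u e = u' e) \<Longrightarrow> lcomb s u c = lcomb s u' c"
  unfolding lcomb_def by (rule sum.cong) auto

lemma lcomb_scale: "lcomb s (\<lambda>e. y e \<cdot>\<^sub>f u e) c = lcomb s u (\<lambda>e. c e * y e)"
  by (simp add: lcomb_def)

lemma lcomb_sc: "lcomb s (\<lambda>e. y \<cdot>\<^sub>f u e) c = y \<cdot>\<^sub>f lcomb s u c"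
  by (auto simp: lcomb_def fun_eq_iff sum_fun_apply sc_apply sum_distrib_left mult_ac)

lemma indep_scale:
  assumes "indep s u" "\<And>e. y e \<noteq> 0"
  shows "indep s (\<lambda>e. y e \<cdot>\<^sub>f u e)"
  unfolding indep_def lcomb_scale using assms unfolding indep_def by (metis mult_eq_0_iff)

lemma indep_hom:
  assumes "lin F" "indep s u'" "\<And>e. e < s \<Longrightarrow> F (u e) = \<xi> \<cdot>\<^sub>f u' e" "\<xi> \<noteq> 0"
  shows "indep s u"
  unfolding indep_def
proof (intro allI impI)
  fix c e assume c: "lcomb s u c = 0" and e: "e < s"
  have "F (lcomb s u c) = lcomb s (\<lambda>e. \<xi> \<cdot>\<^sub>f u' e) c"
    unfolding lin_of_lcomb [OF assms(1)] by (rule lcomb_cong) (rule assms(3))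
  then have "\<xi> \<cdot>\<^sub>f lcomb s u' c = 0" by (simp add: c lin_0 [OF assms(1)] lcomb_sc)
  then have "lcomb s u' c = 0" using assms(4) by (simp add: pointwise)
  then show "c e = 0" using assms(2) e by (simp add: indep_def)
qed

context hact
begin

text \<open>Scaling the e-th pair by \<kappa>^e absorbs one factor \<kappa> at g_(e+1) and leaves
  the other at D0. This is how the scalar of the ladder becomes a factor of \<eta>.\<close>

lemma band_rescale_fin:
  assumes "band 1 0 D0 1 m t \<kappa> f g"
  shows "band 1 0 (\<kappa> * D0) 1 m t 1 (\<lambda>e. \<kappa> ^ e \<cdot>\<^sub>f f e) (\<lambda>e. \<kappa> ^ e \<cdot>\<^sub>f g e)"
  using assms unfolding band_def by (auto simp: wti_sc comb_def sc_add mult_ac)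

text \<open>At infinity \<kappa> disappears: g carries one factor \<kappa> more than f, which suits
  both a^(n-m) f_e = g_(e+1) and d f_e = a^(m-1) g_e. Hence the point \<infinity> is fixed by
  scaling.\<close>

lemma band_rescale_inf:
  assumes "band 0 1 1 0 m t \<kappa> f g" "\<kappa> \<noteq> 0"
  shows "band 0 1 1 0 m t 1 (\<lambda>e. inverse \<kappa> ^ e \<cdot>\<^sub>f f e) (\<lambda>e. (\<kappa> * inverse \<kappa> ^ e) \<cdot>\<^sub>f g e)"
proof -
  show ?thesis using assms(1) unfolding band_def
    by (auto simp: wti_sc comb_def sc_add mult_ac) (simp add: assms(2) flip: mult.assoc)
qed

lemma dpow_apow_eq:
  assumes "wti t (1 - t - int m) g" "d g = 0"
  shows "(d ^^ k) ((a ^^ k) g) = (\<Prod>j<k. alpha q (Suc j) m) \<cdot>\<^sub>f g"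
proof (induction k)
  case (Suc k)
  have "int n dvd t + (1 - t - int m) - 1 + int m" by simp
  from d_apow_hw [OF assms(1) this, of "Suc k"] have "d ((a ^^ Suc k) g) = alpha q (Suc k) m \<cdot>\<^sub>f (a ^^ k) g"
    by (simp only: assms(2) lins diff_Suc_1) simp
  then have "(d ^^ Suc k) ((a ^^ Suc k) g) = alpha q (Suc k) m \<cdot>\<^sub>f (d ^^ k) ((a ^^ k) g)"
    by (simp only: funpow_Suc_right [of k d] o_apply linD [OF lin_funpow [OF lin(4)]])
  then show ?case by (simp add: Suc mult_ac)
qed simp

text \<open>One of the two matrices is the identity, so a^(n-m) or d^m maps every f_e to a nonzero
  multiple of g_e.\<close>

lemma band_indep_f:
  assumes B: "band A0 A1 D0 D1 m t \<kappa> f g" and i: "indep s g" and m: "1 \<le> m" "m < n" and \<kappa>: "\<kappa> \<noteq> 0"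
    and AD: "(A0 = 1 \<and> A1 = 0) \<or> (D0 = 1 \<and> D1 = 0)"
  shows "indep s f"
  using AD
proof (elim disjE conjE)
  assume "A0 = 1" "A1 = 0"
  then have *: "(a ^^ (n - m)) (f e) = 1 \<cdot>\<^sub>f g e" for e using B by (simp add: band_def comb_def)
  show ?thesis by (rule indep_hom [OF lin_funpow [OF lin(1)] i *]) simp
next
  assume "D0 = 1" "D1 = 0"
  then have d: "d (f e) = \<kappa> \<cdot>\<^sub>f (a ^^ (m - 1)) (g e)" for e using B by (simp add: band_def comb_def)
  have e: "(d ^^ (m - 1)) (d (f e)) = (\<kappa> * (\<Prod>j<m - 1. alpha q (Suc j) m)) \<cdot>\<^sub>f g e" for e
    unfolding d linD [OF lin_funpow [OF lin(4)]]
    using dpow_apow_eq [of t m "g e" "m - 1"] B by (simp add: band_def)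
  have "(\<Prod>j<m - 1. alpha q (Suc j) m) \<noteq> 0"
    using m alpha_neq_0' [of _ m] by (auto simp: prod_zero_iff)
  then have "\<kappa> * (\<Prod>j<m - 1. alpha q (Suc j) m) \<noteq> 0" using \<kappa> by simp
  from indep_hom [OF lin_comp [OF lin_funpow [OF lin(4)] lin(4)] i e this] show ?thesis .
qed

end

lemma cyc_pow0: "lin F \<Longrightarrow> (F ^^ k) v = 0 \<Longrightarrow> k \<le> i \<Longrightarrow> (F ^^ i) v = 0"
proof -
  assume F: "lin F" "(F ^^ k) v = 0" "k \<le> i"
  have "(F ^^ i) v = (F ^^ (i - k)) ((F ^^ k) v)"
    using F(3) by (simp only: o_apply [symmetric, of "F ^^ _" "F ^^ _"] funpow_add [symmetric]) simp
  then show ?thesis using F by (simp add: lin_0 [OF lin_funpow])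
qed

context qroot
begin

context
  fixes m :: nat and t :: int and s :: nat and A0 A1 D0 D1 :: 'k
  assumes m: "1 \<le> m" "m < n"
begin

abbreviation "GB \<equiv> band_mod n q s m t A0 A1 D0 D1"

text \<open>The model is presented by the relations of \<open>band\<close>: the images of its basis
  vectors are powers of a applied to f and g. That these vanish past s, and that a^m g = 0, makes
  the formulas match the zero conventions of \<open>bv\<close>.\<close>

lemma band_hom:
  assumes W: "hact n q (op W Ga) (op W Gb) (op W Gc) (op W Gd)" "wfm W"
    and sup: "\<And>e. supp (hdim W) (f e)" "\<And>e. supp (hdim W) (g e)"
    and z: "\<And>e. s \<le> e \<Longrightarrow> f e = 0" "\<And>e. s \<le> e \<Longrightarrow> g e = 0"
    and B: "hact.band n q (op W Ga) (op W Gb) (op W Gc) (op W Gd) A0 A1 D0 D1 m t 1 f g"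
  shows "\<exists>F. hm GB W F \<and> (\<forall>e. F (bv n s 0 e) = f e) \<and> (\<forall>e. F (bv n s (n - m) e) = g e)"
proof -
  interpret hact n q "op W Ga" "op W Gb" "op W Gc" "op W Gd" by (rule W)
  define h where "h = (\<lambda>p e. if p < n - m then (op W Ga ^^ p) (f e) else (op W Ga ^^ (p - (n - m))) (g e))"
  define F where "F = lcomb (n * s) (\<lambda>j. h (j div s) (j mod s))"
  have lF: "lin F" by (simp add: F_def lin_lcomb)
  have g: "wti t (1 - t - int m) (g e)" "op W Gd (g e) = 0" "(op W Ga ^^ m) (g e) = 0"
    and f: "wti (t + int m) (1 - t) (f e)" "(op W Ga ^^ (n - m)) (f e) = comb A0 A1 g e"
      "op W Gd (f e) = (op W Ga ^^ (m - 1)) (comb D0 D1 g e)" for e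
    using B by (auto simp: band_def)
  have h0: "h p e = 0" if "s \<le> e \<or> n \<le> p" for p e
    using that z [of e] cyc_pow0 [OF lin(1) g(3), of "p - (n - m)" e] m
    by (auto simp: h_def lin_0 [OF lin_funpow [OF lin(1)]])
  have Fb: "F (bv n s p e) = h p e" for p e
  proof (cases "p < n \<and> e < s")
    case True
    then have "p * s + e < n * s" by (simp add: idx_less)
    then show ?thesis using True by (simp add: F_def bv_def)
  next
    case False
    then show ?thesis using h0 [of e p] by (auto simp: not_less lin_0 [OF lF])
  qed
  have wh: "op W Gb (h p e) = q powi (t + int m + int p) \<cdot>\<^sub>f h p e" "op W Gc (h p e) = q powi (int p + 1 - t) \<cdot>\<^sub>f h p e" for p e
  proof -
    have "wti (t + int m + int p) (int p + 1 - t) (h p e)"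
    proof (cases "p < n - m")
      case True
      show ?thesis unfolding h_def using True by (simp) (rule wti_cong [OF wti_apow [OF f(1)]]; simp)
    next
      case False
      have "int n dvd t + int (p - (n - m)) - (t + int m + int p)" "int n dvd 1 - t - int m + int (p - (n - m)) - (int p + 1 - t)"
        using False m by (simp_all add: of_nat_diff)
      from wti_cong [OF wti_apow [OF g(1)] this] show ?thesis unfolding h_def using False by simp
    qed
    then show "op W Gb (h p e) = q powi (t + int m + int p) \<cdot>\<^sub>f h p e" "op W Gc (h p e) = q powi (int p + 1 - t) \<cdot>\<^sub>f h p e"
      by (rule wtiD)+
  qed
  have ah: "op W Ga (h p e) = (if Suc p = n - m then comb A0 A1 (h (Suc p)) e else h (Suc p) e)" for p e
  proof -
    consider "Suc p < n - m" | "Suc p = n - m" | "n - m \<le> p" by linarith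
    then show ?thesis
    proof cases
      case 2
      then have "op W Ga (h p e) = (op W Ga ^^ (n - m)) (f e)" by (simp add: h_def flip: 2)
      moreover have "h (Suc p) e = g e" for e using 2 by (simp add: h_def)
      ultimately show ?thesis using 2 by (simp add: f comb_def)
    next
      case 3
      then show ?thesis by (simp add: h_def Suc_diff_le)
    qed (simp add: h_def)
  qed
  have agz: "(op W Ga ^^ k) (comb D0 D1 g e) = 0" if "m \<le> k" for k e
    using cyc_pow0 [OF lin(1) g(3) that] by (simp add: lin_comb [OF lin_funpow [OF lin(1)]]) (simp add: comb_def)
  have dh: "op W Gd (h p e) = (if p = 0 then comb D0 D1 (h (n - 1)) e
    else (if p < n - m then alpha q p (n - m) else if p < n then alpha q (p - (n - m)) m else 0) \<cdot>\<^sub>f h (p - 1) e)" for p e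
  proof -
    consider "p = 0" | "0 < p" "p < n - m" | "n - m \<le> p" "p < n" | "n \<le> p" by linarith
    then show ?thesis
    proof cases
      case 1
      have "n - 1 - (n - m) = m - 1" "\<not> n - 1 < n - m" using m by auto
      then have "h (n - 1) e = (op W Ga ^^ (m - 1)) (g e)" for e by (simp add: h_def)
      then have "comb D0 D1 (h (n - 1)) e = (op W Ga ^^ (m - 1)) (comb D0 D1 g e)"
        by (simp add: comb_def)
      then show ?thesis using 1 m by (simp add: h_def f)
    next
      case 2
      have "int n dvd t + int m + (1 - t) - 1 + int (n - m)" using m by (simp add: of_nat_diff)
      note D = d_apow_hw [OF f(1) this, of p e]
      \<comment> \<open>For p > 0 the term a^p d f contains a^m applied to a combination of g and
        drops out, so the pencil D acts on block 0 only.\<close>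
      have "(op W Ga ^^ p) ((op W Ga ^^ (m - 1)) (comb D0 D1 g e)) = (op W Ga ^^ (p + (m - 1))) (comb D0 D1 g e)"
        by (simp add: funpow_add)
      also have "\<dots> = 0" by (rule agz) (use 2 in simp)
      finally have "op W Gd ((op W Ga ^^ p) (f e)) = alpha q p (n - m) \<cdot>\<^sub>f (op W Ga ^^ (p - 1)) (f e)"
        using D by (simp add: f(3))
      moreover have "p - 1 < n - m" using 2 by linarith
      ultimately show ?thesis using 2 by (simp add: h_def)
    next
      case 3
      have "int n dvd t + (1 - t - int m) - 1 + int m" by simp
      note D = d_apow_hw [OF g(1) this, of "p - (n - m)" e]
      show ?thesis
      proof (cases "p = n - m")
        case True
        then show ?thesis using 3 m by (simp add: h_def g)
      next
        case False
        then have "\<not> p - 1 < n - m" "p - (n - m) - 1 = p - 1 - (n - m)" using 3 by auto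
        then show ?thesis using D 3 m by (simp add: h_def g)
      qed
    next
      case 4
      then show ?thesis using h0 m by simp
    qed
  qed
  have "hm GB W F"
  proof (rule hmI_uv [OF wfm_GG W(2) lF])
    fix j assume "j < hdim GB"
    then have j: "uv j = bv n s (j div s) (j mod s)" by (simp add: uv_bv)
    show "supp (hdim W) (F (uv j))" unfolding j Fb h_def using sup by (simp add: op_funpow_supp [OF W(2)])
    show "F (op GB x (uv j)) = op W x (F (uv j))" for x
      unfolding j Fb
      by (cases x) (simp_all only: op_Ga [OF m] op_Gb [OF m] op_Gc [OF m] op_Gd [OF m] wh ah dh if_distrib [of F] lin_comb [OF lF] linD [OF lF] Fb)
  qed
  moreover have "h 0 e = f e" "h (n - m) e = g e" for e using m by (simp_all add: h_def)
  ultimately show ?thesis using Fb by metis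
qed

lemma diagb_GG: "diagb GB"
  unfolding diagb_def by (intro exI [of _ "\<lambda>j. q powi (t + int m + int (j div s))"]) (simp add: uv_bv op_Gb [OF m])

lemma weight_GG:
  assumes nd: "A0 * D1 \<noteq> A1 * D0" and v: "supp (n * s) v" and b: "op GB Gb v = \<beta> \<cdot>\<^sub>f v" and v0: "v \<noteq> 0"
  shows "\<exists>p c. p < n \<and> \<beta> = q powi (t + int m + int p) \<and> v = lcomb s (bv n s p) c"
proof -
  have l: "lin (\<lambda>v j. q powi (t + int m + int (j div s)) * v j)" by (auto simp: lin_def pointwise algebra_simps)
  have "op GB Gb v = (\<lambda>j. q powi (t + int m + int (j div s)) * v j)"
  proof (rule lin_eq_on_supp [OF lin_mapp l _ v])
    fix j assume j: "j < n * s"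
    show "op GB Gb (uv j) = (\<lambda>i. q powi (t + int m + int (i div s)) * uv j i)"
      unfolding uv_bv [OF j] op_Gb [OF m] unfolding uv_bv [OF j, symmetric] by (auto simp: fun_eq_iff sc_apply uv_def)
  qed
  then have e: "q powi (t + int m + int (j div s)) * v j = \<beta> * v j" for j using b by (metis sc_apply)
  obtain j where j: "v j \<noteq> 0" using v0 by (auto simp: fun_eq_iff zero_fun_apply)
  then have "j < n * s" using v by (metis supp_def not_less)
  then have p: "j div s < n" using idx_less' by blast
  have \<beta>: "\<beta> = q powi (t + int m + int (j div s))" using e [of j] j by simp
  have "v = lcomb s (bv n s (j div s)) (\<lambda>i. v (j div s * s + i))"
    by (rule weight_space [OF m nd v _ p]) (use b in \<open>simp add: \<beta>\<close>)
  then show ?thesis using p \<beta> by blast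
qed

text \<open>Away from the blocks 0 and n - m, d maps a block to the preceding one by a nonzero
  constant and is injective there. Block 0 remains in the list because d can kill vectors in it when
  its pencil is singular, for instance f_(s-1) if \<eta> = 0.\<close>

lemma hw_GG:
  assumes nd: "A0 * D1 \<noteq> A1 * D0" and v: "supp (n * s) v" and b: "op GB Gb v = \<beta> \<cdot>\<^sub>f v" and v0: "v \<noteq> 0" and d: "op GB Gd v = 0"
  shows "\<exists>c. (v = lcomb s (bv n s (n - m)) c \<and> \<beta> = q powi t) \<or> (v = lcomb s (bv n s 0) c \<and> \<beta> = q powi (t + int m))"
proof -
  obtain p c where p: "p < n" and \<beta>: "\<beta> = q powi (t + int m + int p)" and ve: "v = lcomb s (bv n s p) c"
    using weight_GG [OF nd v b v0] by blast
  consider "p = 0" | "p = n - m" | "0 < p" "p \<noteq> n - m" by blast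
  then show ?thesis
  proof cases
    case 1
    then show ?thesis using \<beta> ve by auto
  next
    case 2
    have "q powi (t + int m + int p) = q powi t" using 2 m by (intro qpowi_cong) (simp add: of_nat_diff)
    then show ?thesis using \<beta> ve 2 by metis
  next
    case 3
    define A where "A = (if p < n - m then alpha q p (n - m) else if p < n then alpha q (p - (n - m)) m else 0)"
    have A: "A \<noteq> 0"
    proof (cases "p < n - m")
      case True
      then show ?thesis using 3 alpha_neq_0' [of p "n - m"] by (simp add: A_def)
    next
      case False
      then have "0 < p - (n - m)" "p - (n - m) < m" using 3 p m by auto
      then show ?thesis using False p m alpha_neq_0' [of "p - (n - m)" m] by (simp add: A_def)
    qed
    have "op GB Gd v = lcomb s (\<lambda>e. A \<cdot>\<^sub>f bv n s (p - 1) e) c"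
      unfolding ve lin_of_lcomb [OF lin_mapp] by (rule lcomb_cong) (use 3 in \<open>simp add: op_Gd [OF m] A_def\<close>)
    then have "A \<cdot>\<^sub>f lcomb s (bv n s (p - 1)) c = 0" using d by (simp add: lcomb_sc)
    then have z: "lcomb s (bv n s (p - 1)) c = 0" using A by (simp add: pointwise)
    have "c e = 0" if "e < s" for e
      using lcomb_bv_coord [OF m nd, of "p - 1" e s c] that p by (simp only: z zero_fun_apply)
    then have "v = 0" unfolding ve lcomb_def by simp
    then show ?thesis using v0 by simp
  qed
qed

lemma emb_GG:
  assumes nd: "A0 * D1 \<noteq> A1 * D0" and W: "hact n q (op W Ga) (op W Gb) (op W Gc) (op W Gd)" "wfm W" "diagb W"
    and sup: "\<And>e. supp (hdim W) (f e)" "\<And>e. supp (hdim W) (g e)"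
    and z: "\<And>e. s \<le> e \<Longrightarrow> f e = 0" "\<And>e. s \<le> e \<Longrightarrow> g e = 0"
    and B: "hact.band n q (op W Ga) (op W Gb) (op W Gc) (op W Gd) A0 A1 D0 D1 m t 1 f g"
    and ind: "indep s f" "indep s g"
  shows "emb n q W GB {q powi t, q powi (t + int m)}"
proof -
  obtain F where F: "hm GB W F" "\<And>e. F (bv n s 0 e) = f e" "\<And>e. F (bv n s (n - m) e) = g e"
    using band_hom [OF W(1,2) sup z B] by blast
  note lF = hmD(1) [OF F(1)]
  \<comment> \<open>A nonzero combination of any family has a nonzero coefficient below s, so the
    same coefficients give a nonzero combination of an independent family.\<close>
  have nz: "lcomb s u c \<noteq> 0" if "indep s u" "lcomb s u' c \<noteq> 0" for u u' :: "nat \<Rightarrow> nat \<Rightarrow> 'k" and c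
  proof
    assume "lcomb s u c = 0"
    then have "\<forall>e<s. c e = 0" using that(1) by (simp add: indep_def)
    then have "lcomb s u' c = 0" by (simp add: lcomb_def)
    then show False using that(2) by simp
  qed
  have "finj GB F"
  proof (rule hw_inj [OF is_hmod_GG [OF m] q0 W(2) F(1) diagb_GG W(3)])
    fix \<beta> v assume v: "supp (hdim GB) v" "v \<noteq> 0" "op GB Gd v = 0" "op GB Gb v = \<beta> \<cdot>\<^sub>f v"
    have s: "supp (n * s) v" using v(1) by simp
    obtain c where "v = lcomb s (bv n s (n - m)) c \<or> v = lcomb s (bv n s 0) c" using hw_GG [OF nd s v(4,2,3)] by blast
    then show "F v \<noteq> 0"
      using nz [OF ind(1), of "bv n s 0" c] nz [OF ind(2), of "bv n s (n - m)" c] v(2)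
      by (elim disjE) (simp_all add: lin_of_lcomb [OF lF] F(2,3))
  qed
  moreover have "hws GB {q powi t, q powi (t + int m)}" unfolding hws_def
  proof (intro allI impI, elim conjE)
    fix \<beta> v assume v: "supp (hdim GB) v" "v \<noteq> 0" "op GB Gd v = 0" "op GB Gb v = \<beta> \<cdot>\<^sub>f v"
    have s: "supp (n * s) v" using v(1) by simp
    show "\<beta> \<in> {q powi t, q powi (t + int m)}" using hw_GG [OF nd s v(4,2,3)] by blast
  qed
  ultimately show ?thesis using F(1) unfolding emb_def
    by (intro conjI is_hmod_GG [OF m] diagb_GG exI [of _ F])
qed

end

end

section \<open>Blocks of coordinates, and copies of a module\<close>

definition cmp :: "nat \<Rightarrow> nat \<Rightarrow> (nat \<Rightarrow> 'k::field) \<Rightarrow> nat \<Rightarrow> 'k" where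
  "cmp m e v = (\<lambda>i. if i < m then v (e * m + i) else 0)"

lemma lin_cmp: "lin (cmp m e)" by (auto simp: lin_def cmp_def fun_eq_iff pointwise)
lemma supp_cmp [simp]: "supp m (cmp m e v)" by (simp add: supp_def cmp_def)

lemma cmp_ext:
  assumes "supp (k * m) v" "supp (k * m) w" "\<And>e. e < k \<Longrightarrow> cmp m e v = cmp m e w"
  shows "v = w"
proof
  fix i
  show "v i = w i"
  proof (cases "i < k * m")
    case True
    note d = idx_less' [OF True]
    from assms(3) [of "i div m"] d have "cmp m (i div m) v (i mod m) = cmp m (i div m) w (i mod m)" by simp
    then show ?thesis using d by (simp add: cmp_def)
  next
    case False
    then show ?thesis using assms(1,2) by (simp add: supp_def)
  qed
qed

lemma cmp_uv:
  assumes "j < k * m"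
  shows "cmp m e (uv j) = (if e = j div m then uv (j mod m) else 0)"
proof
  fix i
  show "cmp m e (uv j) i = (if e = j div m then uv (j mod m) else 0) i"
  proof (cases "i < m")
    case True
    have "(e * m + i = j) = (j div m = e \<and> j mod m = i)" using idx_iff [OF True, of j e] by metis
    then show ?thesis using True by (auto simp: cmp_def uv_def zero_fun_apply)
  next
    case False
    then show ?thesis using idx_less' [OF assms] by (auto simp: cmp_def uv_def zero_fun_apply)
  qed
qed

lemma cmp_jn:
  assumes "supp m a"
  shows "cmp m 0 (jn m a b) = a" "cmp m (Suc e) (jn m a b) = cmp m e b"
  using assms by (auto simp: cmp_def jn_def fun_eq_iff supp_def)

lemma cmp_lo_hi: "lo m v = cmp m 0 v" "cmp m e (hi m v) = cmp m (Suc e) v"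
  by (auto simp: cmp_def lo_def hi_def fun_eq_iff ac_simps)

lemma hdim_copies [simp]: "hdim (copies s X) = s * hdim X"
  by (induction s) (simp_all add: copies_def)

lemma cmp_copies:
  assumes "wfm X" "e < s"
  shows "cmp (hdim X) e (op (copies s X) x v) = op X x (cmp (hdim X) e v)"
  using assms(2)
proof (induction s arbitrary: e v)
  case (Suc s)
  have w: "wfm (dsum (replicate s X))" by (rule wfm_dsum) (use assms in auto)
  have o: "op (copies (Suc s) X) x v = jn (hdim X) (op X x (lo (hdim X) v)) (op (copies s X) x (hi (hdim X) v))"
    using op_dsum_Cons [OF assms(1) w] by (simp add: copies_def)
  have s: "supp (hdim X) (op X x (lo (hdim X) v))" using assms(1) by simp
  show ?case
  proof (cases e)
    case 0
    then show ?thesis by (simp add: o cmp_jn(1) [OF s]) (simp add: cmp_lo_hi)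
  next
    case e: (Suc e')
    have "e' < s" using Suc.prems e by simp
    from Suc.IH [OF this] show ?thesis unfolding e o cmp_jn(2) [OF s] by (simp only: cmp_lo_hi(2))
  qed
qed simp

text \<open>Copy e is mapped by its own homomorphism F e. The highest weight vectors of X for a
  given eigenvalue are multiples of u \<beta>, so a highest weight vector of the sum is given by
  coefficients c e, and its image is the combination of the F e (u \<beta>) with these coefficients,
  nonzero by independence.\<close>

lemma emb_copies:
  fixes X :: "'k::field hmod"
  assumes X: "is_hmod n q X" "diagb X" and q: "q \<noteq> 0" and W: "wfm W" "diagb W"
    and hw: "\<And>\<beta> v. supp (hdim X) v \<Longrightarrow> v \<noteq> 0 \<Longrightarrow> op X Gd v = 0 \<Longrightarrow> op X Gb v = \<beta> \<cdot>\<^sub>f v \<Longrightarrow> \<beta> \<in> S \<and> (\<exists>c. v = c \<cdot>\<^sub>f u \<beta>)"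
    and F: "\<And>e. hm X W (F e)" and ind: "\<And>\<beta>. \<beta> \<in> S \<Longrightarrow> indep s (\<lambda>e. F e (u \<beta>))"
  shows "emb n q W (copies s X) S"
proof -
  let ?C = "copies s X" and ?m = "hdim X"
  note wX = is_hmod_wfm [OF X(1)]
  note lF = hmD(1) [OF F]
  have hC: "is_hmod n q ?C" unfolding copies_def by (rule is_hmod_dsum) (use X(1) in auto)
  note wC = is_hmod_wfm [OF hC]
  note cop = cmp_copies [OF wX]
  have sC: "supp (s * ?m) (op ?C x v)" for x v using wC by (metis hdim_copies supp_act)
  obtain bx where bx: "\<And>j. j < ?m \<Longrightarrow> op X Gb (uv j) = bx j \<cdot>\<^sub>f uv j" using X(2) by (auto simp: diagb_def)
  have dC: "diagb ?C" unfolding diagb_def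
  proof (intro exI [of _ "\<lambda>j. bx (j mod ?m)"] allI impI)
    fix j assume j: "j < hdim ?C"
    then have j': "j < s * ?m" by simp
    note d = idx_less' [OF j']
    show "op ?C Gb (uv j) = bx (j mod ?m) \<cdot>\<^sub>f uv j"
    proof (rule cmp_ext [OF sC])
      show "supp (s * ?m) (bx (j mod ?m) \<cdot>\<^sub>f uv j)" using j' by simp
      fix e assume "e < s"
      then show "cmp ?m e (op ?C Gb (uv j)) = cmp ?m e (bx (j mod ?m) \<cdot>\<^sub>f uv j)"
        using d bx [of "j mod ?m"] by (simp add: cop linD [OF lin_cmp] cmp_uv [OF j'])
    qed
  qed
  define H where "H = (\<lambda>v. \<Sum>e<s. F e (cmp ?m e v))"
  have lH: "lin H" unfolding H_def lin_def
    by (auto simp: linD [OF lF] linD [OF lin_cmp] fun_eq_iff sum_fun_apply pointwise sum.distrib sum_distrib_left)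
  have hH: "hm ?C W H" unfolding hm_def
  proof (intro conjI allI impI lH)
    fix v x
    show "supp (hdim W) (H v)" unfolding H_def by (intro supp_sum hmD(2) [OF F] supp_cmp)
    show "H (op ?C x v) = op W x (H v)" unfolding H_def lin_sum [OF lin_mapp]
      by (rule sum.cong) (simp_all add: cop hmD(3) [OF F])
  qed
  have comp: "\<beta> \<in> S \<and> (\<exists>c. (\<forall>e<s. cmp ?m e v = c e \<cdot>\<^sub>f u \<beta>) \<and> (\<exists>e<s. c e \<noteq> 0))"
    if v: "supp (hdim ?C) v" "v \<noteq> 0" "op ?C Gd v = 0" "op ?C Gb v = \<beta> \<cdot>\<^sub>f v" for \<beta> v
  proof -
    have d0: "op X Gd (cmp ?m e v) = 0" "op X Gb (cmp ?m e v) = \<beta> \<cdot>\<^sub>f cmp ?m e v" if "e < s" for e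
      using cop [OF that, of Gd v] cop [OF that, of Gb v] v(3,4) by (simp_all add: lin_0 [OF lin_cmp] linD [OF lin_cmp])
    have ex: "\<exists>e<s. cmp ?m e v \<noteq> 0"
    proof (rule ccontr)
      assume "\<not> ?thesis"
      then have "v = 0" using v(1) by (intro cmp_ext [of s ?m v 0]) (simp_all add: lin_0 [OF lin_cmp])
      then show False using v(2) by simp
    qed
    then obtain e0 where e0: "e0 < s" "cmp ?m e0 v \<noteq> 0" by blast
    have \<beta>: "\<beta> \<in> S" using hw [OF supp_cmp e0(2) d0 [OF e0(1)]] by blast
    have "\<exists>c. cmp ?m e v = c \<cdot>\<^sub>f u \<beta>" if "e < s" for e
    proof (cases "cmp ?m e v = 0")
      case True
      then show ?thesis by (intro exI [of _ 0]) simp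
    next
      case False
      then show ?thesis using hw [OF supp_cmp False d0 [OF that]] by blast
    qed
    then have "\<forall>e. \<exists>c. e < s \<longrightarrow> cmp ?m e v = c \<cdot>\<^sub>f u \<beta>" by blast
    then obtain c where c: "\<forall>e. e < s \<longrightarrow> cmp ?m e v = c e \<cdot>\<^sub>f u \<beta>" by (rule choice [THEN exE])
    moreover have "c e0 \<noteq> 0" using c e0 by auto
    ultimately show ?thesis using \<beta> e0(1) by blast
  qed
  have "finj ?C H"
  proof (rule hw_inj [OF hC q W(1) hH dC W(2)])
    fix \<beta> v assume v: "supp (hdim ?C) v" "v \<noteq> 0" "op ?C Gd v = 0" "op ?C Gb v = \<beta> \<cdot>\<^sub>f v"
    obtain c where \<beta>: "\<beta> \<in> S" and c: "\<forall>e<s. cmp ?m e v = c e \<cdot>\<^sub>f u \<beta>" "\<exists>e<s. c e \<noteq> 0"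
      using comp [OF v] by blast
    have "H v = lcomb s (\<lambda>e. F e (u \<beta>)) c" unfolding H_def lcomb_def
      by (rule sum.cong) (simp_all add: c(1) linD [OF lF])
    then show "H v \<noteq> 0" using ind [OF \<beta>] c(2) unfolding indep_def by metis
  qed
  moreover have "hws ?C S" unfolding hws_def using comp by blast
  ultimately show ?thesis using hC dC hH unfolding emb_def by blast
qed

section \<open>The tensor product with a simple module\<close>

lemma hdim_tensor [simp]: "hdim (tensor M N) = hdim M * hdim N" by (simp add: tensor_def)

lemma kron_carrier: "A \<in> carrier_mat l l \<Longrightarrow> B \<in> carrier_mat m m \<Longrightarrow> kron A B \<in> carrier_mat (l * m) (l * m)"
  by (auto simp: kron_def)

lemma wfm_tensor: "wfm M \<Longrightarrow> wfm N \<Longrightarrow> wfm (tensor M N)"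
  unfolding wfm_def
proof (intro allI)
  fix x assume "\<forall>x. act M x \<in> carrier_mat (hdim M) (hdim M)" "\<forall>x. act N x \<in> carrier_mat (hdim N) (hdim N)"
  then show "act (tensor M N) x \<in> carrier_mat (hdim (tensor M N)) (hdim (tensor M N))"
    by (cases x) (auto simp: tensor_def intro!: kron_carrier add_carrier_mat)
qed

text \<open>Block k of a vector of V \<otimes> N is its component along the k-th basis vector of V,
  so the Kronecker product acts on blocks by the rows of A.\<close>

lemma cmp_kron:
  fixes A B :: "'k::field mat"
  assumes A: "A \<in> carrier_mat l l" and B: "B \<in> carrier_mat m m" and k: "k < l"
  shows "cmp m k (mapp (kron A B) w) = (\<Sum>k'<l. A $$ (k, k') \<cdot>\<^sub>f mapp B (cmp m k' w))"
proof
  fix i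
  show "cmp m k (mapp (kron A B) w) i = (\<Sum>k'<l. A $$ (k, k') \<cdot>\<^sub>f mapp B (cmp m k' w)) i"
  proof (cases "i < m")
    case False
    then show ?thesis using B by (simp add: cmp_def sum_fun_apply sc_apply mapp_def)
  next
    case i: True
    let ?f = "\<lambda>j. A $$ (k, j div m) * B $$ (i, j mod m) * w j"
    have ki: "k * m + i < l * m" by (rule idx_less [OF k i])
    have "cmp m k (mapp (kron A B) w) i = (\<Sum>j<l * m. kron A B $$ (k * m + i, j) * w j)"
      using A B i ki by (simp add: cmp_def mapp_def kron_def)
    also have "\<dots> = (\<Sum>j<l * m. ?f j)"
      using A B i ki by (intro sum.cong) (auto simp: kron_def)
    also have "\<dots> = (\<Sum>k'<l. sum ?f {k' * m..<k' * m + m})" by (rule sum.nat_group [symmetric])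
    also have "\<dots> = (\<Sum>k'<l. \<Sum>j<m. A $$ (k, k') * (B $$ (i, j) * w (k' * m + j)))"
    proof (rule sum.cong [OF refl])
      fix k' assume "k' \<in> {..<l}"
      have "sum ?f {k' * m..<k' * m + m} = (\<Sum>j = 0..<m. ?f (j + k' * m))"
        using sum.shift_bounds_nat_ivl [of ?f 0 "k' * m" m] by (simp add: add.commute)
      also have "\<dots> = (\<Sum>j<m. A $$ (k, k') * (B $$ (i, j) * w (k' * m + j)))"
        by (rule sum.cong) (auto simp: mult.assoc add.commute)
      finally show "sum ?f {k' * m..<k' * m + m} = (\<Sum>j<m. A $$ (k, k') * (B $$ (i, j) * w (k' * m + j)))" .
    qed
    also have "\<dots> = (\<Sum>k'<l. A $$ (k, k') \<cdot>\<^sub>f mapp B (cmp m k' w)) i"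
      using B i by (simp add: sum_fun_apply sc_apply mapp_def cmp_def sum_distrib_left)
    finally show ?thesis .
  qed
qed

lemma sum_delta_sc:
  fixes F :: "nat \<Rightarrow> nat \<Rightarrow> 'k::field"
  shows "(\<Sum>k'<l. (if k' = K then x k' else 0) \<cdot>\<^sub>f F k') = (if K < l then x K \<cdot>\<^sub>f F K else 0)"
proof
  fix i
  have "(\<Sum>k'<l. (if k' = K then x k' else 0) \<cdot>\<^sub>f F k') i = (\<Sum>k'<l. if k' = K then x k' * F k' i else 0)"
    unfolding sum_fun_apply by (rule sum.cong) (auto simp: sc_apply)
  also have "\<dots> = (if K < l then x K * F K i else 0)" by simp
  finally show "(\<Sum>k'<l. (if k' = K then x k' else 0) \<cdot>\<^sub>f F k') i = (if K < l then x K \<cdot>\<^sub>f F K else 0) i"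
    by (simp add: sc_apply zero_fun_apply)
qed

section \<open>The action on V(l,r) \<otimes> N in components, and the ladder maps\<close>

context qroot
begin

context
  fixes N :: "'k hmod" and r :: int
  assumes N: "is_hmod n q N"
begin

abbreviation "TW l \<equiv> tensor (V_mod q l r) N"
abbreviation "cm \<equiv> cmp (hdim N)"

text \<open>The component that a, acting on the left factor, moves to position k; it is zero at k =
  0 because v_1 is not hit by a.\<close>

definition prv :: "nat \<Rightarrow> (nat \<Rightarrow> 'k) \<Rightarrow> nat \<Rightarrow> 'k" where
  "prv k w = (if k = 0 then 0 else cm (k - 1) w)"

lemma wN: "wfm N" by (rule is_hmod_wfm [OF N])
lemma wTW: "wfm (TW l)" by (rule wfm_tensor [OF wfm_V wN])
lemma supp_prv: "supp (hdim N) (prv k w)" by (simp add: prv_def)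

lemma hact_N: "hact n q (op N Ga) (op N Gb) (op N Gc) (op N Gd)" by (rule is_hmod_hact [OF qroot_axioms N])

lemma supp_TW: "supp (l * hdim N) (op (TW l) x v)" using supp_act [OF wTW, of l x v] by simp

text \<open>The comultiplication in components. In the formula for d the component at index l does
  not exist, but its coefficient \<alpha>_l(l) is zero, so the last index needs no separate
  case.\<close>

lemma cm_TW:
  assumes k: "k < l"
  shows "cm k (op (TW l) Ga w) = op N Gb (prv k w) + op N Ga (cm k w)"
    "cm k (op (TW l) Gb w) = q powi (r + int k) \<cdot>\<^sub>f op N Gb (cm k w)"
    "cm k (op (TW l) Gc w) = q powi (int k + 1 - r - int l) \<cdot>\<^sub>f op N Gc (cm k w)"
    "cm k (op (TW l) Gd w) = op N Gc (alpha q (Suc k) l \<cdot>\<^sub>f cm (Suc k) w) + op N Gd (cm k w)"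
proof -
  let ?D = "hdim N"
  have aN: "act N x \<in> carrier_mat ?D ?D" for x using wN by simp
  have aV: "act (V_mod q l r) x \<in> carrier_mat l l" for x using wfmD [OF wfm_V, of q l r x] by simp
  have one: "1\<^sub>m l \<in> carrier_mat l l" by simp
  note K = cmp_kron [OF aV aN k] cmp_kron [OF one aN k]
  have I: "(\<Sum>k'<l. 1\<^sub>m l $$ (k, k') \<cdot>\<^sub>f F k') = F k" for F :: "nat \<Rightarrow> nat \<Rightarrow> 'k"
  proof -
    have "(\<Sum>k'<l. 1\<^sub>m l $$ (k, k') \<cdot>\<^sub>f F k') = (\<Sum>k'<l. (if k' = k then 1 else 0) \<cdot>\<^sub>f F k')"
      using k by (intro sum.cong) auto
    then show ?thesis using k by (simp only: sum_delta_sc) simp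
  qed
  have E: "(\<Sum>k'<l. act (V_mod q l r) x $$ (k, k') \<cdot>\<^sub>f F k') = (if K < l then \<xi> \<cdot>\<^sub>f F K else 0)"
    if "\<And>k'. k' < l \<Longrightarrow> act (V_mod q l r) x $$ (k, k') = (if k' = K then \<xi> else 0)" for x K \<xi> and F :: "nat \<Rightarrow> nat \<Rightarrow> 'k"
  proof -
    have "(\<Sum>k'<l. act (V_mod q l r) x $$ (k, k') \<cdot>\<^sub>f F k') = (\<Sum>k'<l. (if k' = K then \<xi> else 0) \<cdot>\<^sub>f F k')"
      using that by (intro sum.cong) auto
    then show ?thesis by (simp only: sum_delta_sc [of K "\<lambda>_. \<xi>"])
  qed
  note V = V_mod_def basis_mat_def
  have T: "act (TW l) Ga = kron (act (V_mod q l r) Ga) (act N Gb) + kron (1\<^sub>m l) (act N Ga)"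
    "act (TW l) Gb = kron (act (V_mod q l r) Gb) (act N Gb)"
    "act (TW l) Gc = kron (act (V_mod q l r) Gc) (act N Gc)"
    "act (TW l) Gd = kron (act (V_mod q l r) Gd) (act N Gc) + kron (1\<^sub>m l) (act N Gd)"
    by (simp_all add: tensor_def)
  note P = mapp_add_mat [OF kron_carrier [OF aV aN] kron_carrier [OF one aN]] linD(1) [OF lin_cmp]
  show "cm k (op (TW l) Ga w) = op N Gb (prv k w) + op N Ga (cm k w)"
  proof (cases k)
    case 0
    have "(\<Sum>k'<l. act (V_mod q l r) Ga $$ (k, k') \<cdot>\<^sub>f F k') = 0" for F :: "nat \<Rightarrow> nat \<Rightarrow> 'k"
      using k 0 by (intro sum.neutral) (auto simp: V)
    then show ?thesis unfolding T P K I by (simp add: prv_def 0)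
  next
    case (Suc j)
    have "act (V_mod q l r) Ga $$ (k, k') = (if k' = j then 1 else 0)" if "k' < l" for k'
      using that k Suc by (auto simp: V)
    from E [OF this] show ?thesis unfolding T P K I using k Suc by (simp add: prv_def)
  qed
  have "act (V_mod q l r) Gb $$ (k, k') = (if k' = k then q powi (r + int k) else 0)" if "k' < l" for k'
    using that k by (auto simp: V)
  from E [OF this] show "cm k (op (TW l) Gb w) = q powi (r + int k) \<cdot>\<^sub>f op N Gb (cm k w)"
    unfolding T K using k by simp
  have "act (V_mod q l r) Gc $$ (k, k') = (if k' = k then q powi (int k + 1 - r - int l) else 0)" if "k' < l" for k'
    using that k by (auto simp: V algebra_simps)
  from E [OF this] show "cm k (op (TW l) Gc w) = q powi (int k + 1 - r - int l) \<cdot>\<^sub>f op N Gc (cm k w)"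
    unfolding T K using k by simp
  have gd: "act (V_mod q l r) Gd $$ (k, k') = (if k' = Suc k then alpha q (Suc k) l else 0)" if "k' < l" for k'
    using that k by (auto simp: V)
  have G: "(\<Sum>k'<l. act (V_mod q l r) Gd $$ (k, k') \<cdot>\<^sub>f F k') = (if Suc k < l then alpha q (Suc k) l \<cdot>\<^sub>f F (Suc k) else 0)"
    for F :: "nat \<Rightarrow> nat \<Rightarrow> 'k" by (rule E) (rule gd)
  show "cm k (op (TW l) Gd w) = op N Gc (alpha q (Suc k) l \<cdot>\<^sub>f cm (Suc k) w) + op N Gd (cm k w)"
  proof (cases "Suc k < l")
    case True
    then show ?thesis unfolding T P K I G by simp
  next
    case False
    then have "Suc k = l" using k by simp
    then show ?thesis unfolding T P K I G by simp
  qed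
qed

lemma relN:
  assumes "supp (hdim N) v"
  shows "op N Gb (op N Ga v) = q \<cdot>\<^sub>f op N Ga (op N Gb v)" "op N Gd (op N Gb v) = q \<cdot>\<^sub>f op N Gb (op N Gd v)"
    "op N Gc (op N Ga v) = q \<cdot>\<^sub>f op N Ga (op N Gc v)" "op N Gd (op N Gc v) = q \<cdot>\<^sub>f op N Gc (op N Gd v)"
    "op N Gc (op N Gb v) = op N Gb (op N Gc v)"
    "op N Gd (op N Ga v) = q \<cdot>\<^sub>f op N Ga (op N Gd v) + v - op N Gb (op N Gc v)"
  using is_hmodD [OF N assms] by (auto simp: hrel_def algebra_simps)

lemma prv_TW:
  assumes k: "k \<le> l"
  shows "prv k (op (TW l) Gb w) = q powi (r + int k - 1) \<cdot>\<^sub>f op N Gb (prv k w)"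
    "prv k (op (TW l) Gc w) = q powi (int k - r - int l) \<cdot>\<^sub>f op N Gc (prv k w)"
    "prv k (op (TW l) Gd w) = op N Gc (alpha q k l \<cdot>\<^sub>f cm k w) + op N Gd (prv k w)"
proof -
  have "prv k (op (TW l) Gb w) = q powi (r + int k - 1) \<cdot>\<^sub>f op N Gb (prv k w) \<and>
    prv k (op (TW l) Gc w) = q powi (int k - r - int l) \<cdot>\<^sub>f op N Gc (prv k w) \<and>
    prv k (op (TW l) Gd w) = op N Gc (alpha q k l \<cdot>\<^sub>f cm k w) + op N Gd (prv k w)"
  proof (cases k)
    case 0
    then show ?thesis by (simp add: prv_def)
  next
    case (Suc j)
    then have j: "j < l" using k by simp
    have e: "r + int k - 1 = r + int j" "int k - r - int l = int j + 1 - r - int l" by (simp_all add: Suc)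
    have p: "prv k w = cm j w" for w by (simp add: prv_def Suc)
    show ?thesis unfolding p e cm_TW [OF j] unfolding Suc by (intro conjI refl)
  qed
  then show "prv k (op (TW l) Gb w) = q powi (r + int k - 1) \<cdot>\<^sub>f op N Gb (prv k w)"
    "prv k (op (TW l) Gc w) = q powi (int k - r - int l) \<cdot>\<^sub>f op N Gc (prv k w)"
    "prv k (op (TW l) Gd w) = op N Gc (alpha q k l \<cdot>\<^sub>f cm k w) + op N Gd (prv k w)" by blast+
qed

text \<open>The factor \<alpha> is kept on both sides because it vanishes at k + 1 = l, where there
  is no next component.\<close>

lemma nxt_TW:
  assumes k: "k < l"
  shows "alpha q (Suc k) l \<cdot>\<^sub>f cm (Suc k) (op (TW l) Ga w) = op N Gb (alpha q (Suc k) l \<cdot>\<^sub>f cm k w) + op N Ga (alpha q (Suc k) l \<cdot>\<^sub>f cm (Suc k) w)"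
    "alpha q (Suc k) l \<cdot>\<^sub>f cm (Suc k) (op (TW l) Gb w) = q powi (r + int k + 1) \<cdot>\<^sub>f op N Gb (alpha q (Suc k) l \<cdot>\<^sub>f cm (Suc k) w)"
    "alpha q (Suc k) l \<cdot>\<^sub>f cm (Suc k) (op (TW l) Gc w) = q powi (int k + 2 - r - int l) \<cdot>\<^sub>f op N Gc (alpha q (Suc k) l \<cdot>\<^sub>f cm (Suc k) w)"
proof -
  have e: "r + int (Suc k) = r + int k + 1" "int (Suc k) + 1 - r - int l = int k + 2 - r - int l" by simp_all
  have z: "alpha q (Suc k) l = 0" if "\<not> Suc k < l"
  proof -
    have "Suc k = l" using that k by simp
    then show ?thesis by simp
  qed
  show "alpha q (Suc k) l \<cdot>\<^sub>f cm (Suc k) (op (TW l) Ga w) = op N Gb (alpha q (Suc k) l \<cdot>\<^sub>f cm k w) + op N Ga (alpha q (Suc k) l \<cdot>\<^sub>f cm (Suc k) w)"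
    by (cases "Suc k < l") (simp_all add: cm_TW(1) sc_add prv_def z)
  show "alpha q (Suc k) l \<cdot>\<^sub>f cm (Suc k) (op (TW l) Gb w) = q powi (r + int k + 1) \<cdot>\<^sub>f op N Gb (alpha q (Suc k) l \<cdot>\<^sub>f cm (Suc k) w)"
  proof (cases "Suc k < l")
    case True
    show ?thesis by (simp only: cm_TW(2) [OF True] e linD [OF lin_mapp] sc_sc mult.commute)
  qed (simp add: z)
  show "alpha q (Suc k) l \<cdot>\<^sub>f cm (Suc k) (op (TW l) Gc w) = q powi (int k + 2 - r - int l) \<cdot>\<^sub>f op N Gc (alpha q (Suc k) l \<cdot>\<^sub>f cm (Suc k) w)"
  proof (cases "Suc k < l")
    case True
    show ?thesis by (simp only: cm_TW(3) [OF True] e linD [OF lin_mapp] sc_sc mult.commute)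
  qed (simp add: z)
qed

lemma hact_TW: "hact n q (op (TW l) Ga) (op (TW l) Gb) (op (TW l) Gc) (op (TW l) Gd)"
proof (rule hactI [OF qroot_axioms wTW])
  fix j :: nat
  assume "j < hdim (TW l)"
  then have sw: "supp (l * hdim N) (uv j :: nat \<Rightarrow> 'k)" by simp
  define w :: "nat \<Rightarrow> 'k" where "w = uv j"
  have sw: "supp (l * hdim N) w" using sw by (simp add: w_def)
  have qs: "q powi (x + 1) = q * q powi x" for x by (simp add: qpowi_add mult.commute)
  note eqI = cmp_ext [of l "hdim N"]
  have l1: "op N x (c \<cdot>\<^sub>f v) = c \<cdot>\<^sub>f op N x v" "op N x (v + v') = op N x v + op N x v'" for x c v v'
    by (simp_all add: linD [OF lin_mapp])
  note lc = linD [OF lin_cmp] lin_diff [OF lin_cmp]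
  show "hrel0 q (TW l) (uv j)" unfolding hrel0_def w_def [symmetric]
  proof (intro conjI; (rule eqI, (intro supp_TW supp_sc supp_add supp_diff sw)[1], (intro supp_TW supp_sc supp_add supp_diff sw)[1]))
    fix k assume k: "k < l"
    have kl: "k \<le> l" using k by simp
    \<comment> \<open>Component k of either side depends only on the components k - 1, k and k + 1
      of w, so each relation becomes an identity in three vectors of N.\<close>
    define x where "x = cm k w"
    define y where "y = prv k w"
    define z where "z = alpha q (Suc k) l \<cdot>\<^sub>f cm (Suc k) w"
    have sx: "supp (hdim N) x" and sy: "supp (hdim N) y" and sz: "supp (hdim N) z"
      by (simp_all add: x_def y_def z_def supp_prv)
    note rel = relN [OF sx] relN [OF sy] relN [OF sz]
    note df = x_def [symmetric] y_def [symmetric] z_def [symmetric]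
    have q1: "q powi (r + int k) = q * q powi (r + int k - 1)"
      "q powi (int k + 1 - r - int l) = q * q powi (int k - r - int l)"
      "q powi (r + int k + 1) = q * q powi (r + int k)"
      "q powi (int k + 2 - r - int l) = q * q powi (int k + 1 - r - int l)"
      using qs [of "r + int k - 1"] qs [of "int k - r - int l"] qs [of "r + int k"] qs [of "int k + 1 - r - int l"]
      by (simp_all add: algebra_simps)
    show "cm k (op (TW l) Gb (op (TW l) Ga w)) = cm k (q \<cdot>\<^sub>f op (TW l) Ga (op (TW l) Gb w))"
      unfolding lc cm_TW [OF k] prv_TW [OF kl] df l1 rel sc_sc sc_add q1(1) by (simp only: mult_ac)
    show "cm k (op (TW l) Gd (op (TW l) Gb w)) = cm k (q \<cdot>\<^sub>f op (TW l) Gb (op (TW l) Gd w))"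
      unfolding lc cm_TW [OF k] nxt_TW [OF k] df l1 rel sc_sc sc_add q1(3) by (simp only: mult_ac)
    show "cm k (op (TW l) Gc (op (TW l) Ga w)) = cm k (q \<cdot>\<^sub>f op (TW l) Ga (op (TW l) Gc w))"
      unfolding lc cm_TW [OF k] prv_TW [OF kl] df l1 rel sc_sc sc_add q1(2) by (simp only: mult_ac)
    show "cm k (op (TW l) Gd (op (TW l) Gc w)) = cm k (q \<cdot>\<^sub>f op (TW l) Gc (op (TW l) Gd w))"
      unfolding lc cm_TW [OF k] nxt_TW [OF k] df l1 rel sc_sc sc_add q1(4) by (simp only: mult_ac)
    have a: "alpha q (Suc k) l = q * alpha q k l + 1 - q powi (r + int k) * q powi (int k + 1 - r - int l)"
    proof -
      have "2 * int k + 1 - int l = r + int k + (int k + 1 - r - int l)" by simp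
      then show ?thesis by (simp only: alpha_step qpowi_add [symmetric])
    qed
    show "cm k (op (TW l) Gd (op (TW l) Ga w)) = cm k (q \<cdot>\<^sub>f op (TW l) Ga (op (TW l) Gd w) + w - op (TW l) Gb (op (TW l) Gc w))"
      unfolding lc cm_TW [OF k] nxt_TW [OF k] prv_TW [OF kl] df l1 rel sc_sc sc_add
      unfolding a by (simp add: pointwise algebra_simps)
  qed
qed

text \<open>The homomorphism V(2,0) \<otimes> V(l,r) \<rightarrow> V(l+1,r), with k counted from 0,
  is u_1 \<otimes> v_k \<mapsto> (1 - q^(k-l)) v_k and u_2 \<otimes> v_k \<mapsto> (q - 1) q^(-l-r)
  v_(k+1). Tensored with N, its components are L1 and L2. The factor in L1 vanishes at k = l, so the
  coordinates of w in that block do not matter.\<close>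

definition L1 :: "nat \<Rightarrow> (nat \<Rightarrow> 'k) \<Rightarrow> nat \<Rightarrow> 'k" where
  "L1 l w = (\<lambda>i. if i < Suc l * hdim N then (1 - q powi (int (i div hdim N) - int l)) * w i else 0)"
definition L2 :: "nat \<Rightarrow> (nat \<Rightarrow> 'k) \<Rightarrow> nat \<Rightarrow> 'k" where
  "L2 l w = (\<lambda>i. if hdim N \<le> i \<and> i < Suc l * hdim N then ((q - 1) * q powi (- int l - r)) * w (i - hdim N) else 0)"

lemma lin_L: "lin (L1 l)" "lin (L2 l)" by (auto simp: lin_def L1_def L2_def pointwise algebra_simps)
lemma supp_L: "supp (Suc l * hdim N) (L1 l w)" "supp (Suc l * hdim N) (L2 l w)"
  by (auto simp: supp_def L1_def L2_def)

lemma cm_L: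
  assumes k: "k \<le> l"
  shows "cm k (L1 l w) = (1 - q powi (int k - int l)) \<cdot>\<^sub>f cm k w"
    "cm k (L2 l w) = ((q - 1) * q powi (- int l - r)) \<cdot>\<^sub>f prv k w"
proof -
  have i: "i < hdim N \<Longrightarrow> k * hdim N + i < Suc l * hdim N" for i using k by (intro idx_less) auto
  show "cm k (L1 l w) = (1 - q powi (int k - int l)) \<cdot>\<^sub>f cm k w"
    using i by (auto simp: fun_eq_iff cmp_def L1_def sc_apply simp del: mult_Suc)
  show "cm k (L2 l w) = ((q - 1) * q powi (- int l - r)) \<cdot>\<^sub>f prv k w"
    using i by (cases k) (auto simp: fun_eq_iff cmp_def L2_def prv_def sc_apply zero_fun_apply ac_simps)
qed

lemma ladder_TW:
  "ladder n q (op (TW l) Ga) (op (TW l) Gb) (op (TW l) Gc) (op (TW l) Gd)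
    (op (TW (Suc l)) Ga) (op (TW (Suc l)) Gb) (op (TW (Suc l)) Gc) (op (TW (Suc l)) Gd) (L1 l) (L2 l)"
proof (intro ladder.intro hact_TW ladder_axioms.intro lin_L)
  fix w :: "nat \<Rightarrow> 'k"
  note eqI = cmp_ext [of "Suc l" "hdim N"]
  note S = supp_TW supp_L supp_sc supp_add
  have l1: "op N x (c \<cdot>\<^sub>f v) = c \<cdot>\<^sub>f op N x v" "op N x (v + v') = op N x v + op N x v'" "op N x 0 = 0" for x c v v'
    by (simp_all add: linD [OF lin_mapp] lin_0 [OF lin_mapp])
  note lc = linD [OF lin_cmp]
  define \<rho> where "\<rho> = (q - 1) * q powi (- int l - r)"
  have pL: "prv k (L1 l w) = (1 - q powi (int k - 1 - int l)) \<cdot>\<^sub>f prv k w" if "k \<le> l" for k w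
    using that by (cases k) (simp_all add: prv_def cm_L)
  have z: "1 - q powi (int l - int l) = 0" by simp
  have qi: "q powi (x - 1) = q powi x / q" for x by (simp add: power_int_diff)
  \<comment> \<open>This fixes the constant of L2: at component k - 1 the map L1 has the factor 1 -
    q^(k-1-l) in place of 1 - q^(k-l), and L2 b has to supply the difference.\<close>
  have inv: "(q - 1) * q powi (- int l - r) * q powi (r + int k - 1) = q powi (int k - int l) - q powi (int k - 1 - int l)" for k
  proof -
    have "q powi (- int l - r) * q powi (r + int k - 1) = q powi (int k - 1 - int l)"
      unfolding qpowi_add [symmetric] by (rule arg_cong [of _ _ "\<lambda>x. q powi x"]) simp
    moreover have "q powi (int k - int l) = q * q powi (int k - 1 - int l)"
      using qpowi_add [of 1 "int k - 1 - int l"] by simp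
    ultimately show ?thesis by (simp add: algebra_simps)
  qed
  show "op (TW (Suc l)) Ga (L1 l w) = L1 l (op (TW l) Ga w) + L2 l (op (TW l) Gb w)"
  proof (rule eqI, (intro S)[1], (intro S)[1])
    fix k assume "k < Suc l"
    then have k: "k \<le> l" by simp
    have A: "(1 - q powi (int k - int l)) \<cdot>\<^sub>f cm k (op (TW l) Ga w) = (1 - q powi (int k - int l)) \<cdot>\<^sub>f (op N Gb (prv k w) + op N Ga (cm k w))"
      using k by (cases "k = l") (simp_all add: cm_TW)
    show "cm k (op (TW (Suc l)) Ga (L1 l w)) = cm k (L1 l (op (TW l) Ga w) + L2 l (op (TW l) Gb w))"
      unfolding lc cm_TW [OF \<open>k < Suc l\<close>] cm_L [OF k] pL [OF k] A prv_TW [OF k] l1 sc_sc inv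
      by (simp add: pointwise algebra_simps)
  qed
  show "op (TW (Suc l)) Ga (L2 l w) = L2 l (op (TW l) Ga w)"
  proof (rule eqI, (intro S)[1], (intro S)[1])
    fix k assume k': "k < Suc l"
    then have k: "k \<le> l" by simp
    show "cm k (op (TW (Suc l)) Ga (L2 l w)) = cm k (L2 l (op (TW l) Ga w))"
    proof (cases k)
      case 0
      then show ?thesis unfolding cm_TW [OF k'] cm_L [OF k] by (simp add: prv_def l1)
    next
      case (Suc j)
      then have j: "j < l" "j \<le> l" using k by auto
      have "prv k (L2 l w) = ((q - 1) * q powi (- int l - r)) \<cdot>\<^sub>f prv j w" "prv k (op (TW l) Ga w) = cm j (op (TW l) Ga w)" "prv k w = cm j w"
        using cm_L(2) [OF j(2)] by (simp_all add: prv_def Suc)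
      then show ?thesis unfolding cm_TW(1) [OF k'] cm_L(2) [OF k] by (simp add: cm_TW(1) [OF j(1)] l1 sc_add)
    qed
  qed
  show "op (TW (Suc l)) Gd (L1 l w) = L1 l (op (TW l) Gd w)"
  proof (rule eqI, (intro S)[1], (intro S)[1])
    fix k assume k': "k < Suc l"
    then have k: "k \<le> l" by simp
    show "cm k (op (TW (Suc l)) Gd (L1 l w)) = cm k (L1 l (op (TW l) Gd w))"
    proof (cases "k = l")
      case True
      then show ?thesis unfolding cm_TW(4) [OF k'] cm_L [OF k] by (simp add: l1)
    next
      case False
      then have kl: "k < l" "Suc k \<le> l" using k by auto
      have "alpha q (Suc k) (Suc l) * (1 - q powi (int (Suc k) - int l)) = (1 - q powi (int k - int l)) * alpha q (Suc k) l"
        by (simp add: alpha_def)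
      then show ?thesis unfolding cm_TW(4) [OF k'] cm_L(1) [OF k] cm_L(1) [OF kl(2)] cm_TW(4) [OF kl(1)] l1 sc_sc sc_add by simp
    qed
  qed
  show "op (TW (Suc l)) Gd (L2 l w) = (1 - 1 / q) \<cdot>\<^sub>f L1 l (op (TW l) Gc w) + L2 l (op (TW l) Gd w)"
  proof (rule eqI, (intro S)[1], (intro S)[1])
    fix k assume k': "k < Suc l"
    then have k: "k \<le> l" by simp
    show "cm k (op (TW (Suc l)) Gd (L2 l w)) = cm k ((1 - 1 / q) \<cdot>\<^sub>f L1 l (op (TW l) Gc w) + L2 l (op (TW l) Gd w))"
    proof (cases "k = l")
      case True
      then show ?thesis unfolding lc cm_TW(4) [OF k'] cm_L [OF k] prv_TW(3) [OF k] by (simp add: l1)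
    next
      case False
      then have kl: "k < l" "Suc k \<le> l" using k by auto
      have p: "prv (Suc k) w = cm k w" by (simp add: prv_def)
      have "alpha q (Suc k) (Suc l) - alpha q k l = q ^ k * (1 - q powi (int k - int l))"
        by (simp add: alpha_def qint_Suc algebra_simps)
      then have a1: "alpha q (Suc k) (Suc l) = alpha q k l + q ^ k * (1 - q powi (int k - int l))" by (simp add: algebra_simps)
      have a2: "(q - 1) * q powi (- int l - r) * q ^ k = (1 - 1 / q) * q powi (int k + 1 - r - int l)"
      proof -
        have "(1 - 1 / q) * q powi (int k + 1 - r - int l) = (q - 1) * (q powi (int k + 1 - r - int l) / q)" by (simp add: field_simps)
        also have "q powi (int k + 1 - r - int l) / q = q powi (int k + 1 - r - int l - 1)" by (rule qi [symmetric])
        also have "int k + 1 - r - int l - 1 = - int l - r + int k" by simp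
        also have "q powi (- int l - r + int k) = q powi (- int l - r) * q ^ k" by (simp only: qpowi_add power_int_of_nat)
        finally show ?thesis by (simp add: mult.assoc)
      qed
      have a3: "(1 - 1 / q) * ((1 - q powi (int k - int l)) * q powi (int k + 1 - r - int l)) = (q - 1) * q powi (- int l - r) * q ^ k * (1 - q powi (int k - int l))"
        unfolding a2 by (simp only: mult_ac)
      show ?thesis
        unfolding lc cm_TW(4) [OF k'] cm_L [OF k] cm_L(2) [OF kl(2)] prv_TW(3) [OF k] cm_TW(3) [OF kl(1)] l1 sc_sc sc_add p a1 a3
        by (simp add: pointwise algebra_simps)
    qed
  qed
  show "op (TW (Suc l)) Gb (L1 l w) = L1 l (op (TW l) Gb w)"
  proof (rule eqI, (intro S)[1], (intro S)[1])
    fix k assume k': "k < Suc l"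
    then have k: "k \<le> l" by simp
    show "cm k (op (TW (Suc l)) Gb (L1 l w)) = cm k (L1 l (op (TW l) Gb w))"
      unfolding cm_TW [OF k'] cm_L [OF k] using k by (cases "k = l") (simp_all add: cm_TW l1 mult.commute)
  qed
  show "op (TW (Suc l)) Gb (L2 l w) = q \<cdot>\<^sub>f L2 l (op (TW l) Gb w)"
  proof (rule eqI, (intro S)[1], (intro S)[1])
    fix k assume k': "k < Suc l"
    then have k: "k \<le> l" by simp
    have "q powi (r + int k) = q * q powi (r + int k - 1)" by (simp add: qi)
    then show "cm k (op (TW (Suc l)) Gb (L2 l w)) = cm k (q \<cdot>\<^sub>f L2 l (op (TW l) Gb w))"
      unfolding lc cm_TW [OF k'] cm_L [OF k] prv_TW [OF k] l1 sc_sc by (simp only: mult_ac)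
  qed
  show "op (TW (Suc l)) Gc (L1 l w) = (1 / q) \<cdot>\<^sub>f L1 l (op (TW l) Gc w)"
  proof (rule eqI, (intro S)[1], (intro S)[1])
    fix k assume k': "k < Suc l"
    then have k: "k \<le> l" by simp
    have e: "q powi (int k + 1 - r - int (Suc l)) = q powi (int k + 1 - r - int l) / q"
    proof -
      have "int k + 1 - r - int (Suc l) = int k + 1 - r - int l - 1" by simp
      then show ?thesis by (simp only: qi)
    qed
    show "cm k (op (TW (Suc l)) Gc (L1 l w)) = cm k ((1 / q) \<cdot>\<^sub>f L1 l (op (TW l) Gc w))"
      unfolding lc cm_TW [OF k'] cm_L [OF k] e using k by (cases "k = l") (simp_all add: cm_TW l1 mult_ac)
  qed
  show "op (TW (Suc l)) Gc (L2 l w) = L2 l (op (TW l) Gc w)"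
  proof (rule eqI, (intro S)[1], (intro S)[1])
    fix k assume k': "k < Suc l"
    then have k: "k \<le> l" by simp
    have e: "int k + 1 - r - int (Suc l) = int k - r - int l" by simp
    show "cm k (op (TW (Suc l)) Gc (L2 l w)) = cm k (L2 l (op (TW l) Gc w))"
      unfolding lc cm_TW [OF k'] cm_L [OF k] prv_TW [OF k] l1 sc_sc e by (simp only: mult_ac)
  qed
qed

lemma cm_0_apow: "1 \<le> l \<Longrightarrow> cm 0 ((op (TW l) Ga ^^ k) w) = (op N Ga ^^ k) (cm 0 w)"
  by (induction k) (simp_all add: cm_TW prv_def)

lemma cm_self: "supp (hdim N) v \<Longrightarrow> cm 0 v = v"
  by (auto simp: cmp_def supp_def fun_eq_iff)

lemma TW_1:
  assumes v: "supp (hdim N) v"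
  shows "op (TW (Suc 0)) Ga v = op N Ga v" "op (TW (Suc 0)) Gb v = q powi r \<cdot>\<^sub>f op N Gb v"
    "op (TW (Suc 0)) Gc v = q powi (- r) \<cdot>\<^sub>f op N Gc v" "op (TW (Suc 0)) Gd v = op N Gd v"
proof -
  have s: "cm 0 (op (TW (Suc 0)) x v) = op (TW (Suc 0)) x v" for x
    using supp_TW [of "Suc 0" x v] by (intro cm_self) simp
  show "op (TW (Suc 0)) Ga v = op N Ga v" "op (TW (Suc 0)) Gb v = q powi r \<cdot>\<^sub>f op N Gb v"
    "op (TW (Suc 0)) Gc v = q powi (- r) \<cdot>\<^sub>f op N Gc v" "op (TW (Suc 0)) Gd v = op N Gd v"
    using cm_TW [of 0 "Suc 0" v] by (simp_all add: s cm_self [OF v] prv_def)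
qed

lemma TW_1_apow: "supp (hdim N) v \<Longrightarrow> (op (TW (Suc 0)) Ga ^^ k) v = (op N Ga ^^ k) v"
  by (induction k) (simp_all add: TW_1 op_funpow_supp [OF wN])

context
  assumes wtN: "\<And>j. j < hdim N \<Longrightarrow> \<exists>x y. op N Gb (uv j) = q powi x \<cdot>\<^sub>f uv j \<and> op N Gc (uv j) = q powi y \<cdot>\<^sub>f uv j"
begin

lemma wt_TW:
  assumes J: "J < l * hdim N"
  shows "\<exists>X Y. op (TW l) Gb (uv J) = q powi X \<cdot>\<^sub>f uv J \<and> op (TW l) Gc (uv J) = q powi Y \<cdot>\<^sub>f uv J"
proof -
  note d = idx_less' [OF J]
  let ?k = "J div hdim N"
  obtain x y where xy: "op N Gb (uv (J mod hdim N)) = q powi x \<cdot>\<^sub>f uv (J mod hdim N)"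
    "op N Gc (uv (J mod hdim N)) = q powi y \<cdot>\<^sub>f uv (J mod hdim N)" using wtN d by blast
  have su: "supp (l * hdim N) (c \<cdot>\<^sub>f uv J)" for c :: 'k using J by simp
  have "op (TW l) Gb (uv J) = q powi (r + int ?k + x) \<cdot>\<^sub>f uv J"
  proof (rule cmp_ext [OF supp_TW su])
    fix k assume "k < l"
    then show "cm k (op (TW l) Gb (uv J)) = cm k (q powi (r + int ?k + x) \<cdot>\<^sub>f uv J)"
      by (simp add: cm_TW cmp_uv [OF J] linD [OF lin_cmp] xy qpowi_add)
  qed
  moreover have "op (TW l) Gc (uv J) = q powi (int ?k + 1 - r - int l + y) \<cdot>\<^sub>f uv J"
  proof (rule cmp_ext [OF supp_TW su])
    fix k assume "k < l"
    then show "cm k (op (TW l) Gc (uv J)) = cm k (q powi (int ?k + 1 - r - int l + y) \<cdot>\<^sub>f uv J)"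
      unfolding cm_TW(3) [OF \<open>k < l\<close>] cmp_uv [OF J] linD [OF lin_cmp] by (simp add: xy qpowi_add)
  qed
  ultimately show ?thesis by blast
qed

lemma diagb_TW: "diagb (TW l)"
proof -
  have "\<forall>J. \<exists>\<beta>. J < l * hdim N \<longrightarrow> op (TW l) Gb (uv J) = \<beta> \<cdot>\<^sub>f uv J" using wt_TW [of _ l] by blast
  then obtain \<beta> where "\<forall>J. J < l * hdim N \<longrightarrow> op (TW l) Gb (uv J) = \<beta> J \<cdot>\<^sub>f uv J" by (rule choice [THEN exE])
  then show ?thesis unfolding diagb_def by auto
qed

text \<open>\<open>TW (Suc l)\<close> is spanned by the images of the two ladder maps, which commute with \<open>a\<^sup>n\<close> since \<open>(n)\<^sub>q = 0\<close>.\<close>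

lemma an_TW:
  assumes l: "1 \<le> l" "l \<le> n" and w: "supp (l * hdim N) w"
  shows "(op (TW l) Ga ^^ n) w = 0"
  using l w
proof (induction l arbitrary: w)
  case (Suc l)
  show ?case
  proof (cases "l = 0")
    case True
    then have s: "supp (hdim N) w" using Suc.prems by simp
    have "(op N Ga ^^ n) w = 0" using is_hmodD [OF N s] by (simp add: hrel_def)
    then show ?thesis using TW_1_apow [OF s, of n] True by simp
  next
    case False
    interpret ladder n q "op (TW l) Ga" "op (TW l) Gb" "op (TW l) Gc" "op (TW l) Gd"
      "op (TW (Suc l)) Ga" "op (TW (Suc l)) Gb" "op (TW (Suc l)) Gc" "op (TW (Suc l)) Gd" "L1 l" "L2 l"
      by (rule ladder_TW)
    have IH: "(op (TW l) Ga ^^ n) v = 0" if "supp (l * hdim N) v" for v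
      using Suc.IH [OF _ _ that] Suc.prems False by simp
    have z0: "lin (\<lambda>v :: nat \<Rightarrow> 'k. 0 :: nat \<Rightarrow> 'k)" by (simp add: lin_def)
    have 1: "(op (TW (Suc l)) Ga ^^ n) (L1 l v) = 0" if "supp (l * hdim N) v" for v
    proof (rule lin_eq_on_supp [OF lin_comp [OF lin_funpow [OF lin_mapp] lin_L(1)] z0 _ that])
      fix J assume J: "J < l * hdim N"
      obtain X Y where "wti X Y (uv J)" using wt_TW [OF J] by (auto simp: wti_def wt_def)
      from apow_P1 [OF this, of n] show "(op (TW (Suc l)) Ga ^^ n) (L1 l (uv J)) = 0"
        using IH [of "uv J"] J by (simp add: qint_n)
    qed
    have 2: "(op (TW (Suc l)) Ga ^^ n) (L2 l v) = 0" if "supp (l * hdim N) v" for v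
      using apow_P2 [of n v] IH [OF that] by simp
    let ?D = "hdim N" and ?y = "(q - 1) * q powi (- int l - r)"
    have y: "?y \<noteq> 0" using q1 q0 by simp
    \<comment> \<open>The blocks below l come from L1, whose factors are invertible there because l
      < n; block l comes from L2.\<close>
    define w1 where "w1 = (\<lambda>i. if i < l * ?D then w i / (1 - q powi (int (i div ?D) - int l)) else 0)"
    define w2 where "w2 = (\<lambda>i. if i < l * ?D \<and> l * ?D \<le> i + ?D then w (i + ?D) / ?y else 0)"
    have s12: "supp (l * ?D) w1" "supp (l * ?D) w2" by (auto simp: supp_def w1_def w2_def)
    have "w = L1 l w1 + L2 l w2"
    proof
      fix i
      consider "i < l * ?D" | "l * ?D \<le> i" "i < Suc l * ?D" | "Suc l * ?D \<le> i" by linarith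
      then show "w i = (L1 l w1 + L2 l w2) i"
      proof cases
        case 1
        then have k: "i div ?D < l" using idx_less' by blast
        have "q powi (int (i div ?D) - int l) \<noteq> 1"
        proof
          assume "q powi (int (i div ?D) - int l) = 1"
          then have "int n dvd int (i div ?D) - int l" by (simp only: qpowi_eq_1_iff)
          then have "i div ?D = l" by (rule nat_eq_of_dvd [rotated 2]) (use k Suc.prems in auto)
          then show False using k by simp
        qed
        then show ?thesis using 1 by (auto simp: plus_fun_apply L1_def L2_def w1_def w2_def)
      next
        case 2
        moreover have "?D \<le> i" using 2 False by (cases l) auto
        ultimately show ?thesis using y by (auto simp: plus_fun_apply L1_def L2_def w1_def w2_def)
      next
        case 3
        then show ?thesis using Suc.prems(3) by (simp add: plus_fun_apply L1_def L2_def supp_def)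
      qed
    qed
    then show ?thesis using 1 [OF s12(1)] 2 [OF s12(2)] by (simp add: linD [OF lin_funpow [OF lin_mapp]])
  qed
qed simp

end

text \<open>For i < l the family with index i is moved up one step of the ladder; the new index i =
  l arises from index l - 1 by a step down. The constants telescope to (l + l' - 1 - 2i)_q / (l')_q.
  Component 0 of g is followed through the induction because it later shows that the g e are
  independent.\<close>

lemma TW_bands:
  assumes l': "1 \<le> l'" "l' < n" and B: "hact.band n q (op N Ga) (op N Gb) (op N Gc) (op N Gd) A0 A1 D0 D1 l' r' 1 f0 g0"
    and sup: "\<And>e. supp (hdim N) (f0 e)" "\<And>e. supp (hdim N) (g0 e)"
    and z: "\<forall>e. s \<le> e \<longrightarrow> f0 e = 0 \<and> g0 e = 0"
    and l: "1 \<le> l" "l + l' \<le> n" "i < min l l'"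
  shows "\<exists>f g \<xi>. hact.band n q (op (TW l) Ga) (op (TW l) Gb) (op (TW l) Gc) (op (TW l) Gd) A0 A1 D0 D1
      (l + l' - 1 - 2 * i) (r + r' + int i) (qint q (l + l' - 1 - 2 * i) / qint q l') f g \<and>
    (\<forall>e. supp (l * hdim N) (f e) \<and> supp (l * hdim N) (g e)) \<and> (\<forall>e. s \<le> e \<longrightarrow> f e = 0 \<and> g e = 0) \<and>
    \<xi> \<noteq> 0 \<and> (\<forall>e. cm 0 (g e) = \<xi> \<cdot>\<^sub>f (op N Ga ^^ i) (g0 e))"
  using l
proof (induction l arbitrary: i)
  case (Suc l)
  show ?case
  proof (cases "l = 0")
    case True
    \<comment> \<open>Tensoring with the one-dimensional V(1,r) only shifts the weights, by r for b
      and by -r for c.\<close>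
    then have i: "i = 0" using Suc.prems by simp
    interpret T: hact n q "op (TW (Suc 0)) Ga" "op (TW (Suc 0)) Gb" "op (TW (Suc 0)) Gc" "op (TW (Suc 0)) Gd" by (rule hact_TW)
    interpret S: hact n q "op N Ga" "op N Gb" "op N Gc" "op N Gd" by (rule hact_N)
    have sc: "supp (hdim N) (comb x y g0 e)" for x y e by (simp add: comb_def sup)
    have w: "T.wti (r + x) (y - r) v" if "S.wti x y v" "supp (hdim N) v" for x y v
      using that(1) unfolding S.wti_def T.wti_def S.wt_def T.wt_def TW_1 [OF that(2)]
      by (simp add: qpowi_add [symmetric] add.commute)
    have "T.band A0 A1 D0 D1 l' (r + r') 1 f0 g0"
      unfolding T.band_def
    proof (intro allI)
      fix e
      have b: "S.wti r' (1 - r' - int l') (g0 e)" "S.wti (r' + int l') (1 - r') (f0 e)"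
        "op N Gd (g0 e) = 0" "(op N Ga ^^ l') (g0 e) = 0" "(op N Ga ^^ (n - l')) (f0 e) = comb A0 A1 g0 e"
        "op N Gd (f0 e) = 1 \<cdot>\<^sub>f (op N Ga ^^ (l' - 1)) (comb D0 D1 g0 e)"
        using B unfolding S.band_def by blast+
      have e1: "1 - r' - int l' - r = 1 - (r + r') - int l'" "r + (r' + int l') = r + r' + int l'" "1 - r' - r = 1 - (r + r')" by simp_all
      show "T.wti (r + r') (1 - (r + r') - int l') (g0 e) \<and> T.wti (r + r' + int l') (1 - (r + r')) (f0 e) \<and>
        op (TW (Suc 0)) Gd (g0 e) = 0 \<and> (op (TW (Suc 0)) Ga ^^ l') (g0 e) = 0 \<and>
        (op (TW (Suc 0)) Ga ^^ (n - l')) (f0 e) = comb A0 A1 g0 e \<and>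
        op (TW (Suc 0)) Gd (f0 e) = 1 \<cdot>\<^sub>f (op (TW (Suc 0)) Ga ^^ (l' - 1)) (comb D0 D1 g0 e)"
        unfolding TW_1 [OF sup(1)] TW_1 [OF sup(2)] TW_1_apow [OF sup(1)] TW_1_apow [OF sup(2)] TW_1_apow [OF sc]
        using w [OF b(1) sup(2)] w [OF b(2) sup(1)] b(3-6) unfolding e1 by blast
    qed
    moreover have "qint q l' \<noteq> 0" using qint_neq_0 [of l'] l' by simp
    moreover have "Suc l + l' - 1 - 2 * i = l'" using True i by simp
    ultimately show ?thesis unfolding True i
      by (intro exI [of _ f0] exI [of _ g0] exI [of _ 1]) (simp add: sup z cm_self)
  next
    case False
    interpret ladder n q "op (TW l) Ga" "op (TW l) Gb" "op (TW l) Gc" "op (TW l) Gd"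
      "op (TW (Suc l)) Ga" "op (TW (Suc l)) Gb" "op (TW (Suc l)) Gc" "op (TW (Suc l)) Gd" "L1 l" "L2 l"
      by (rule ladder_TW)
    have "\<not> int n dvd - int l"
    proof
      assume "int n dvd - int l"
      then have "n dvd l" by simp
      then have "n \<le> l" using False by (simp add: dvd_imp_le)
      then show False using Suc.prems by simp
    qed
    then have x0: "1 - q powi (- int l) \<noteq> 0" by (simp add: qpowi_eq_1_iff)
    have l1: "1 \<le> l" "l + l' \<le> n" using False Suc.prems by auto
    note sL = supp_L [of l]
    show ?thesis
    proof (cases "i < l")
      case True
      then have i: "i < min l l'" using Suc.prems by simp
      from Suc.IH [OF l1 i] obtain f g \<xi> where fg: "band A0 A1 D0 D1 (l + l' - 1 - 2 * i) (r + r' + int i) (qint q (l + l' - 1 - 2 * i) / qint q l') f g"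
        "\<forall>e. s \<le> e \<longrightarrow> f e = 0 \<and> g e = 0" "\<xi> \<noteq> 0" "\<forall>e. cm 0 (g e) = \<xi> \<cdot>\<^sub>f (op N Ga ^^ i) (g0 e)"
        by (elim exE conjE) (rule that)
      let ?m = "l + l' - 1 - 2 * i"
      have m: "1 \<le> ?m" "?m + 1 < n" and mS: "Suc l + l' - 1 - 2 * i = Suc ?m" using i Suc.prems by auto
      have m0: "qint q ?m \<noteq> 0" using m by (intro qint_neq_0) auto
      let ?f = "\<lambda>e. L1 l (op (TW l) Ga (f e)) + (q powi (r + r' + int i) * qint q (Suc ?m)) \<cdot>\<^sub>f L2 l (f e)"
      have "tgt.band A0 A1 D0 D1 (Suc ?m) (r + r' + int i) (qint q (Suc ?m) / qint q l') ?f (\<lambda>e. L1 l (g e))"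
        using band_up [OF fg(1) m] m0 by simp
      moreover have "cm 0 (L1 l (g e)) = ((1 - q powi (- int l)) * \<xi>) \<cdot>\<^sub>f (op N Ga ^^ i) (g0 e)" for e
        using fg(4) by (simp add: cm_L)
      ultimately show ?thesis unfolding mS using fg(2,3) x0 sL
        by (intro exI [of _ ?f] exI [of _ "\<lambda>e. L1 l (g e)"] exI [of _ "(1 - q powi (- int l)) * \<xi>"]) (simp del: mult_Suc)
    next
      case nl: False
      then have il: "i = l" "l < l'" using Suc.prems by auto
      let ?j = "l - 1"
      have j: "?j < min l l'" using il False by simp
      from Suc.IH [OF l1 j] obtain f g \<xi> where fg: "band A0 A1 D0 D1 (l + l' - 1 - 2 * ?j) (r + r' + int ?j) (qint q (l + l' - 1 - 2 * ?j) / qint q l') f g"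
        "\<forall>e. s \<le> e \<longrightarrow> f e = 0 \<and> g e = 0" "\<xi> \<noteq> 0" "\<forall>e. cm 0 (g e) = \<xi> \<cdot>\<^sub>f (op N Ga ^^ ?j) (g0 e)"
        by (elim exE conjE) (rule that)
      let ?m = "l + l' - 1 - 2 * ?j"
      have m: "2 \<le> ?m" "?m < n" and mS: "Suc l + l' - 1 - 2 * i = ?m - 1" using il Suc.prems False by auto
      have tS: "r + r' + int ?j + 1 = r + r' + int i" using il False by (simp add: of_nat_diff)
      have m0: "qint q ?m \<noteq> 0" using m by (intro qint_neq_0) auto
      let ?\<kappa> = "qint q ?m / qint q l'"
      let ?f = "\<lambda>e. L1 l (f e) + (- ?\<kappa> * q powi (r + r' + int ?j + int ?m) / ((q - 1) * qint q ?m)) \<cdot>\<^sub>f L2 l ((op (TW l) Ga ^^ (?m - 1)) (comb D0 D1 g e))"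
      let ?g = "\<lambda>e. L1 l (op (TW l) Ga (g e)) + (- (q powi (r + r' + int ?j + 1) * qint q (?m - 1))) \<cdot>\<^sub>f L2 l (g e)"
      have b: "tgt.band A0 A1 D0 D1 (?m - 1) (r + r' + int i) (qint q (?m - 1) / qint q l') ?f ?g"
        using band_down [OF fg(1) m] m0 unfolding tS by simp
      have c0: "cm 0 (?g e) = ((1 - q powi (- int l)) * \<xi>) \<cdot>\<^sub>f (op N Ga ^^ i) (g0 e)" for e
      proof -
        have "cm 0 (?g e) = (1 - q powi (- int l)) \<cdot>\<^sub>f op N Ga (cm 0 (g e))"
          using False by (simp add: linD [OF lin_cmp] cm_L cm_TW prv_def)
        moreover have "op N Ga ((op N Ga ^^ ?j) (g0 e)) = (op N Ga ^^ i) (g0 e)"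
          using il False by (cases l) simp_all
        ultimately show ?thesis using fg(4) by simp
      qed
      have zz: "?f e = 0" "?g e = 0" if "s \<le> e" for e
        using fg(2) [rule_format, of e] fg(2) [rule_format, of "Suc e"] that by (simp_all add: comb_def)
      have ss: "supp (Suc l * hdim N) (?f e)" "supp (Suc l * hdim N) (?g e)" for e
        by (intro supp_add supp_sc sL)+
      show ?thesis unfolding mS
      proof (rule exI [of _ ?f], rule exI [of _ ?g], rule exI [of _ "(1 - q powi (- int l)) * \<xi>"], intro conjI allI impI)
        show "(1 - q powi (- int l)) * \<xi> \<noteq> 0" using x0 fg(3) by simp
      qed (rule b, rule ss(1), rule ss(2), erule zz(1), erule zz(2), rule c0)
    qed
  qed
qed simp

text \<open>Component k of d x = z reads \<alpha>_(k+1) c x_(k+1) + d x_k = z_k and determines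
  x_(k+1) from x_k, starting with x_0 = u. The weights of the x_k descend and reach r' at k = J,
  where \<open>kill\<close> gives d x_J = 0. As z_k = 0 from J on, all later x_k vanish, and the
  last equation, in which there is no x_l, holds.\<close>

lemma TW_solve:
  assumes l: "1 \<le> l" "l < n" and J: "J < l" and u: "supp (hdim N) u" "op N Gb u = q powi (r' + int J) \<cdot>\<^sub>f u" "op N Gc u = q powi Y \<cdot>\<^sub>f u"
    and z: "supp (l * hdim N) z" "op (TW l) Gb z = q powi (r + r' + int J - 1) \<cdot>\<^sub>f z" "op (TW l) Gc z = q powi (Y - r - int l) \<cdot>\<^sub>f z"
    and zk: "\<forall>k. J \<le> k \<longrightarrow> k < l \<longrightarrow> cm k z = 0"
    and kill: "\<forall>v. supp (hdim N) v \<and> op N Gb v = q powi r' \<cdot>\<^sub>f v \<longrightarrow> op N Gd v = 0"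
  shows "\<exists>x. supp (l * hdim N) x \<and> op (TW l) Gb x = q powi (r + r' + int J) \<cdot>\<^sub>f x \<and>
    op (TW l) Gc x = q powi (Y + 1 - r - int l) \<cdot>\<^sub>f x \<and> op (TW l) Gd x = z \<and> cm 0 x = u \<and> (\<forall>k. J < k \<longrightarrow> k < l \<longrightarrow> cm k x = 0)"
proof -
  interpret S: hact n q "op N Ga" "op N Gb" "op N Gc" "op N Gd" by (rule hact_N)
  let ?D = "hdim N" and ?X = "r' + int J"
  \<comment> \<open>The power of q in the divisor is the eigenvalue of c on x_(k+1).\<close>
  define y where "y = rec_nat u (\<lambda>k v. (1 / (alpha q (Suc k) l * q powi (Y - int (Suc k)))) \<cdot>\<^sub>f (cm k z - op N Gd v))"
  have y0: "y 0 = u" and yS: "y (Suc k) = (1 / (alpha q (Suc k) l * q powi (Y - int (Suc k)))) \<cdot>\<^sub>f (cm k z - op N Gd (y k))" for k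
    by (simp_all add: y_def)
  \<comment> \<open>Dividing the weight of z by that of the k-th basis vector of V(l,r) gives the
    weight of component k.\<close>
  have cz: "S.wti (?X - int (Suc k)) (Y - int (Suc k)) (cm k z)" for k
  proof (cases "k < l")
    case True
    have "q powi (r + int k) \<cdot>\<^sub>f op N Gb (cm k z) = q powi (r + r' + int J - 1) \<cdot>\<^sub>f cm k z"
      "q powi (int k + 1 - r - int l) \<cdot>\<^sub>f op N Gc (cm k z) = q powi (Y - r - int l) \<cdot>\<^sub>f cm k z"
      using cm_TW(2,3) [OF True, of z] z(2,3) by (simp_all add: linD [OF lin_cmp])
    moreover have "q powi (r + r' + int J - 1) = q powi (r + int k) * q powi (?X - int (Suc k))"
      "q powi (Y - r - int l) = q powi (int k + 1 - r - int l) * q powi (Y - int (Suc k))"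
      unfolding qpowi_add [symmetric] by (rule arg_cong [of _ _ "\<lambda>x. q powi x"], simp)+
    ultimately have "q powi (r + int k) \<cdot>\<^sub>f (op N Gb (cm k z) - q powi (?X - int (Suc k)) \<cdot>\<^sub>f cm k z) = 0"
      "q powi (int k + 1 - r - int l) \<cdot>\<^sub>f (op N Gc (cm k z) - q powi (Y - int (Suc k)) \<cdot>\<^sub>f cm k z) = 0"
      by (simp_all add: pointwise algebra_simps)
    then have "op N Gb (cm k z) - q powi (?X - int (Suc k)) \<cdot>\<^sub>f cm k z = 0" "op N Gc (cm k z) - q powi (Y - int (Suc k)) \<cdot>\<^sub>f cm k z = 0"
      using q0 by (simp_all add: pointwise)
    then show ?thesis unfolding S.wti_def S.wt_def by simp
  next
    case False
    then have "cm k z = 0" using z(1) by (auto simp: cmp_def supp_def fun_eq_iff zero_fun_apply not_less intro: trans_le_add1 mult_le_mono1)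
    then show ?thesis by simp
  qed
  have wy: "supp ?D (y k) \<and> S.wti (?X - int k) (Y - int k) (y k)" for k
  proof (induction k)
    case 0
    then show ?case using u by (simp add: y0 S.wti_def S.wt_def)
  next
    case (Suc k)
    have "S.wti (?X - int (Suc k)) (Y - int (Suc k)) (op N Gd (y k))"
      by (rule S.wti_cong [OF S.wti_d [OF conjunct2 [OF Suc]]]) simp_all
    then have "S.wti (?X - int (Suc k)) (Y - int (Suc k)) (y (Suc k))" unfolding yS by (intro S.wti_sc S.wti_diff cz)
    moreover have "supp ?D (op N Gd (y k))" using supp_act [OF wN] .
    ultimately show ?case unfolding yS by simp
  qed
  have dJ: "op N Gd (y J) = 0"
    using wy [of J] by (intro kill [rule_format]) (auto dest: S.wtiD)
  have cmz: "cm k z = 0" if "J \<le> k" for k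
  proof (cases "k < l")
    case False
    then show ?thesis using z(1) by (auto simp: cmp_def supp_def fun_eq_iff zero_fun_apply not_less intro: trans_le_add1 mult_le_mono1)
  qed (rule zk [rule_format, OF that])
  have yJ: "y k = 0" if "J < k" for k
    using that
  proof (induction k)
    case (Suc k)
    then have "op N Gd (y k) = 0" using dJ by (cases "k = J") auto
    then show ?case unfolding yS using cmz [of k] Suc.prems by simp
  qed simp
  define x where "x = (\<lambda>i. if i < l * ?D then y (i div ?D) (i mod ?D) else 0)"
  have sx: "supp (l * ?D) x" by (simp add: supp_def x_def)
  have cx: "cm k x = y k" if "k < l" for k
  proof
    fix i
    show "cm k x i = y k i"
    proof (cases "i < ?D")
      case True
      then show ?thesis using idx_less [OF that True] idx_iff [OF True, of "k * ?D + i" k] by (simp add: cmp_def x_def)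
    next
      case False
      then show ?thesis using wy [of k] by (simp add: cmp_def supp_def)
    qed
  qed
  have "op (TW l) Gb x = q powi (r + r' + int J) \<cdot>\<^sub>f x"
  proof (rule cmp_ext [OF supp_TW])
    fix k assume k: "k < l"
    have "q powi (r + int k) * q powi (?X - int k) = q powi (r + r' + int J)"
      unfolding qpowi_add [symmetric] by (rule arg_cong [of _ _ "\<lambda>x. q powi x"]) simp
    then show "cm k (op (TW l) Gb x) = cm k (q powi (r + r' + int J) \<cdot>\<^sub>f x)"
      using S.wtiD(1) [OF conjunct2 [OF wy, of k]] by (simp only: cm_TW [OF k] linD [OF lin_cmp] cx [OF k] sc_sc)
  qed (use sx in simp)
  moreover have "op (TW l) Gc x = q powi (Y + 1 - r - int l) \<cdot>\<^sub>f x"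
  proof (rule cmp_ext [OF supp_TW])
    fix k assume k: "k < l"
    have "q powi (int k + 1 - r - int l) * q powi (Y - int k) = q powi (Y + 1 - r - int l)"
      unfolding qpowi_add [symmetric] by (rule arg_cong [of _ _ "\<lambda>x. q powi x"]) simp
    then show "cm k (op (TW l) Gc x) = cm k (q powi (Y + 1 - r - int l) \<cdot>\<^sub>f x)"
      using S.wtiD(2) [OF conjunct2 [OF wy, of k]] by (simp only: cm_TW [OF k] linD [OF lin_cmp] cx [OF k] sc_sc)
  qed (use sx in simp)
  moreover have "op (TW l) Gd x = z"
  proof (rule cmp_ext [OF supp_TW z(1)])
    fix k assume k: "k < l"
    show "cm k (op (TW l) Gd x) = cm k z"
    proof (cases "Suc k < l")
      case True
      have A: "alpha q (Suc k) l * q powi (Y - int (Suc k)) \<noteq> 0" using alpha_neq_0' [of "Suc k" l] True l by simp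
      have "op N Gc (alpha q (Suc k) l \<cdot>\<^sub>f y (Suc k)) = (alpha q (Suc k) l * q powi (Y - int (Suc k))) \<cdot>\<^sub>f y (Suc k)"
        using S.wtiD(2) [OF conjunct2 [OF wy, of "Suc k"]] by (simp only: linD [OF lin_mapp] sc_sc)
      also have "\<dots> = cm k z - op N Gd (y k)" unfolding yS sc_sc using A by (simp only: times_divide_eq_right mult_1_right divide_self) simp
      finally show ?thesis unfolding cm_TW(4) [OF k] cx [OF k] cx [OF True] by simp
    next
      case False
      then have kl: "Suc k = l" using k by simp
      have "J \<le> k" using J kl by simp
      then have "op N Gd (y k) = 0" using dJ yJ [of k] by (cases "k = J") auto
      then show ?thesis unfolding cm_TW(4) [OF k] cx [OF k] using kl cmz [OF \<open>J \<le> k\<close>] by simp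
    qed
  qed
  moreover have "cm 0 x = u" using cx [of 0] l y0 by simp
  moreover have "\<forall>k. J < k \<longrightarrow> k < l \<longrightarrow> cm k x = 0" using cx yJ by simp
  ultimately show ?thesis using sx by blast
qed

text \<open>The vector p solves d p = 0 with component 0 equal to u; the vector x solves d x =
  a^(J-J'-1) p with component 0 equal to zero. Since p ends at component J' and each a adds at most
  one component, the right-hand side ends below J, as \<open>TW_solve\<close> requires.\<close>

lemma TW_proj:
  assumes l: "1 \<le> l" "l < n" and J: "J' \<le> J" "J < l" and u: "supp (hdim N) u"
      "op N Gb u = q powi (r' + int J') \<cdot>\<^sub>f u" "op N Gc u = q powi (int l - r' - int J) \<cdot>\<^sub>f u"
    and kill: "\<forall>v. supp (hdim N) v \<and> op N Gb v = q powi r' \<cdot>\<^sub>f v \<longrightarrow> op N Gd v = 0"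
  shows "\<exists>p x. supp (l * hdim N) p \<and> supp (l * hdim N) x \<and>
    hact.wti q (op (TW l) Gb) (op (TW l) Gc) (r + r' + int J') (1 - (r + r') - int J) p \<and>
    hact.wti q (op (TW l) Gb) (op (TW l) Gc) (r + r' + int J) (1 - (r + r') - int J') x \<and>
    op (TW l) Gd p = 0 \<and> (J' < J \<longrightarrow> op (TW l) Gd x = (op (TW l) Ga ^^ (J - J' - 1)) p) \<and> cm 0 p = u"
proof -
  interpret T: hact n q "op (TW l) Ga" "op (TW l) Gb" "op (TW l) Gc" "op (TW l) Gd" by (rule hact_TW)
  have z0: "supp (l * hdim N) 0" "op (TW l) Gb 0 = q powi (r + r' + int J' - 1) \<cdot>\<^sub>f 0"
    "op (TW l) Gc 0 = q powi (int l - r' - int J - r - int l) \<cdot>\<^sub>f 0" "\<forall>k. J' \<le> k \<longrightarrow> k < l \<longrightarrow> cm k 0 = 0"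
    by (simp_all add: lin_0 [OF lin_cmp])
  have J': "J' < l" using J by simp
  obtain p where p: "supp (l * hdim N) p" "op (TW l) Gb p = q powi (r + r' + int J') \<cdot>\<^sub>f p"
    "op (TW l) Gc p = q powi (int l - r' - int J + 1 - r - int l) \<cdot>\<^sub>f p" "op (TW l) Gd p = 0" "cm 0 p = u"
    "\<forall>k. J' < k \<longrightarrow> k < l \<longrightarrow> cm k p = 0"
    using TW_solve [OF l J' u z0 kill] by (elim exE conjE) (rule that)
  have e: "int l - r' - int J + 1 - r - int l = 1 - (r + r') - int J" by simp
  have wp: "T.wti (r + r' + int J') (1 - (r + r') - int J) p"
    using p(2,3) unfolding e by (simp add: T.wti_def T.wt_def)
  show ?thesis
  proof (cases "J' < J")
    case False
    then have "J' = J" using J by simp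
    then show ?thesis using p wp by (intro exI [of _ p] exI [of _ 0]) simp
  next
    case JJ: True
    define z where "z = (op (TW l) Ga ^^ (J - J' - 1)) p"
    have sz: "supp (l * hdim N) z" unfolding z_def using op_funpow_supp [OF wTW] p(1) by simp
    have wz: "T.wti (r + r' + int J - 1) (- (r + r') - int J') z"
      unfolding z_def by (rule T.wti_cong [OF T.wti_apow [OF wp]]) (use JJ in \<open>simp_all add: of_nat_diff\<close>)
    have ak: "\<forall>k. J' + i < k \<longrightarrow> k < l \<longrightarrow> cm k ((op (TW l) Ga ^^ i) p) = 0" for i
    proof (induction i)
      case (Suc i)
      show ?case
      proof (intro allI impI)
        fix k assume k: "J' + Suc i < k" "k < l"
        then have "J' + i < k - 1" "k - 1 < l" "J' + i < k" by auto
        then have "prv k ((op (TW l) Ga ^^ i) p) = 0" "cm k ((op (TW l) Ga ^^ i) p) = 0"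
          using Suc k by (simp_all add: prv_def)
        then show "cm k ((op (TW l) Ga ^^ Suc i) p) = 0" by (simp add: cm_TW(1) [OF k(2)])
      qed
    qed (use p(6) in simp)
    have zk: "\<forall>k. J \<le> k \<longrightarrow> k < l \<longrightarrow> cm k z = 0"
      unfolding z_def by (intro allI impI, rule ak [rule_format]) (use JJ in auto)
    \<comment> \<open>The exponent for c for which the solution x gets the weight 1 - (r + r') -
      J'.\<close>
    define Y where "Y = r + int l - (r + r') - int J'"
    have zw: "op (TW l) Gb z = q powi (r + r' + int J - 1) \<cdot>\<^sub>f z" "op (TW l) Gc z = q powi (Y - r - int l) \<cdot>\<^sub>f z"
    proof -
      have "Y - r - int l = - (r + r') - int J'" by (simp add: Y_def)
      then show "op (TW l) Gb z = q powi (r + r' + int J - 1) \<cdot>\<^sub>f z" "op (TW l) Gc z = q powi (Y - r - int l) \<cdot>\<^sub>f z"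
        using T.wtiD [OF wz] by (simp_all only:)
    qed
    have s0: "supp (hdim N) 0" "op N Gb 0 = q powi (r' + int J) \<cdot>\<^sub>f 0" "op N Gc 0 = q powi Y \<cdot>\<^sub>f 0" by simp_all
    obtain x where x: "supp (l * hdim N) x" "op (TW l) Gb x = q powi (r + r' + int J) \<cdot>\<^sub>f x"
      "op (TW l) Gc x = q powi (Y + 1 - r - int l) \<cdot>\<^sub>f x" "op (TW l) Gd x = z"
      using TW_solve [OF l J(2) s0 sz zw zk kill] by (elim exE conjE) (rule that)
    have e: "Y + 1 - r - int l = 1 - (r + r') - int J'" by (simp add: Y_def)
    have "T.wti (r + r' + int J) (1 - (r + r') - int J') x"
      using x(2,3) unfolding e by (simp add: T.wti_def T.wt_def)
    then show ?thesis using p wp x(1,4) unfolding z_def by blast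
  qed
qed

end

end

context qroot
begin

lemma indep_bv:
  assumes "p < n"
  shows "indep s (bv n s p :: nat \<Rightarrow> nat \<Rightarrow> 'k)"
  unfolding indep_def
proof (intro allI impI)
  fix c :: "nat \<Rightarrow> 'k" and e assume c: "lcomb s (bv n s p) c = 0" and e: "e < s"
  have "lcomb s (bv n s p) c (p * s + e) = (\<Sum>e'<s. if e' = e then c e' else 0)"
    unfolding lcomb_def sum_fun_apply using assms e by (intro sum.cong) (auto simp: bv_apply sc_apply)
  then show "c e = 0" using e by (simp add: c zero_fun_apply)
qed

lemma hw_V:
  assumes v: "supp n v" and v0: "v \<noteq> 0" and d: "op (V_mod q n t) Gd v = 0" and b: "op (V_mod q n t) Gb v = \<beta> \<cdot>\<^sub>f v"
  shows "\<beta> = q powi t \<and> (\<exists>c. v = c \<cdot>\<^sub>f vv n 0)"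
proof -
  have l: "lin (\<lambda>v j. q powi (t + int j) * v j)" by (auto simp: lin_def pointwise algebra_simps)
  have "op (V_mod q n t) Gb v = (\<lambda>j. q powi (t + int j) * v j)"
  proof (rule lin_eq_on_supp [OF lin_mapp l _ v])
    fix j assume "j < n"
    then show "op (V_mod q n t) Gb (uv j) = (\<lambda>i. q powi (t + int i) * uv j i)"
      unfolding uv_vv [OF \<open>j < n\<close>] op_V by (auto simp: fun_eq_iff sc_apply vv_def uv_def)
  qed
  then have e: "q powi (t + int j) * v j = \<beta> * v j" for j using b by (metis sc_apply)
  obtain j where j: "v j \<noteq> 0" using v0 by (auto simp: fun_eq_iff zero_fun_apply)
  then have jn: "j < n" using v by (metis supp_def not_less)
  have \<beta>: "\<beta> = q powi (t + int j)" using e [of j] j by simp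
  have only: "v k = 0" if "k \<noteq> j" for k
  proof (rule ccontr)
    assume k: "v k \<noteq> 0"
    then have kn: "k < n" using v by (metis supp_def not_less)
    have "q powi (t + int k) = q powi (t + int j)" using e [of k] k \<beta> by simp
    then have "int n dvd int k - int j" by (simp add: qpowi_eq_iff)
    then show False using nat_eq_of_dvd [OF kn jn] that by simp
  qed
  have ve: "v = v j \<cdot>\<^sub>f vv n j"
    using only jn by (auto simp: fun_eq_iff sc_apply vv_def uv_def)
  have "op (V_mod q n t) Gd (v j \<cdot>\<^sub>f vv n j) = 0" using d ve by simp
  then have D: "(v j * alpha q j n) \<cdot>\<^sub>f vv n (j - 1) = 0" by (simp only: linD [OF lin_mapp] op_V sc_sc)
  have "j = 0"
  proof (rule ccontr)
    assume "j \<noteq> 0"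
    then have A: "alpha q j n \<noteq> 0" using alpha_neq_0' [of j n] jn by simp
    have "vv n (j - 1) (j - 1) = (1 :: 'k)" using jn by (simp add: vv_def uv_def)
    then show False using fun_cong [OF D, of "j - 1"] A j by (simp add: sc_apply zero_fun_apply)
  qed
  then show ?thesis using \<beta> ve by auto
qed

text \<open>The eigenvalues of b on highest weight vectors of the summand with index i: q^t and
  q^(t+m) with t = R + i and m = L - 2i. For projective summands m is n + L - 2i, which is the same
  modulo n.\<close>

definition wset :: "int \<Rightarrow> nat \<Rightarrow> nat \<Rightarrow> 'k set" where
  "wset R L i = {q powi (R + int i), q powi (R + int (L - i))}"

text \<open>The pairs {i, L - i} and {j, L - j} are disjoint exactly under the last two conditions,
  and all four numbers are below n, hence distinct modulo n.\<close>

lemma wset_disjoint: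
  assumes "L < n" "i \<le> L" "j \<le> L" "i \<noteq> j" "i + j \<noteq> L"
  shows "wset R L i \<inter> wset R L j = {}"
proof -
  have ne: "q powi (R + int a) \<noteq> q powi (R + int b)" if "a \<noteq> b" "a < n" "b < n" for a b
    using nat_eq_of_dvd [OF that(2,3)] that(1) by (auto simp: qpowi_eq_iff)
  have "q powi (R + int i) \<noteq> q powi (R + int j)" "q powi (R + int i) \<noteq> q powi (R + int (L - j))"
    "q powi (R + int (L - i)) \<noteq> q powi (R + int j)" "q powi (R + int (L - i)) \<noteq> q powi (R + int (L - j))"
    by (rule ne; use assms in linarith)+
  then show ?thesis by (auto simp: wset_def)
qed

definition Pm :: "nat \<Rightarrow> int \<Rightarrow> 'k hmod" where
  "Pm m t = (if m = n then V_mod q n t else PP m t)"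

section \<open>The summands inside the tensor product of V(l,r) with a band module\<close>

context
  fixes s l l' :: nat and r r' :: int and A0 A1 D0 D1 :: 'k
  assumes l: "1 \<le> l" "l < n" and l': "1 \<le> l'" "l' < n" and ll: "l + l' \<le> n"
    and nd: "A0 * D1 \<noteq> A1 * D0"
begin

abbreviation "NG \<equiv> band_mod n q s l' r' A0 A1 D0 D1"
abbreviation "WG \<equiv> tensor (V_mod q l r) NG"

lemma hNG: "is_hmod n q NG" by (rule is_hmod_GG [OF l'])

lemma wtNG: "j < hdim NG \<Longrightarrow> \<exists>x y. op NG Gb (uv j) = q powi x \<cdot>\<^sub>f uv j \<and> op NG Gc (uv j) = q powi y \<cdot>\<^sub>f uv j"
  using op_Gb [OF l'] op_Gc [OF l'] by (simp add: uv_bv) blast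

lemma diagb_WG: "diagb WG" by (rule diagb_TW [OF hNG wtNG])

lemmas WG = hact_TW [OF hNG, of l r] wTW [OF hNG, of l r] diagb_WG

lemma WG_bands:
  assumes i: "i < min l l'"
  shows "\<exists>f g. hact.band n q (op WG Ga) (op WG Gb) (op WG Gc) (op WG Gd) A0 A1 D0 D1
      (l + l' - 1 - 2 * i) (r + r' + int i) (qint q (l + l' - 1 - 2 * i) / qint q l') f g \<and>
    (\<forall>e. supp (hdim WG) (f e) \<and> supp (hdim WG) (g e)) \<and> (\<forall>e. s \<le> e \<longrightarrow> f e = 0 \<and> g e = 0) \<and> indep s g"
proof -
  have sup: "supp (hdim NG) (bv n s p e)" for p e by simp
  have z: "\<forall>e. s \<le> e \<longrightarrow> bv n s 0 e = 0 \<and> bv n s (n - l') e = 0" by simp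
  obtain f g \<xi> where fg: "hact.band n q (op WG Ga) (op WG Gb) (op WG Gc) (op WG Gd) A0 A1 D0 D1
      (l + l' - 1 - 2 * i) (r + r' + int i) (qint q (l + l' - 1 - 2 * i) / qint q l') f g"
    "\<forall>e. supp (l * hdim NG) (f e) \<and> supp (l * hdim NG) (g e)" "\<forall>e. s \<le> e \<longrightarrow> f e = 0 \<and> g e = 0"
    "\<xi> \<noteq> 0" "\<forall>e. cmp (hdim NG) 0 (g e) = \<xi> \<cdot>\<^sub>f (op NG Ga ^^ i) (bv n s (n - l') e)"
    using TW_bands [OF hNG l' band_GG [OF l'] sup sup z l(1) ll i, where r = r] by (elim exE conjE) (rule that)
  have "cmp (hdim NG) 0 (g e) = \<xi> \<cdot>\<^sub>f bv n s (n - l' + i) e" for e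
    using fg(5) by (simp add: apow_bv_upper [OF l' order_refl])
  note c = this
  have "i < l'" using i by simp
  then have p: "n - l' + i < n" using l' by linarith
  have "indep s g" by (rule indep_hom [OF lin_cmp indep_bv [OF p] c fg(4)])
  then show ?thesis using fg(1-3) by auto
qed

text \<open>The rescaling that absorbs \<kappa> differs for finite and infinite \<eta> and is
  therefore passed in as \<open>resc\<close>. It multiplies each f e and g e by a nonzero scalar,
  which preserves independence.\<close>

lemma emb_WG_band:
  assumes i: "i < min l l'" and AD: "(A0 = 1 \<and> A1 = 0) \<or> (D0 = 1 \<and> D1 = 0)"
    and nd': "A0 * D1' \<noteq> A1 * D0'"
    and resc: "\<And>f g \<kappa>. \<kappa> = qint q (l + l' - 1 - 2 * i) / qint q l' \<Longrightarrow> \<kappa> \<noteq> 0 \<Longrightarrow>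
      hact.band n q (op WG Ga) (op WG Gb) (op WG Gc) (op WG Gd) A0 A1 D0 D1 (l + l' - 1 - 2 * i) (r + r' + int i) \<kappa> f g \<Longrightarrow>
      \<exists>x y. (\<forall>e. x e \<noteq> 0) \<and> (\<forall>e. y e \<noteq> 0) \<and> hact.band n q (op WG Ga) (op WG Gb) (op WG Gc) (op WG Gd) A0 A1 D0' D1' (l + l' - 1 - 2 * i)
        (r + r' + int i) 1 (\<lambda>e. x e \<cdot>\<^sub>f f e) (\<lambda>e. y e \<cdot>\<^sub>f g e)"
  shows "emb n q WG (band_mod n q s (l + l' - 1 - 2 * i) (r + r' + int i) A0 A1 D0' D1') (wset (r + r') (l + l' - 1) i)"
proof -
  interpret W: hact n q "op WG Ga" "op WG Gb" "op WG Gc" "op WG Gd" by (rule WG(1))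
  let ?m = "l + l' - 1 - 2 * i" and ?t = "r + r' + int i"
  have m: "1 \<le> ?m" "?m < n" using i ll l l' by auto
  obtain f g where fg: "W.band A0 A1 D0 D1 ?m ?t (qint q ?m / qint q l') f g"
    "\<forall>e. supp (hdim WG) (f e) \<and> supp (hdim WG) (g e)" "\<forall>e. s \<le> e \<longrightarrow> f e = 0 \<and> g e = 0" "indep s g"
    using WG_bands [OF i] by (elim exE conjE) (rule that)
  have \<kappa>: "qint q ?m / qint q l' \<noteq> 0" using qint_neq_0 [of ?m] qint_neq_0 [of l'] m l' by simp
  obtain x y where xy: "\<forall>e. x e \<noteq> 0" "\<forall>e. y e \<noteq> 0" "W.band A0 A1 D0' D1' ?m ?t 1 (\<lambda>e. x e \<cdot>\<^sub>f f e) (\<lambda>e. y e \<cdot>\<^sub>f g e)"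
    using resc [OF refl \<kappa> fg(1)] by (elim exE conjE) (rule that)
  have ig: "indep s (\<lambda>e. y e \<cdot>\<^sub>f g e)" using indep_scale [OF fg(4)] xy(2) by blast
  have if': "indep s f"
    by (rule W.band_indep_f [OF fg(1,4) m \<kappa> AD])
  have "indep s (\<lambda>e. x e \<cdot>\<^sub>f f e)" using indep_scale [OF if'] xy(1) by blast
  moreover have "supp (hdim WG) (x e \<cdot>\<^sub>f f e)" "supp (hdim WG) (y e \<cdot>\<^sub>f g e)" for e using fg(2) by auto
  moreover have "x e \<cdot>\<^sub>f f e = 0" "y e \<cdot>\<^sub>f g e = 0" if "s \<le> e" for e using fg(3) that by auto
  ultimately have "emb n q WG (band_mod n q s ?m ?t A0 A1 D0' D1') {q powi ?t, q powi (?t + int ?m)}"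
    using emb_GG [OF m nd' WG, of "\<lambda>e. x e \<cdot>\<^sub>f f e" "\<lambda>e. y e \<cdot>\<^sub>f g e" s ?t] xy(3) ig by blast
  moreover have "?t + int ?m = r + r' + int (l + l' - 1 - i)"
  proof -
    have "i + ?m = l + l' - 1 - i" using i by auto
    from arg_cong [OF this, of int] show ?thesis by (simp only: of_nat_add add.assoc)
  qed
  ultimately show ?thesis by (simp only: wset_def)
qed

text \<open>With J = l + l' - 1 - j \<le> j, the highest weight vectors p are built so that their
  component 0 is a^(J-l') f_e. The vectors to be shown independent are the p and the a^(j-J) p,
  whose components 0 are a^(J-l') f_e and a^(j-l') f_e; these are basis vectors because j - l' < n -
  l'.\<close>

lemma emb_WG_proj:
  assumes j: "l + l' - 1 \<le> 2 * j" "j < l"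
    and hV: "n + l + l' - 1 - 2 * j = n \<Longrightarrow> is_hmod n q (V_mod q n (r + r' + int j))"
  shows "emb n q WG (copies s (Pm (n + l + l' - 1 - 2 * j) (r + r' + int j))) (wset (r + r') (l + l' - 1) j)"
proof -
  interpret W: hact n q "op WG Ga" "op WG Gb" "op WG Gc" "op WG Gd" by (rule WG(1))
  let ?J = "l + l' - 1 - j" and ?R = "r + r'"
  let ?t = "?R + int j" and ?m = "n + l + l' - 1 - 2 * j"
  have J: "?J \<le> j" "l' \<le> ?J" "j - l' < n - l'" using j l' ll l by auto
  \<comment> \<open>The truncated differences are first written as sums of natural numbers, then
    turned into integer equations for the exponents.\<close>
  have h: "?J + j + 1 = l + l'" "?m + 2 * j + 1 = n + l + l'" "(?J - l') + j + 1 = l" "(?J - l') + l' = ?J"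
    using j l l' ll by auto
  have ia: "int a = int c - int b - 1" if "a + b + 1 = c" for a b c using that by simp
  have ib: "int a = int c - int b" if "a + b = c" for a b c using that by simp
  have iJ: "int ?J = int l + int l' - int j - 1" using ia [OF h(1)] by (simp only: of_nat_add)
  have im: "int ?m = int n + int l + int l' - 2 * int j - 1"
    using ia [OF h(2)] by (simp only: of_nat_add of_nat_mult of_nat_numeral)
  note iJl = ia [OF h(3)] ib [OF h(4)]
  define u :: "nat \<Rightarrow> nat \<Rightarrow> 'k" where "u = (\<lambda>e. bv n s (?J - l') e)"
  have su: "supp (hdim NG) (u e)" for e by (simp add: u_def)
  have ub: "op NG Gb (u e) = q powi (r' + int ?J) \<cdot>\<^sub>f u e" for e
  proof -
    have e: "r' + int l' + int (?J - l') = r' + int ?J" unfolding iJl(2) by simp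
    show ?thesis by (simp only: u_def op_Gb [OF l'] e)
  qed
  have uc: "op NG Gc (u e) = q powi (int l - r' - int j) \<cdot>\<^sub>f u e" for e
  proof -
    have e: "int (?J - l') + 1 - r' = int l - r' - int j" unfolding iJl(1) by simp
    show ?thesis by (simp only: u_def op_Gc [OF l'] e)
  qed
  \<comment> \<open>Modulo n, the weight r' occurs only in block n - l', whose vectors are the
    combinations of the g_e, and d g_e = 0.\<close>
  have kill: "\<forall>v. supp (hdim NG) v \<and> op NG Gb v = q powi r' \<cdot>\<^sub>f v \<longrightarrow> op NG Gd v = 0"
  proof (intro allI impI, elim conjE)
    fix v assume v: "supp (hdim NG) v" "op NG Gb v = q powi r' \<cdot>\<^sub>f v"
    show "op NG Gd v = 0"
    proof (cases "v = 0")
      case False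
      have "supp (n * s) v" using v(1) by simp
      then obtain p c where p: "p < n" "q powi r' = q powi (r' + int l' + int p)" "v = lcomb s (bv n s p) c"
        using weight_GG [OF l' nd _ v(2) False] by blast
      have "int n dvd - int (l' + p)" using p(2) by (simp add: qpowi_eq_iff algebra_simps)
      then have "n dvd l' + p" by (simp only: dvd_minus_iff int_dvd_int_iff)
      then obtain k where k: "l' + p = n * k" by blast
      have "k = 1"
      proof -
        have "0 < n * k" "n * k < n * 2" unfolding k [symmetric] using p(1) l' by auto
        then have "0 < k" "k < 2" by simp_all
        then show ?thesis by simp
      qed
      then have pn: "p = n - l'" using k by simp
      have "op NG Gd (bv n s p e) = 0" for e using l' by (simp add: pn op_Gd [OF l'])
      then show ?thesis unfolding p(3) lin_of_lcomb [OF lin_mapp] by (simp add: lcomb_def)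
    qed simp
  qed
  have "\<forall>e. \<exists>p x. supp (l * hdim NG) p \<and> supp (l * hdim NG) x \<and>
    W.wti (?R + int ?J) (1 - ?R - int j) p \<and> W.wti (?R + int j) (1 - ?R - int ?J) x \<and>
    op WG Gd p = 0 \<and> (?J < j \<longrightarrow> op WG Gd x = (op WG Ga ^^ (j - ?J - 1)) p) \<and> cmp (hdim NG) 0 p = u e"
    by (intro allI, rule TW_proj [OF hNG l J(1) j(2) su ub uc kill])
  then obtain p x where px: "\<forall>e. supp (l * hdim NG) (p e) \<and> supp (l * hdim NG) (x e) \<and>
    W.wti (?R + int ?J) (1 - ?R - int j) (p e) \<and> W.wti (?R + int j) (1 - ?R - int ?J) (x e) \<and>
    op WG Gd (p e) = 0 \<and> (?J < j \<longrightarrow> op WG Gd (x e) = (op WG Ga ^^ (j - ?J - 1)) (p e)) \<and> cmp (hdim NG) 0 (p e) = u e"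
    unfolding choice_iff by (elim exE) (rule that)
  have sp: "supp (hdim WG) (p e)" and sx: "supp (hdim WG) (x e)"
    and wp: "W.wti (?R + int ?J) (1 - ?R - int j) (p e)" and wx: "W.wti (?R + int j) (1 - ?R - int ?J) (x e)"
    and dp: "op WG Gd (p e) = 0" and dx: "?J < j \<Longrightarrow> op WG Gd (x e) = (op WG Ga ^^ (j - ?J - 1)) (p e)"
    and cp: "cmp (hdim NG) 0 (p e) = u e" for e using px by auto
  have ln: "l \<le> n" using l by simp
  have an: "(op WG Ga ^^ n) v = 0" if "supp (hdim WG) v" for v
    by (rule an_TW [OF hNG wtNG l(1) ln]) (use that in simp_all)
  have ap: "cmp (hdim NG) 0 ((op WG Ga ^^ k) (p e)) = 1 \<cdot>\<^sub>f bv n s (?J - l' + k) e" if "?J - l' + k < n - l'" for k e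
    unfolding cm_0_apow [OF hNG l(1)] cp u_def using apow_bv_lower [OF l' that] by simp
  have indp: "indep s (\<lambda>e. (op WG Ga ^^ k) (p e))" if "?J - l' + k < n - l'" for k
  proof (rule indep_hom [OF lin_cmp indep_bv ap [OF that]])
    show "?J - l' + k < n" using that by simp
  qed simp
  have JN: "?J - l' + (j - ?J) < n - l'" "?J - l' + 0 < n - l'" using J by auto
  show ?thesis
  proof (cases "?J = j")
    case True
    \<comment> \<open>Here the two highest weights coincide, and the summand is the simple
      projective module V(n, _) generated by p alone.\<close>
    then have m: "?m = n" using j ll l' by simp
    have hVn: "is_hmod n q (V_mod q n ?t)" by (rule hV [OF m])
    have wp': "W.wti ?t (1 - ?t - int n) (p e)" for e
      by (rule W.wti_cong [OF wp]) (use True in simp_all)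
    have "\<forall>e. \<exists>F. hm (V_mod q n ?t) WG F \<and> (\<forall>i. F (vv n i) = (op WG Ga ^^ i) (p e))"
      using V_hom [OF WG(1,2) order_refl sp wp' dp an [OF sp]] by blast
    then obtain F where F: "\<forall>e. hm (V_mod q n ?t) WG (F e) \<and> (\<forall>i. F e (vv n i) = (op WG Ga ^^ i) (p e))"
      unfolding choice_iff by (elim exE) (rule that)
    have "emb n q WG (copies s (V_mod q n ?t)) {q powi ?t}"
    proof (rule emb_copies [where u = "\<lambda>_. vv n 0", OF hVn diagb_V q0 WG(2,3)])
      fix \<beta> v assume v: "supp (hdim (V_mod q n ?t)) v" "v \<noteq> 0" "op (V_mod q n ?t) Gd v = 0" "op (V_mod q n ?t) Gb v = \<beta> \<cdot>\<^sub>f v"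
      then show "\<beta> \<in> {q powi ?t} \<and> (\<exists>c. v = c \<cdot>\<^sub>f vv n 0)" using hw_V [of v ?t \<beta>] by simp
    next
      show "hm (V_mod q n ?t) WG (F e)" for e using F by blast
      show "indep s (\<lambda>e. F e (vv n 0))" using F indp [OF JN(2)] by simp
    qed
    moreover have "wset ?R (l + l' - 1) j = {q powi ?t}" using True by (simp add: wset_def)
    ultimately show ?thesis by (simp only: m Pm_def simp_thms if_True)
  next
    case False
    then have JJ: "?J < j" using J by simp
    have m: "1 \<le> ?m" "?m < n" and mJ: "n - ?m = j - ?J" using J JJ j ll l l' by auto
    have wx': "W.wti ?t (1 - ?t - int ?m) (x e)" for e
      by (rule W.wti_cong [OF wx]) (simp_all only: iJ im, simp_all add: algebra_simps)
    have wp': "W.wti (?t + int ?m) (1 - ?t) (p e)" for e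
      by (rule W.wti_cong [OF wp]) (simp_all only: iJ im, simp_all add: algebra_simps)
    have dx': "op WG Gd (x e) = (op WG Ga ^^ (n - ?m - 1)) (p e)" for e using dx [OF JJ] by (simp only: mJ)
    have "\<forall>e. \<exists>F. hm (PP ?m ?t) WG F \<and> (\<forall>i. F (xv i) = (op WG Ga ^^ i) (x e)) \<and> (\<forall>i. F (pv i) = (op WG Ga ^^ i) (p e))"
      using PP_hom [OF m WG(1,2) sx sp wx' wp' dp dx' an [OF sx] an [OF sp]] by blast
    then obtain F where F: "\<forall>e. hm (PP ?m ?t) WG (F e) \<and> (\<forall>i. F e (xv i) = (op WG Ga ^^ i) (x e)) \<and> (\<forall>i. F e (pv i) = (op WG Ga ^^ i) (p e))"
      unfolding choice_iff by (elim exE) (rule that)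
    have ne: "q powi ?t \<noteq> q powi (?t + int ?m)"
    proof
      assume "q powi ?t = q powi (?t + int ?m)"
      then have "int n dvd - int ?m" by (simp only: qpowi_eq_iff) simp
      then have "n dvd ?m" by (simp only: dvd_minus_iff int_dvd_int_iff)
      then show False using m by (auto dest: dvd_imp_le)
    qed
    have "emb n q WG (copies s (PP ?m ?t)) {q powi ?t, q powi (?t + int ?m)}"
    proof (rule emb_copies [where u = "\<lambda>\<beta>. if \<beta> = q powi ?t then pv (n - ?m) else pv 0", OF is_hmod_PP [OF m] diagb_PP [OF m] q0 WG(2,3)])
      fix \<beta> v assume v: "supp (hdim (PP ?m ?t)) v" "v \<noteq> 0" "op (PP ?m ?t) Gd v = 0" "op (PP ?m ?t) Gb v = \<beta> \<cdot>\<^sub>f v"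
      have "supp (2 * n) v" using v(1) by simp
      from hw_PP [OF m this v(4,2,3)]
      show "\<beta> \<in> {q powi ?t, q powi (?t + int ?m)} \<and> (\<exists>c. v = c \<cdot>\<^sub>f (if \<beta> = q powi ?t then pv (n - ?m) else pv 0))"
        using ne by auto
    next
      show "hm (PP ?m ?t) WG (F e)" for e using F by blast
      have "indep s (\<lambda>e. F e (pv (n - ?m)))" "indep s (\<lambda>e. F e (pv 0))"
        unfolding mJ using F indp [OF JN(2)] indp [OF JN(1)] by simp_all
      then show "indep s (\<lambda>e. F e (if \<beta> = q powi ?t then pv (n - ?m) else pv 0))" for \<beta> by simp
    qed
    moreover have "q powi (?t + int ?m) = q powi (?R + int ?J)"
      by (rule qpowi_cong) (simp only: iJ im, simp)
    ultimately show ?thesis using m by (simp only: wset_def Pm_def) simp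
  qed
qed

text \<open>Weights of band and projective summands do not meet: for i < min l l' and the occurring
  j one has i < j and L - i \<ge> l > j. So the whole sum embeds, and it remains to count
  dimensions: n s for each band summand, 2 n s for s copies of each P(m, _) with m < n, and n s for
  s copies of V(n, _), in total l n s.\<close>

lemma tensor_decomp:
  fixes Yc :: "nat \<Rightarrow> 'k hmod"
  assumes Y: "\<And>i. i < min l l' \<Longrightarrow> emb n q WG (Yc i) (wset (r + r') (l + l' - 1) i)"
    and hY: "\<And>i. i < min l l' \<Longrightarrow> hdim (Yc i) = n * s"
    and hV: "\<And>j. n + l + l' - 1 - 2 * j = n \<Longrightarrow> (l + l') div 2 \<le> j \<Longrightarrow> j < l \<Longrightarrow> is_hmod n q (V_mod q n (r + r' + int j))"
  shows "is_hmod n q WG \<and> fiso WG (dsum [dsum (map Yc [0..<min l l']),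
    dsum (map (\<lambda>j. copies s (Pm (n + l + l' - 1 - 2 * j) (r + r' + int j))) [(l + l') div 2..<l])])"
proof -
  let ?L = "l + l' - 1" and ?c = "(l + l') div 2" and ?S = "wset (r + r') (l + l' - 1)"
  let ?P = "\<lambda>j. copies s (Pm (n + l + l' - 1 - 2 * j) (r + r' + int j))"
  let ?A = "dsum (map Yc [0..<min l l'])" and ?B = "dsum (map ?P [?c..<l])"
  have L: "?L < n" using ll l by simp
  have 1: "emb n q WG ?A (\<Union>i\<in>set [0..<min l l']. ?S i)"
  proof (rule emb_dsum [OF q0 WG(2,3)])
    show "emb n q WG (Yc i) (?S i)" if "i \<in> set [0..<min l l']" for i using that Y by simp
    show "?S i \<inter> ?S j = {}" if "i \<in> set [0..<min l l']" "j \<in> set [0..<min l l']" "i \<noteq> j" for i j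
      by (rule wset_disjoint [OF L]) (use that in auto)
  qed (rule distinct_upt)
  have 2: "emb n q WG ?B (\<Union>j\<in>set [?c..<l]. ?S j)"
  proof (rule emb_dsum [OF q0 WG(2,3)])
    show "emb n q WG (?P j) (?S j)" if "j \<in> set [?c..<l]" for j
      by (rule emb_WG_proj) (use that hV [of j] in auto)
    show "?S i \<inter> ?S j = {}" if "i \<in> set [?c..<l]" "j \<in> set [?c..<l]" "i \<noteq> j" for i j
      by (rule wset_disjoint [OF L]) (use that l' in auto)
  qed (rule distinct_upt)
  have d: "(\<Union>i\<in>set [0..<min l l']. ?S i) \<inter> (\<Union>j\<in>set [?c..<l]. ?S j) = {}"
  proof -
    have S: "?S i \<inter> ?S j = {}" if "i < min l l'" "?c \<le> j" "j < l" for i j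
      by (rule wset_disjoint [OF L]) (use that l' in auto)
    show ?thesis
    proof (rule equals0I)
      fix x assume "x \<in> (\<Union>i\<in>set [0..<min l l']. ?S i) \<inter> (\<Union>j\<in>set [?c..<l]. ?S j)"
      then obtain i j where "i < min l l'" "?c \<le> j" "j < l" "x \<in> ?S i" "x \<in> ?S j" by auto
      then show False using S [of i j] by blast
    qed
  qed
  let ?X = "dsum [?A, ?B]"
  have "emb n q WG (dsum [?B]) ((\<Union>j\<in>set [?c..<l]. ?S j) \<union> {})"
    by (rule emb_Cons [OF q0 WG(2,3) 2 emb_Nil [OF WG(2)]]) simp
  then have "emb n q WG ?X ((\<Union>i\<in>set [0..<min l l']. ?S i) \<union> ((\<Union>j\<in>set [?c..<l]. ?S j) \<union> {}))"
    by (rule emb_Cons [OF q0 WG(2,3) 1]) (use d in simp)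
  then obtain F where X: "is_hmod n q ?X" and F: "hm ?X WG F" "finj ?X F"
    unfolding emb_def by (elim conjE exE) (rule that)
  have hA: "hdim ?A = min l l' * (n * s)"
  proof -
    have "hdim ?A = sum_list (map (\<lambda>i. hdim (Yc i)) [0..<min l l'])" by (simp add: dsum_def o_def)
    also have "map (\<lambda>i. hdim (Yc i)) [0..<min l l'] = map (\<lambda>i. n * s) [0..<min l l']" using hY by auto
    finally show ?thesis by (simp add: sum_list_const_mult [symmetric] sum_list_triv)
  qed
  have hP: "hdim (?P j) = (if 2 * j = ?L then s * n else s * (2 * n))" if "j < l" for j
  proof -
    have "n + l + l' - 1 - 2 * j = n \<longleftrightarrow> 2 * j = ?L" using that l ll l' by auto
    then show ?thesis by (simp add: Pm_def)
  qed
  have hB: "hdim ?B = (l - min l l') * (n * s)"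
  proof -
    have "hdim ?B = sum_list (map (\<lambda>j. hdim (?P j)) [?c..<l])" by (simp add: dsum_def o_def)
    also have "\<dots> = sum_list (map (\<lambda>j. if 2 * j = ?L then s * n else s * (2 * n)) [?c..<l])"
      by (rule arg_cong [of _ _ sum_list], rule map_cong [OF refl]) (simp only: set_upt hP atLeastLessThan_iff)
    also have "\<dots> = (l - min l l') * (n * s)"
    proof (cases "l \<le> l'")
      case True
      then have "l \<le> ?c" by simp
      then show ?thesis using True by simp
    next
      case False
      show ?thesis
      \<comment> \<open>For even L the index j = L div 2 contributes the copies of V(n, _), with
        half the dimension of the other projective summands.\<close>
      proof (cases "even ?L")
        case True
        then obtain k where k: "?L = 2 * k" by blast
        have c: "?c = k" "k < l" using k False l' by auto
        have "sum_list (map (\<lambda>j. if 2 * j = ?L then s * n else s * (2 * n)) [?c..<l])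
          = s * n + sum_list (map (\<lambda>j. s * (2 * n)) [Suc k..<l])"
          unfolding c(1) k upt_conv_Cons [OF c(2)] by (simp cong: map_cong) (rule arg_cong [of _ _ sum_list], rule map_cong, auto)
        also have "\<dots> = s * n + (l - Suc k) * (s * (2 * n))" by (simp add: sum_list_triv)
        also have "\<dots> = (1 + (l - Suc k) * 2) * (n * s)" by (simp add: algebra_simps)
        also have "1 + (l - Suc k) * 2 = l - l'" using k c False l' by auto
        finally show ?thesis using False by simp
      next
        case odd: False
        have "sum_list (map (\<lambda>j. if 2 * j = ?L then s * n else s * (2 * n)) [?c..<l]) = sum_list (map (\<lambda>j. s * (2 * n)) [?c..<l])"
        proof -
          have "2 * j \<noteq> ?L" for j using odd dvd_triv_left [of 2 j] by (intro notI) (simp only:)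
          then show ?thesis by (simp only: if_False)
        qed
        also have "\<dots> = (l - ?c) * (s * (2 * n))" by (simp add: sum_list_triv)
        also have "\<dots> = ((l - ?c) * 2) * (n * s)" by (simp add: algebra_simps)
        also have "(l - ?c) * 2 = l - l'" using odd False l' by presburger
        finally show ?thesis using False by simp
      qed
    qed
    finally show ?thesis .
  qed
  have "hdim ?X = hdim ?A + hdim ?B" by simp
  also have "\<dots> = (min l l' + (l - min l l')) * (n * s)" unfolding hA hB by (simp only: add_mult_distrib)
  finally have dim: "hdim ?X = hdim WG" by simp
  note wX = is_hmod_wfm [OF X]
  \<comment> \<open>Equality of dimensions makes the embedding onto, so the relations of the direct
    sum pass to the tensor product.\<close>
  have hW: "is_hmod n q WG" by (rule is_hmod_transport [OF X WG(2) F(1) finj_fsurj [OF wX WG(2) F dim]])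
  obtain K where K: "inverses ?X WG F K" by (rule finj_inverses [OF wX WG(2) F dim])
  have "fiso ?X WG" unfolding fiso_def by (intro exI) (rule K)
  then have "fiso WG ?X" by (rule fiso_sym)
  with hW show ?thesis by (rule conjI)
qed

end

text \<open>The map id \<otimes> F applies F to every block; that it commutes with the generators
  can be read off from the componentwise formulas \<open>cm_TW\<close>, in which the action on the
  second factor is the only thing that changes.\<close>

lemma fiso_tensor:
  assumes M: "is_hmod n q M" "is_hmod n q M'" and "fiso M M'"
  shows "fiso (tensor (V_mod q l r) M) (tensor (V_mod q l r) M')"
proof -
  obtain F K where FK: "inverses M M' F K" using assms(3) by (auto simp: fiso_def)
  define T :: "'k hmod \<Rightarrow> 'k hmod \<Rightarrow> ((nat \<Rightarrow> 'k) \<Rightarrow> nat \<Rightarrow> 'k) \<Rightarrow> (nat \<Rightarrow> 'k) \<Rightarrow> nat \<Rightarrow> 'k"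
    where "T = (\<lambda>A B F w i. if i < l * hdim B then F (cmp (hdim A) (i div hdim B) w) (i mod hdim B) else 0)"
  let ?t = "\<lambda>N. tensor (V_mod q l r) N"
  have sT: "supp (l * hdim B) (T A B F w)" for A B F w by (simp add: T_def supp_def)
  have cT: "cmp (hdim B) k (T A B F w) = F (cmp (hdim A) k w)" if F: "hm A B F" and k: "k < l" for A B F w k
  proof
    fix i
    have s: "supp (hdim B) (F (cmp (hdim A) k w))" by (rule hmD(2) [OF F supp_cmp])
    show "cmp (hdim B) k (T A B F w) i = F (cmp (hdim A) k w) i"
    proof (cases "i < hdim B")
      case True
      then show ?thesis using idx_less [OF k True] idx_iff [OF True, of "k * hdim B + i" k] by (simp add: cmp_def [of "hdim B"] T_def)
    next
      case False
      then show ?thesis using s by (simp add: cmp_def [of "hdim B"] supp_def)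
    qed
  qed
  have hT: "hm (?t A) (?t B) (T A B F)" if A: "is_hmod n q A" and B: "is_hmod n q B" and F: "hm A B F" for A B F
  proof -
    note lF = hmD(1) [OF F] and cT = cT [OF F]
    have "lin (T A B F)" by (auto simp: lin_def T_def fun_eq_iff plus_fun_apply sc_apply linD [OF lin_cmp] linD [OF lF])
    moreover have "T A B F (op (?t A) x w) = op (?t B) x (T A B F w)" for x w
    proof (rule cmp_ext [OF sT supp_TW [OF B]])
      fix k assume k: "k < l"
      have p: "prv B k (T A B F w) = F (prv A k w)"
        using k cT [of "k - 1" w] by (cases k) (simp_all add: prv_def [OF A] prv_def [OF B] lin_0 [OF lF])
      have al: "alpha q (Suc k) l \<cdot>\<^sub>f cmp (hdim B) (Suc k) (T A B F w) = F (alpha q (Suc k) l \<cdot>\<^sub>f cmp (hdim A) (Suc k) w)"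
      proof (cases "Suc k < l")
        case True
        then show ?thesis by (simp add: cT linD [OF lF])
      next
        case False
        then have "l = Suc k" using k by simp
        then show ?thesis by (simp add: lin_0 [OF lF])
      qed
      have sp: "supp (hdim A) (prv A k w)" by (rule supp_prv [OF A])
      have sa: "supp (hdim A) (alpha q (Suc k) l \<cdot>\<^sub>f cmp (hdim A) (Suc k) w)" by simp
      show "cmp (hdim B) k (T A B F (op (?t A) x w)) = cmp (hdim B) k (op (?t B) x (T A B F w))"
        unfolding cT [OF k]
        by (cases x) (simp_all only: cm_TW [OF A k] cm_TW [OF B k] p al cT [OF k] linD [OF lF] hmD(3) [OF F supp_cmp] hmD(3) [OF F sp] hmD(3) [OF F sa])
    qed
    ultimately show ?thesis using sT by (simp add: hm_def)
  qed
  have inv: "T B A K (T A B F w) = w" if F: "hm A B F" and K: "hm B A K" and KF: "\<And>v. supp (hdim A) v \<Longrightarrow> K (F v) = v"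
    and w: "supp (l * hdim A) w" for A B F K w
    by (rule cmp_ext [OF sT w]) (simp add: cT [OF K] cT [OF F] KF)
  note D = inversesD [OF FK]
  have "inverses (?t M) (?t M') (T M M' F) (T M' M K)" unfolding inverses_def
    using hT [OF M D(1)] hT [OF M(2,1) D(2)] inv [OF D(1,2,3)] inv [OF D(2,1,4)] by simp
  then show ?thesis by (auto simp: fiso_def)
qed

end

section \<open>From the explicit models to modules given up to isomorphism\<close>

theorem theorem3p16:
  fixes n s l l' :: nat and r r' :: int
    and q :: "'k::alg_closed_field" and \<eta> :: "'k proj_line"
    and M :: "'k hmod" and Y P :: "nat \<Rightarrow> 'k hmod"
  assumes "n > 2" and "primitive_root_of_unity n q"
    and "1 \<le> l" and "l < n" and "1 \<le> l'" and "l' < n" and "1 \<le> s"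
    and "l + l' \<le> n"
    and "is_M n q s l' r' \<eta> M"
    and "\<And>i. i < min l l' \<Longrightarrow>
           is_M n q s (l + l' - 1 - 2 * i) (r + r' + int i)
             (scale_pt (q powi (2 * int i - int l + 1) * (qint q (l + l' - 1 - 2 * i) / qint q l')) \<eta>)
             (Y i)"
    and "\<And>i. c_half (int l + int l' - 1) \<le> int i \<Longrightarrow> i \<le> l - 1 \<Longrightarrow>
           is_P n q (n + l + l' - 1 - 2 * i) (r + r' + int i) (P i)"
  shows "hmod_iso n q (tensor (V_mod q l r) M)
           (dsum [dsum (map Y [0..<min l l']),
                  dsum (map (\<lambda>i. copies s (P i)) [nat (c_half (int l + int l' - 1))..<l])])"
proof -
  interpret qroot n q using assms(1,2) by unfold_locales
  note l = assms(3,4) and l' = assms(5,6) and ll = assms(8)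
  let ?c = "(l + l') div 2"
  define pt where "pt = (\<lambda>i. scale_pt (q powi (2 * int i - int l + 1) * (qint q (l + l' - 1 - 2 * i) / qint q l')) \<eta>)"
  define Yc where "Yc = (\<lambda>i. Gm s (l + l' - 1 - 2 * i) (r + r' + int i) (pt i))"
  define Pc where "Pc = (\<lambda>j. Pm (n + l + l' - 1 - 2 * j) (r + r' + int j))"
  have c: "c_half (int l + int l' - 1) = int ?c" by (simp add: c_half_def zdiv_int)
  have M: "is_hmod n q M" "fiso M (Gm s l' r' \<eta>)" using is_M_Gm [OF l' assms(9)] by auto
  have Y: "is_hmod n q (Y i)" "fiso (Y i) (Yc i)" if "i < min l l'" for i
  proof -
    have "1 \<le> l + l' - 1 - 2 * i" "l + l' - 1 - 2 * i < n" using that l l' ll by auto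
    from is_M_Gm [OF this assms(10) [OF that]] show "is_hmod n q (Y i)" "fiso (Y i) (Yc i)"
      by (auto simp: Yc_def pt_def)
  qed
  \<comment> \<open>For second index n the hypothesis on P is an isomorphism with V(n, _), which
    carries the information that V(n, _) is a module.\<close>
  have P: "is_hmod n q (P j)" "fiso (P j) (Pc j)" "wfm (Pc j)"
    "n + l + l' - 1 - 2 * j = n \<longrightarrow> is_hmod n q (V_mod q n (r + r' + int j))" if j: "?c \<le> j" "j < l" for j
  proof -
    let ?m = "n + l + l' - 1 - 2 * j"
    have m: "1 \<le> ?m" "?m \<le> n" using j l l' ll by auto
    have p: "is_P n q ?m (r + r' + int j) (P j)" by (rule assms(11)) (use j c in auto)
    have "is_hmod n q (P j) \<and> fiso (P j) (Pc j) \<and> wfm (Pc j) \<and> (?m = n \<longrightarrow> is_hmod n q (V_mod q n (r + r' + int j)))"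
    proof (cases "?m = n")
      case True
      then have "hmod_iso n q (P j) (V_mod q n (r + r' + int j))" using p by (simp only: is_P_def if_True)
      then show ?thesis unfolding hmod_iso_iff Pc_def Pm_def True by simp
    next
      case False
      then obtain p0 where "is_projective_cover n q (P j) (V_mod q ?m (r + r' + int j)) p0"
        using p by (auto simp only: is_P_def if_False)
      moreover have "?m < n" using m False by simp
      ultimately show ?thesis using cover_PP [OF m(1)] False by (simp add: Pc_def Pm_def)
    qed
    then show "is_hmod n q (P j)" "fiso (P j) (Pc j)" "wfm (Pc j)" "?m = n \<longrightarrow> is_hmod n q (V_mod q n (r + r' + int j))" by blast+
  qed
  let ?G = "Gm s l' r' \<eta>" and ?V = "V_mod q l r"
  have core: "is_hmod n q (tensor ?V ?G) \<and> is_hmod n q ?G \<and> fiso (tensor ?V ?G) (dsum [dsum (map Yc [0..<min l l']),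
    dsum (map (\<lambda>j. copies s (Pc j)) [?c..<l])])"
  proof (cases \<eta>)
    case (Fin y)
    have nd: "1 * 1 \<noteq> 0 * (y * q ^ l')" by simp
    interpret W: hact n q "op (tensor ?V ?G) Ga" "op (tensor ?V ?G) Gb" "op (tensor ?V ?G) Gc" "op (tensor ?V ?G) Gd"
      using WG(1) [OF l l' ll nd] by (simp add: Gm_def Fin)
    have e: "emb n q (tensor ?V ?G) (Yc i) (wset (r + r') (l + l' - 1) i)" if i: "i < min l l'" for i
    proof -
      let ?m = "l + l' - 1 - 2 * i"
      define \<kappa> where "\<kappa> = qint q ?m / qint q l'"
      \<comment> \<open>The pencil of M_s(l',r',\<eta>) contains \<eta>q^(l'), that of the summand
        its own parameter times q^m with m = l + l' - 1 - 2i. The exponent l' - m = 2i - l + 1 makes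
        the two agree up to \<kappa>.\<close>
      have x: "q powi (2 * int i - int l + 1) * q ^ ?m = q ^ l'"
      proof -
        have "2 * int i - int l + 1 + int ?m = int l'" using i by linarith
        from qpowi_add [of "2 * int i - int l + 1" "int ?m", unfolded this power_int_of_nat] show ?thesis by (rule sym)
      qed
      have Yi: "Yc i = band_mod n q s ?m (r + r' + int i) 1 0 (\<kappa> * (y * q ^ l')) 1"
      proof -
        have "q powi (2 * int i - int l + 1) * \<kappa> * y * q ^ ?m = \<kappa> * (y * (q powi (2 * int i - int l + 1) * q ^ ?m))"
          by (simp only: mult_ac)
        then show ?thesis
          unfolding Yc_def pt_def Fin scale_pt.simps Gm_def proj_line.case \<kappa>_def [symmetric] x by (simp only:)
      qed
      have nd': "1 * 1 \<noteq> 0 * (\<kappa> * (y * q ^ l'))" by simp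
      show ?thesis unfolding Yi Gm_def Fin proj_line.case
      proof (rule emb_WG_band [OF l l' ll nd i _ nd'])
        fix f g and k :: 'k
        assume k: "k = qint q ?m / qint q l'" "k \<noteq> 0"
        assume "hact.band n q (op (tensor ?V (band_mod n q s l' r' 1 0 (y * q ^ l') 1)) Ga) (op (tensor ?V (band_mod n q s l' r' 1 0 (y * q ^ l') 1)) Gb)
          (op (tensor ?V (band_mod n q s l' r' 1 0 (y * q ^ l') 1)) Gc) (op (tensor ?V (band_mod n q s l' r' 1 0 (y * q ^ l') 1)) Gd)
          1 0 (y * q ^ l') 1 ?m (r + r' + int i) k f g"
        note B = hact.band_rescale_fin [OF WG(1) [OF l l' ll nd] this]
        show "\<exists>x z. (\<forall>e. x e \<noteq> 0) \<and> (\<forall>e. z e \<noteq> 0) \<and> hact.band n q (op (tensor ?V (band_mod n q s l' r' 1 0 (y * q ^ l') 1)) Ga)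
          (op (tensor ?V (band_mod n q s l' r' 1 0 (y * q ^ l') 1)) Gb)
          (op (tensor ?V (band_mod n q s l' r' 1 0 (y * q ^ l') 1)) Gc) (op (tensor ?V (band_mod n q s l' r' 1 0 (y * q ^ l') 1)) Gd)
          1 0 (\<kappa> * (y * q ^ l')) 1 ?m (r + r' + int i) 1 (\<lambda>e. x e \<cdot>\<^sub>f f e) (\<lambda>e. z e \<cdot>\<^sub>f g e)"
          by (intro exI [of _ "\<lambda>e. k ^ e"] conjI) (use B k \<kappa>_def in auto)
      qed simp
    qed
    show ?thesis
      using tensor_decomp [OF l l' ll nd, where s = s and r = r and r' = r' and Yc = Yc] e hNG [OF l l' ll nd, of s r'] P(4)
      by (simp add: Gm_def Fin Yc_def pt_def Pc_def)
  next
    case Infty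
    have nd: "0 * 0 \<noteq> 1 * (1 :: 'k)" by simp
    have e: "emb n q (tensor ?V ?G) (Yc i) (wset (r + r') (l + l' - 1) i)" if i: "i < min l l'" for i
    proof -
      let ?m = "l + l' - 1 - 2 * i"
      have Yi: "Yc i = band_mod n q s ?m (r + r' + int i) 0 1 1 0" by (simp add: Yc_def pt_def Infty Gm_def)
      show ?thesis unfolding Yi Gm_def Infty proj_line.case
      proof (rule emb_WG_band [OF l l' ll nd i _ nd])
        fix f g and k :: 'k
        assume k: "k = qint q ?m / qint q l'" "k \<noteq> 0"
        assume "hact.band n q (op (tensor ?V (band_mod n q s l' r' 0 1 1 0)) Ga) (op (tensor ?V (band_mod n q s l' r' 0 1 1 0)) Gb)
          (op (tensor ?V (band_mod n q s l' r' 0 1 1 0)) Gc) (op (tensor ?V (band_mod n q s l' r' 0 1 1 0)) Gd)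
          0 1 1 0 ?m (r + r' + int i) k f g"
        note B = hact.band_rescale_inf [OF WG(1) [OF l l' ll nd] this k(2)]
        show "\<exists>x z. (\<forall>e. x e \<noteq> 0) \<and> (\<forall>e. z e \<noteq> 0) \<and> hact.band n q (op (tensor ?V (band_mod n q s l' r' 0 1 1 0)) Ga)
          (op (tensor ?V (band_mod n q s l' r' 0 1 1 0)) Gb)
          (op (tensor ?V (band_mod n q s l' r' 0 1 1 0)) Gc) (op (tensor ?V (band_mod n q s l' r' 0 1 1 0)) Gd)
          0 1 1 0 ?m (r + r' + int i) 1 (\<lambda>e. x e \<cdot>\<^sub>f f e) (\<lambda>e. z e \<cdot>\<^sub>f g e)"
          by (intro exI [of _ "\<lambda>e. inverse k ^ e"] exI [of _ "\<lambda>e. k * inverse k ^ e"] conjI) (use B k in auto)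
      qed simp
    qed
    show ?thesis
      using tensor_decomp [OF l l' ll nd, where s = s and r = r and r' = r' and Yc = Yc] e hNG [OF l l' ll nd, of s r'] P(4)
      by (simp add: Gm_def Infty Yc_def pt_def Pc_def)
  qed
  let ?A = "dsum (map Y [0..<min l l'])" and ?B = "dsum (map (\<lambda>i. copies s (P i)) [?c..<l])"
  let ?A' = "dsum (map Yc [0..<min l l'])" and ?B' = "dsum (map (\<lambda>j. copies s (Pc j)) [?c..<l])"
  have wYc: "wfm (Yc i)" for i by (cases "pt i") (simp_all add: Yc_def Gm_def)
  have hcop: "is_hmod n q (copies s (P j))" if "j \<in> set [?c..<l]" for j
    unfolding copies_def by (rule is_hmod_dsum) (use P(1) that in auto)
  have wcop: "wfm (copies s (Pc j))" if "j \<in> set [?c..<l]" for j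
    unfolding copies_def by (rule wfm_dsum) (use P(3) that in auto)
  have A: "is_hmod n q ?A" by (rule is_hmod_dsum) (use Y(1) in auto)
  have B: "is_hmod n q ?B" by (rule is_hmod_dsum) (use hcop in auto)
  have AB: "is_hmod n q (dsum [?A, ?B])" by (rule is_hmod_dsum) (use A B in auto)
  have wY: "wfm (Y i)" if "i < min l l'" for i by (rule is_hmod_wfm [OF Y(1) [OF that]])
  have fcop: "fiso (copies s (P j)) (copies s (Pc j))" if "j \<in> set [?c..<l]" for j
    by (rule fiso_copies) (use P that is_hmod_wfm [OF P(1)] in auto)
  have fA: "fiso ?A ?A'" by (rule fiso_dsum_map) (use Y(2) wYc wY in auto)
  have fB: "fiso ?B ?B'" by (rule fiso_dsum_map) (use fcop is_hmod_wfm [OF hcop] wcop in auto)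
  have wA': "wfm ?A'" by (rule wfm_dsum) (use wYc in auto)
  have wB': "wfm ?B'" by (rule wfm_dsum) (use wcop in auto)
  note w = is_hmod_wfm [OF A] is_hmod_wfm [OF B]
  have "fiso (dsum [?A, ?B]) (dsum [?A', ?B'])"
    by (rule fiso_dsum_Cons) (simp_all add: w wA' wB' fA fB dsum_single)
  then have f: "fiso (tensor ?V ?G) (dsum [?A, ?B])" using core fiso_trans fiso_sym by blast
  have G: "is_hmod n q ?G" using core by blast
  have f1: "fiso (tensor ?V M) (tensor ?V ?G)" by (rule fiso_tensor [OF M(1) G M(2)])
  \<comment> \<open>The relations are known for the tensor product with the model; along this
    isomorphism they pass to the tensor product with M.\<close>
  obtain F K where FK: "inverses (tensor ?V ?G) (tensor ?V M) F K" using fiso_sym [OF f1] by (auto simp: fiso_def)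
  note D = inversesD [OF FK]
  have "fsurj (tensor ?V ?G) (tensor ?V M) F" unfolding fsurj_def using D(4) hmD(2) [OF D(2)] by blast
  then have "is_hmod n q (tensor ?V M)"
    using is_hmod_transport [OF _ wTW [OF M(1)] D(1)] core by blast
  then show ?thesis unfolding hmod_iso_iff c nat_int using AB fiso_trans [OF f1 f] by blast
qed

end
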